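(* Let $\beta>0$. There exists a constant $C_\beta>0$, depending only on $\beta$, such that for all $n\ge1$ and all $-\infty\le\Lambda_1<\Lambda_2\le\infty$, $$\mathbb{E}\left[(N_n(\Lambda_1,\Lambda_2)-N_{sc}(\Lambda_1,\Lambda_2))^2\right]\le C_\beta\,\log\left(2+\min\left(\sqrt{n}(\Lambda_2-\Lambda_1),\,n\right)\right),$$ where $N_n(\Lambda_1,\Lambda_2)$ is the number of points, between $\Lambda_1$ and $\Lambda_2$, of a Gaussian $\beta$ Ensemble with $n$ points, and $N_{sc}(\Lambda_1,\Lambda_2)$ is $n$ times the measure of $(\Lambda_1,\Lambda_2)$ under the semi-circle distribution on $[-2\sqrt n,2\sqrt n]$: $$N_{sc}(\Lambda_1,\Lambda_2):=\frac{n}{2\pi}\int_{\Lambda_1/\sqrt n}^{\Lambda_2/\sqrt n}\sqrt{(4-x^2)_+}\,dx.$$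
   Context: The Gaussian $\beta$ Ensemble with $n$ points is the set of $n$ random points $\lambda_1,\dots,\lambda_n$ on the real line whose joint distribution has a density proportional to $e^{-(\beta/4)\sum_{1\le j\le n}\lambda_j^2}\prod_{1\le j<k\le n}|\lambda_j-\lambda_k|^\beta$ with respect to the Lebesgue measure on $\mathbb{R}^n$. The notation $y_+$ means $\max(y,0)$. *)

theory Defs
  imports "HOL-Probability.Probability"
begin

text \<open>
  Points of \<open>\<real>\<^sup>n\<close> are functions \<open>x\<close> with coordinates \<open>x j\<close> for \<open>j < n\<close> (and \<open>undefined\<close>
  elsewhere), so that \<open>n\<close> can be quantified over inside a statement.
\<close>

definition lebesgue_Rn :: "nat \<Rightarrow> (nat \<Rightarrow> real) measure" where
  "lebesgue_Rn n = PiM {..<n} (\<lambda>_. lborel)"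

definition gbe_weight :: "real \<Rightarrow> nat \<Rightarrow> (nat \<Rightarrow> real) \<Rightarrow> real" where
  "gbe_weight \<beta> n x =
     exp (- (\<beta> / 4) * (\<Sum>j<n. (x j)\<^sup>2)) * (\<Prod>k<n. \<Prod>j<k. \<bar>x j - x k\<bar> powr \<beta>)"

text \<open>
  The joint law of the \<open>n\<close> points. The normalising constant is positive and finite, so this is a
  probability measure; see \<open>prob_space_gaussian_beta_ensemble\<close> below.
\<close>

definition gaussian_beta_ensemble :: "real \<Rightarrow> nat \<Rightarrow> (nat \<Rightarrow> real) measure" where
  "gaussian_beta_ensemble \<beta> n =
     density (lebesgue_Rn n)
       (\<lambda>x. ennreal (gbe_weight \<beta> n x) / (\<integral>\<^sup>+ y. ennreal (gbe_weight \<beta> n y) \<partial>lebesgue_Rn n))"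

text \<open>
  Points are counted with multiplicity (almost surely there are no coincidences), and the
  endpoints are excluded (almost surely no point is an endpoint).
\<close>

definition num_points :: "nat \<Rightarrow> ereal \<Rightarrow> ereal \<Rightarrow> (nat \<Rightarrow> real) \<Rightarrow> nat" where
  "num_points n \<Lambda>1 \<Lambda>2 x = card {j. j < n \<and> \<Lambda>1 < ereal (x j) \<and> ereal (x j) < \<Lambda>2}"

definition semicircle_count :: "nat \<Rightarrow> ereal \<Rightarrow> ereal \<Rightarrow> real" where
  "semicircle_count n \<Lambda>1 \<Lambda>2 =
     real n / (2 * pi) *
       (LBINT x=\<Lambda>1 / ereal (sqrt (real n))..\<Lambda>2 / ereal (sqrt (real n)). sqrt (max (4 - x\<^sup>2) 0))"

lemma gbe_weight_measurable [measurable]: "gbe_weight \<beta> n \<in> borel_measurable (lebesgue_Rn n)"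
proof -
  have c: "(\<lambda>x. x j) \<in> borel_measurable (lebesgue_Rn n)" if "j < n" for j
    using that unfolding lebesgue_Rn_def
    by (auto intro!: measurable_component_singleton[where M = "\<lambda>_. lborel", simplified])
  have 1: "(\<lambda>x. \<Sum>j<n. (x j)\<^sup>2) \<in> borel_measurable (lebesgue_Rn n)"
    by (intro borel_measurable_sum borel_measurable_power c) auto
  have 2: "(\<lambda>x. \<Prod>k<n. \<Prod>j<k. \<bar>x j - x k\<bar> powr \<beta>) \<in> borel_measurable (lebesgue_Rn n)"
    by (intro borel_measurable_prod powr_real_measurable borel_measurable_abs borel_measurable_diff
        c borel_measurable_const) auto
  show ?thesis
    unfolding gbe_weight_def using 1 2 by measurable
qed

lemma gbe_weight_le:
  assumes "\<beta> > 0"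
  shows "gbe_weight \<beta> n x \<le>
    (\<Prod>j<n. exp (- (\<beta> / 4) * (x j)\<^sup>2) * exp (2 * real n * \<beta> * \<bar>x j\<bar>))"
proof -
  have b: "\<bar>s - t\<bar> powr \<beta> \<le> exp (\<beta> * \<bar>s\<bar>) * exp (\<beta> * \<bar>t\<bar>)" for s t :: real
  proof -
    have "\<bar>s - t\<bar> \<le> exp (\<bar>s\<bar> + \<bar>t\<bar>)"
      using exp_ge_add_one_self[of "\<bar>s\<bar> + \<bar>t\<bar>"] by linarith
    then have "\<bar>s - t\<bar> powr \<beta> \<le> exp (\<bar>s\<bar> + \<bar>t\<bar>) powr \<beta>"
      using assms by (intro powr_mono2) auto
    also have "\<dots> = exp (\<beta> * \<bar>s\<bar>) * exp (\<beta> * \<bar>t\<bar>)"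
      by (simp add: powr_def exp_add[symmetric] algebra_simps)
    finally show ?thesis .
  qed
  have "(\<Prod>k<n. \<Prod>j<k. \<bar>x j - x k\<bar> powr \<beta>) \<le> (\<Prod>k<n. \<Prod>j<k. exp (\<beta> * \<bar>x j\<bar>) * exp (\<beta> * \<bar>x k\<bar>))"
    by (intro prod_mono conjI prod_nonneg b) auto
  also have "\<dots> = exp (\<Sum>k<n. \<Sum>j<k. \<beta> * \<bar>x j\<bar> + \<beta> * \<bar>x k\<bar>)"
    by (simp add: exp_sum exp_add)
  also have "\<dots> \<le> exp (\<Sum>k<n. \<Sum>j<n. \<beta> * \<bar>x j\<bar> + \<beta> * \<bar>x k\<bar>)"
    using assms by (subst exp_le_cancel_iff, intro sum_mono sum_mono2) auto
  also have "(\<Sum>k<n. \<Sum>j<n. \<beta> * \<bar>x j\<bar> + \<beta> * \<bar>x k\<bar>) = (\<Sum>j<n. 2 * real n * \<beta> * \<bar>x j\<bar>)"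
    by (simp add: sum.distrib sum_distrib_left[symmetric] sum_distrib_right[symmetric])
  finally have "gbe_weight \<beta> n x \<le>
      exp (- (\<beta> / 4) * (\<Sum>j<n. (x j)\<^sup>2)) * exp (\<Sum>j<n. 2 * real n * \<beta> * \<bar>x j\<bar>)"
    unfolding gbe_weight_def by (intro mult_left_mono) auto
  also have "\<dots> = (\<Prod>j<n. exp (- (\<beta> / 4) * (x j)\<^sup>2) * exp (2 * real n * \<beta> * \<bar>x j\<bar>))"
    by (simp add: exp_sum prod.distrib sum_distrib_left)
  finally show ?thesis .
qed

lemma nn_integral_gaussian_exp_finite:
  fixes b a :: real
  assumes "b > 0"
  shows "(\<integral>\<^sup>+ t. ennreal (exp (- b * t\<^sup>2) * exp (a * \<bar>t\<bar>)) \<partial>lborel) < \<infinity>"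
proof -
  define \<sigma> where "\<sigma> = 1 / sqrt b"
  have s: "\<sigma> > 0" "\<sigma>\<^sup>2 = 1 / b"
    using assms by (auto simp: \<sigma>_def power_divide)
  define K where "K = exp (a\<^sup>2 / (2 * b)) * sqrt (2 * pi * \<sigma>\<^sup>2)"
  have "exp (- b * t\<^sup>2) * exp (a * \<bar>t\<bar>) \<le> K * normal_density 0 \<sigma> t" for t :: real
  proof -
    have "0 \<le> (b * \<bar>t\<bar> - a)\<^sup>2 / (2 * b)"
      using assms by simp
    also have "\<dots> = b * t\<^sup>2 / 2 - a * \<bar>t\<bar> + a\<^sup>2 / (2 * b)"
      using assms by (simp add: power2_eq_square field_simps)
    finally have "exp (- b * t\<^sup>2 + a * \<bar>t\<bar>) \<le> exp (a\<^sup>2 / (2 * b) - b * t\<^sup>2 / 2)"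
      by simp
    also have "\<dots> = exp (a\<^sup>2 / (2 * b)) * exp (- (t - 0)\<^sup>2 / (2 * \<sigma>\<^sup>2))"
      unfolding s(2) by (simp add: exp_add[symmetric])
    also have "\<dots> = K * normal_density 0 \<sigma> t"
      using s(1) by (simp add: K_def normal_density_def)
    finally show ?thesis by (simp add: exp_add[symmetric])
  qed
  then have "(\<integral>\<^sup>+ t. ennreal (exp (- b * t\<^sup>2) * exp (a * \<bar>t\<bar>)) \<partial>lborel)
      \<le> (\<integral>\<^sup>+ t. ennreal (K * normal_density 0 \<sigma> t) \<partial>lborel)"
    by (intro nn_integral_mono ennreal_leI)
  also have "\<dots> < \<infinity>"
  proof -
    have "integrable lborel (\<lambda>t. K * normal_density 0 \<sigma> t)"
      using s by auto
    moreover have "K \<ge> 0" by (simp add: K_def)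
    ultimately show ?thesis
      by (subst nn_integral_eq_integral) auto
  qed
  finally show ?thesis .
qed

lemma gbe_normalisation_finite:
  assumes "\<beta> > 0"
  shows "(\<integral>\<^sup>+ x. ennreal (gbe_weight \<beta> n x) \<partial>lebesgue_Rn n) < \<infinity>"
proof -
  interpret product_sigma_finite "\<lambda>_::nat. lborel :: real measure"
    by standard
  define g where "g = (\<lambda>t::real. exp (- (\<beta> / 4) * t\<^sup>2) * exp (2 * real n * \<beta> * \<bar>t\<bar>))"
  have [measurable]: "g \<in> borel_measurable borel" unfolding g_def by measurable
  have g0: "g t \<ge> 0" for t by (simp add: g_def)
  have "(\<integral>\<^sup>+ x. ennreal (gbe_weight \<beta> n x) \<partial>lebesgue_Rn n)
      \<le> (\<integral>\<^sup>+ x. (\<Prod>j<n. ennreal (g (x j))) \<partial>lebesgue_Rn n)"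
    using gbe_weight_le[OF assms, of n]
    by (intro nn_integral_mono) (auto simp: prod_ennreal g0 g_def intro!: ennreal_leI)
  also have "\<dots> = (\<Prod>j<n. \<integral>\<^sup>+ t. ennreal (g t) \<partial>lborel)"
    unfolding lebesgue_Rn_def by (intro product_nn_integral_prod) auto
  also have "\<dots> < \<infinity>"
    using nn_integral_gaussian_exp_finite[of "\<beta> / 4" "2 * real n * \<beta>"] assms
    by (simp add: g_def power_less_top_ennreal)
  finally show ?thesis .
qed

lemma gbe_normalisation_pos:
  shows "(\<integral>\<^sup>+ x. ennreal (gbe_weight \<beta> n x) \<partial>lebesgue_Rn n) > 0"
proof (rule ccontr)
  interpret product_sigma_finite "\<lambda>_::nat. lborel :: real measure"
    by standard
  let ?B = "PiE {..<n} (\<lambda>j. {2 * real j <..< 2 * real j + 1})"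
  assume "\<not> ?thesis"
  then have "AE x in lebesgue_Rn n. ennreal (gbe_weight \<beta> n x) = 0"
    by (subst nn_integral_0_iff_AE[symmetric]) auto
  moreover have "gbe_weight \<beta> n x > 0" if "x \<in> ?B" for x
  proof -
    have "x j \<noteq> x k" if "j < k" "k < n" for j k
    proof -
      have "x j < 2 * real j + 1" "2 * real k < x k"
        using \<open>x \<in> ?B\<close> that by (auto simp: PiE_iff)
      with \<open>j < k\<close> show ?thesis by linarith
    qed
    then show ?thesis
      unfolding gbe_weight_def by (intro mult_pos_pos prod_pos) auto
  qed
  ultimately have "AE x in lebesgue_Rn n. x \<notin> ?B"
    by (auto elim!: eventually_mono simp: ennreal_eq_0_iff) (use not_le in blast)
  moreover have B: "?B \<in> sets (lebesgue_Rn n)"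
    unfolding lebesgue_Rn_def by (intro sets_PiM_I_finite) auto
  ultimately have "emeasure (lebesgue_Rn n) ?B = 0"
    by (metis AE_iff_null_sets null_setsD1)
  moreover have "emeasure (lebesgue_Rn n) ?B = 1"
    unfolding lebesgue_Rn_def by (subst emeasure_PiM) auto
  ultimately show False by simp
qed

lemma prob_space_gaussian_beta_ensemble:
  assumes "\<beta> > 0"
  shows "prob_space (gaussian_beta_ensemble \<beta> n)"
proof
  let ?Z = "\<integral>\<^sup>+ y. ennreal (gbe_weight \<beta> n y) \<partial>lebesgue_Rn n"
  have "emeasure (gaussian_beta_ensemble \<beta> n) (space (gaussian_beta_ensemble \<beta> n))
      = (\<integral>\<^sup>+ x. ennreal (gbe_weight \<beta> n x) / ?Z \<partial>lebesgue_Rn n)"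
    unfolding gaussian_beta_ensemble_def
    by (subst emeasure_density) (auto intro!: nn_integral_cong)
  also have "\<dots> = ?Z / ?Z"
    by (subst nn_integral_divide) auto
  also have "\<dots> = 1"
    using gbe_normalisation_finite[OF assms, of n] gbe_normalisation_pos[of n \<beta>]
    by (intro ennreal_divide_self) auto
  finally show "emeasure (gaussian_beta_ensemble \<beta> n) (space (gaussian_beta_ensemble \<beta> n)) = 1" .
qed

end

theory Submission
  imports Defs
begin

text \<open>
  Rescale the points by \<open>1 / sqrt n\<close> to \<open>y\<^sub>1, \<dots>, y\<^sub>n\<close>; let \<open>h\<^sub>j = 1 / (y\<^sub>j - z)\<close>, let \<open>s\<close> be the average of the
  \<open>h\<^sub>j\<close> and \<open>m\<close> the Stieltjes transform of the semicircle law, a root of \<open>w\<^sup>2 + z w + 1\<close>. Invariance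
  of the partition function under the change of variables \<open>y\<^sub>j \<mapsto> y\<^sub>j + \<epsilon> h\<^sub>j\<close> gives, for smooth
  bounded \<open>F\<close>, the loop equation
  \<open>E [F (P - (1 - 2 / \<beta>) s' / n)] = 2 / (\<beta> n\<^sup>2) E [\<Sum>j. h\<^sub>j \<partial>\<^sub>j F]\<close> with \<open>P = s\<^sup>2 + z s + 1\<close>.
  Taking for \<open>F\<close> the cubic \<open>cnj P\<^sup>2 P\<close> bounds the fourth moment of \<open>P\<close>, hence
  \<open>E |s - m|\<^sup>4 \<le> C / (n Im z)\<^sup>4\<close> down to the scale \<open>n Im z |z\<^sup>2 - 4|\<^bsup>1/2\<^esup> \<ge> 1\<close>.

  A sum of arctangents, i.e. a smoothed count, is the integral of \<open>n Re (s - m)\<close> along a vertical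
  half-line. Since \<open>s - m = (P - (s - m)\<^sup>2) / (z\<^sup>2 - 4)\<^bsup>1/2\<^esup>\<close>, testing the loop equation against
  that integral itself bounds its variance: the right-hand side is an integral of \<open>1 / Im z\<close> between
  the mesoscopic scale and the scale of the interval, whence the logarithm. The passage to sharp counts
  costs a bounded error, and endpoints within \<open>n\<^bsup>-2/3\<^esup>\<close> of \<open>\<plusminus>2\<close> or beyond can be moved to that
  distance, because the number of points there has bounded second moment.
\<close>

section \<open>The Stieltjes transform of the semicircle law\<close>

text \<open>Four obstacles shape the estimates. The correction
  \<open>(1 - 2 / \<beta>) s' / n\<close>, multiplied by \<open>n / sc_root z\<close>, is only of
  order 1 / Im z in absolute value; integrated over heights this is a logarithm in the smoothed
  count itself, hence a squared logarithm in the variance. It is therefore compared with a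
  logarithmic derivative, at the price of a term with the factor \<open>s - m\<close>. The quadratic
  term \<open>n (s - m)^2 / sc_root z\<close> must be controlled in mean square, which takes a
  fourth moment of \<open>s - m\<close>. Separate bounds for two endpoints would give the logarithm
  of the distance to the edges, not that of the interval; for endpoints at comparable distance from
  the edges the smoothed counts are subtracted before the loop equation is used, so that the kernels
  cancel at heights above the distance of the endpoints. Finally, one arctangent misses the step
  function by order a / |y|, and the sum of this over the points is not controlled by Im s;
  \<open>2 * arctan (y / a) - arctan (y / (2 * a))\<close> cancels this order, and the same
  combination of primitives cancels it on the semicircle side.\<close>

definition sc_root :: "complex \<Rightarrow> complex" where
  "sc_root z = \<i> * csqrt (4 - z\<^sup>2)"

text \<open>With the convention \<open>1 / (x - z)\<close> the transform has nonnegative imaginary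
  part in the upper half-plane; this selects the root.\<close>

definition sc_stieltjes :: "complex \<Rightarrow> complex" where
  "sc_stieltjes z = (sc_root z - z) / 2"

lemma sc_root_square: "(sc_root z)\<^sup>2 = z\<^sup>2 - 4"
  by (simp add: sc_root_def power_mult_distrib)

lemma norm_le_normI:
  assumes "\<bar>Re a\<bar> \<le> \<bar>Re b\<bar>" "\<bar>Im a\<bar> \<le> \<bar>Im b\<bar>"
  shows "norm a \<le> norm b"
  using assms unfolding cmod_def abs_le_square_iff by simp

text \<open>Keeps \<open>4 - z\<^sup>2\<close> off the cut of \<open>csqrt\<close> on the whole
  strip |Re z| < 2. This is why \<open>sc_root\<close> is
  \<open>\<i> * csqrt (4 - z\<^sup>2)\<close>: the cut of \<open>csqrt (z\<^sup>2 - 4)\<close> runs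
  along the interval (-2, 2) and the imaginary axis.\<close>

lemma Re_four_minus_square:
  assumes "\<bar>Re z\<bar> < 2" shows "Re (4 - z\<^sup>2) > 0"
proof -
  have "(Re z)\<^sup>2 < 4" using assms abs_square_less_1[of "Re z / 2"] by (simp add: power_divide)
  then show ?thesis by (simp add: Re_power2) (smt (verit) zero_le_power2)
qed

text \<open>A square in the right half-plane has its root within 45 degrees of the real
  axis.\<close>

lemma norm_le_sqrt_2_Re:
  assumes "Re (c\<^sup>2) \<ge> 0" "Re c \<ge> 0" shows "norm c \<le> sqrt 2 * Re c"
proof -
  have "(Im c)\<^sup>2 \<le> (Re c)\<^sup>2" using assms unfolding Re_power2 by simp
  then have "(norm c)\<^sup>2 \<le> 2 * (Re c)\<^sup>2" unfolding cmod_power2 by linarith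
  then have "(norm c)\<^sup>2 \<le> (sqrt 2 * Re c)\<^sup>2" by (simp only: power_mult_distrib) simp
  then show ?thesis by (rule power2_le_imp_le) (use assms(2) in simp)
qed

lemma Re_csqrt_nonneg: "Re (csqrt w) \<ge> 0"
  using csqrt_principal[of w] by linarith

text \<open>Values of \<open>sc_root\<close> lie within 45 degrees of the positive imaginary axis.
  Quantitative form of Im > 0: a sum of two such values, or of one and a point of the upper
  half-plane, cannot be much smaller than they are.\<close>

lemma norm_sc_root_le_Im:
  assumes "\<bar>Re z\<bar> < 2" shows "norm (sc_root z) \<le> sqrt 2 * Im (sc_root z)"
proof -
  define c where "c = csqrt (4 - z\<^sup>2)"
  have "norm c \<le> sqrt 2 * Re c"
  proof (rule norm_le_sqrt_2_Re)
    show "Re (c\<^sup>2) \<ge> 0" unfolding c_def power2_csqrt using Re_four_minus_square[OF assms] by linarith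
    show "Re c \<ge> 0" unfolding c_def by (rule Re_csqrt_nonneg)
  qed
  then show ?thesis unfolding sc_root_def c_def[symmetric] by (simp add: norm_mult)
qed

lemma sc_root_nonzero:
  assumes "\<bar>Re z\<bar> < 2" shows "sc_root z \<noteq> 0"
  using Re_four_minus_square[OF assms] by (auto simp: sc_root_def)

lemma norm_sc_root_pos: "\<bar>Re z\<bar> < 2 \<Longrightarrow> norm (sc_root z) > 0"
  using sc_root_nonzero by simp

lemma Im_sc_root_pos:
  assumes "\<bar>Re z\<bar> < 2" shows "Im (sc_root z) > 0"
  using norm_sc_root_le_Im[OF assms] norm_sc_root_pos[OF assms]
  by (smt (verit) mult_nonneg_nonpos real_sqrt_ge_0_iff)

lemma norm_sc_root_square: "(norm (sc_root z))\<^sup>2 = norm (z - 2) * norm (z + 2)"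
proof -
  have "(norm (sc_root z))\<^sup>2 = norm ((z - 2) * (z + 2))"
    by (subst norm_power[symmetric], subst sc_root_square)
      (simp add: algebra_simps power2_eq_square)
  then show ?thesis by (simp add: norm_mult)
qed

text \<open>All bounds are read off |z - 2| |z + 2|. The factor of the farther edge is at least 2
  and at least |z|; that of the nearer edge is at least 2 - |Re z|; both are at least Im z. The
  third bound replaces the first when Im z is large.\<close>

lemma norm_sc_root_lower:
  assumes "\<bar>Re z\<bar> < 2" "Im z \<ge> 0"
  shows "2 * (2 - \<bar>Re z\<bar>) \<le> (norm (sc_root z))\<^sup>2" "2 * Im z \<le> (norm (sc_root z))\<^sup>2"
    "Im z * norm z \<le> (norm (sc_root z))\<^sup>2" "Im z \<le> norm (sc_root z)"
proof -
  have r: "\<bar>Re z - 2\<bar> \<le> norm (z - 2)" "\<bar>Re z + 2\<bar> \<le> norm (z + 2)"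
    using abs_Re_le_cmod[of "z - 2"] abs_Re_le_cmod[of "z + 2"] by auto
  have i: "Im z \<le> norm (z - 2)" "Im z \<le> norm (z + 2)"
    using abs_Im_le_cmod[of "z - 2"] abs_Im_le_cmod[of "z + 2"] by auto
  show "Im z \<le> norm (sc_root z)"

  proof (rule power2_le_imp_le)
    show "(Im z)\<^sup>2 \<le> (norm (sc_root z))\<^sup>2"
      unfolding norm_sc_root_square power2_eq_square[of "Im z"] using i assms by (intro mult_mono) auto
  qed auto
  have cmp: "norm z \<le> norm (z + 2)" if "Re z \<ge> 0"
    using that by (intro norm_le_normI) auto
  have cmp': "norm z \<le> norm (z - 2)" if "Re z \<le> 0"
    using that by (intro norm_le_normI) auto
  show "2 * (2 - \<bar>Re z\<bar>) \<le> (norm (sc_root z))\<^sup>2"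
  proof (cases "Re z \<ge> 0")
    case True
    have "(2 - \<bar>Re z\<bar>) * 2 \<le> norm (z - 2) * norm (z + 2)"
      using True r assms by (intro mult_mono) auto
    then show ?thesis by (simp add: norm_sc_root_square)
  next
    case False
    have "2 * (2 - \<bar>Re z\<bar>) \<le> norm (z - 2) * norm (z + 2)"
      using False r assms by (intro mult_mono) auto
    then show ?thesis by (simp add: norm_sc_root_square)
  qed
  show "2 * Im z \<le> (norm (sc_root z))\<^sup>2"
  proof (cases "Re z \<ge> 0")
    case True
    have "Im z * 2 \<le> norm (z - 2) * norm (z + 2)"
      using True r i assms by (intro mult_mono) auto
    then show ?thesis by (simp add: norm_sc_root_square)
  next
    case False
    have "2 * Im z \<le> norm (z - 2) * norm (z + 2)"
      using False r i assms by (intro mult_mono) auto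
    then show ?thesis by (simp add: norm_sc_root_square)
  qed
  show "Im z * norm z \<le> (norm (sc_root z))\<^sup>2"
  proof (cases "Re z \<ge> 0")
    case True
    have "Im z * norm z \<le> norm (z - 2) * norm (z + 2)"
      using True cmp i assms by (intro mult_mono) auto
    then show ?thesis by (simp add: norm_sc_root_square)
  next
    case False
    have "norm z * Im z \<le> norm (z - 2) * norm (z + 2)"
      using False cmp' i assms by (intro mult_mono) auto
    then show ?thesis by (simp add: norm_sc_root_square mult.commute)
  qed
qed

lemma norm_sc_root_upper:
  assumes "\<bar>Re z\<bar> < 2" "Im z \<ge> 0"
  shows "(norm (sc_root z))\<^sup>2 \<le> (2 - \<bar>Re z\<bar> + Im z) * (4 + Im z)"
proof -
  have a: "norm (z - 2) \<le> \<bar>Re z - 2\<bar> + Im z" "norm (z + 2) \<le> \<bar>Re z + 2\<bar> + Im z"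
    using cmod_le[of "z - 2"] cmod_le[of "z + 2"] assms by auto
  show ?thesis
  proof (cases "Re z \<ge> 0")
    case True
    have "norm (z - 2) * norm (z + 2) \<le> (2 - \<bar>Re z\<bar> + Im z) * (4 + Im z)"
      using True a assms by (intro mult_mono) auto
    then show ?thesis by (simp add: norm_sc_root_square)
  next
    case False
    have "norm (z + 2) * norm (z - 2) \<le> (2 - \<bar>Re z\<bar> + Im z) * (4 + Im z)"
      using False a assms by (intro mult_mono) auto
    then show ?thesis by (simp add: norm_sc_root_square mult.commute)
  qed
qed

text \<open>Moving up increases the distance to both edges. Along a vertical line
  \<open>sc_root\<close> may thus be replaced by its value at the lowest height.\<close>

lemma norm_sc_root_mono:
  assumes "0 \<le> s" "s \<le> t"
  shows "norm (sc_root (Complex E s)) \<le> norm (sc_root (Complex E t))"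
proof (rule power2_le_imp_le)
  show "(norm (sc_root (Complex E s)))\<^sup>2 \<le> (norm (sc_root (Complex E t)))\<^sup>2"
    unfolding norm_sc_root_square using assms by (intro mult_mono norm_le_normI) auto
qed auto

text \<open>The other root of \<open>w\<^sup>2 + z w + 1\<close> lies in the lower half-plane, far from \<open>w\<close>.\<close>
lemma stability:
  assumes z: "\<bar>Re z\<bar> < 2" "Im z \<ge> 0" and w: "Im w \<ge> 0"
  shows "norm (w - sc_stieltjes z) \<le> 2 * sqrt 2 * norm (w\<^sup>2 + z * w + 1) / norm (sc_root z)"
proof -
  let ?k = "sc_root z"
  let ?m' = "(- ?k - z) / 2"
  have "(w - sc_stieltjes z) * (w - ?m') = w\<^sup>2 + z * w + (z\<^sup>2 - ?k\<^sup>2) / 4"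
    by (simp add: sc_stieltjes_def field_simps power2_eq_square)
  then have eq: "w\<^sup>2 + z * w + 1 = (w - sc_stieltjes z) * (w - ?m')"
    by (simp add: sc_root_square)
  have "Im ?k / 2 \<le> Im (w - ?m')" using z w by (simp add: field_simps)
  also have "\<dots> \<le> norm (w - ?m')" using abs_Im_le_cmod by (meson abs_le_D1)
  finally have "Im ?k \<le> 2 * norm (w - ?m')" by simp
  then have "sqrt 2 * Im ?k \<le> sqrt 2 * (2 * norm (w - ?m'))" by (rule mult_left_mono) simp
  then have "norm ?k \<le> 2 * sqrt 2 * norm (w - ?m')"
    using norm_sc_root_le_Im[OF z(1)] by linarith
  then have "norm (w - sc_stieltjes z) * norm ?k
     \<le> norm (w - sc_stieltjes z) * (2 * sqrt 2 * norm (w - ?m'))"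
    by (intro mult_left_mono) auto
  also have "\<dots> = 2 * sqrt 2 * norm (w\<^sup>2 + z * w + 1)"
    unfolding eq norm_mult by simp
  finally show ?thesis
    using norm_sc_root_pos[OF z(1)] by (simp add: field_simps)
qed

lemma Im_sc_stieltjes_le:
  assumes "Im z \<ge> 0" shows "Im (sc_stieltjes z) \<le> norm (sc_root z) / 2"
  using assms abs_Im_le_cmod[of "sc_root z"] by (simp add: sc_stieltjes_def)

text \<open>With p and q the two roots, (p - q)(p + q) = z1^2 - z2^2, and |p + q| is comparable to
  |p| + |q| by the sector bound. No path of integration between z1 and z2 is needed.\<close>

lemma sc_root_diff_le:
  assumes "\<bar>Re z1\<bar> < 2" "Im z1 > 0" "\<bar>Re z2\<bar> < 2" "Im z2 > 0"
  shows "norm (sc_root z1 - sc_root z2) \<le>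
     sqrt 2 * norm (z1 - z2) * (norm z1 + norm z2) / (norm (sc_root z1) + norm (sc_root z2))"
proof -
  let ?p = "sc_root z1" and ?q = "sc_root z2"
  have pos: "norm ?p + norm ?q > 0" using norm_sc_root_pos[OF assms(1)] by (simp add: add_pos_nonneg)
  have "norm ?p + norm ?q \<le> sqrt 2 * Im (?p + ?q)"
    using norm_sc_root_le_Im[OF assms(1)] norm_sc_root_le_Im[OF assms(3)] by (simp add: algebra_simps)
  also have "\<dots> \<le> sqrt 2 * norm (?p + ?q)" using abs_Im_le_cmod[of "?p + ?q"] by simp
  finally have "norm (?p - ?q) * (norm ?p + norm ?q) \<le> norm (?p - ?q) * (sqrt 2 * norm (?p + ?q))"
    by (intro mult_left_mono) auto
  also have "\<dots> = sqrt 2 * norm ((?p - ?q) * (?p + ?q))" by (simp add: norm_mult)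
  also have "(?p - ?q) * (?p + ?q) = (z1 - z2) * (z1 + z2)"
    using sc_root_square[of z1] sc_root_square[of z2]
    by (metis (no_types, opaque_lifting) add_diff_cancel_right' diff_add_cancel diff_diff_eq2 mult.commute power2_eq_square square_diff_square_factored)
  also have "sqrt 2 * norm \<dots> \<le> sqrt 2 * norm (z1 - z2) * (norm z1 + norm z2)"
    by (simp add: norm_mult mult_left_mono norm_triangle_ineq)
  finally show ?thesis using pos by (simp add: field_simps)
qed

section \<open>A primitive of the Stieltjes transform in the strip\<close>

lemma Im_Ln_eq_arctan:
  assumes "Re w > 0" shows "Im (Ln w) = arctan (Im w / Re w)"
proof -
  have w: "w \<noteq> 0" using assms by auto
  define t where "t = Im (Ln w)"
  have "\<bar>t\<bar> < pi / 2" unfolding t_def using Re_Ln_pos_lt[OF w] assms by blast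
  moreover have "Re w = norm w * cos t" "Im w = norm w * sin t"
    using exp_Ln[OF w] w unfolding t_def
    by (metis Re_exp Re_Ln exp_ln zero_less_norm_iff, metis Im_exp Re_Ln exp_ln zero_less_norm_iff)
  then have "Im w / Re w = tan t" using w by (simp add: tan_def)
  ultimately show ?thesis unfolding t_def[symmetric] by (intro arctan_unique[symmetric]) auto
qed

text \<open>This is ln 2 - i arcsin (z / 2), a primitive of 1 / \<open>sc_root\<close>.\<close>

definition sc_log :: "complex \<Rightarrow> complex" where
  "sc_log z = Ln (csqrt (4 - z\<^sup>2) - \<i> * z)"

text \<open>A primitive of \<open>sc_stieltjes\<close>: as \<open>sc_root\<close> has square z^2 -
  4, the derivative of \<open>z * sc_root z / 2\<close> is \<open>sc_root z + 2 / sc_root z\<close>.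
  The imaginary part tends to 0 at infinite height and becomes, on the real axis, pi times the
  semicircle distribution function minus pi / 2.\<close>

definition sc_primitive :: "complex \<Rightarrow> complex" where
  "sc_primitive z = (z * sc_root z - z\<^sup>2) / 4 - sc_log z"

lemma Re_csqrt_pos:
  assumes "\<bar>Re z\<bar> < 2" shows "Re (csqrt (4 - z\<^sup>2)) > 0"
  using Im_sc_root_pos[OF assms] by (simp add: sc_root_def del: csqrt.simps)

lemma four_minus_square_notin:
  assumes "\<bar>Re z\<bar> < 2" shows "4 - z\<^sup>2 \<notin> \<real>\<^sub>\<le>\<^sub>0"
  using Re_four_minus_square[OF assms] complex_nonpos_Reals_iff by force

lemma csqrt_minus_iz_notin:
  assumes "\<bar>Re z\<bar> < 2" "Im z \<ge> 0"
  shows "Re (csqrt (4 - z\<^sup>2) - \<i> * z) > 0" "csqrt (4 - z\<^sup>2) - \<i> * z \<notin> \<real>\<^sub>\<le>\<^sub>0"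
proof -
  show *: "Re (csqrt (4 - z\<^sup>2) - \<i> * z) > 0" using Re_csqrt_pos[OF assms(1)] assms(2)
    by (simp del: csqrt.simps)
  show "csqrt (4 - z\<^sup>2) - \<i> * z \<notin> \<real>\<^sub>\<le>\<^sub>0"
    using * complex_nonpos_Reals_iff by force
qed

lemma has_field_derivative_csqrt_four:
  assumes "\<bar>Re z\<bar> < 2"
  shows "((\<lambda>z. csqrt (4 - z\<^sup>2)) has_field_derivative (- z / csqrt (4 - z\<^sup>2))) (at z)"
  by (rule derivative_eq_intros refl four_minus_square_notin assms)+ simp

lemma has_field_derivative_sc_root:
  assumes "\<bar>Re z\<bar> < 2"
  shows "(sc_root has_field_derivative (z / sc_root z)) (at z)"
proof -
  have "((\<lambda>z. \<i> * csqrt (4 - z\<^sup>2)) has_field_derivative (\<i> * (- z / csqrt (4 - z\<^sup>2)))) (at z)"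
    by (intro DERIV_cmult has_field_derivative_csqrt_four assms)
  moreover have "\<i> * (- z / csqrt (4 - z\<^sup>2)) = z / sc_root z"
    using sc_root_nonzero[OF assms] by (simp add: sc_root_def field_simps)
  ultimately show ?thesis by (simp add: sc_root_def[abs_def])
qed

lemma has_field_derivative_sc_log:
  assumes "\<bar>Re z\<bar> < 2" "Im z \<ge> 0"
  shows "(sc_log has_field_derivative (1 / sc_root z)) (at z)"
proof -
  let ?c = "csqrt (4 - z\<^sup>2)"
  have n: "?c \<noteq> 0" "?c - \<i> * z \<noteq> 0"
    using sc_root_nonzero[OF assms(1)] csqrt_minus_iz_notin[OF assms] by (auto simp: sc_root_def)
  have "((\<lambda>z. Ln (csqrt (4 - z\<^sup>2) - \<i> * z)) has_field_derivative
      (- z / ?c - \<i>) / (?c - \<i> * z)) (at z)"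
    by (rule derivative_eq_intros refl has_field_derivative_csqrt_four csqrt_minus_iz_notin assms)+
      (simp add: field_simps)
  moreover have "(- z / ?c - \<i>) / (?c - \<i> * z) = 1 / sc_root z"
    using n by (simp add: sc_root_def divide_simps) (simp add: algebra_simps)
  ultimately show ?thesis by (simp add: sc_log_def[abs_def])
qed

lemma has_field_derivative_sc_primitive:
  assumes "\<bar>Re z\<bar> < 2" "Im z \<ge> 0"
  shows "(sc_primitive has_field_derivative sc_stieltjes z) (at z)"
proof -
  let ?k = "sc_root z"
  have "((\<lambda>z. (z * sc_root z - z\<^sup>2) / 4) has_field_derivative (1 * ?k + z * (z / ?k) - 2 * z) / 4) (at z)"
    by (rule derivative_eq_intros refl has_field_derivative_sc_root assms)+
      (simp, simp add: mult.commute diff_divide_distrib add_divide_distrib)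
  from DERIV_diff[OF this has_field_derivative_sc_log[OF assms]]
  have "(sc_primitive has_field_derivative ((1 * ?k + z * (z / ?k) - 2 * z) / 4 - 1 / ?k)) (at z)"
    by (simp add: sc_primitive_def[abs_def])
  moreover have "z * (z / ?k) = ?k + 4 / ?k"
  proof -
    have e: "z * z = ?k * ?k + 4" using sc_root_square[of z] by (simp add: power2_eq_square)
    show ?thesis unfolding times_divide_eq_right e using sc_root_nonzero[OF assms(1)] by (simp add: add_divide_distrib)
  qed
  then have "(1 * ?k + z * (z / ?k) - 2 * z) / 4 - 1 / ?k = sc_stieltjes z"
    by (simp only:) (simp add: sc_stieltjes_def field_simps)
  ultimately show ?thesis by simp
qed

lemma has_vector_derivative_vertical:
  assumes "(f has_field_derivative D) (at (Complex E t))"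
  shows "((\<lambda>t. f (Complex E t)) has_vector_derivative \<i> * D) (at t within S)"
proof -
  have "((\<lambda>t. complex_of_real E + \<i> * complex_of_real t) has_vector_derivative \<i>) (at t within S)"
    by (auto intro!: derivative_eq_intros)
  from field_vector_diff_chain_within[OF this, of f D]
  show ?thesis
    using has_field_derivative_at_within[OF assms]
    by (simp add: o_def Complex_eq)
qed

lemma has_real_derivative_Im_vertical:
  assumes "(f has_field_derivative D) (at (Complex E t))"
  shows "((\<lambda>t. Im (f (Complex E t))) has_real_derivative Re D) (at t within S)"
  using has_vector_derivative_vertical[OF assms, of S, THEN bounded_linear.has_vector_derivative[OF bounded_linear_Im]]
  by (simp add: has_real_derivative_iff_has_vector_derivative)

text \<open>Comparing imaginary parts in c^2 = 4 - z^2 gives Re c Im c = - Re z Im z, and Re c is at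
  least Im z / sqrt 2 by the sector bound.\<close>

lemma Im_csqrt_bound:
  assumes "\<bar>Re z\<bar> < 2" "Im z > 0"
  shows "\<bar>Im (csqrt (4 - z\<^sup>2))\<bar> \<le> 4"
proof -
  define c where "c = csqrt (4 - z\<^sup>2)"
  have "c\<^sup>2 = 4 - z\<^sup>2" by (simp add: c_def)
  then have "Im (c\<^sup>2) = Im (4 - z\<^sup>2)" by simp
  then have eq: "Re c * Im c = - (Re z * Im z)" by (simp add: Im_power2 mult.commute)
  have k: "norm (sc_root z) = norm c" by (simp add: sc_root_def c_def norm_mult)
  have "Im z \<le> sqrt 2 * Re c"
    using norm_sc_root_lower(4)[of z] norm_sc_root_le_Im[of z] assms
    by (simp add: sc_root_def c_def del: csqrt.simps)
  then have "\<bar>Im c\<bar> * Im z \<le> \<bar>Im c\<bar> * (sqrt 2 * Re c)" by (intro mult_left_mono) auto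
  also have "\<dots> = sqrt 2 * \<bar>Re c * Im c\<bar>"
    using Re_csqrt_pos[OF assms(1)] by (simp add: c_def[symmetric] abs_mult)
  also have "\<dots> = sqrt 2 * \<bar>Re z\<bar> * Im z" unfolding eq using assms by (simp add: abs_mult)
  finally have "\<bar>Im c\<bar> \<le> sqrt 2 * \<bar>Re z\<bar>" using assms by simp
  also have "\<dots> \<le> 2 * 2" using assms by (intro mult_mono) (auto intro: real_le_lsqrt)
  finally show ?thesis by (simp add: c_def)
qed

text \<open>\<open>z * sc_root z - z\<^sup>2\<close> is a difference of two large terms.
  Rationalising with w = c - i z, for which w (c + i z) = 4, turns it into 4 i z / w; this term and
  the logarithm are then controlled by Re w >= Im z together with bounds on Re z and Im w. The decay
  identifies the limit of the smoothed counts at infinite height.\<close>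

lemma Im_sc_primitive_bound:
  assumes "\<bar>Re z\<bar> < 2" "Im z > 0"
  shows "\<bar>Im (sc_primitive z)\<bar> \<le> 20 / Im z"
proof -
  define c where "c = csqrt (4 - z\<^sup>2)"
  define w where "w = c - \<i> * z"
  have c2: "c\<^sup>2 = 4 - z\<^sup>2" by (simp add: c_def)
  have Re_w: "Re w > 0" "Re w \<ge> Im z"
    using csqrt_minus_iz_notin[of z] Re_csqrt_pos[of z] assms by (auto simp: w_def c_def simp del: csqrt.simps)
  then have w0: "w \<noteq> 0" by auto
  have Im_w: "\<bar>Im w\<bar> \<le> 6" using Im_csqrt_bound[OF assms] assms by (simp add: w_def c_def del: csqrt.simps)
  have "w * (\<i> * (c + \<i> * z)) = 4 * \<i>"
  proof -
    have "w * (\<i> * (c + \<i> * z)) = \<i> * (c\<^sup>2 + z\<^sup>2)"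
      by (simp add: w_def algebra_simps power2_eq_square)
    then show ?thesis by (simp add: c2)
  qed
  then have 1: "(z * sc_root z - z\<^sup>2) / 4 = \<i> * z / w"
  proof -
    have "(z * sc_root z - z\<^sup>2) * w = z * (w * (\<i> * (c + \<i> * z)))"
      unfolding sc_root_def c_def[symmetric] by (simp add: algebra_simps power2_eq_square)
    also have "\<dots> = 4 * (\<i> * z)" using \<open>w * _ = _\<close> by simp
    finally show ?thesis using w0 by (simp add: field_simps)
  qed
  have "Im (\<i> * z / w) = (Re z * Re w + Im z * Im w) / ((Re w)\<^sup>2 + (Im w)\<^sup>2)"
    by (simp add: Im_divide)
  also have "\<bar>\<dots>\<bar> \<le> (2 * Re w + Re w * 6) / (Re w)\<^sup>2"
    unfolding abs_divide
  proof (intro frac_le)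
    have "\<bar>Re z * Re w\<bar> \<le> 2 * Re w" "\<bar>Im z * Im w\<bar> \<le> Re w * 6"
      unfolding abs_mult using Re_w Im_w assms by (auto intro!: mult_mono)
    then show "\<bar>Re z * Re w + Im z * Im w\<bar> \<le> 2 * Re w + Re w * 6" by linarith
  qed (use Re_w in auto)
  also have "\<dots> = 8 / Re w" using Re_w by (simp add: field_simps power2_eq_square)
  also have "\<dots> \<le> 8 / Im z" using Re_w assms by (intro divide_left_mono) auto
  finally have 2: "\<bar>Im (\<i> * z / w)\<bar> \<le> 8 / Im z" .
  have "\<bar>Im (sc_log z)\<bar> = \<bar>arctan (Im w / Re w)\<bar>"
    using Im_Ln_eq_arctan[OF Re_w(1)] by (simp add: sc_log_def w_def c_def)
  also have "\<dots> \<le> \<bar>Im w / Re w\<bar>" by (metis abs_arctan_le)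
  also have "\<dots> \<le> 6 / Im z" unfolding abs_divide using Re_w Im_w assms by (intro frac_le) auto
  finally have 3: "\<bar>Im (sc_log z)\<bar> \<le> 6 / Im z" .
  have "Im (sc_primitive z) = Im (\<i> * z / w) - Im (sc_log z)" unfolding sc_primitive_def 1 by simp
  also have "\<bar>\<dots>\<bar> \<le> 8 / Im z + 6 / Im z" using 2 3 by linarith
  also have "\<dots> \<le> 20 / Im z" using assms by (simp add: field_simps)
  finally show ?thesis .
qed

text \<open>The odd primitive of half the square root in the semicircle density, running from - pi /
  2 at -2 to pi / 2 at 2.\<close>

definition sc_antideriv :: "real \<Rightarrow> real" where
  "sc_antideriv x = x * sqrt (4 - x\<^sup>2) / 4 + arcsin (x / 2)"

lemma Im_sc_primitive_real:
  assumes "\<bar>E\<bar> < 2"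
  shows "Im (sc_primitive (Complex E 0)) = sc_antideriv E"
proof -
  have "E\<^sup>2 < 4" using assms abs_square_less_1[of "E / 2"] by (simp add: power_divide)
  then have s: "sqrt (4 - E\<^sup>2) > 0" by simp
  have "4 - (Complex E 0)\<^sup>2 = complex_of_real (4 - E\<^sup>2)" by (simp add: complex_eq_iff power2_eq_square)
  then have c: "csqrt (4 - (Complex E 0)\<^sup>2) = complex_of_real (sqrt (4 - E\<^sup>2))"
    using \<open>E\<^sup>2 < 4\<close> by (simp add: csqrt_of_real_nonneg del: csqrt.simps)
  have "Im (sc_log (Complex E 0)) = arctan (- E / sqrt (4 - E\<^sup>2))"
    unfolding sc_log_def c using s by (subst Im_Ln_eq_arctan) auto
  also have "\<dots> = - arcsin (E / 2)"
  proof -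
    have "1 - (E / 2)\<^sup>2 = (4 - E\<^sup>2) / 2\<^sup>2" by (simp add: field_simps)
    then have "sqrt (1 - (E / 2)\<^sup>2) = sqrt (4 - E\<^sup>2) / 2" by (simp only: real_sqrt_divide) simp
    moreover have "arcsin (E / 2) = arctan (E / 2 / sqrt (1 - (E / 2)\<^sup>2))"
      using assms by (intro arcsin_arctan) auto
    ultimately have "arcsin (E / 2) = arctan (E / sqrt (4 - E\<^sup>2))" by (simp only:) simp
    then show ?thesis by (simp add: arctan_minus)
  qed
  finally show ?thesis
    by (simp add: sc_primitive_def sc_root_def c sc_antideriv_def Im_power2 del: csqrt.simps)
qed

text \<open>The conditions on t and h keep both points within norm 4; the singular factor comes from
  \<open>sc_root_diff_le\<close>, whose denominator is at least 2 sqrt 2 times the root of the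
  distance to the edge.\<close>

lemma sc_stieltjes_shift:
  assumes "\<bar>E\<bar> < 2" "0 < t" "t \<le> h" "h \<le> 1"
  shows "norm (sc_stieltjes (Complex E t) - sc_stieltjes (Complex E (t + h))) \<le> 3 * h / sqrt (2 - \<bar>E\<bar>)"
proof -
  define a where "a = 2 - \<bar>E\<bar>"
  let ?z = "Complex E t" and ?w = "Complex E (t + h)"
  have a: "a > 0" "a \<le> 2" using assms by (auto simp: a_def)
  have k: "sqrt 2 * sqrt a \<le> norm (sc_root (Complex E u))" if "u \<ge> 0" for u
  proof (rule power2_le_imp_le)
    show "(sqrt 2 * sqrt a)\<^sup>2 \<le> (norm (sc_root (Complex E u)))\<^sup>2"
      using norm_sc_root_lower(1)[of "Complex E u"] assms that a
      by (simp add: a_def power_mult_distrib)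
  qed auto
  have d: "norm (?z - ?w) = h" using assms by (simp add: cmod_def)
  have n: "norm ?z \<le> 4" "norm ?w \<le> 4"
    using cmod_le[of ?z] cmod_le[of ?w] assms by auto
  have "norm (sc_root ?z - sc_root ?w) \<le> sqrt 2 * h * (norm ?z + norm ?w) / (norm (sc_root ?z) + norm (sc_root ?w))"
    using sc_root_diff_le[of ?z ?w] assms d by simp
  also have "\<dots> \<le> sqrt 2 * h * (4 + 4) / (sqrt 2 * sqrt a + sqrt 2 * sqrt a)"
    using k[of t] k[of "t + h"] n a assms
    by (intro frac_le mult_left_mono add_mono) (auto intro!: add_pos_pos)
  also have "\<dots> = 4 * (h / sqrt a)" using a by (simp add: field_simps)
  finally have 1: "norm (sc_root ?z - sc_root ?w) \<le> 4 * (h / sqrt a)" .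
  have "sqrt a \<le> 2" using a by (intro real_le_lsqrt) auto
  then have "h \<le> 2 * (h / sqrt a)" using a assms by (simp add: field_simps mult_left_mono)
  moreover have "norm (sc_stieltjes ?z - sc_stieltjes ?w) \<le> (norm (sc_root ?z - sc_root ?w) + norm (?z - ?w)) / 2"
  proof -
    have "sc_stieltjes ?z - sc_stieltjes ?w = ((sc_root ?z - sc_root ?w) - (?z - ?w)) / 2"
      by (simp add: sc_stieltjes_def diff_divide_distrib)
    then have "norm (sc_stieltjes ?z - sc_stieltjes ?w) = norm ((sc_root ?z - sc_root ?w) - (?z - ?w)) / 2"
      by (simp only: norm_divide norm_numeral)
    then show ?thesis using norm_triangle_ineq4[of "sc_root ?z - sc_root ?w" "?z - ?w"]
      by (simp only: divide_right_mono)
  qed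
  ultimately have "norm (sc_stieltjes ?z - sc_stieltjes ?w) \<le> (4 * (h / sqrt a) + 2 * (h / sqrt a)) / 2"
    using 1 unfolding d by (smt (verit) divide_right_mono)
  then show ?thesis by (simp add: a_def)
qed

text \<open>Richardson extrapolation: the linear term in h drops out and the Lipschitz bound for the
  Stieltjes transform leaves h^2. With h = 1 / (n sqrt \<alpha>) the linear term times n would be of
  order 1 / sqrt \<alpha>, unbounded near the edge.\<close>

lemma sc_primitive_extrapolation:
  assumes "\<bar>E\<bar> < 2" "0 < h" "h \<le> 1"
  shows "\<bar>2 * Im (sc_primitive (Complex E h)) - Im (sc_primitive (Complex E (2 * h))) - sc_antideriv E\<bar>
    \<le> 3 * h\<^sup>2 / sqrt (2 - \<bar>E\<bar>)"
proof -
  define B where "B t = Im (sc_primitive (Complex E t))" for t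
  \<comment> \<open>The increment of \<open>\<phi>\<close> over [0, h] is exactly 2 B(h) - B(2 h) -
    B(0), so one use of the mean value theorem suffices.\<close>
  define \<phi> where "\<phi> t = B t - B (t + h)" for t
  have B: "(B has_real_derivative Re (sc_stieltjes (Complex E t))) (at t within S)" if "t \<ge> 0" for t S
    unfolding B_def using that assms
    by (intro has_real_derivative_Im_vertical has_field_derivative_sc_primitive) auto
  have \<phi>: "(\<phi> has_real_derivative Re (sc_stieltjes (Complex E t)) - Re (sc_stieltjes (Complex E (t + h))))
      (at t)" if "t \<ge> 0" for t
  proof -
    have "((\<lambda>t. B (t + h)) has_real_derivative Re (sc_stieltjes (Complex E (t + h))) * 1) (at t)"
      using that assms by (intro DERIV_chain2[OF B]) (auto intro!: derivative_eq_intros)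
    from DERIV_diff[OF B[OF that] this] show ?thesis unfolding \<phi>_def by simp
  qed
  have "\<exists>t. 0 < t \<and> t < h \<and> \<phi> h - \<phi> 0 =
     (h - 0) * (Re (sc_stieltjes (Complex E t)) - Re (sc_stieltjes (Complex E (t + h))))"
    using assms \<phi> by (intro MVT2) auto
  then obtain t where t: "0 < t" "t < h" and
    eq: "\<phi> h - \<phi> 0 = h * Re (sc_stieltjes (Complex E t) - sc_stieltjes (Complex E (t + h)))" by auto
  have "\<bar>\<phi> h - \<phi> 0\<bar> \<le> h * norm (sc_stieltjes (Complex E t) - sc_stieltjes (Complex E (t + h)))"
    unfolding eq abs_mult using assms by (intro mult_mono abs_Re_le_cmod) auto
  also have "\<dots> \<le> h * (3 * h / sqrt (2 - \<bar>E\<bar>))"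
    using assms t by (intro mult_left_mono sc_stieltjes_shift) auto
  finally show ?thesis
    using Im_sc_primitive_real[OF assms(1)]
    by (simp add: \<phi>_def B_def power2_eq_square mult_2[symmetric] algebra_simps)
qed

section \<open>The loop equation\<close>

lemma distr_density_diffeo_lborel:
  fixes T T' :: "real \<Rightarrow> real"
  assumes T: "\<And>x. (T has_real_derivative T' x) (at x)" and pos: "\<And>x. T' x > 0"
    and T': "continuous_on UNIV T'" and near: "\<And>x. \<bar>T x - x\<bar> \<le> K"
  shows "distr (density lborel (\<lambda>x. ennreal (T' x))) borel T = lborel"
proof (rule lborel_eqI[symmetric])
  have contT: "continuous_on UNIV T" using T by (meson DERIV_continuous continuous_at_imp_continuous_on)
  have [measurable]: "T \<in> borel_measurable borel" "T' \<in> borel_measurable borel"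
    using contT T' by (auto intro: borel_measurable_continuous_onI)
  have mono: "strict_mono T"
    by (rule strict_monoI, rule DERIV_pos_imp_increasing) (use T pos in auto)
  \<comment> \<open>Bounded displacement brackets y between \<open>T (y - K)\<close> and
    \<open>T (y + K)\<close>.\<close>
  have surj: "\<exists>x. T x = y" for y
  proof -
    have "T (y - K) \<le> y" "y \<le> T (y + K)" "y - K \<le> y + K"
      using near[of "y - K"] near[of "y + K"] near[of y] by linarith+
    from IVT'[OF this continuous_on_subset[OF contT]] show ?thesis by auto
  qed
  fix l u :: real assume "\<And>b. b \<in> Basis \<Longrightarrow> l \<bullet> b \<le> u \<bullet> b"
  then have lu: "l \<le> u" by simp
  obtain a b where ab: "T a = l" "T b = u" using surj by blast
  have "a \<le> b" using lu ab strict_mono_less_eq[OF mono] by blast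
  have vim: "T -` box l u = box a b"
    using ab strict_mono_less[OF mono] by auto
  have "emeasure (distr (density lborel (\<lambda>x. ennreal (T' x))) borel T) (box l u)
      = (\<integral>\<^sup>+ x. ennreal (T' x) * indicator {a<..<b} x \<partial>lborel)"
    unfolding box_real using vim by (subst emeasure_distr) (simp_all add: emeasure_density)
  also have "\<dots> = (\<integral>\<^sup>+ x. ennreal (T' x) * indicator {a..b} x \<partial>lborel)"
  proof (rule nn_integral_cong_AE)
    have "AE x in lborel. x \<noteq> a \<and> x \<noteq> b"
      using AE_lborel_singleton[of a] AE_lborel_singleton[of b] by eventually_elim auto
    then show "AE x in lborel. ennreal (T' x) * indicator {a<..<b} x = ennreal (T' x) * indicator {a..b} x"
      by eventually_elim (auto simp: indicator_def)
  qed
  also have "\<dots> = ennreal (u - l)"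
    unfolding ab(1)[symmetric] ab(2)[symmetric]
    by (rule nn_integral_FTC_Icc) (use T \<open>a \<le> b\<close> pos in \<open>auto simp: less_imp_le has_field_derivative_at_within\<close>)
  finally show "emeasure (distr (density lborel (\<lambda>x. ennreal (T' x))) borel T) (box l u)
    = (\<Prod>b\<in>Basis. (u - l) \<bullet> b)" by simp
qed simp

text \<open>The value \<open>undefined\<close> outside the index set keeps the image in the space of
  the product measure.\<close>

definition coordwise :: "nat \<Rightarrow> (real \<Rightarrow> real) \<Rightarrow> (nat \<Rightarrow> real) \<Rightarrow> nat \<Rightarrow> real" where
  "coordwise n T x = (\<lambda>j. if j < n then T (x j) else undefined)"

lemma component_measurable_Rn [measurable (raw)]:
  "j < n \<Longrightarrow> (\<lambda>x. x j) \<in> borel_measurable (lebesgue_Rn n)"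
  unfolding lebesgue_Rn_def
  by (auto intro!: measurable_component_singleton[where M = "\<lambda>_. lborel", simplified])

lemma coordwise_measurable:
  assumes "T \<in> borel_measurable borel"
  shows "coordwise n T \<in> lebesgue_Rn n \<rightarrow>\<^sub>M lebesgue_Rn n"
proof -
  have "(\<lambda>x. \<lambda>j\<in>{..<n}. T (x j)) \<in> lebesgue_Rn n \<rightarrow>\<^sub>M (\<Pi>\<^sub>M j\<in>{..<n}. lborel)"
    using assms by (intro measurable_restrict) (auto intro!: measurable_compose[OF component_measurable_Rn])
  then show ?thesis by (simp add: coordwise_def[abs_def] restrict_def lebesgue_Rn_def)
qed

text \<open>A product measure is determined on rectangles, where density and indicator both factor
  over the coordinates.\<close>

lemma distr_density_coordwise:
  fixes T T' :: "real \<Rightarrow> real"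
  assumes T: "\<And>x. (T has_real_derivative T' x) (at x)" and pos: "\<And>x. T' x > 0"
    and T': "continuous_on UNIV T'" and near: "\<And>x. \<bar>T x - x\<bar> \<le> K"
  shows "distr (density (lebesgue_Rn n) (\<lambda>x. ennreal (\<Prod>j<n. T' (x j)))) (lebesgue_Rn n) (coordwise n T)
     = lebesgue_Rn n"
proof -
  interpret product_sigma_finite "\<lambda>_::nat. lborel :: real measure" by standard
  have contT: "continuous_on UNIV T" using T by (meson DERIV_continuous continuous_at_imp_continuous_on)
  have [measurable]: "T \<in> borel_measurable borel" "T' \<in> borel_measurable borel"
    using contT T' by (auto intro: borel_measurable_continuous_onI)
  note cm[measurable] = coordwise_measurable[of T n]
  show ?thesis
    unfolding lebesgue_Rn_def
  proof (rule PiM_eqI)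
    fix A :: "nat \<Rightarrow> real set" assume A: "\<And>i. i \<in> {..<n} \<Longrightarrow> A i \<in> sets lborel"
    have sB: "PiE {..<n} A \<in> sets (lebesgue_Rn n)"
      unfolding lebesgue_Rn_def using A by (intro sets_PiM_I_finite) auto
    have one: "(\<integral>\<^sup>+ t. ennreal (T' t) * indicator (A i) (T t) \<partial>lborel) = emeasure lborel (A i)" if "i < n" for i
    proof -
      have [measurable]: "A i \<in> sets borel" using A[of i] that by auto
      have "emeasure lborel (A i) = emeasure (distr (density lborel (\<lambda>x. ennreal (T' x))) borel T) (A i)"
        using distr_density_diffeo_lborel[OF assms] by simp
      also have "\<dots> = (\<integral>\<^sup>+ t. ennreal (T' t) * indicator (T -` A i) t \<partial>lborel)"
        using measurable_sets_borel[of T borel "A i"] by (subst emeasure_distr) (simp_all add: emeasure_density)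
      finally show ?thesis by (simp add: indicator_def)
    qed
    have "emeasure (distr (density (lebesgue_Rn n) (\<lambda>x. ennreal (\<Prod>j<n. T' (x j)))) (lebesgue_Rn n) (coordwise n T)) (PiE {..<n} A)
       = (\<integral>\<^sup>+ x. ennreal (\<Prod>j<n. T' (x j)) * indicator (coordwise n T -` PiE {..<n} A \<inter> space (lebesgue_Rn n)) x \<partial>lebesgue_Rn n)"
      using sB by (subst emeasure_distr) (auto simp: emeasure_density measurable_sets[OF cm])
    also have "\<dots> = (\<integral>\<^sup>+ x. (\<Prod>j<n. ennreal (T' (x j)) * indicator (A j) (T (x j))) \<partial>lebesgue_Rn n)"
    proof (rule nn_integral_cong)
      fix x assume x: "x \<in> space (lebesgue_Rn n)"
      have "indicator (coordwise n T -` PiE {..<n} A \<inter> space (lebesgue_Rn n)) x = (\<Prod>j<n. indicator (A j) (T (x j)) :: ennreal)"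
        using x by (auto simp: indicator_def coordwise_def PiE_iff extensional_def)
      then show "ennreal (\<Prod>j<n. T' (x j)) * indicator (coordwise n T -` PiE {..<n} A \<inter> space (lebesgue_Rn n)) x
         = (\<Prod>j<n. ennreal (T' (x j)) * indicator (A j) (T (x j)))"
        by (simp add: prod.distrib prod_ennreal less_imp_le[OF pos])
    qed
    also have "\<dots> = (\<Prod>j<n. \<integral>\<^sup>+ t. ennreal (T' t) * indicator (A j) (T t) \<partial>lborel)"
    proof -
      have "(\<lambda>t. ennreal (T' t) * indicator (A i) (T t)) \<in> borel_measurable lborel" if "i \<in> {..<n}" for i
      proof -
        have [measurable]: "A i \<in> sets borel" using A[OF that] by auto
        show ?thesis by measurable
      qed
      then show ?thesis unfolding lebesgue_Rn_def by (intro product_nn_integral_prod) auto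
    qed
    also have "\<dots> = (\<Prod>j<n. emeasure lborel (A j))" by (intro prod.cong refl one) auto
    finally show "emeasure (distr (density (Pi\<^sub>M {..<n} (\<lambda>_. lborel)) (\<lambda>x. ennreal (\<Prod>j<n. T' (x j)))) (Pi\<^sub>M {..<n} (\<lambda>_. lborel)) (coordwise n T)) (PiE {..<n} A) = (\<Prod>j<n. emeasure lborel (A j))"
      by (simp add: lebesgue_Rn_def)
  qed auto
qed

lemma integral_coordwise:
  fixes T T' :: "real \<Rightarrow> real" and f :: "(nat \<Rightarrow> real) \<Rightarrow> complex"
  assumes T: "\<And>x. (T has_real_derivative T' x) (at x)" and pos: "\<And>x. T' x > 0"
    and T': "continuous_on UNIV T'" and near: "\<And>x. \<bar>T x - x\<bar> \<le> K"
    and f: "f \<in> borel_measurable (lebesgue_Rn n)"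
  shows "(\<integral>x. f x \<partial>lebesgue_Rn n) = (\<integral>x. (\<Prod>j<n. T' (x j)) *\<^sub>R f (coordwise n T x) \<partial>lebesgue_Rn n)"
proof -
  have contT: "continuous_on UNIV T" using T by (meson DERIV_continuous continuous_at_imp_continuous_on)
  have [measurable]: "T \<in> borel_measurable borel" "T' \<in> borel_measurable borel"
    using contT T' by (auto intro: borel_measurable_continuous_onI)
  note cm[measurable] = coordwise_measurable[of T n]
  note f[measurable]
  have J: "(\<lambda>x. \<Prod>j<n. T' (x j)) \<in> borel_measurable (lebesgue_Rn n)"
    by (intro borel_measurable_prod) (auto intro!: measurable_compose[OF component_measurable_Rn])
  have "(\<integral>x. f x \<partial>lebesgue_Rn n) = (\<integral>x. f x \<partial>distr (density (lebesgue_Rn n) (\<lambda>x. ennreal (\<Prod>j<n. T' (x j)))) (lebesgue_Rn n) (coordwise n T))"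
    by (simp add: distr_density_coordwise[OF T pos T' near])
  also have "\<dots> = (\<integral>x. f (coordwise n T x) \<partial>density (lebesgue_Rn n) (\<lambda>x. ennreal (\<Prod>j<n. T' (x j))))"
    by (intro integral_distr) auto
  also have "\<dots> = (\<integral>x. (\<Prod>j<n. T' (x j)) *\<^sub>R f (coordwise n T x) \<partial>lebesgue_Rn n)"
    using J by (intro integral_density) (auto intro!: prod_nonneg less_imp_le[OF pos])
  finally show ?thesis .
qed

section \<open>The ensemble as a real density and its exponential moments\<close>

lemma sets_gbe [measurable_cong]: "sets (gaussian_beta_ensemble \<beta> n) = sets (lebesgue_Rn n)"
  by (simp add: gaussian_beta_ensemble_def)

lemma gbe_weight_nonneg: "gbe_weight \<beta> n x \<ge> 0"
  unfolding gbe_weight_def by (intro mult_nonneg_nonneg prod_nonneg) auto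

lemma gbe_density_real:
  assumes "\<beta> > 0"
  obtains Z where "Z > 0" "gaussian_beta_ensemble \<beta> n = density (lebesgue_Rn n) (\<lambda>x. ennreal (gbe_weight \<beta> n x / Z))"
proof
  let ?Z = "\<integral>\<^sup>+ y. ennreal (gbe_weight \<beta> n y) \<partial>lebesgue_Rn n"
  show pos: "enn2real ?Z > 0"
    using gbe_normalisation_finite[OF assms, of n] gbe_normalisation_pos[of n \<beta>]
    by (simp add: enn2real_positive_iff)
  have Z: "ennreal (enn2real ?Z) = ?Z"
    using gbe_normalisation_finite[OF assms, of n] by simp
  have "ennreal (gbe_weight \<beta> n x) / ?Z = ennreal (gbe_weight \<beta> n x / enn2real ?Z)" for x
    using divide_ennreal[OF gbe_weight_nonneg pos, of \<beta> n x] unfolding Z .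
  then show "gaussian_beta_ensemble \<beta> n = density (lebesgue_Rn n) (\<lambda>x. ennreal (gbe_weight \<beta> n x / enn2real ?Z))"
    by (simp add: gaussian_beta_ensemble_def)
qed

text \<open>The Gaussian factor beats every exponential of linear growth. These functions serve as
  the majorants when the deformed integral is differentiated.\<close>

lemma integrable_exp_gbe:
  assumes "\<beta> > 0"
  shows "integrable (gaussian_beta_ensemble \<beta> n) (\<lambda>x. exp (c * (1 + (\<Sum>j<n. \<bar>x j\<bar>))) :: real)"
proof -
  interpret product_sigma_finite "\<lambda>_::nat. lborel :: real measure" by standard
  obtain Z where Z: "Z > 0" and gbe: "gaussian_beta_ensemble \<beta> n = density (lebesgue_Rn n) (\<lambda>x. ennreal (gbe_weight \<beta> n x / Z))"
    using gbe_density_real[OF assms] .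
  define g where "g = (\<lambda>t::real. exp (- (\<beta> / 4) * t\<^sup>2) * exp ((2 * real n * \<beta> + c) * \<bar>t\<bar>))"
  have [measurable]: "g \<in> borel_measurable borel" unfolding g_def by measurable
  have g0: "g t \<ge> 0" for t by (simp add: g_def)
  have m[measurable]: "(\<lambda>x. exp (c * (1 + (\<Sum>j<n. \<bar>x j\<bar>)))) \<in> borel_measurable (lebesgue_Rn n)"
    by measurable
  have le: "gbe_weight \<beta> n x * exp (c * (1 + (\<Sum>j<n. \<bar>x j\<bar>))) \<le> exp c * (\<Prod>j<n. g (x j))" for x
  proof -
    have "exp (c * (1 + (\<Sum>j<n. \<bar>x j\<bar>))) = exp c * (\<Prod>j<n. exp (c * \<bar>x j\<bar>))"
      by (simp add: distrib_left exp_add sum_distrib_left exp_sum)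
    then have "gbe_weight \<beta> n x * exp (c * (1 + (\<Sum>j<n. \<bar>x j\<bar>)))
       \<le> (\<Prod>j<n. exp (- (\<beta> / 4) * (x j)\<^sup>2) * exp (2 * real n * \<beta> * \<bar>x j\<bar>)) * (exp c * (\<Prod>j<n. exp (c * \<bar>x j\<bar>)))"
      using gbe_weight_le[OF assms, of n x] by (simp add: mult_right_mono prod_nonneg)
    also have "\<dots> = exp c * (\<Prod>j<n. g (x j))"
      by (simp add: g_def prod.distrib[symmetric] exp_add[symmetric] algebra_simps)
    finally show ?thesis .
  qed
  have "(\<integral>\<^sup>+ x. ennreal (gbe_weight \<beta> n x * exp (c * (1 + (\<Sum>j<n. \<bar>x j\<bar>)))) \<partial>lebesgue_Rn n)
     \<le> (\<integral>\<^sup>+ x. ennreal (exp c) * (\<Prod>j<n. ennreal (g (x j))) \<partial>lebesgue_Rn n)"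
    using le by (intro nn_integral_mono) (auto simp: prod_ennreal g0 ennreal_mult[symmetric] prod_nonneg intro!: ennreal_leI)
  also have "\<dots> = ennreal (exp c) * (\<Prod>j<n. \<integral>\<^sup>+ t. ennreal (g t) \<partial>lborel)"
  proof -
    have "(\<integral>\<^sup>+ x. (\<Prod>j<n. ennreal (g (x j))) \<partial>lebesgue_Rn n) = (\<Prod>j<n. \<integral>\<^sup>+ t. ennreal (g t) \<partial>lborel)"
      unfolding lebesgue_Rn_def by (intro product_nn_integral_prod) auto
    then show ?thesis by (subst nn_integral_cmult) auto
  qed
  also have "\<dots> < \<infinity>"
    using nn_integral_gaussian_exp_finite[of "\<beta> / 4" "2 * real n * \<beta> + c"] assms
    by (simp add: g_def power_less_top_ennreal ennreal_mult_less_top)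
  finally have "integrable (lebesgue_Rn n) (\<lambda>x. gbe_weight \<beta> n x * exp (c * (1 + (\<Sum>j<n. \<bar>x j\<bar>))))"
    using gbe_weight_nonneg by (intro integrableI_nonneg) auto
  then have "integrable (lebesgue_Rn n) (\<lambda>x. (gbe_weight \<beta> n x / Z) *\<^sub>R exp (c * (1 + (\<Sum>j<n. \<bar>x j\<bar>))))"
    using integrable_mult_left[of "1 / Z"] by (simp add: mult.commute mult.assoc)
  then show ?thesis unfolding gbe
    using Z gbe_weight_nonneg by (subst integrable_density) auto
qed

text \<open>\<open>G j\<close> is the partial derivative of \<open>F\<close> in coordinate
  \<open>j\<close>. Derivatives are demanded only at the base point of each line; as the base point
  is arbitrary, they exist along the whole line, which is all that a deformation of the points uses.
  The common bound supplies the majorants.\<close>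

definition smooth_statistic ::
    "nat \<Rightarrow> ((nat \<Rightarrow> real) \<Rightarrow> complex) \<Rightarrow> (nat \<Rightarrow> (nat \<Rightarrow> real) \<Rightarrow> complex) \<Rightarrow> bool" where
  "smooth_statistic n F G \<longleftrightarrow>
     F \<in> borel_measurable (lebesgue_Rn n) \<and> (\<forall>j<n. G j \<in> borel_measurable (lebesgue_Rn n)) \<and>
     (\<exists>B. \<forall>x. norm (F x) \<le> B \<and> (\<forall>j<n. norm (G j x) \<le> B)) \<and>
     (\<forall>x v. ((\<lambda>e. F (\<lambda>j. x j + e * v j)) has_vector_derivative (\<Sum>j<n. of_real (v j) * G j x)) (at 0))"

lemma smooth_statisticD:
  assumes "smooth_statistic n F G"
  shows "F \<in> borel_measurable (lebesgue_Rn n)" "j < n \<Longrightarrow> G j \<in> borel_measurable (lebesgue_Rn n)"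
    "((\<lambda>e. F (\<lambda>j. x j + e * v j)) has_vector_derivative (\<Sum>j<n. of_real (v j) * G j x)) (at 0)"
  using assms by (simp_all add: smooth_statistic_def)

lemma smooth_statistic_bound:
  assumes "smooth_statistic n F G"
  obtains A where "\<And>x. norm (F x) \<le> A" "\<And>x j. j < n \<Longrightarrow> norm (G j x) \<le> A" "A \<ge> 0"
  using assms unfolding smooth_statistic_def by (meson norm_ge_zero order_trans)

text \<open>Re-basing the line at each of its points gives the derivative everywhere on it, then the
  mean value inequality applies.\<close>

lemma smooth_statistic_lipschitz:
  assumes "smooth_statistic n F G" "\<And>j. j < n \<Longrightarrow> \<bar>v j\<bar> \<le> B" "\<And>x j. j < n \<Longrightarrow> norm (G j x) \<le> A" "B \<ge> 0"
  shows "norm (F (\<lambda>j. x j + e * v j) - F x) \<le> real n * B * A * \<bar>e\<bar>"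
proof -
  define f where "f t = F (\<lambda>j. x j + t * v j)" for t
  have d: "(f has_vector_derivative (\<Sum>j<n. of_real (v j) * G j (\<lambda>j. x j + t * v j))) (at t within S)" for t S
  proof -
    have "((\<lambda>e. F (\<lambda>j. (x j + t * v j) + e * v j)) has_vector_derivative (\<Sum>j<n. of_real (v j) * G j (\<lambda>j. x j + t * v j))) (at 0)"
      by (rule smooth_statisticD[OF assms(1)])
    then have "((\<lambda>e. f (t + e)) has_vector_derivative (\<Sum>j<n. of_real (v j) * G j (\<lambda>j. x j + t * v j))) (at (t - t))"
      by (simp add: f_def algebra_simps)
    moreover have "((\<lambda>s. s - t) has_vector_derivative 1) (at t)"
      by (auto intro!: derivative_eq_intros)
    ultimately have "(((\<lambda>e. f (t + e)) \<circ> (\<lambda>s. s - t)) has_vector_derivative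
        1 *\<^sub>R (\<Sum>j<n. of_real (v j) * G j (\<lambda>j. x j + t * v j))) (at t)"
      by (intro vector_diff_chain_at)
    then have "(f has_vector_derivative (\<Sum>j<n. of_real (v j) * G j (\<lambda>j. x j + t * v j))) (at t)"
      by (simp add: o_def)
    then show ?thesis by (rule has_vector_derivative_at_within)
  qed
  have b: "norm (\<Sum>j<n. of_real (v j) * G j (\<lambda>j. x j + t * v j)) \<le> real n * B * A" for t
  proof -
    have "norm (\<Sum>j<n. of_real (v j) * G j (\<lambda>j. x j + t * v j)) \<le> (\<Sum>j<n. B * A)"
      using assms by (intro sum_norm_le) (auto simp: norm_mult intro!: mult_mono)
    then show ?thesis by (simp add: mult.assoc)
  qed
  have "norm (f e - f 0) \<le> real n * B * A * norm (e - 0)"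
  proof (rule differentiable_bound)
    show "(f has_derivative (\<lambda>y. y *\<^sub>R (\<Sum>j<n. of_real (v j) * G j (\<lambda>j. x j + t * v j)))) (at t within UNIV)" for t
      using d[of t UNIV] by (simp add: has_vector_derivative_def)
    show "onorm (\<lambda>y. y *\<^sub>R (\<Sum>j<n. of_real (v j) * G j (\<lambda>j. x j + t * v j))) \<le> real n * B * A" for t
      using mult_left_mono[OF b[of t] abs_ge_zero] by (intro onorm_le) (simp add: mult_ac)
  qed auto
  then show ?thesis by (simp add: f_def)
qed

text \<open>Difference quotients along a null sequence, the form in which dominated convergence
  takes them.\<close>

lemma has_vector_derivative_sequentially:
  assumes "(f has_vector_derivative D) (at (0::real))" "e \<longlonglongrightarrow> 0" "\<And>m::nat. e m \<noteq> 0"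
  shows "(\<lambda>m. (f (e m) - f 0) /\<^sub>R e m) \<longlonglongrightarrow> D"
proof -
  have "((\<lambda>h. norm (f (0 + h) - f 0 - h *\<^sub>R D) / norm h) \<longlongrightarrow> 0) (at 0)"
    using assms(1) unfolding has_vector_derivative_def has_derivative_at by blast
  moreover have "filterlim e (at 0) sequentially"
    using assms by (auto simp: filterlim_at)
  ultimately have "(\<lambda>m. norm (f (0 + e m) - f 0 - e m *\<^sub>R D) / norm (e m)) \<longlonglongrightarrow> 0"
    by (rule filterlim_compose)
  moreover have "norm (f (0 + e m) - f 0 - e m *\<^sub>R D) / norm (e m) = norm ((f (e m) - f 0) /\<^sub>R e m - D)" for m
  proof -
    have "(f (e m) - f 0) /\<^sub>R e m - D = (f (e m) - f 0 - e m *\<^sub>R D) /\<^sub>R e m"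
      using assms(3)[of m] by (simp add: scaleR_diff_right)
    then show ?thesis by (simp add: divide_inverse mult.commute)
  qed
  ultimately have "(\<lambda>m. norm ((f (e m) - f 0) /\<^sub>R e m - D)) \<longlonglongrightarrow> 0" by simp
  then show ?thesis using LIM_zero_cancel tendsto_norm_zero_iff by blast
qed

section \<open>Integration by parts along a deformation of the points\<close>

lemma abs_ln_one_plus_le:
  fixes u :: real assumes "\<bar>u\<bar> \<le> 1 / 2" shows "\<bar>ln (1 + u)\<bar> \<le> 2 * \<bar>u\<bar>"
proof -
  have "\<bar>ln (1 + u) - u\<bar> \<le> 2 * u\<^sup>2" by (rule abs_ln_one_plus_x_minus_x_bound[OF assms])
  also have "\<dots> \<le> \<bar>u\<bar>" using mult_right_mono[OF assms, of "\<bar>u\<bar>"] by (simp add: power2_eq_square abs_mult_self_eq)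
  finally show ?thesis by linarith
qed

text \<open>The points move along \<open>x + e * h x\<close>. \<open>D\<close> is the divided
  difference of \<open>h\<close>, with the derivative on the diagonal: each difference of two points
  is multiplied by \<open>1 + e * D\<close>, so the Vandermonde factor transforms smoothly even
  where points coincide. The bound \<open>B\<close> makes the map a diffeomorphism when |e| B <= 1 /
  2.\<close>

locale deformation =
  fixes \<beta> :: real and n :: nat and h :: "real \<Rightarrow> real" and D :: "real \<Rightarrow> real \<Rightarrow> real" and B :: real
  assumes \<beta>: "\<beta> > 0"
    and h_deriv: "(h has_real_derivative D x x) (at x)"
    and h_diff: "h x - h y = D x y * (x - y)"
    and h_bound: "\<bar>h x\<bar> \<le> B"
    and D_bound: "\<bar>D x y\<bar> \<le> B"
    and D_continuous: "continuous_on UNIV (\<lambda>p. D (fst p) (snd p))"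
begin

text \<open>The logarithm of (Jacobian times deformed weight) over the original weight;
  \<open>drift\<close> below is its derivative at e = 0.\<close>

definition log_jacobian :: "real \<Rightarrow> (nat \<Rightarrow> real) \<Rightarrow> real" where
  "log_jacobian e x = - (\<beta> / 4) * (\<Sum>j<n. 2 * e * x j * h (x j) + e\<^sup>2 * (h (x j))\<^sup>2)
     + \<beta> * (\<Sum>k<n. \<Sum>j<k. ln (1 + e * D (x j) (x k))) + (\<Sum>j<n. ln (1 + e * D (x j) (x j)))"

definition drift :: "(nat \<Rightarrow> real) \<Rightarrow> real" where
  "drift x = - (\<beta> / 2) * (\<Sum>j<n. x j * h (x j))
     + \<beta> * (\<Sum>k<n. \<Sum>j<k. D (x j) (x k)) + (\<Sum>j<n. D (x j) (x j))"

lemma B_nonneg: "B \<ge> 0" using h_bound[of 0] by linarith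

lemma eD: assumes "\<bar>e\<bar> * B \<le> 1 / 2" shows "\<bar>e * D x y\<bar> \<le> \<bar>e\<bar> * B" "\<bar>e * D x y\<bar> \<le> 1 / 2" "1 + e * D x y > 0"
proof -
  show 1: "\<bar>e * D x y\<bar> \<le> \<bar>e\<bar> * B" unfolding abs_mult by (intro mult_left_mono D_bound) auto
  then show "\<bar>e * D x y\<bar> \<le> 1 / 2" "1 + e * D x y > 0" using assms by linarith+
qed

lemma h_continuous: "continuous_on UNIV h"
  using h_deriv by (meson DERIV_continuous continuous_at_imp_continuous_on)

lemma h_measurable [measurable]: "h \<in> borel_measurable borel"
  by (intro borel_measurable_continuous_onI h_continuous)

lemma D_diag_continuous: "continuous_on UNIV (\<lambda>x. D x x)"
proof -
  have "continuous_on UNIV (\<lambda>x::real. (x, x))" by (intro continuous_intros)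
  from continuous_on_compose2[OF D_continuous this] show ?thesis by simp
qed

lemma D_diag_measurable [measurable]: "(\<lambda>x. D x x) \<in> borel_measurable borel"
  by (intro borel_measurable_continuous_onI D_diag_continuous)

lemma D_measurable:
  assumes "j < n" "k < n" shows "(\<lambda>x. D (x j) (x k)) \<in> borel_measurable (lebesgue_Rn n)"
  using assms by (intro borel_measurable_continuous_Pair[OF _ _ D_continuous]) auto

lemma log_jacobian_measurable [measurable]: "log_jacobian e \<in> borel_measurable (lebesgue_Rn n)"
proof -
  have 1: "(\<lambda>x. \<Sum>k<n. \<Sum>j<k. ln (1 + e * D (x j) (x k))) \<in> borel_measurable (lebesgue_Rn n)"
    using D_measurable by (intro borel_measurable_sum borel_measurable_ln borel_measurable_add
        borel_measurable_times borel_measurable_const) auto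
  have 2: "(\<lambda>x. \<Sum>j<n. ln (1 + e * D (x j) (x j))) \<in> borel_measurable (lebesgue_Rn n)"
    using D_measurable by (intro borel_measurable_sum borel_measurable_ln borel_measurable_add
        borel_measurable_times borel_measurable_const) auto
  have 3: "(\<lambda>x. \<Sum>j<n. 2 * e * x j * h (x j) + e\<^sup>2 * (h (x j))\<^sup>2) \<in> borel_measurable (lebesgue_Rn n)"
    by measurable
  show ?thesis unfolding log_jacobian_def[abs_def] using 1 2 3 by measurable
qed

lemma drift_measurable [measurable]: "drift \<in> borel_measurable (lebesgue_Rn n)"
proof -
  have 1: "(\<lambda>x. \<Sum>k<n. \<Sum>j<k. D (x j) (x k)) \<in> borel_measurable (lebesgue_Rn n)"
    using D_measurable by (intro borel_measurable_sum) auto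
  have 2: "(\<lambda>x. \<Sum>j<n. D (x j) (x j)) \<in> borel_measurable (lebesgue_Rn n)"
    using D_measurable by (intro borel_measurable_sum) auto
  show ?thesis unfolding drift_def[abs_def] using 1 2 by measurable
qed

lemma gbe_weight_flow:
  assumes "\<bar>e\<bar> * B \<le> 1 / 2"
  shows "(\<Prod>j<n. 1 + e * D (x j) (x j)) * gbe_weight \<beta> n (coordwise n (\<lambda>t. t + e * h t) x)
     = exp (log_jacobian e x) * gbe_weight \<beta> n x"
proof -
  let ?y = "coordwise n (\<lambda>t. t + e * h t) x"
  have y: "?y j = x j + e * h (x j)" if "j < n" for j using that by (simp add: coordwise_def)
  have J: "(\<Prod>j<n. 1 + e * D (x j) (x j)) = exp (\<Sum>j<n. ln (1 + e * D (x j) (x j)))"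
    using eD(3)[OF assms] by (simp add: exp_sum)
  have "(\<Sum>j<n. (?y j)\<^sup>2) = (\<Sum>j<n. (x j)\<^sup>2) + (\<Sum>j<n. 2 * e * x j * h (x j) + e\<^sup>2 * (h (x j))\<^sup>2)"
    unfolding sum.distrib[symmetric] by (intro sum.cong) (auto simp: y power2_eq_square algebra_simps)
  then have S: "exp (- (\<beta> / 4) * (\<Sum>j<n. (?y j)\<^sup>2)) = exp (- (\<beta> / 4) * (\<Sum>j<n. (x j)\<^sup>2))
      * exp (- (\<beta> / 4) * (\<Sum>j<n. 2 * e * x j * h (x j) + e\<^sup>2 * (h (x j))\<^sup>2))"
    by (simp add: exp_add[symmetric] algebra_simps)
  have pair: "\<bar>?y j - ?y k\<bar> powr \<beta> = \<bar>x j - x k\<bar> powr \<beta> * exp (\<beta> * ln (1 + e * D (x j) (x k)))"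
    if "j < n" "k < n" for j k
  proof -
    have "?y j - ?y k = (x j - x k) + e * (h (x j) - h (x k))"
      using that by (simp add: y algebra_simps)
    also have "\<dots> = (x j - x k) * (1 + e * D (x j) (x k))"
      unfolding h_diff[of "x j" "x k"] by (simp add: algebra_simps)
    finally have "\<bar>?y j - ?y k\<bar> = \<bar>x j - x k\<bar> * (1 + e * D (x j) (x k))"
      using eD(3)[OF assms, of "x j" "x k"] by (simp add: abs_mult)
    moreover have "(1 + e * D (x j) (x k)) powr \<beta> = exp (\<beta> * ln (1 + e * D (x j) (x k)))"
      using eD(3)[OF assms, of "x j" "x k"] by (simp add: powr_def)
    ultimately show ?thesis
      using eD(3)[OF assms, of "x j" "x k"] by (simp add: powr_mult)
  qed
  have "(\<Prod>k<n. \<Prod>j<k. \<bar>?y j - ?y k\<bar> powr \<beta>)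
     = (\<Prod>k<n. \<Prod>j<k. \<bar>x j - x k\<bar> powr \<beta> * exp (\<beta> * ln (1 + e * D (x j) (x k))))"
    by (intro prod.cong refl pair) auto
  also have "\<dots> = (\<Prod>k<n. \<Prod>j<k. \<bar>x j - x k\<bar> powr \<beta>) * exp (\<beta> * (\<Sum>k<n. \<Sum>j<k. ln (1 + e * D (x j) (x k))))"
    by (simp add: prod.distrib exp_sum sum_distrib_left)
  finally show ?thesis
    unfolding gbe_weight_def log_jacobian_def S J exp_add by (simp only: mult_ac)
qed

lemma integral_flow:
  assumes "\<bar>e\<bar> * B \<le> 1 / 2" and f[measurable]: "f \<in> borel_measurable (lebesgue_Rn n)"
  shows "(\<integral>x. (f x :: complex) \<partial>gaussian_beta_ensemble \<beta> n)
     = (\<integral>x. exp (log_jacobian e x) *\<^sub>R f (coordwise n (\<lambda>t. t + e * h t) x) \<partial>gaussian_beta_ensemble \<beta> n)"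
proof -
  let ?T = "\<lambda>t. t + e * h t"
  obtain Z where Z: "Z > 0" and gbe: "gaussian_beta_ensemble \<beta> n = density (lebesgue_Rn n) (\<lambda>x. ennreal (gbe_weight \<beta> n x / Z))"
    using gbe_density_real[OF \<beta>] .
  have cm[measurable]: "coordwise n ?T \<in> lebesgue_Rn n \<rightarrow>\<^sub>M lebesgue_Rn n"
    by (intro coordwise_measurable) measurable
  have T: "(?T has_real_derivative 1 + e * D x x) (at x)" for x
    by (auto intro!: derivative_eq_intros h_deriv)
  have near: "\<bar>?T x - x\<bar> \<le> \<bar>e\<bar> * B" for x
    unfolding add_diff_cancel_left' abs_mult by (intro mult_left_mono h_bound) auto
  have cont: "continuous_on UNIV (\<lambda>x. 1 + e * D x x)"
    by (intro continuous_intros D_diag_continuous)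
  have "(\<integral>x. f x \<partial>gaussian_beta_ensemble \<beta> n) = (\<integral>x. (gbe_weight \<beta> n x / Z) *\<^sub>R f x \<partial>lebesgue_Rn n)"
    unfolding gbe using Z gbe_weight_nonneg by (intro integral_density) auto
  also have "\<dots> = (\<integral>x. (\<Prod>j<n. 1 + e * D (x j) (x j)) *\<^sub>R ((gbe_weight \<beta> n (coordwise n ?T x) / Z) *\<^sub>R f (coordwise n ?T x)) \<partial>lebesgue_Rn n)"
    using eD(3)[OF assms(1)] by (intro integral_coordwise[OF T _ cont near]) auto
  also have "\<dots> = (\<integral>x. (gbe_weight \<beta> n x / Z) *\<^sub>R (exp (log_jacobian e x) *\<^sub>R f (coordwise n ?T x)) \<partial>lebesgue_Rn n)"
  proof (rule Bochner_Integration.integral_cong[OF refl])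
    fix x
    have "(\<Prod>j<n. 1 + e * D (x j) (x j)) * (gbe_weight \<beta> n (coordwise n ?T x) / Z)
      = (gbe_weight \<beta> n x / Z) * exp (log_jacobian e x)"
      using gbe_weight_flow[OF assms(1), of x] by (simp add: mult.commute)
    then show "(\<Prod>j<n. 1 + e * D (x j) (x j)) *\<^sub>R ((gbe_weight \<beta> n (coordwise n ?T x) / Z) *\<^sub>R f (coordwise n ?T x))
      = (gbe_weight \<beta> n x / Z) *\<^sub>R (exp (log_jacobian e x) *\<^sub>R f (coordwise n ?T x))"
      by (simp only: scaleR_scaleR)
  qed
  also have "\<dots> = (\<integral>x. exp (log_jacobian e x) *\<^sub>R f (coordwise n ?T x) \<partial>gaussian_beta_ensemble \<beta> n)"
    unfolding gbe using Z gbe_weight_nonneg by (intro integral_density[symmetric]) auto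
  finally show ?thesis .
qed

text \<open>Linear in |e| with a factor of linear growth in the points: this dominates both the
  exponential and its difference quotient by functions covered by \<open>integrable_exp_gbe\<close>.
  Every term carries a factor |e| because each summand vanishes at e = 0.\<close>

lemma log_jacobian_bound:
  assumes "\<bar>e\<bar> * B \<le> 1 / 2"
  shows "\<bar>log_jacobian e x\<bar> \<le> \<bar>e\<bar> * ((\<beta> * B * (real n + 1) + 2 * \<beta> * B * (real n)\<^sup>2 + 2 * B * real n) * (1 + (\<Sum>j<n. \<bar>x j\<bar>)))"
proof -
  define S where "S = (\<Sum>j<n. \<bar>x j\<bar>)"
  have S: "S \<ge> 0" by (simp add: S_def sum_nonneg)
  have ln: "\<bar>ln (1 + e * D u v)\<bar> \<le> 2 * (\<bar>e\<bar> * B)" for u v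
    using abs_ln_one_plus_le[of "e * D u v"] eD[OF assms, of u v] by linarith
  have 1: "\<bar>\<Sum>j<n. ln (1 + e * D (x j) (x j))\<bar> \<le> real n * (2 * (\<bar>e\<bar> * B))"
    using ln by (intro order_trans[OF sum_abs] sum_bounded_above[where A="{..<n}", simplified]) auto
  have 2: "\<bar>\<Sum>k<n. \<Sum>j<k. ln (1 + e * D (x j) (x k))\<bar> \<le> real n * (real n * (2 * (\<bar>e\<bar> * B)))"
  proof -
    have "\<bar>\<Sum>j<k. ln (1 + e * D (x j) (x k))\<bar> \<le> real n * (2 * (\<bar>e\<bar> * B))" if "k < n" for k
    proof -
      have "\<bar>\<Sum>j<k. ln (1 + e * D (x j) (x k))\<bar> \<le> real k * (2 * (\<bar>e\<bar> * B))"
        using ln by (intro order_trans[OF sum_abs] sum_bounded_above[where A="{..<k}", simplified]) auto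
      also have "\<dots> \<le> real n * (2 * (\<bar>e\<bar> * B))" using that B_nonneg by (intro mult_right_mono) auto
      finally show ?thesis .
    qed
    then have "(\<Sum>k<n. \<bar>\<Sum>j<k. ln (1 + e * D (x j) (x k))\<bar>) \<le> (\<Sum>k<n. real n * (2 * (\<bar>e\<bar> * B)))"
      by (intro sum_mono) auto
    from order_trans[OF sum_abs this] show ?thesis by simp
  qed
  have 3: "\<bar>\<Sum>j<n. 2 * e * x j * h (x j) + e\<^sup>2 * (h (x j))\<^sup>2\<bar> \<le> \<bar>e\<bar> * (2 * B * S + B * real n)"
  proof -
    have t: "\<bar>2 * e * y * h y + e\<^sup>2 * (h y)\<^sup>2\<bar> \<le> \<bar>e\<bar> * (2 * B * \<bar>y\<bar> + B)" for y
    proof -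
      have "\<bar>2 * e * y * h y\<bar> \<le> 2 * \<bar>e\<bar> * \<bar>y\<bar> * B"
        unfolding abs_mult using h_bound[of y] by (intro mult_mono) auto
      moreover have "e\<^sup>2 * (h y)\<^sup>2 \<le> \<bar>e\<bar> * B"
      proof -
        have "e\<^sup>2 * (h y)\<^sup>2 = (\<bar>e\<bar> * \<bar>h y\<bar>) * (\<bar>e\<bar> * \<bar>h y\<bar>)"
          using power_mult_distrib[of "\<bar>e\<bar>" "\<bar>h y\<bar>" 2] by (simp add: power2_eq_square[of "_ * _"])
        also have "\<dots> \<le> (\<bar>e\<bar> * B) * (\<bar>e\<bar> * B)" using h_bound[of y] B_nonneg by (intro mult_mono) auto
        also have "\<dots> \<le> (\<bar>e\<bar> * B) * 1" using assms B_nonneg by (intro mult_left_mono) auto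
        finally show ?thesis by simp
      qed
      moreover have "0 \<le> e\<^sup>2 * (h y)\<^sup>2" by simp
      ultimately have "\<bar>2 * e * y * h y + e\<^sup>2 * (h y)\<^sup>2\<bar> \<le> 2 * \<bar>e\<bar> * \<bar>y\<bar> * B + \<bar>e\<bar> * B" by linarith
      then show ?thesis by (simp add: algebra_simps)
    qed
    have "\<bar>\<Sum>j<n. 2 * e * x j * h (x j) + e\<^sup>2 * (h (x j))\<^sup>2\<bar> \<le> (\<Sum>j<n. \<bar>e\<bar> * (2 * B * \<bar>x j\<bar> + B))"
      by (intro order_trans[OF sum_abs] sum_mono t)
    also have "\<dots> = \<bar>e\<bar> * (2 * B * S + B * real n)"
      by (simp add: S_def sum_distrib_left[symmetric] sum.distrib)
    finally show ?thesis .
  qed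
  have "\<bar>log_jacobian e x\<bar> \<le> (\<beta> / 4) * (\<bar>e\<bar> * (2 * B * S + B * real n))
     + \<beta> * (real n * (real n * (2 * (\<bar>e\<bar> * B)))) + real n * (2 * (\<bar>e\<bar> * B))"
  proof -
    have "\<bar>- (\<beta> / 4) * (\<Sum>j<n. 2 * e * x j * h (x j) + e\<^sup>2 * (h (x j))\<^sup>2)\<bar> \<le> (\<beta> / 4) * (\<bar>e\<bar> * (2 * B * S + B * real n))"
      unfolding abs_mult using 3 \<beta> by (intro mult_mono) auto
    moreover have "\<bar>\<beta> * (\<Sum>k<n. \<Sum>j<k. ln (1 + e * D (x j) (x k)))\<bar> \<le> \<beta> * (real n * (real n * (2 * (\<bar>e\<bar> * B))))"
      unfolding abs_mult using 2 \<beta> by (intro mult_mono) auto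
    ultimately show ?thesis using 1 unfolding log_jacobian_def by linarith
  qed
  also have "\<dots> \<le> \<bar>e\<bar> * ((\<beta> * B * (real n + 1) + 2 * \<beta> * B * (real n)\<^sup>2 + 2 * B * real n) * (1 + S))"
  proof -
    define u where "u = \<beta> * B"
    have u: "u \<ge> 0" using \<beta> B_nonneg by (simp add: u_def)
    have "u * S / 2 + u * real n / 4 + 2 * u * (real n)\<^sup>2 + 2 * B * real n
      \<le> (u * (real n + 1) + 2 * u * (real n)\<^sup>2 + 2 * B * real n) * (1 + S)"
    proof -
      have "0 \<le> u * real n" "0 \<le> u * S" "0 \<le> u * real n * S" "0 \<le> u * (real n)\<^sup>2 * S" "0 \<le> B * real n * S"
        using u S B_nonneg by auto
      moreover have "(u * (real n + 1) + 2 * u * (real n)\<^sup>2 + 2 * B * real n) * (1 + S)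
        = u * real n + u + 2 * u * (real n)\<^sup>2 + 2 * B * real n + u * real n * S + u * S
          + 2 * (u * (real n)\<^sup>2 * S) + 2 * (B * real n * S)"
        by (simp add: algebra_simps)
      ultimately show ?thesis using u by linarith
    qed
    then have "\<bar>e\<bar> * (u * S / 2 + u * real n / 4 + 2 * u * (real n)\<^sup>2 + 2 * B * real n)
      \<le> \<bar>e\<bar> * ((u * (real n + 1) + 2 * u * (real n)\<^sup>2 + 2 * B * real n) * (1 + S))"
      by (rule mult_left_mono) simp
    moreover have "(\<beta> / 4) * (\<bar>e\<bar> * (2 * B * S + B * real n))
     + \<beta> * (real n * (real n * (2 * (\<bar>e\<bar> * B)))) + real n * (2 * (\<bar>e\<bar> * B))
      = \<bar>e\<bar> * (u * S / 2 + u * real n / 4 + 2 * u * (real n)\<^sup>2 + 2 * B * real n)"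
      by (simp add: u_def algebra_simps power2_eq_square)
    ultimately show ?thesis by (simp add: u_def mult.assoc)
  qed
  finally show ?thesis by (simp add: S_def)
qed

lemma log_jacobian_deriv: "((\<lambda>e. log_jacobian e x) has_real_derivative drift x) (at 0)"
proof -
  have ln: "((\<lambda>e. ln (1 + e * c)) has_real_derivative c) (at 0)" for c :: real
    by (auto intro!: derivative_eq_intros)
  have "((\<lambda>e. 2 * e * y * h y + e\<^sup>2 * (h y)\<^sup>2) has_real_derivative 2 * (y * h y)) (at 0)" for y
    by (auto intro!: derivative_eq_intros)
  then have 1: "((\<lambda>e. \<Sum>j<n. 2 * e * x j * h (x j) + e\<^sup>2 * (h (x j))\<^sup>2) has_real_derivative
      (\<Sum>j<n. 2 * (x j * h (x j)))) (at 0)" by (intro DERIV_sum)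
  have 2: "((\<lambda>e. \<Sum>k<n. \<Sum>j<k. ln (1 + e * D (x j) (x k))) has_real_derivative (\<Sum>k<n. \<Sum>j<k. D (x j) (x k))) (at 0)"
    by (intro DERIV_sum ln)
  have 3: "((\<lambda>e. \<Sum>j<n. ln (1 + e * D (x j) (x j))) has_real_derivative (\<Sum>j<n. D (x j) (x j))) (at 0)"
    by (intro DERIV_sum ln)
  show ?thesis unfolding log_jacobian_def drift_def
    by (rule DERIV_cong[OF DERIV_add[OF DERIV_add[OF DERIV_cmult[OF 1] DERIV_cmult[OF 2]] 3]])
      (simp add: sum_distrib_left[symmetric])
qed

text \<open>By \<open>integral_flow\<close> the deformed integral does not depend on e;
  differentiating it at e = 0 under the integral gives the identity.\<close>

theorem integration_by_parts:
  assumes F: "smooth_statistic n F G"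
  shows "(\<integral>x. (\<Sum>j<n. of_real (h (x j)) * G j x) + of_real (drift x) * F x \<partial>gaussian_beta_ensemble \<beta> n) = 0"
    "integrable (gaussian_beta_ensemble \<beta> n) (\<lambda>x. (\<Sum>j<n. of_real (h (x j)) * G j x) + of_real (drift x) * F x)"
proof -
  let ?M = "gaussian_beta_ensemble \<beta> n"
  interpret prob_space ?M by (rule prob_space_gaussian_beta_ensemble[OF \<beta>])
  obtain A where A: "\<And>x. norm (F x) \<le> A" "\<And>x j. j < n \<Longrightarrow> norm (G j x) \<le> A" "A \<ge> 0"
    using smooth_statistic_bound[OF F] by blast
  note [measurable] = smooth_statisticD(1,2)[OF F]
  define K where "K = \<beta> * B * (real n + 1) + 2 * \<beta> * B * (real n)\<^sup>2 + 2 * B * real n"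
  have K: "K \<ge> 0" using \<beta> B_nonneg by (auto simp: K_def)
  define q where "q x = K * (1 + (\<Sum>j<n. \<bar>x j\<bar>))" for x :: "nat \<Rightarrow> real"
  have q: "q x \<ge> 0" for x using K by (simp add: q_def sum_nonneg)
  have lj: "\<bar>log_jacobian e x\<bar> \<le> \<bar>e\<bar> * q x" if "\<bar>e\<bar> * B \<le> 1 / 2" for e x
    using log_jacobian_bound[OF that, of x] by (simp add: K_def q_def)
  \<comment> \<open>Extending \<open>h (x j)\<close> by 0 keeps the \<open>undefined\<close>
    coordinates in place, so moving along \<open>v x\<close> agrees with \<open>coordwise\<close> on
    the space of the measure.\<close>
  define v where "v x j = (if j < n then h (x j) else 0)" for x :: "nat \<Rightarrow> real" and j
  define \<psi> where "\<psi> x e = exp (log_jacobian e x) *\<^sub>R F (\<lambda>j. x j + e * v x j)" for x e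
  \<comment> \<open>A null sequence with e <= 1 and e B <= 1 / 2; adding 2 to 2 B covers B =
    0.\<close>
  define e where "e m = 1 / ((2 * B + 2) * (real m + 1))" for m
  have e_pos: "e m > 0" for m using B_nonneg by (simp add: e_def)
  have e_le: "e m \<le> 1 / (2 * B + 2)" for m
  proof -
    have "(2 * B + 2) * 1 \<le> (2 * B + 2) * (real m + 1)" using B_nonneg by (intro mult_left_mono) auto
    then show ?thesis unfolding e_def using B_nonneg by (intro divide_left_mono) auto
  qed
  have eB: "\<bar>e m\<bar> * B \<le> 1 / 2" for m
  proof -
    have "e m * B \<le> 1 / (2 * B + 2) * B" using e_le B_nonneg by (intro mult_right_mono) auto
    also have "\<dots> \<le> 1 / 2" using B_nonneg by (simp add: field_simps)
    finally show ?thesis using e_pos[of m] by simp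
  qed
  have e1: "e m \<le> 1" for m
    by (rule order_trans[OF e_le]) (use B_nonneg in \<open>simp add: field_simps\<close>)
  have e_lim: "e \<longlonglongrightarrow> 0"
  proof -
    have "(\<lambda>m. (1 / (2 * B + 2)) * inverse (real (Suc m))) \<longlonglongrightarrow> (1 / (2 * B + 2)) * 0"
      by (intro tendsto_mult tendsto_const LIMSEQ_inverse_real_of_nat)
    then show ?thesis by (simp add: e_def[abs_def] field_simps)
  qed
  have T: "coordwise n (\<lambda>t. t + a * h t) x = (\<lambda>j. x j + a * v x j)" if "x \<in> space ?M" for x a
  proof
    fix j
    have "x j = undefined" if "\<not> j < n"
      using \<open>x \<in> space ?M\<close> that
      by (auto simp: gaussian_beta_ensemble_def lebesgue_Rn_def space_PiM PiE_def extensional_def)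
    then show "coordwise n (\<lambda>t. t + a * h t) x j = x j + a * v x j"
      by (simp add: coordwise_def v_def)
  qed
  have cm: "coordwise n (\<lambda>t. t + a * h t) \<in> lebesgue_Rn n \<rightarrow>\<^sub>M lebesgue_Rn n" for a
    by (intro coordwise_measurable) measurable
  have \<psi>_meas: "(\<lambda>x. \<psi> x a) \<in> borel_measurable ?M" for a
  proof -
    have "(\<lambda>x. exp (log_jacobian a x) *\<^sub>R F (coordwise n (\<lambda>t. t + a * h t) x)) \<in> borel_measurable ?M"
      using cm[of a] by measurable
    then show ?thesis by (rule measurable_cong[THEN iffD1, rotated]) (simp add: \<psi>_def T)
  qed
  have \<psi>_bound: "norm (\<psi> x (e m)) \<le> exp (q x) * A" for x m
  proof -
    have "\<bar>e m\<bar> * q x \<le> 1 * q x" using e1[of m] e_pos[of m] q[of x] by (intro mult_right_mono) auto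
    then have "log_jacobian (e m) x \<le> q x" using lj[OF eB, of m x] by linarith
    then show ?thesis using A unfolding \<psi>_def norm_scaleR by (intro mult_mono) auto
  qed
  have int_q: "integrable ?M (\<lambda>x. exp (a * q x) * b)" for a b :: real
    using integrable_mult_left[OF integrable_exp_gbe[OF \<beta>, of n "a * K"], of b] by (simp add: q_def mult.assoc)
  have \<psi>_int: "integrable ?M (\<lambda>x. \<psi> x (e m))" for m
    using \<psi>_bound \<psi>_meas int_q[of 1 A] A(3) by (intro Bochner_Integration.integrable_bound[OF int_q[of 1 A]]) auto
  have F_int: "integrable ?M F"
    using A by (intro integrable_const_bound[of _ A]) auto
  have eq: "(\<integral>x. \<psi> x (e m) \<partial>?M) = (\<integral>x. F x \<partial>?M)" for m
  proof -
    have "(\<integral>x. F x \<partial>?M) = (\<integral>x. exp (log_jacobian (e m) x) *\<^sub>R F (coordwise n (\<lambda>t. t + e m * h t) x) \<partial>?M)"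
      by (rule integral_flow[OF eB]) measurable
    also have "\<dots> = (\<integral>x. \<psi> x (e m) \<partial>?M)"
      by (intro Bochner_Integration.integral_cong refl) (simp add: \<psi>_def T)
    finally show ?thesis by simp
  qed
  define u where "u m x = (\<psi> x (e m) - F x) /\<^sub>R e m" for m x
  define L where "L x = (\<Sum>j<n. of_real (h (x j)) * G j x) + of_real (drift x) * F x" for x
  have L_meas: "L \<in> borel_measurable ?M" unfolding L_def[abs_def] by measurable
  have u_meas: "u m \<in> borel_measurable ?M" for m
    unfolding u_def[abs_def] using \<psi>_meas by measurable
  have lim: "(\<lambda>m. u m x) \<longlonglongrightarrow> L x" for x
  proof -
    have "log_jacobian 0 x = 0" by (simp add: log_jacobian_def)
    moreover have "((\<lambda>e. exp (log_jacobian e x)) has_real_derivative exp (log_jacobian 0 x) * drift x) (at 0)"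
      by (intro DERIV_fun_exp log_jacobian_deriv)
    ultimately have "((\<lambda>e. exp (log_jacobian e x)) has_real_derivative drift x) (at 0)" by simp
    from has_vector_derivative_scaleR[OF this smooth_statisticD(3)[OF F, of x "v x"]]
    have "((\<lambda>e. \<psi> x e) has_vector_derivative L x) (at 0)"
    proof -
      have "(\<Sum>j<n. of_real (v x j) * G j x) = (\<Sum>j<n. of_real (h (x j)) * G j x)"
        by (intro sum.cong) (auto simp: v_def)
      then show ?thesis
        using \<open>((\<lambda>e. exp (log_jacobian e x) *\<^sub>R _ e) has_vector_derivative _) (at 0)\<close> \<open>log_jacobian 0 x = 0\<close>
        by (simp add: \<psi>_def L_def scaleR_conv_of_real)
    qed
    from has_vector_derivative_sequentially[OF this e_lim] e_pos
    have "(\<lambda>m. (\<psi> x (e m) - \<psi> x 0) /\<^sub>R e m) \<longlonglongrightarrow> L x" by (simp add: less_imp_neq[symmetric])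
    moreover have "\<psi> x 0 = F x" using \<open>log_jacobian 0 x = 0\<close> by (simp add: \<psi>_def)
    ultimately show ?thesis by (simp add: u_def)
  qed
  \<comment> \<open>The quotient is split by the product rule: the increment of F is Lipschitz in e,
    that of the exponential is at most |r| exp |r|. The remaining factor q is absorbed by q exp q <=
    exp (2 q).\<close>
  have bnd: "norm (u m x) \<le> exp (2 * q x) * (real n * B * A + A)" for m x
  proof -
    define r where "r = log_jacobian (e m) x"
    have r: "\<bar>r\<bar> \<le> e m * q x" using lj[OF eB, of m x] e_pos[of m] by (simp add: r_def)
    have r': "\<bar>r\<bar> \<le> q x" using r mult_right_mono[OF e1[of m] q[of x]] by linarith
    have "\<bar>exp r - 1\<bar> \<le> \<bar>r\<bar> * exp \<bar>r\<bar>"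
    proof (cases "r \<ge> 0")
      case True
      have "1 - r \<le> exp (- r)" using exp_ge_add_one_self[of "-r"] by simp
      then have "exp r * (1 - r) \<le> exp r * exp (- r)" by (intro mult_left_mono) auto
      then show ?thesis using True by (simp add: exp_minus algebra_simps)
    next
      case False
      have "1 + r \<le> exp r" by (rule exp_ge_add_one_self)
      moreover have "exp r \<le> 1" using False by simp
      moreover have "- r * 1 \<le> - r * exp (- r)" using False by (intro mult_left_mono) auto
      moreover have "\<bar>r\<bar> = - r" using False by simp
      ultimately show ?thesis by (simp only: abs_of_nonpos)
    qed
    also have "\<dots> \<le> (e m * q x) * exp (q x)" using r r' by (intro mult_mono) auto
    finally have r1: "\<bar>exp r - 1\<bar> \<le> (e m * q x) * exp (q x)" .
    have "norm (F (\<lambda>j. x j + e m * v x j) - F x) \<le> real n * B * A * \<bar>e m\<bar>"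
      using A h_bound by (intro smooth_statistic_lipschitz[OF F _ _ B_nonneg]) (auto simp: v_def)
    then have f1: "norm (F (\<lambda>j. x j + e m * v x j) - F x) \<le> real n * B * A * e m" using e_pos[of m] by simp
    have "\<psi> x (e m) - F x = exp r *\<^sub>R (F (\<lambda>j. x j + e m * v x j) - F x) + (exp r - 1) *\<^sub>R F x"
      by (simp add: \<psi>_def r_def scaleR_diff_right scaleR_diff_left)
    then have "norm (\<psi> x (e m) - F x) \<le> exp r * norm (F (\<lambda>j. x j + e m * v x j) - F x) + \<bar>exp r - 1\<bar> * norm (F x)"
      by (metis norm_triangle_ineq norm_scaleR abs_exp_cancel)
    also have "\<dots> \<le> exp (q x) * (real n * B * A * e m) + ((e m * q x) * exp (q x)) * A"
      using f1 r1 A r' q[of x] e_pos[of m] by (intro add_mono mult_mono) auto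
    also have "\<dots> \<le> exp (2 * q x) * (real n * B * A * e m) + (e m * exp (2 * q x)) * A"
    proof -
      have "q x * exp (q x) \<le> exp (q x) * exp (q x)"
        using exp_ge_add_one_self[of "q x"] by (intro mult_right_mono) (linarith, simp)
      then have "q x * exp (q x) \<le> exp (2 * q x)" by (simp add: exp_add[symmetric])
      then have "e m * (q x * exp (q x)) \<le> e m * exp (2 * q x)" using e_pos[of m] by (intro mult_left_mono) auto
      then show ?thesis using A q[of x] e_pos[of m] B_nonneg
        by (intro add_mono mult_right_mono) (auto simp: mult.assoc)
    qed
    finally have "norm (\<psi> x (e m) - F x) \<le> (exp (2 * q x) * (real n * B * A + A)) * e m"
      by (simp add: algebra_simps)
    then have "norm (\<psi> x (e m) - F x) / e m \<le> exp (2 * q x) * (real n * B * A + A)"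
      using e_pos[of m] by (simp only: pos_divide_le_eq)
    then show ?thesis using e_pos[of m] unfolding u_def norm_scaleR by (simp add: divide_inverse mult.commute)
  qed
  have bnd_int: "integrable ?M (\<lambda>x. exp (2 * q x) * (real n * B * A + A))" by (rule int_q)
  have "(\<lambda>m. \<integral>x. u m x \<partial>?M) \<longlonglongrightarrow> (\<integral>x. L x \<partial>?M)"
    by (rule integral_dominated_convergence[OF L_meas u_meas bnd_int AE_I2[OF lim] AE_I2[OF bnd]])
  moreover have "(\<integral>x. u m x \<partial>?M) = 0" for m
    unfolding u_def using \<psi>_int F_int eq by simp
  ultimately have "(\<integral>x. L x \<partial>?M) = 0" by (simp add: LIMSEQ_const_iff)
  then show "(\<integral>x. (\<Sum>j<n. of_real (h (x j)) * G j x) + of_real (drift x) * F x \<partial>?M) = 0"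
    by (simp add: L_def)
  have "integrable ?M L"
    by (rule integrable_dominated_convergence[OF L_meas u_meas bnd_int AE_I2[OF lim] AE_I2[OF bnd]])
  then show "integrable ?M (\<lambda>x. (\<Sum>j<n. of_real (h (x j)) * G j x) + of_real (drift x) * F x)"
    by (simp add: L_def[abs_def])
qed

end

section \<open>The loop equation for the rescaled points\<close>

definition scaled_gbe :: "real \<Rightarrow> nat \<Rightarrow> (nat \<Rightarrow> real) measure" where
  "scaled_gbe \<beta> n = distr (gaussian_beta_ensemble \<beta> n) (lebesgue_Rn n) (coordwise n (\<lambda>t. t / sqrt (real n)))"

lemma sets_scaled_gbe [measurable_cong, simp]: "sets (scaled_gbe \<beta> n) = sets (lebesgue_Rn n)"
  by (simp add: scaled_gbe_def)

lemma coordwise_scale_measurable [measurable]: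
  "coordwise n (\<lambda>t. t / c) \<in> lebesgue_Rn n \<rightarrow>\<^sub>M lebesgue_Rn n"
  by (intro coordwise_measurable) measurable

lemma prob_space_scaled_gbe:
  assumes "\<beta> > 0" shows "prob_space (scaled_gbe \<beta> n)"
proof -
  interpret prob_space "gaussian_beta_ensemble \<beta> n" by (rule prob_space_gaussian_beta_ensemble[OF assms])
  show ?thesis unfolding scaled_gbe_def by (rule prob_space_distr) measurable
qed

definition empirical_stieltjes :: "nat \<Rightarrow> complex \<Rightarrow> (nat \<Rightarrow> real) \<Rightarrow> complex" where
  "empirical_stieltjes n z x = (\<Sum>j<n. 1 / (of_real (x j) - z)) / of_nat n"

definition empirical_stieltjes' :: "nat \<Rightarrow> complex \<Rightarrow> (nat \<Rightarrow> real) \<Rightarrow> complex" where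
  "empirical_stieltjes' n z x = (\<Sum>j<n. 1 / (of_real (x j) - z)\<^sup>2) / of_nat n"

definition sc_defect :: "nat \<Rightarrow> complex \<Rightarrow> (nat \<Rightarrow> real) \<Rightarrow> complex" where
  "sc_defect n z x = (empirical_stieltjes n z x)\<^sup>2 + z * empirical_stieltjes n z x + 1"

text \<open>The drift of the resolvent deformation, divided by - \<beta> n^2 / 2. The coefficient
  \<open>1 - 2 / \<beta>\<close> arises from the diagonal: completing the sum over pairs to a square
  adds diagonal terms with weight \<beta> / 2, while the Jacobian contributes them with weight
  1.\<close>

definition loop_operator :: "real \<Rightarrow> nat \<Rightarrow> complex \<Rightarrow> (nat \<Rightarrow> real) \<Rightarrow> complex" where
  "loop_operator \<beta> n z x = sc_defect n z x - of_real ((1 - 2 / \<beta>) / real n) * empirical_stieltjes' n z x"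

lemma real_minus_nonreal: "Im z > 0 \<Longrightarrow> of_real t - z \<noteq> 0"
  by (auto simp: complex_eq_iff)

lemma norm_resolvent_le:
  assumes "Im z > 0" shows "norm (1 / (of_real t - z)) \<le> 1 / Im z"
proof -
  have "Im z \<le> norm (of_real t - z)" using abs_Im_le_cmod[of "of_real t - z"] assms by simp
  then show ?thesis using assms by (auto simp: norm_divide intro!: divide_left_mono mult_pos_pos)
qed

lemma empirical_stieltjes_measurable [measurable]:
  "empirical_stieltjes n z \<in> borel_measurable (lebesgue_Rn n)"
  unfolding empirical_stieltjes_def[abs_def] by measurable

lemma empirical_stieltjes'_measurable [measurable]:
  "empirical_stieltjes' n z \<in> borel_measurable (lebesgue_Rn n)"
  unfolding empirical_stieltjes'_def[abs_def] by measurable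

lemma sc_defect_measurable [measurable]: "sc_defect n z \<in> borel_measurable (lebesgue_Rn n)"
  unfolding sc_defect_def[abs_def] by measurable

lemma loop_operator_measurable [measurable]: "loop_operator \<beta> n z \<in> borel_measurable (lebesgue_Rn n)"
  unfolding loop_operator_def[abs_def] by measurable

lemma norm_empirical_stieltjes_le:
  assumes "Im z > 0" shows "norm (empirical_stieltjes n z x) \<le> 1 / Im z"
proof -
  have "norm (\<Sum>j<n. 1 / (of_real (x j) - z)) \<le> real (card {..<n}) * (1 / Im z)"
    by (intro sum_norm_bound norm_resolvent_le assms)
  then have "norm (empirical_stieltjes n z x) \<le> real n * (1 / Im z) / real n"
    unfolding empirical_stieltjes_def norm_divide norm_of_nat
    by (intro divide_right_mono) simp_all
  also have "\<dots> \<le> 1 / Im z" using assms by (cases "n = 0") auto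
  finally show ?thesis .
qed

lemma norm_empirical_stieltjes'_le:
  assumes "Im z > 0" shows "norm (empirical_stieltjes' n z x) \<le> (1 / Im z)\<^sup>2"
proof -
  have "norm (1 / (of_real t - z)\<^sup>2) \<le> (1 / Im z)\<^sup>2" for t
  proof -
    have "1 / (of_real t - z)\<^sup>2 = (1 / (of_real t - z))\<^sup>2" by (simp add: power_divide)
    then show ?thesis unfolding norm_power using norm_resolvent_le[OF assms, of t] by (simp only: norm_power power_mono norm_ge_zero)
  qed
  then have "norm (\<Sum>j<n. 1 / (of_real (x j) - z)\<^sup>2) \<le> real (card {..<n}) * (1 / Im z)\<^sup>2"
    by (intro sum_norm_bound)
  then have "norm (empirical_stieltjes' n z x) \<le> real n * (1 / Im z)\<^sup>2 / real n"
    unfolding empirical_stieltjes'_def norm_divide norm_of_nat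
    by (intro divide_right_mono) simp_all
  also have "\<dots> \<le> (1 / Im z)\<^sup>2" using assms by (cases "n = 0") auto
  finally show ?thesis .
qed

lemma norm_sc_defect_le:
  assumes "Im z > 0" shows "norm (sc_defect n z x) \<le> (1 / Im z)\<^sup>2 + norm z * (1 / Im z) + 1"
proof -
  let ?s = "empirical_stieltjes n z x"
  note s = norm_empirical_stieltjes_le[OF assms, of n x]
  have "norm (?s\<^sup>2) \<le> (1 / Im z)\<^sup>2" unfolding norm_power by (intro power_mono s) auto
  moreover have "norm (z * ?s) \<le> norm z * (1 / Im z)" unfolding norm_mult by (intro mult_left_mono s) auto
  ultimately show ?thesis unfolding sc_defect_def
    using norm_triangle_ineq[of "?s\<^sup>2 + z * ?s" 1] norm_triangle_ineq[of "?s\<^sup>2" "z * ?s"] by simp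
qed

lemma loop_operator_bound:
  assumes "Im z > 0" shows "\<exists>B. \<forall>x. norm (loop_operator \<beta> n z x) \<le> B"
proof (intro exI allI)
  fix x
  have "norm (of_real ((1 - 2 / \<beta>) / real n) * empirical_stieltjes' n z x) \<le> \<bar>(1 - 2 / \<beta>) / real n\<bar> * (1 / Im z)\<^sup>2"
    unfolding norm_mult norm_of_real by (intro mult_left_mono norm_empirical_stieltjes'_le assms) auto
  then show "norm (loop_operator \<beta> n z x) \<le> ((1 / Im z)\<^sup>2 + norm z * (1 / Im z) + 1) + \<bar>(1 - 2 / \<beta>) / real n\<bar> * (1 / Im z)\<^sup>2"
    unfolding loop_operator_def by (intro norm_triangle_le_diff add_mono norm_sc_defect_le assms)
qed

lemma resolvent_diff:
  assumes "Im z > 0"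
  shows "1 / (of_real x - z) - 1 / (of_real y - z) = of_real (x - y) * (- 1 / ((of_real x - z) * (of_real y - z)))"
proof -
  have "1 / a - 1 / b = (a - b) * (- 1 / (a * b))" if "a \<noteq> 0" "b \<noteq> 0" for a b :: complex
    using that by (simp add: field_simps)
  note * = this[OF real_minus_nonreal[OF assms, of x] real_minus_nonreal[OF assms, of y]]
  have e: "complex_of_real (x - y) = (of_real x - z) - (of_real y - z)" by simp
  show ?thesis unfolding e by (rule *)
qed

text \<open>The points can only move by real amounts, so the resolvent enters through a real-linear
  functional, later Re or Im. The factor \<sigma> makes the rescaled points move by
  \<open>\<phi>\<close> of the resolvent, and it cancels in the divided difference.\<close>

lemma deformation_resolvent:
  fixes \<phi> :: "complex \<Rightarrow> real"
  assumes \<beta>: "\<beta> > 0" and z: "Im z > 0" and \<sigma>: "\<sigma> > 0" and \<phi>: "bounded_linear \<phi>" "\<And>w. \<bar>\<phi> w\<bar> \<le> norm w"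
  shows "deformation \<beta> (\<lambda>t. \<sigma> * \<phi> (1 / (of_real (t / \<sigma>) - z)))
    (\<lambda>t u. \<phi> (- 1 / ((of_real (t / \<sigma>) - z) * (of_real (u / \<sigma>) - z)))) (\<sigma> / Im z + 1 / (Im z)\<^sup>2)"
proof
  interpret \<phi>: bounded_linear \<phi> by fact
  note nz = real_minus_nonreal[OF z]
  show "\<beta> > 0" by fact
  fix x y :: real
  show "\<sigma> * \<phi> (1 / (of_real (x / \<sigma>) - z)) - \<sigma> * \<phi> (1 / (of_real (y / \<sigma>) - z))
     = \<phi> (- 1 / ((of_real (x / \<sigma>) - z) * (of_real (y / \<sigma>) - z))) * (x - y)"
  proof -
    have "\<sigma> * \<phi> (1 / (of_real (x / \<sigma>) - z)) - \<sigma> * \<phi> (1 / (of_real (y / \<sigma>) - z))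
      = \<sigma> * \<phi> (1 / (of_real (x / \<sigma>) - z) - 1 / (of_real (y / \<sigma>) - z))"
      by (simp add: \<phi>.diff right_diff_distrib)
    also have "\<dots> = \<sigma> * \<phi> ((x / \<sigma> - y / \<sigma>) *\<^sub>R (- 1 / ((of_real (x / \<sigma>) - z) * (of_real (y / \<sigma>) - z))))"
      by (subst resolvent_diff[OF z]) (simp add: scaleR_conv_of_real)
    also have "\<dots> = \<phi> (- 1 / ((of_real (x / \<sigma>) - z) * (of_real (y / \<sigma>) - z))) * (x - y)"
      unfolding \<phi>.scaleR using \<sigma> by (simp add: field_simps)
    finally show ?thesis .
  qed
  show "((\<lambda>t. \<sigma> * \<phi> (1 / (of_real (t / \<sigma>) - z))) has_real_derivative
      \<phi> (- 1 / ((of_real (x / \<sigma>) - z) * (of_real (x / \<sigma>) - z)))) (at x)"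
  proof -
    have "((\<lambda>w. 1 / (w - z)) has_field_derivative (- 1 / ((of_real (x / \<sigma>) - z) * (of_real (x / \<sigma>) - z)))) (at (of_real (x / \<sigma>)))"
      using nz[of "x / \<sigma>"] by (auto intro!: derivative_eq_intros simp del: of_real_divide)
    then have 1: "((\<lambda>t. 1 / (of_real t - z)) has_vector_derivative (- 1 / ((of_real (x / \<sigma>) - z) * (of_real (x / \<sigma>) - z)))) (at (x / \<sigma>))"
      by (rule has_vector_derivative_real_field)
    have "((\<lambda>t. t / \<sigma>) has_vector_derivative 1 / \<sigma>) (at x)"
      using \<sigma> by (auto intro!: derivative_eq_intros simp: has_real_derivative_iff_has_vector_derivative[symmetric])
    from vector_diff_chain_at[OF this 1]
    have "((\<lambda>t. 1 / (of_real (t / \<sigma>) - z)) has_vector_derivative (1 / \<sigma>) *\<^sub>R (- 1 / ((of_real (x / \<sigma>) - z) * (of_real (x / \<sigma>) - z)))) (at x)"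
      by (simp add: o_def)
    from bounded_linear.has_vector_derivative[OF \<phi>(1) this]
    have "((\<lambda>t. \<phi> (1 / (of_real (t / \<sigma>) - z))) has_real_derivative (1 / \<sigma>) * \<phi> (- 1 / ((of_real (x / \<sigma>) - z) * (of_real (x / \<sigma>) - z)))) (at x)"
      by (simp only: has_real_derivative_iff_has_vector_derivative \<phi>.scaleR real_scaleR_def)
    from DERIV_cmult[OF this, of \<sigma>] show ?thesis using \<sigma> by simp
  qed
  have "\<bar>\<phi> (1 / (of_real (x / \<sigma>) - z))\<bar> \<le> 1 / Im z"
    by (rule order_trans[OF \<phi>(2) norm_resolvent_le[OF z]])
  then have "\<sigma> * \<bar>\<phi> (1 / (of_real (x / \<sigma>) - z))\<bar> \<le> \<sigma> * (1 / Im z)" using \<sigma> by (intro mult_left_mono) auto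
  moreover have "0 \<le> 1 / (Im z)\<^sup>2" by simp
  moreover have "\<bar>\<sigma> * \<phi> (1 / (of_real (x / \<sigma>) - z))\<bar> = \<sigma> * \<bar>\<phi> (1 / (of_real (x / \<sigma>) - z))\<bar>"
    unfolding abs_mult using \<sigma> by (simp only: abs_of_pos)
  ultimately show "\<bar>\<sigma> * \<phi> (1 / (of_real (x / \<sigma>) - z))\<bar> \<le> \<sigma> / Im z + 1 / (Im z)\<^sup>2"
    unfolding times_divide_eq_right mult_1_right by linarith
  have "\<bar>\<phi> (- 1 / ((of_real (x / \<sigma>) - z) * (of_real (y / \<sigma>) - z)))\<bar>
     \<le> norm (1 / (of_real (x / \<sigma>) - z)) * norm (1 / (of_real (y / \<sigma>) - z))"
    by (rule order_trans[OF \<phi>(2)]) (simp only: norm_divide norm_mult norm_minus_cancel norm_one times_divide_times_eq mult_1 order_refl)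
  also have "\<dots> \<le> (1 / Im z) * (1 / Im z)"
    using z by (intro mult_mono norm_resolvent_le) auto
  also have "\<dots> = 1 / (Im z)\<^sup>2" by (rule power2_eq_square[of "1 / Im z", unfolded power_one_over, symmetric])
  also have "\<dots> \<le> \<sigma> / Im z + 1 / (Im z)\<^sup>2" using divide_nonneg_pos[OF less_imp_le[OF \<sigma>] z] by linarith
  finally show "\<bar>\<phi> (- 1 / ((of_real (x / \<sigma>) - z) * (of_real (y / \<sigma>) - z)))\<bar> \<le> \<sigma> / Im z + 1 / (Im z)\<^sup>2" .
  show "continuous_on UNIV (\<lambda>p. \<phi> (- 1 / ((of_real (fst p / \<sigma>) - z) * (of_real (snd p / \<sigma>) - z))))"
    using nz \<sigma> by (intro \<phi>.continuous_on continuous_intros) (auto simp del: of_real_divide)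
qed

lemma sum_pairs:
  fixes a :: "nat \<Rightarrow> complex"
  shows "2 * (\<Sum>k<n. \<Sum>j<k. a j * a k) = (\<Sum>j<n. a j)\<^sup>2 - (\<Sum>j<n. (a j)\<^sup>2)"
proof (induction n)
  case (Suc n)
  have "2 * (\<Sum>k<Suc n. \<Sum>j<k. a j * a k) = 2 * (\<Sum>k<n. \<Sum>j<k. a j * a k) + 2 * ((\<Sum>j<n. a j) * a n)"
    by (simp only: sum.lessThan_Suc distrib_left sum_distrib_right)
  then show ?case unfolding Suc.IH sum.lessThan_Suc by (simp add: power2_sum)
qed simp

text \<open>Three facts: x r = 1 + z r for the confining term, \<open>sum_pairs\<close> for the
  interaction, and the leftover diagonal, which combines with the Jacobian.\<close>

lemma drift_identity:
  assumes "Im z > 0" "n \<ge> 1" "\<beta> > 0"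
  defines "r \<equiv> \<lambda>t. 1 / (complex_of_real t - z)"
  shows "- of_real (\<beta> / 2 * real n) * (\<Sum>j<n. of_real (x j) * r (x j)) + of_real \<beta> * (\<Sum>k<n. \<Sum>j<k. - (r (x j) * r (x k)))
     + (\<Sum>j<n. - (r (x j) * r (x j))) = - of_real (\<beta> / 2 * (real n)\<^sup>2) * loop_operator \<beta> n z x"
proof -
  let ?n = "complex_of_nat n" and ?s = "\<Sum>j<n. r (x j)" and ?t = "\<Sum>j<n. (r (x j))\<^sup>2"
  have n0: "?n \<noteq> 0" using assms by auto
  have 1: "(\<Sum>j<n. of_real (x j) * r (x j)) = ?n + z * ?s"
  proof -
    have "of_real t * r t = 1 + z * r t" for t
      using real_minus_nonreal[OF assms(1), of t] by (simp add: r_def field_simps)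
    then show ?thesis by (simp add: sum.distrib sum_distrib_left)
  qed
  have 2: "(\<Sum>k<n. \<Sum>j<k. - (r (x j) * r (x k))) = - (?s\<^sup>2 - ?t) / 2"
    using sum_pairs[of "\<lambda>j. r (x j)" n] by (simp add: sum_negf field_simps)
  have 3: "(\<Sum>j<n. - (r (x j) * r (x j))) = - ?t" by (simp add: sum_negf power2_eq_square)
  have s: "empirical_stieltjes n z x = ?s / ?n" "empirical_stieltjes' n z x = ?t / ?n"
    by (simp_all add: empirical_stieltjes_def empirical_stieltjes'_def r_def power_divide)
  show ?thesis
    unfolding 1 2 3 loop_operator_def sc_defect_def s
    using n0 assms(3) by (simp add: field_simps power2_eq_square)
qed

text \<open>Integration by parts for the deformations by the real and by the imaginary part of the
  resolvent, recombined to a complex identity and transported to the rescaled points.\<close>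

theorem loop_equation:
  assumes \<beta>: "\<beta> > 0" and n: "n \<ge> 1" and z: "Im z > 0" and F: "smooth_statistic n F G"
  shows "(\<integral>x. F x * loop_operator \<beta> n z x \<partial>scaled_gbe \<beta> n)
    = of_real (2 / (\<beta> * (real n)\<^sup>2)) * (\<integral>x. (\<Sum>j<n. G j x / (of_real (x j) - z)) \<partial>scaled_gbe \<beta> n)"
proof -
  let ?M = "gaussian_beta_ensemble \<beta> n"
  define \<sigma> where "\<sigma> = sqrt (real n)"
  have \<sigma>: "\<sigma> > 0" "\<sigma> * \<sigma> = real n" using n by (auto simp: \<sigma>_def)
  let ?y = "coordwise n (\<lambda>t. t / \<sigma>)"
  define r where "r t = 1 / (complex_of_real t - z)" for t
  obtain A where A: "\<And>x. norm (F x) \<le> A" "\<And>x j. j < n \<Longrightarrow> norm (G j x) \<le> A" "A \<ge> 0"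
    using smooth_statistic_bound[OF F] by blast
  note meas[measurable] = smooth_statisticD(1,2)[OF F]
  \<comment> \<open>Chain rule: the factor 1 / \<sigma> in the gradient cancels the \<sigma> in the
    deformation.\<close>
  have F': "smooth_statistic n (\<lambda>x. F (?y x)) (\<lambda>j x. G j (?y x) / of_real \<sigma>)"
    unfolding smooth_statistic_def
  proof (intro conjI allI impI)
    show "(\<lambda>x. F (?y x)) \<in> borel_measurable (lebesgue_Rn n)" by measurable
    show "(\<lambda>x. G j (?y x) / of_real \<sigma>) \<in> borel_measurable (lebesgue_Rn n)" if "j < n" for j
      using meas(2)[OF that] by measurable
    show "\<exists>B. \<forall>x. norm (F (?y x)) \<le> B \<and> (\<forall>j<n. norm (G j (?y x) / of_real \<sigma>) \<le> B)"
    proof (intro exI[of _ "A + A / \<sigma>"] allI conjI impI)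
      fix x show "norm (F (?y x)) \<le> A + A / \<sigma>" using A(1)[of "?y x"] A(3) \<sigma> by (simp add: add_increasing2)
      fix j assume "j < n"
      then have "norm (G j (?y x)) / \<sigma> \<le> A / \<sigma>" using A(2)[of j "?y x"] \<sigma> by (intro divide_right_mono) auto
      then show "norm (G j (?y x) / of_real \<sigma>) \<le> A + A / \<sigma>" using A(3) \<sigma> by (simp add: norm_divide)
    qed
    fix x v :: "nat \<Rightarrow> real"
    have "?y (\<lambda>j. x j + e * v j) = (\<lambda>j. ?y x j + e * (if j < n then v j / \<sigma> else 0))" for e
      by (auto simp: coordwise_def fun_eq_iff add_divide_distrib)
    moreover have "(\<Sum>j<n. of_real (v j) * (G j (?y x) / of_real \<sigma>)) = (\<Sum>j<n. of_real (if j < n then v j / \<sigma> else 0) * G j (?y x))"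
      by (intro sum.cong) auto
    ultimately show "((\<lambda>e. F (?y (\<lambda>j. x j + e * v j))) has_vector_derivative
        (\<Sum>j<n. of_real (v j) * (G j (?y x) / of_real \<sigma>))) (at 0)"
      using smooth_statisticD(3)[OF F, of "?y x" "\<lambda>j. if j < n then v j / \<sigma> else 0"] by simp
  qed
  define b where "b x = - of_real (\<beta> / 2 * real n) * (\<Sum>j<n. of_real (x j) * r (x j)) + of_real \<beta> * (\<Sum>k<n. \<Sum>j<k. - (r (x j) * r (x k)))
     + (\<Sum>j<n. - (r (x j) * r (x j)))" for x :: "nat \<Rightarrow> real"
  \<comment> \<open>The identity for one real-linear functional of the resolvent; the case Re plus i
    times the case Im yields the complex one.\<close>
  have key: "(\<integral>x. (\<Sum>j<n. of_real (\<phi> (r (?y x j))) * G j (?y x)) + of_real (\<phi> (b (?y x))) * F (?y x) \<partial>?M) = 0 \<and>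
     integrable ?M (\<lambda>x. (\<Sum>j<n. of_real (\<phi> (r (?y x j))) * G j (?y x)) + of_real (\<phi> (b (?y x))) * F (?y x))"
    if \<phi>: "bounded_linear \<phi>" "\<And>w. \<bar>\<phi> w\<bar> \<le> norm w" for \<phi>
  proof -
    interpret \<phi>: bounded_linear \<phi> by fact
    interpret deformation \<beta> n "\<lambda>t. \<sigma> * \<phi> (1 / (of_real (t / \<sigma>) - z))"
      "\<lambda>t u. \<phi> (- 1 / ((of_real (t / \<sigma>) - z) * (of_real (u / \<sigma>) - z)))" "\<sigma> / Im z + 1 / (Im z)\<^sup>2"
      by (rule deformation_resolvent[OF \<beta> z \<sigma>(1) \<phi>])
    have \<phi>mult: "\<phi> (of_real c * w) = c * \<phi> w" for c w
      using \<phi>.scaleR[of c w] by (simp add: scaleR_conv_of_real)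
    have d: "drift x = \<phi> (b (?y x))" for x
    proof -
      have 1: "(\<Sum>j<n. x j * (\<sigma> * \<phi> (1 / (of_real (x j / \<sigma>) - z)))) = real n * (\<Sum>j<n. \<phi> (of_real (?y x j) * r (?y x j)))"
        unfolding sum_distrib_left \<phi>mult
      proof (intro sum.cong refl)
        fix j assume "j \<in> {..<n}"
        then show "x j * (\<sigma> * \<phi> (1 / (of_real (x j / \<sigma>) - z))) = real n * (?y x j * \<phi> (r (?y x j)))"
          using \<sigma> unfolding \<sigma>(2)[symmetric] by (simp add: coordwise_def r_def field_simps)
      qed
      have 2: "(\<Sum>k<n. \<Sum>j<k. \<phi> (- 1 / ((of_real (x j / \<sigma>) - z) * (of_real (x k / \<sigma>) - z))))
        = (\<Sum>k<n. \<Sum>j<k. \<phi> (- (r (?y x j) * r (?y x k))))"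
        by (intro sum.cong refl) (auto simp: coordwise_def r_def)
      have 3: "(\<Sum>j<n. \<phi> (- 1 / ((of_real (x j / \<sigma>) - z) * (of_real (x j / \<sigma>) - z))))
        = (\<Sum>j<n. \<phi> (- (r (?y x j) * r (?y x j))))"
        by (intro sum.cong refl) (auto simp: coordwise_def r_def)
      show ?thesis
        unfolding drift_def 1 2 3 b_def \<phi>.add \<phi>.sum
          of_real_minus[symmetric] \<phi>mult by simp
    qed
    have "(\<Sum>j<n. of_real (\<sigma> * \<phi> (1 / (of_real (x j / \<sigma>) - z))) * (G j (?y x) / of_real \<sigma>))
       = (\<Sum>j<n. of_real (\<phi> (r (?y x j))) * G j (?y x))" for x
      using \<sigma> by (intro sum.cong refl) (auto simp: coordwise_def r_def)
    with integration_by_parts[OF F'] show ?thesis unfolding d by simp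
  qed
  have R: "(\<integral>x. (\<Sum>j<n. r (?y x j) * G j (?y x)) + b (?y x) * F (?y x) \<partial>?M) = 0"
  proof -
    let ?f = "\<lambda>\<phi> x. (\<Sum>j<n. of_real (\<phi> (r (?y x j))) * G j (?y x)) + of_real (\<phi> (b (?y x))) * F (?y x)"
    note kR = key[OF bounded_linear_Re abs_Re_le_cmod] and kI = key[OF bounded_linear_Im abs_Im_le_cmod]
    have "(\<integral>x. ?f Re x + \<i> * ?f Im x \<partial>?M) = (\<integral>x. ?f Re x \<partial>?M) + (\<integral>x. \<i> * ?f Im x \<partial>?M)"
      by (rule Bochner_Integration.integral_add[OF conjunct2[OF kR] integrable_mult_right[OF conjunct2[OF kI]]])
    also have "(\<integral>x. \<i> * ?f Im x \<partial>?M) = \<i> * (\<integral>x. ?f Im x \<partial>?M)"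
      by (rule integral_mult_right_zero)
    finally have "(\<integral>x. ?f Re x + \<i> * ?f Im x \<partial>?M) = 0"
      unfolding conjunct1[OF kR] conjunct1[OF kI] by simp
    moreover have "?f Re x + \<i> * ?f Im x = (\<Sum>j<n. r (?y x j) * G j (?y x)) + b (?y x) * F (?y x)" for x
    proof -
      have w: "w * u = of_real (Re w) * u + \<i> * (of_real (Im w) * u)" for w u :: complex
        by (simp add: complex_eq_iff)
      have "(\<Sum>j<n. r (?y x j) * G j (?y x)) = (\<Sum>j<n. of_real (Re (r (?y x j))) * G j (?y x)) +
         \<i> * (\<Sum>j<n. of_real (Im (r (?y x j))) * G j (?y x))"
        unfolding sum_distrib_left sum.distrib[symmetric] by (intro sum.cong refl w)
      then show ?thesis using w[of "b (?y x)" "F (?y x)"] by (simp only: distrib_left add_ac)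
    qed
    ultimately show ?thesis by simp
  qed
  interpret S: prob_space "scaled_gbe \<beta> n" by (rule prob_space_scaled_gbe[OF \<beta>])
  have r_meas: "(\<lambda>x. r (x j)) \<in> borel_measurable (lebesgue_Rn n)" if "j < n" for j
    unfolding r_def using that by measurable
  have r_bound: "norm (r t) \<le> 1 / Im z" for t unfolding r_def by (rule norm_resolvent_le[OF z])
  have b_eq: "b x = - of_real (\<beta> / 2 * (real n)\<^sup>2) * loop_operator \<beta> n z x" for x
    unfolding b_def r_def by (rule drift_identity[OF z n \<beta>])
  note [measurable] = loop_operator_measurable[of \<beta> n z]
  obtain BL where L_bound: "\<And>x. norm (loop_operator \<beta> n z x) \<le> BL"
    using loop_operator_bound[OF z] by blast
  have i1: "integrable (scaled_gbe \<beta> n) (\<lambda>x. F x * loop_operator \<beta> n z x)"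
  proof (rule S.integrable_const_bound)
    show "AE x in scaled_gbe \<beta> n. norm (F x * loop_operator \<beta> n z x) \<le> A * BL"
      using A L_bound by (intro AE_I2) (auto simp: norm_mult intro!: mult_mono)
  qed measurable
  have i2: "integrable (scaled_gbe \<beta> n) (\<lambda>x. \<Sum>j<n. r (x j) * G j x)"
  proof (rule S.integrable_const_bound)
    show "AE x in scaled_gbe \<beta> n. norm (\<Sum>j<n. r (x j) * G j x) \<le> real n * (1 / Im z * A)"
    proof (intro AE_I2)
      fix x
      show "norm (\<Sum>j<n. r (x j) * G j x) \<le> real n * (1 / Im z * A)"
      proof -
        have "norm (r (x j) * G j x) \<le> 1 / Im z * A" if "j \<in> {..<n}" for j
          unfolding norm_mult using that r_bound A z by (intro mult_mono) auto
        from sum_norm_bound[of "{..<n}" "\<lambda>j. r (x j) * G j x", OF this] show ?thesis by simp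
      qed
    qed
    show "(\<lambda>x. \<Sum>j<n. r (x j) * G j x) \<in> borel_measurable (scaled_gbe \<beta> n)"
      using r_meas meas(2) by (intro borel_measurable_sum borel_measurable_times) (auto simp: measurable_cong_sets[OF sets_scaled_gbe refl])
  qed
  have "(\<integral>x. (\<Sum>j<n. r (x j) * G j x) + b x * F x \<partial>scaled_gbe \<beta> n)
     = (\<integral>x. (\<Sum>j<n. r (?y x j) * G j (?y x)) + b (?y x) * F (?y x) \<partial>?M)"
  proof -
    have "(\<lambda>x. (\<Sum>j<n. r (x j) * G j x) + b x * F x) \<in> borel_measurable (lebesgue_Rn n)"
      unfolding b_eq using r_meas meas(2)
      by (intro borel_measurable_add borel_measurable_sum borel_measurable_times) auto
    then show ?thesis unfolding scaled_gbe_def \<sigma>_def[symmetric]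
      by (intro integral_distr) (simp_all add: measurable_cong_sets[OF sets_gbe refl] coordwise_scale_measurable)
  qed
  then have "(\<integral>x. (\<Sum>j<n. r (x j) * G j x) + b x * F x \<partial>scaled_gbe \<beta> n) = 0"
    using R by (rule trans)
  moreover have "b x * F x = - of_real (\<beta> / 2 * (real n)\<^sup>2) * (F x * loop_operator \<beta> n z x)" for x
    unfolding b_eq by (simp only: mult_ac)
  ultimately have "(\<integral>x. (\<Sum>j<n. r (x j) * G j x) + - of_real (\<beta> / 2 * (real n)\<^sup>2) * (F x * loop_operator \<beta> n z x) \<partial>scaled_gbe \<beta> n) = 0"
    by simp
  moreover have "(\<integral>x. (\<Sum>j<n. r (x j) * G j x) + - of_real (\<beta> / 2 * (real n)\<^sup>2) * (F x * loop_operator \<beta> n z x) \<partial>scaled_gbe \<beta> n)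
     = (\<integral>x. (\<Sum>j<n. r (x j) * G j x) \<partial>scaled_gbe \<beta> n) + - of_real (\<beta> / 2 * (real n)\<^sup>2) * (\<integral>x. F x * loop_operator \<beta> n z x \<partial>scaled_gbe \<beta> n)"
    by (subst Bochner_Integration.integral_add[OF i2 integrable_mult_right[OF i1]]) simp
  ultimately have "(\<integral>x. (\<Sum>j<n. r (x j) * G j x) \<partial>scaled_gbe \<beta> n) = of_real (\<beta> / 2 * (real n)\<^sup>2) * (\<integral>x. F x * loop_operator \<beta> n z x \<partial>scaled_gbe \<beta> n)"
    by simp
  moreover have "(\<Sum>j<n. r (x j) * G j x) = (\<Sum>j<n. G j x / (of_real (x j) - z))" for x
    by (simp add: r_def)
  ultimately show ?thesis using \<beta> n by (simp add: field_simps)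
qed

section \<open>Moments of the empirical Stieltjes transform\<close>

lemma smooth_statisticI:
  assumes "F \<in> borel_measurable (lebesgue_Rn n)" "\<And>j. j < n \<Longrightarrow> G j \<in> borel_measurable (lebesgue_Rn n)"
    "\<And>x. norm (F x) \<le> A" "\<And>j x. j < n \<Longrightarrow> norm (G j x) \<le> B"
    "\<And>x v. ((\<lambda>e. F (\<lambda>j. x j + e * v j)) has_vector_derivative (\<Sum>j<n. of_real (v j) * G j x)) (at 0)"
  shows "smooth_statistic n F G"
proof -
  have "norm (F x) \<le> max A B \<and> (\<forall>j<n. norm (G j x) \<le> max A B)" for x
    using assms(3)[of x] assms(4)[of _ x] by (simp add: le_max_iff_disj)
  then have "\<exists>C. \<forall>x. norm (F x) \<le> C \<and> (\<forall>j<n. norm (G j x) \<le> C)" by blast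
  then show ?thesis
    unfolding smooth_statistic_def using assms(1,2,5) by (intro conjI allI impI) assumption+
qed

lemma smooth_statistic_add:
  assumes "smooth_statistic n F1 G1" "smooth_statistic n F2 G2"
  shows "smooth_statistic n (\<lambda>x. F1 x + F2 x) (\<lambda>j x. G1 j x + G2 j x)"
proof -
  obtain A1 where A1: "\<And>x. norm (F1 x) \<le> A1" "\<And>x j. j < n \<Longrightarrow> norm (G1 j x) \<le> A1" "A1 \<ge> 0"
    using smooth_statistic_bound[OF assms(1)] by metis
  obtain A2 where A2: "\<And>x. norm (F2 x) \<le> A2" "\<And>x j. j < n \<Longrightarrow> norm (G2 j x) \<le> A2" "A2 \<ge> 0"
    using smooth_statistic_bound[OF assms(2)] by metis
  show ?thesis
  proof (rule smooth_statisticI[where A = "A1 + A2" and B = "A1 + A2"])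
    fix x v
    from has_vector_derivative_add[OF smooth_statisticD(3)[OF assms(1), of x v] smooth_statisticD(3)[OF assms(2), of x v]]
    show "((\<lambda>e. F1 (\<lambda>j. x j + e * v j) + F2 (\<lambda>j. x j + e * v j)) has_vector_derivative (\<Sum>j<n. of_real (v j) * (G1 j x + G2 j x))) (at 0)"
      by (simp only: distrib_left sum.distrib)
  qed (use A1 A2 smooth_statisticD(1,2)[OF assms(1)] smooth_statisticD(1,2)[OF assms(2)] in \<open>auto intro!: norm_triangle_le add_mono\<close>)
qed

lemma smooth_statistic_mult:
  assumes "smooth_statistic n F1 G1" "smooth_statistic n F2 G2"
  shows "smooth_statistic n (\<lambda>x. F1 x * F2 x) (\<lambda>j x. F1 x * G2 j x + G1 j x * F2 x)"
proof -
  obtain A1 where A1: "\<And>x. norm (F1 x) \<le> A1" "\<And>x j. j < n \<Longrightarrow> norm (G1 j x) \<le> A1" "A1 \<ge> 0"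
    using smooth_statistic_bound[OF assms(1)] by metis
  obtain A2 where A2: "\<And>x. norm (F2 x) \<le> A2" "\<And>x j. j < n \<Longrightarrow> norm (G2 j x) \<le> A2" "A2 \<ge> 0"
    using smooth_statistic_bound[OF assms(2)] by metis
  show ?thesis
  proof (rule smooth_statisticI[where A = "A1 * A2" and B = "A1 * A2 + A1 * A2"])
    fix x v
    have e: "F1 x * (\<Sum>j<n. of_real (v j) * G2 j x) + (\<Sum>j<n. of_real (v j) * G1 j x) * F2 x
       = (\<Sum>j<n. of_real (v j) * (F1 x * G2 j x + G1 j x * F2 x))"
      unfolding sum_distrib_left sum_distrib_right sum.distrib[symmetric]
      by (intro sum.cong refl) (simp add: algebra_simps)
    from has_vector_derivative_mult[OF smooth_statisticD(3)[OF assms(1), of x v] smooth_statisticD(3)[OF assms(2), of x v]]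
    show "((\<lambda>e. F1 (\<lambda>j. x j + e * v j) * F2 (\<lambda>j. x j + e * v j)) has_vector_derivative (\<Sum>j<n. of_real (v j) * (F1 x * G2 j x + G1 j x * F2 x))) (at 0)"
      by (simp add: e)
  next
    show "norm (F1 x * F2 x) \<le> A1 * A2" for x unfolding norm_mult using A1 A2 by (intro mult_mono) auto
    show "norm (F1 x * G2 j x + G1 j x * F2 x) \<le> A1 * A2 + A1 * A2" if "j < n" for j x
      using that A1 A2 by (intro norm_triangle_le add_mono) (auto simp: norm_mult intro!: mult_mono)
  qed (use smooth_statisticD(1,2)[OF assms(1)] smooth_statisticD(1,2)[OF assms(2)] in auto)
qed

lemma smooth_statistic_cnj:
  assumes "smooth_statistic n F G"
  shows "smooth_statistic n (\<lambda>x. cnj (F x)) (\<lambda>j x. cnj (G j x))"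
proof -
  obtain A where A: "\<And>x. norm (F x) \<le> A" "\<And>x j. j < n \<Longrightarrow> norm (G j x) \<le> A" "A \<ge> 0"
    using smooth_statistic_bound[OF assms(1)] by metis
  show ?thesis
  proof (rule smooth_statisticI[where A = A and B = A])
    fix x v
    from bounded_linear.has_vector_derivative[OF bounded_linear_cnj smooth_statisticD(3)[OF assms, of x v]]
    show "((\<lambda>e. cnj (F (\<lambda>j. x j + e * v j))) has_vector_derivative (\<Sum>j<n. of_real (v j) * cnj (G j x))) (at 0)"
      by simp
    have "(\<lambda>x. cnj (H x)) \<in> borel_measurable (lebesgue_Rn n)" if "H \<in> borel_measurable (lebesgue_Rn n)" for H
      using measurable_compose[OF that borel_measurable_continuous_onI[OF continuous_on_cnj[OF continuous_on_id]]] by simp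
    then show "(\<lambda>x. cnj (F x)) \<in> borel_measurable (lebesgue_Rn n)"
      "\<And>j. j < n \<Longrightarrow> (\<lambda>x. cnj (G j x)) \<in> borel_measurable (lebesgue_Rn n)"
      using smooth_statisticD(1,2)[OF assms(1)] by auto
  qed (use A in auto)
qed

lemma smooth_statistic_const: "smooth_statistic n (\<lambda>x. c) (\<lambda>j x. 0)"
  by (rule smooth_statisticI[where A = "norm c" and B = 0]) auto

lemma smooth_statistic_linear:
  fixes f f' :: "real \<Rightarrow> complex"
  assumes d: "\<And>t. (f has_vector_derivative f' t) (at t)"
    and b: "\<And>t. norm (f t) \<le> A" "\<And>t. norm (f' t) \<le> B"
    and m: "f \<in> borel_measurable borel" "f' \<in> borel_measurable borel"
  shows "smooth_statistic n (\<lambda>x. \<Sum>j<n. f (x j)) (\<lambda>j x. f' (x j))"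
proof (rule smooth_statisticI[where A = "real n * A" and B = B])
  note [measurable] = m
  show "(\<lambda>x. \<Sum>j<n. f (x j)) \<in> borel_measurable (lebesgue_Rn n)" by measurable
  show "(\<lambda>x. f' (x j)) \<in> borel_measurable (lebesgue_Rn n)" if "j < n" for j using that by measurable
  show "norm (\<Sum>j<n. f (x j)) \<le> real n * A" for x
    using sum_norm_bound[of "{..<n}" "\<lambda>j. f (x j)" A] b by simp
  fix x v :: "nat \<Rightarrow> real"
  have "((\<lambda>e. f (x j + e * v j)) has_vector_derivative of_real (v j) * f' (x j)) (at 0)" for j
  proof -
    have "((\<lambda>e. x j + e * v j) has_vector_derivative v j) (at 0)"
      by (auto intro!: derivative_eq_intros)
    from vector_diff_chain_at[OF this, of f] d[of "x j"] show ?thesis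
      by (simp add: o_def scaleR_conv_of_real)
  qed
  then show "((\<lambda>e. \<Sum>j<n. f (x j + e * v j)) has_vector_derivative (\<Sum>j<n. of_real (v j) * f' (x j))) (at 0)"
    by (intro has_vector_derivative_sum)
qed (use b in auto)

lemma smooth_statistic_empirical:
  assumes z: "Im z > 0"
  shows "smooth_statistic n (empirical_stieltjes n z) (\<lambda>j x. - 1 / (of_real (x j) - z)\<^sup>2 / of_nat n)"
proof -
  have nz: "complex_of_real t \<noteq> z" for t using real_minus_nonreal[OF z, of t] by auto
  have "smooth_statistic n (\<lambda>x. \<Sum>j<n. 1 / (of_real (x j) - z) / of_nat n) (\<lambda>j x. - 1 / (of_real (x j) - z)\<^sup>2 / of_nat n)"
  proof (rule smooth_statistic_linear[where A = "1 / Im z" and B = "(1 / Im z)\<^sup>2"])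
    fix t :: real
    have "((\<lambda>w. 1 / (w - z)) has_field_derivative (- 1 / (of_real t - z)\<^sup>2)) (at (of_real t))"
      using nz[of t] by (auto intro!: derivative_eq_intros simp: power2_eq_square)
    then show "((\<lambda>t. 1 / (of_real t - z) / of_nat n) has_vector_derivative - 1 / (of_real t - z)\<^sup>2 / of_nat n) (at t)"
      by (intro has_vector_derivative_divide has_vector_derivative_real_field)
    have le: "norm w / real n \<le> norm w" for w :: complex
      by (cases "n = 0") (auto simp: divide_le_eq mult_le_cancel_left1)
    show "norm (1 / (of_real t - z) / of_nat n) \<le> 1 / Im z"
      using order_trans[OF le norm_resolvent_le[OF z, of t]] unfolding norm_divide norm_of_nat .
    have "norm ((1 / (of_real t - z))\<^sup>2) \<le> (1 / Im z)\<^sup>2"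
      unfolding norm_power by (intro power_mono norm_resolvent_le z) auto
    then have "norm (- 1 / (of_real t - z)\<^sup>2) \<le> (1 / Im z)\<^sup>2"
      by (simp only: power_divide norm_divide norm_minus_cancel power_one)
    from order_trans[OF le this] show "norm (- 1 / (of_real t - z)\<^sup>2 / of_nat n) \<le> (1 / Im z)\<^sup>2"
      unfolding norm_divide norm_of_nat .
  qed measurable
  then show ?thesis by (simp add: empirical_stieltjes_def[abs_def] sum_divide_distrib)
qed

text \<open>Since s has partial derivatives - r_j^2 / n, those of the defect carry the factor 2 s +
  z. Its square is the discriminant of w^2 + z w + 1 plus four times the defect, which is what
  closes the moment estimate.\<close>

lemma smooth_statistic_defect:
  assumes z: "Im z > 0"
  shows "smooth_statistic n (sc_defect n z)
     (\<lambda>j x. - (2 * empirical_stieltjes n z x + z) / (of_real (x j) - z)\<^sup>2 / of_nat n)"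
proof -
  note s = smooth_statistic_empirical[OF z, of n]
  have "smooth_statistic n (\<lambda>x. empirical_stieltjes n z x * empirical_stieltjes n z x + z * empirical_stieltjes n z x + 1)
    (\<lambda>j x. ((empirical_stieltjes n z x * (- 1 / (of_real (x j) - z)\<^sup>2 / of_nat n) + (- 1 / (of_real (x j) - z)\<^sup>2 / of_nat n) * empirical_stieltjes n z x)
     + (z * (- 1 / (of_real (x j) - z)\<^sup>2 / of_nat n) + 0 * empirical_stieltjes n z x)) + 0)"
    by (intro smooth_statistic_add smooth_statistic_mult[OF s s] smooth_statistic_mult[OF smooth_statistic_const s] smooth_statistic_const)
  moreover have "(s * (- 1 / a / m) + (- 1 / a / m) * s) + (z * (- 1 / a / m) + 0 * s) + 0 = - (2 * s + z) / a / m"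
    for s a m :: complex
  proof -
    have q: "(s * (- q) + (- q) * s) + (z * (- q) + 0 * s) + 0 = - (2 * s + z) * q" for q
      by (simp add: algebra_simps)
    show ?thesis using q[of "1 / a / m"] by simp
  qed
  ultimately have "smooth_statistic n (\<lambda>x. empirical_stieltjes n z x * empirical_stieltjes n z x + z * empirical_stieltjes n z x + 1)
     (\<lambda>j x. - (2 * empirical_stieltjes n z x + z) / (of_real (x j) - z)\<^sup>2 / of_nat n)"
    by (simp only:)
  then show ?thesis unfolding sc_defect_def[abs_def] power2_eq_square[of "empirical_stieltjes _ _ _"] .
qed

text \<open>The Ward identity. Summed over the points it trades squared resolvents for Im s / Im
  z.\<close>

lemma Im_resolvent:
  assumes "Im z > 0" shows "Im (1 / (of_real t - z)) = Im z * (norm (1 / (of_real t - z)))\<^sup>2"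
proof -
  have "Im (1 / (of_real t - z)) = Im z / ((t - Re z)\<^sup>2 + (Im z)\<^sup>2)"
    by (simp add: Im_divide)
  moreover have "(norm (1 / (of_real t - z)))\<^sup>2 = 1 / ((t - Re z)\<^sup>2 + (Im z)\<^sup>2)"
    by (simp add: norm_divide power_divide cmod_power2)
  ultimately show ?thesis by simp
qed

lemma Im_empirical:
  assumes "Im z > 0"
  shows "Im (empirical_stieltjes n z x) = Im z * (\<Sum>j<n. (norm (1 / (of_real (x j) - z)))\<^sup>2) / real n"
  unfolding empirical_stieltjes_def by (simp add: Im_resolvent[OF assms] sum_distrib_left)

lemma Im_empirical_nonneg: "Im z > 0 \<Longrightarrow> Im (empirical_stieltjes n z x) \<ge> 0"
  by (subst Im_empirical) (auto intro!: divide_nonneg_nonneg mult_nonneg_nonneg sum_nonneg)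

lemma sum_norm_resolvent_square:
  assumes "Im z > 0" "n \<ge> 1"
  shows "(\<Sum>j<n. (norm (1 / (of_real (x j) - z)))\<^sup>2) = real n * Im (empirical_stieltjes n z x) / Im z"
  using assms by (subst Im_empirical) auto

lemma norm_empirical'_le_Im:
  assumes "Im z > 0" "n \<ge> 1"
  shows "norm (empirical_stieltjes' n z x) \<le> Im (empirical_stieltjes n z x) / Im z"
proof -
  have "norm (\<Sum>j<n. 1 / (of_real (x j) - z)\<^sup>2) \<le> (\<Sum>j<n. (norm (1 / (of_real (x j) - z)))\<^sup>2)"
    by (intro sum_norm_le) (simp add: norm_divide norm_power power_divide)
  also have "\<dots> = real n * Im (empirical_stieltjes n z x) / Im z"
    by (rule sum_norm_resolvent_square[OF assms])
  finally have "norm (empirical_stieltjes' n z x) \<le> real n * Im (empirical_stieltjes n z x) / Im z / real n"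
    unfolding empirical_stieltjes'_def norm_divide norm_of_nat by (rule divide_right_mono) simp
  then show ?thesis using assms by simp
qed

text \<open>One factor is bounded by 1 / Im z, the other two by the Ward identity. Third powers
  occur because the gradient of the defect is again multiplied by the resolvent in the loop
  equation.\<close>

lemma sum_norm_resolvent_cube:
  assumes "Im z > 0" "n \<ge> 1"
  shows "(\<Sum>j<n. (norm (1 / (of_real (x j) - z)))^3) \<le> real n * Im (empirical_stieltjes n z x) / (Im z)\<^sup>2"
proof -
  have "(\<Sum>j<n. (norm (1 / (of_real (x j) - z)))^3) \<le> (\<Sum>j<n. (1 / Im z) * (norm (1 / (of_real (x j) - z)))\<^sup>2)"
  proof (intro sum_mono)
    fix j
    have "norm (1 / (of_real (x j) - z)) * (norm (1 / (of_real (x j) - z)))\<^sup>2 \<le> (1 / Im z) * (norm (1 / (of_real (x j) - z)))\<^sup>2"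
      by (intro mult_right_mono norm_resolvent_le assms) auto
    then show "(norm (1 / (of_real (x j) - z)))^3 \<le> (1 / Im z) * (norm (1 / (of_real (x j) - z)))\<^sup>2"
      by (simp only: power3_eq_cube power2_eq_square mult.assoc)
  qed
  also have "\<dots> = (1 / Im z) * (real n * Im (empirical_stieltjes n z x) / Im z)"
    unfolding sum_distrib_left[symmetric] sum_norm_resolvent_square[OF assms] ..
  also have "\<dots> = real n * Im (empirical_stieltjes n z x) / (Im z)\<^sup>2" by (simp add: power2_eq_square)
  finally show ?thesis .
qed

lemma Im_empirical_le_discriminant:
  assumes "Im z > 0"
  shows "Im (empirical_stieltjes n z x) \<le> norm (2 * empirical_stieltjes n z x + z) / 2"
  using abs_Im_le_cmod[of "2 * empirical_stieltjes n z x + z"] assms by simp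

text \<open>(2 s + z)^2 = z^2 - 4 + 4 P with P the defect. The error terms of the loop equation are
  thereby bounded by the defect itself and deterministic quantities.\<close>

lemma discriminant_le:
  "norm (2 * empirical_stieltjes n z x + z) \<le> norm (sc_root z) + 2 * sqrt (norm (sc_defect n z x))"
proof (rule power2_le_imp_le)
  let ?s = "empirical_stieltjes n z x"
  have e: "(2 * ?s + z)\<^sup>2 = (sc_root z)\<^sup>2 + 4 * sc_defect n z x"
    unfolding sc_root_square sc_defect_def by (simp add: power2_eq_square algebra_simps)
  have "(norm (2 * ?s + z))\<^sup>2 \<le> (norm (sc_root z))\<^sup>2 + 4 * norm (sc_defect n z x)"
    unfolding norm_power[symmetric] e using norm_triangle_ineq[of "(sc_root z)\<^sup>2" "4 * sc_defect n z x"]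
    by (simp add: norm_mult norm_power)
  also have "\<dots> \<le> (norm (sc_root z) + 2 * sqrt (norm (sc_defect n z x)))\<^sup>2"
    by (simp add: power2_sum power_mult_distrib)
  finally show "(norm (2 * ?s + z))\<^sup>2 \<le> (norm (sc_root z) + 2 * sqrt (norm (sc_defect n z x)))\<^sup>2" .
qed auto

text \<open>To be used with Q = |P|, A = |\<open>sc_root z\<close>| / (n Im z) and U = |2 s + z| /
  (n Im z). If Q <= M A, everything is at most a multiple of A^4; otherwise U is at most a small
  multiple of Q and both terms are absorbed into Q^4 / 2.\<close>

lemma absorption:
  fixes c1 c2 :: real assumes c: "c1 \<ge> 0" "c2 \<ge> 0"
  shows "\<exists>C\<ge>0. \<forall>A\<ge>0. \<forall>Q\<ge>0. \<forall>U\<ge>0. U \<le> A + 2 * sqrt A * sqrt Q \<longrightarrow>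
     c1 * Q^3 * U + c2 * Q\<^sup>2 * U\<^sup>2 \<le> Q^4 / 2 + C * A^4"
proof -
  \<comment> \<open>The large case yields U <= 3 Q / R; 12 c1 and 36 c2 bring each of the two terms
    below Q^4 / 4. M is R^2 because A enters through its square root.\<close>
  define R where "R = 12 * c1 + 36 * c2 + 1"
  have R: "R \<ge> 1" using c by (simp add: R_def)
  define M where "M = R\<^sup>2"
  have M: "M \<ge> 1" "sqrt M = R" using R by (auto simp: M_def)
  define C where "C = c1 * M^3 * (1 + 2 * R) + c2 * M\<^sup>2 * (1 + 2 * R)\<^sup>2"
  show ?thesis
  proof (intro exI[of _ C] conjI allI impI)
    show "C \<ge> 0" using c M R by (simp add: C_def)
    fix A Q U :: real assume *: "0 \<le> A" "0 \<le> Q" "0 \<le> U" "U \<le> A + 2 * sqrt A * sqrt Q"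
    show "c1 * Q^3 * U + c2 * Q\<^sup>2 * U\<^sup>2 \<le> Q^4 / 2 + C * A^4"
    proof (cases "Q \<le> M * A")
      case True
      have "sqrt A * sqrt Q \<le> sqrt A * sqrt (M * A)" using True * by (intro mult_left_mono) auto
      also have "\<dots> = R * A" using M * by (simp add: real_sqrt_mult)
      finally have U: "U \<le> A * (1 + 2 * R)" using * by (simp add: algebra_simps)
      have "c1 * Q^3 * U \<le> c1 * (M * A)^3 * (A * (1 + 2 * R))"
        using True * U c by (intro mult_mono power_mono) (auto intro!: mult_nonneg_nonneg)
      moreover have "c2 * Q\<^sup>2 * U\<^sup>2 \<le> c2 * (M * A)\<^sup>2 * (A * (1 + 2 * R))\<^sup>2"
        using True * U c by (intro mult_mono power_mono) (auto intro!: mult_nonneg_nonneg)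
      moreover have "c1 * (M * A)^3 * (A * (1 + 2 * R)) + c2 * (M * A)\<^sup>2 * (A * (1 + 2 * R))\<^sup>2 = C * A^4"
        unfolding C_def by (simp add: power_mult_distrib) (simp add: algebra_simps power_numeral_reduce)
      moreover have "0 \<le> Q^4 / 2" by simp
      ultimately show ?thesis by linarith
    next
      case False
      then have Q: "A \<le> Q / M" "Q > 0" using M * by (auto simp: field_simps) (metis less_le_trans mult_nonneg_nonneg not_le order_trans zero_le_one)
      have "sqrt A * sqrt Q \<le> sqrt (Q / M) * sqrt Q" using Q * by (intro mult_right_mono) auto
      also have "\<dots> = Q / R" using M Q by (simp add: real_sqrt_divide)
      finally have 1: "sqrt A * sqrt Q \<le> Q / R" .
      have "A \<le> Q / R"
      proof -
        have "Q / M \<le> Q / R" using Q R unfolding M_def by (intro divide_left_mono) (auto simp: power2_eq_square)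
        then show ?thesis using Q by linarith
      qed
      then have U: "U \<le> 3 * Q / R" using * 1 by linarith
      have "c1 * Q^3 * U \<le> c1 * Q^3 * (3 * Q / R)" using U c * by (intro mult_left_mono) auto
      also have "\<dots> = Q^4 * (3 * c1 / R)" by (simp add: power_numeral_reduce)
      also have "\<dots> \<le> Q^4 * (1 / 4)" using c R by (intro mult_left_mono) (auto simp: field_simps R_def)
      finally have a: "c1 * Q^3 * U \<le> Q^4 / 4" by simp
      have "c2 * Q\<^sup>2 * U\<^sup>2 \<le> c2 * Q\<^sup>2 * (3 * Q / R)\<^sup>2" using U c * by (intro mult_left_mono power_mono) auto
      also have "\<dots> = Q^4 * (9 * c2 / (R * R))" by (simp add: power_numeral_reduce)
      also have "\<dots> \<le> Q^4 * (1 / 4)"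
      proof (intro mult_left_mono)
        have "9 * c2 / (R * R) \<le> 9 * c2 / R" using c R by (intro divide_left_mono) auto
        also have "\<dots> \<le> 1 / 4" using c R by (auto simp: field_simps R_def)
        finally show "9 * c2 / (R * R) \<le> 1 / 4" .
      qed auto
      finally have b: "c2 * Q\<^sup>2 * U\<^sup>2 \<le> Q^4 / 4" by simp
      have "0 \<le> C * A^4" using \<open>C \<ge> 0\<close> by simp
      then show ?thesis using a b by linarith
    qed
  qed
qed

section \<open>Fourth moments of the defect and of the deviation\<close>

lemma integrable_bounded_scaled:
  fixes f :: "(nat \<Rightarrow> real) \<Rightarrow> 'a::{banach, second_countable_topology}"
  assumes "\<beta> > 0" "f \<in> borel_measurable (lebesgue_Rn n)" "\<And>x. norm (f x) \<le> B"
  shows "integrable (scaled_gbe \<beta> n) f"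
proof -
  interpret prob_space "scaled_gbe \<beta> n" by (rule prob_space_scaled_gbe[OF assms(1)])
  show ?thesis using assms by (intro integrable_const_bound[of _ B]) (simp_all add: measurable_cong_sets[OF sets_scaled_gbe refl])
qed

lemma integrable_bounded_scaled':
  fixes f :: "(nat \<Rightarrow> real) \<Rightarrow> real"
  assumes "\<beta> > 0" "f \<in> borel_measurable (lebesgue_Rn n)" "\<And>x. 0 \<le> f x" "\<And>x. f x \<le> B"
  shows "integrable (scaled_gbe \<beta> n) f"
  using assms by (intro integrable_bounded_scaled[of _ _ _ B]) auto

text \<open>The chosen F satisfies F P = |P|^4, so the loop equation expresses the moment itself
  through error terms, and these are absorbed. The scale condition n Im z |\<open>sc_root z\<close>|
  >= 1 means that at height Im z an order-one number of points is seen.\<close>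

theorem defect_fourth_moment:
  assumes \<beta>: "\<beta> > 0"
  shows "\<exists>C\<ge>0. \<forall>n\<ge>1. \<forall>z. Im z > 0 \<longrightarrow> 1 \<le> real n * Im z * norm (sc_root z) \<longrightarrow>
    (\<integral>x. norm (sc_defect n z x) ^ 4 \<partial>scaled_gbe \<beta> n) \<le> C * (norm (sc_root z) / (real n * Im z)) ^ 4"
proof -
  \<comment> \<open>Both constants contain 1 / 2 from Im s <= |2 s + z| / 2; in \<open>c2\<close> it
    multiplies 2 / \<beta> from the loop equation and 3 from the product rule for the cubic
    F.\<close>
  define c1 where "c1 = \<bar>1 - 2 / \<beta>\<bar> / 2"
  define c2 where "c2 = 3 / \<beta>"
  have c: "c1 \<ge> 0" "c2 \<ge> 0" using \<beta> by (auto simp: c1_def c2_def)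
  obtain C where C: "C \<ge> 0" and absorb: "\<And>A Q U. 0 \<le> A \<Longrightarrow> 0 \<le> Q \<Longrightarrow> 0 \<le> U \<Longrightarrow> U \<le> A + 2 * sqrt A * sqrt Q \<Longrightarrow>
     c1 * Q^3 * U + c2 * Q\<^sup>2 * U\<^sup>2 \<le> Q^4 / 2 + C * A^4"
    using absorption[OF c] by blast
  show ?thesis
  proof (intro exI[of _ "2 * C"] conjI allI impI)
    show "2 * C \<ge> 0" using C by simp
    fix n :: nat and z :: complex
    assume n: "n \<ge> 1" and z: "Im z > 0" and k: "1 \<le> real n * Im z * norm (sc_root z)"
    let ?M = "scaled_gbe \<beta> n" and ?P = "sc_defect n z" and ?s = "empirical_stieltjes n z"
    interpret prob_space ?M by (rule prob_space_scaled_gbe[OF \<beta>])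
    define \<delta> where "\<delta> = 1 / (real n * Im z)"
    define A where "A = norm (sc_root z) / (real n * Im z)"
    define Q where "Q x = norm (?P x)" for x
    define U where "U x = \<delta> * norm (2 * ?s x + z)" for x
    have \<delta>: "\<delta> > 0" using n z by (simp add: \<delta>_def)
    have A: "A = \<delta> * norm (sc_root z)" by (simp add: A_def \<delta>_def)
    \<comment> \<open>The scale condition says \<delta> <= |\<open>sc_root z\<close>|, so \<delta>^2
      <= A; this turns the coefficient \<delta> of sqrt Q into the sqrt A that
      \<open>absorption\<close> asks for.\<close>
    have "\<delta> \<le> norm (sc_root z)" using k n z by (simp add: \<delta>_def field_simps)
    then have \<delta>A: "\<delta> \<le> sqrt A" unfolding A using \<delta> by (intro real_le_rsqrt) (simp add: power2_eq_square)
    have A0: "A \<ge> 0" using \<delta> by (simp add: A)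
    have Q0: "Q x \<ge> 0" and U0: "U x \<ge> 0" for x using \<delta> by (simp_all add: Q_def U_def)
    have U_le: "U x \<le> A + 2 * sqrt A * sqrt (Q x)" for x
    proof -
      have "U x \<le> \<delta> * (norm (sc_root z) + 2 * sqrt (Q x))"
        unfolding U_def Q_def using \<delta> by (intro mult_left_mono discriminant_le) auto
      also have "\<dots> = A + 2 * (\<delta> * sqrt (Q x))" unfolding A by (simp add: algebra_simps)
      also have "\<delta> * sqrt (Q x) \<le> sqrt A * sqrt (Q x)" using \<delta>A Q0 by (intro mult_right_mono) auto
      finally show ?thesis by simp
    qed
    have Q_meas[measurable]: "Q \<in> borel_measurable (lebesgue_Rn n)" unfolding Q_def[abs_def] by measurable
    have U_meas[measurable]: "U \<in> borel_measurable (lebesgue_Rn n)" unfolding U_def[abs_def] by measurable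
    obtain BQ where BQ: "\<And>x. Q x \<le> BQ" using norm_sc_defect_le[OF z, of n] unfolding Q_def by blast
    have BU: "U x \<le> A + 2 * sqrt A * sqrt BQ" for x
      using U_le[of x] BQ[of x] A0 mult_left_mono[OF real_sqrt_le_mono[OF BQ[of x]], of "2 * sqrt A"] by simp
    define F where "F x = cnj (?P x) * cnj (?P x) * ?P x" for x
    define dP where "dP j x = - (2 * ?s x + z) / (of_real (x j) - z)\<^sup>2 / of_nat n" for j x
    define G where "G j x = cnj (?P x) * cnj (?P x) * dP j x + (cnj (?P x) * cnj (dP j x) + cnj (dP j x) * cnj (?P x)) * ?P x" for j x
    have smooth: "smooth_statistic n F G"
      unfolding F_def G_def dP_def
      by (intro smooth_statistic_mult smooth_statistic_cnj smooth_statistic_defect z)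
    have FP: "F x * ?P x = of_real (Q x ^ 4)" for x
    proof -
      have "?P x * cnj (?P x) = of_real ((Q x)\<^sup>2)" by (simp add: complex_norm_square[symmetric] Q_def)
      moreover have "F x * ?P x = (?P x * cnj (?P x)) * (?P x * cnj (?P x))" by (simp add: F_def mult_ac)
      ultimately have "F x * ?P x = of_real ((Q x)\<^sup>2 * (Q x)\<^sup>2)" by (simp only: of_real_mult)
      then show ?thesis by (simp only: power_add[symmetric]) simp
    qed
    have normF: "norm (F x) = Q x ^ 3" for x by (simp add: F_def norm_mult Q_def power3_eq_cube)
    have F_meas[measurable]: "F \<in> borel_measurable (lebesgue_Rn n)" by (rule smooth_statisticD(1)[OF smooth])
    have Q4_int: "integrable ?M (\<lambda>x. Q x ^ 4)"
      using Q0 BQ by (intro integrable_bounded_scaled'[OF \<beta>, of _ _ "BQ ^ 4"]) (auto intro!: power_mono)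
    have t1: "norm (F x) * norm (empirical_stieltjes' n z x) / real n \<le> Q x ^ 3 * U x / 2" for x
    proof -
      have "norm (empirical_stieltjes' n z x) \<le> Im (?s x) / Im z" by (rule norm_empirical'_le_Im[OF z n])
      also have "\<dots> \<le> norm (2 * ?s x + z) / 2 / Im z"
        using z by (intro divide_right_mono Im_empirical_le_discriminant) auto
      finally have "norm (empirical_stieltjes' n z x) / real n \<le> norm (2 * ?s x + z) / 2 / Im z / real n"
        by (rule divide_right_mono) simp
      also have "\<dots> = U x / 2" by (simp add: U_def \<delta>_def)
      finally have "Q x ^ 3 * (norm (empirical_stieltjes' n z x) / real n) \<le> Q x ^ 3 * (U x / 2)"
        using Q0 by (intro mult_left_mono) auto
      then show ?thesis by (simp add: normF)
    qed
    have t2: "norm (\<Sum>j<n. G j x / (of_real (x j) - z)) / (real n)\<^sup>2 \<le> 3 / 2 * ((Q x)\<^sup>2 * (U x)\<^sup>2)" for x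
    proof -
      have "norm (\<Sum>j<n. G j x / (of_real (x j) - z)) \<le> (\<Sum>j<n. 3 * (Q x)\<^sup>2 * (norm (2 * ?s x + z) / real n) * (norm (1 / (of_real (x j) - z)))^3)"
      proof (intro sum_norm_le)
        fix j
        let ?a = "complex_of_real (x j) - z"
        have d: "norm (dP j x) = norm (2 * ?s x + z) / real n * (norm (1 / ?a))\<^sup>2"
          unfolding dP_def norm_divide norm_power norm_minus_cancel norm_of_nat norm_one by (simp add: power_divide)
        have "norm (G j x) \<le> 3 * (Q x)\<^sup>2 * norm (dP j x)"
        proof -
          have "norm (G j x) \<le> norm (cnj (?P x) * cnj (?P x) * dP j x) + norm ((cnj (?P x) * cnj (dP j x) + cnj (dP j x) * cnj (?P x)) * ?P x)"
            unfolding G_def by (rule norm_triangle_ineq)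
          also have "cnj (?P x) * cnj (dP j x) + cnj (dP j x) * cnj (?P x) = 2 * (cnj (?P x) * cnj (dP j x))" by simp
          finally show ?thesis unfolding norm_mult complex_mod_cnj Q_def[symmetric] norm_numeral
            by (simp add: power2_eq_square mult_ac)
        qed
        then have "norm (G j x / ?a) \<le> 3 * (Q x)\<^sup>2 * norm (dP j x) * norm (1 / ?a)"
          unfolding norm_divide norm_one by (simp add: divide_right_mono)
        then show "norm (G j x / ?a) \<le> 3 * (Q x)\<^sup>2 * (norm (2 * ?s x + z) / real n) * (norm (1 / ?a))^3"
          unfolding d power3_eq_cube power2_eq_square[of "norm (1 / ?a)"] by (simp only: mult.assoc)
      qed
      also have "\<dots> = 3 * (Q x)\<^sup>2 * (norm (2 * ?s x + z) / real n) * (\<Sum>j<n. (norm (1 / (of_real (x j) - z)))^3)"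
        by (simp only: sum_distrib_left)
      also have "\<dots> \<le> 3 * (Q x)\<^sup>2 * (norm (2 * ?s x + z) / real n) * (real n * Im (?s x) / (Im z)\<^sup>2)"
        by (intro mult_left_mono sum_norm_resolvent_cube z n) auto
      also have "\<dots> \<le> 3 * (Q x)\<^sup>2 * (norm (2 * ?s x + z) / real n) * (real n * (norm (2 * ?s x + z) / 2) / (Im z)\<^sup>2)"
        by (intro mult_left_mono divide_right_mono Im_empirical_le_discriminant z) auto
      also have "\<dots> = 3 / 2 * ((Q x)\<^sup>2 * (U x)\<^sup>2) * (real n)\<^sup>2"
        using n by (simp add: U_def \<delta>_def power2_eq_square)
      finally show ?thesis using n by (simp add: pos_divide_le_eq)
    qed
    have s2_int: "integrable ?M (\<lambda>x. F x * empirical_stieltjes' n z x)"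
    proof (rule integrable_bounded_scaled[OF \<beta>])
      show "norm (F x * empirical_stieltjes' n z x) \<le> BQ ^ 3 * (1 / Im z)\<^sup>2" for x
        unfolding norm_mult normF using Q0 BQ norm_empirical_stieltjes'_le[OF z, of n x]
        by (intro mult_mono power_mono) (auto intro: order_trans)
    qed measurable
    have FP_int: "integrable ?M (\<lambda>x. F x * ?P x)"
      unfolding FP using Q4_int by (rule integrable_of_real)
    have eq: "(\<integral>x. F x * ?P x \<partial>?M) = of_real (2 / (\<beta> * (real n)\<^sup>2)) * (\<integral>x. (\<Sum>j<n. G j x / (of_real (x j) - z)) \<partial>?M)
       + of_real ((1 - 2 / \<beta>) / real n) * (\<integral>x. F x * empirical_stieltjes' n z x \<partial>?M)"
    proof -
      have "F x * loop_operator \<beta> n z x = F x * ?P x - of_real ((1 - 2 / \<beta>) / real n) * (F x * empirical_stieltjes' n z x)" for x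
        unfolding loop_operator_def by (simp only: right_diff_distrib mult.left_commute)
      then have "(\<integral>x. F x * loop_operator \<beta> n z x \<partial>?M)
         = (\<integral>x. F x * ?P x \<partial>?M) - of_real ((1 - 2 / \<beta>) / real n) * (\<integral>x. F x * empirical_stieltjes' n z x \<partial>?M)"
        using FP_int s2_int by (simp only: Bochner_Integration.integral_diff integrable_mult_right integral_mult_right_zero)
      then show ?thesis using loop_equation[OF \<beta> n z smooth] by (simp add: algebra_simps)
    qed
    have g_meas: "(\<lambda>x. \<Sum>j<n. G j x / (of_real (x j) - z)) \<in> borel_measurable (lebesgue_Rn n)"
      using smooth_statisticD(2)[OF smooth] by (intro borel_measurable_sum borel_measurable_divide) auto
    have QU_int: "integrable ?M (\<lambda>x. (Q x)\<^sup>2 * (U x)\<^sup>2)"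
      using Q0 U0 BQ BU by (intro integrable_bounded_scaled'[OF \<beta>, of _ _ "BQ\<^sup>2 * (A + 2 * sqrt A * sqrt BQ)\<^sup>2"]) (auto intro!: mult_mono power_mono)
    have QU'_int: "integrable ?M (\<lambda>x. Q x ^ 3 * U x)"
      using Q0 U0 BQ BU order_trans[OF Q0 BQ] by (intro integrable_bounded_scaled'[OF \<beta>, of _ _ "BQ^3 * (A + 2 * sqrt A * sqrt BQ)"]) (auto intro!: mult_mono power_mono)
    have n1: "norm (\<integral>x. (\<Sum>j<n. G j x / (of_real (x j) - z)) \<partial>?M) \<le> (\<integral>x. (real n)\<^sup>2 * (3 / 2 * ((Q x)\<^sup>2 * (U x)\<^sup>2)) \<partial>?M)"
    proof (rule order_trans[OF integral_norm_bound integral_mono_AE'])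
      show "AE x in ?M. norm (\<Sum>j<n. G j x / (of_real (x j) - z)) \<le> (real n)\<^sup>2 * (3 / 2 * ((Q x)\<^sup>2 * (U x)\<^sup>2))"
        using t2 n by (simp add: pos_divide_le_eq mult.commute)
    qed (use QU_int in auto)
    have n2: "norm (\<integral>x. F x * empirical_stieltjes' n z x \<partial>?M) \<le> (\<integral>x. real n * (Q x ^ 3 * U x / 2) \<partial>?M)"
    proof (rule order_trans[OF integral_norm_bound integral_mono_AE'])
      show "AE x in ?M. norm (F x * empirical_stieltjes' n z x) \<le> real n * (Q x ^ 3 * U x / 2)"
        using t1 n by (simp add: pos_divide_le_eq norm_mult mult.commute)
    qed (use QU'_int Q0 U0 in auto)
    have "(\<integral>x. Q x ^ 4 \<partial>?M) = norm (\<integral>x. F x * ?P x \<partial>?M)"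
    proof -
      have "(\<integral>x. F x * ?P x \<partial>?M) = of_real (\<integral>x. Q x ^ 4 \<partial>?M)" unfolding FP by (rule integral_complex_of_real)
      moreover have "(\<integral>x. Q x ^ 4 \<partial>?M) \<ge> 0" using Q0 by (intro integral_nonneg_AE) auto
      ultimately show ?thesis by simp
    qed
    also have "\<dots> \<le> (2 / (\<beta> * (real n)\<^sup>2)) * (\<integral>x. (real n)\<^sup>2 * (3 / 2 * ((Q x)\<^sup>2 * (U x)\<^sup>2)) \<partial>?M)
        + \<bar>1 - 2 / \<beta>\<bar> / real n * (\<integral>x. real n * (Q x ^ 3 * U x / 2) \<partial>?M)"
    proof -
      have "norm (of_real (2 / (\<beta> * (real n)\<^sup>2)) * (\<integral>x. (\<Sum>j<n. G j x / (of_real (x j) - z)) \<partial>?M))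
         \<le> (2 / (\<beta> * (real n)\<^sup>2)) * (\<integral>x. (real n)\<^sup>2 * (3 / 2 * ((Q x)\<^sup>2 * (U x)\<^sup>2)) \<partial>?M)"
        unfolding norm_mult norm_of_real using \<beta> by (intro mult_mono n1) auto
      moreover have "norm (of_real ((1 - 2 / \<beta>) / real n) * (\<integral>x. F x * empirical_stieltjes' n z x \<partial>?M))
         \<le> \<bar>1 - 2 / \<beta>\<bar> / real n * (\<integral>x. real n * (Q x ^ 3 * U x / 2) \<partial>?M)"
        unfolding norm_mult norm_of_real by (intro mult_mono n2) (auto simp: abs_divide)
      ultimately show ?thesis unfolding eq by (intro norm_triangle_le add_mono)
    qed
    also have "\<dots> = (\<integral>x. c1 * Q x ^ 3 * U x + c2 * (Q x)\<^sup>2 * (U x)\<^sup>2 \<partial>?M)"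
    proof -
      have "(\<integral>x. c1 * Q x ^ 3 * U x + c2 * (Q x)\<^sup>2 * (U x)\<^sup>2 \<partial>?M) = c1 * (\<integral>x. Q x ^ 3 * U x \<partial>?M) + c2 * (\<integral>x. (Q x)\<^sup>2 * (U x)\<^sup>2 \<partial>?M)"
        using QU_int QU'_int by (simp add: mult.assoc)
      then show ?thesis using n by (simp add: c1_def c2_def)
    qed
    also have "\<dots> \<le> (\<integral>x. Q x ^ 4 / 2 + C * A ^ 4 \<partial>?M)"
      using absorb[OF A0 Q0 U0 U_le] QU_int QU'_int Q4_int
      by (intro integral_mono) (auto simp: mult.assoc)
    also have "\<dots> = (\<integral>x. Q x ^ 4 \<partial>?M) / 2 + C * A ^ 4"
      using Q4_int by (simp add: prob_space)
    finally show "(\<integral>x. norm (sc_defect n z x) ^ 4 \<partial>?M) \<le> 2 * C * (norm (sc_root z) / (real n * Im z)) ^ 4"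
      by (simp add: Q_def A_def)
  qed
qed

definition deviation :: "nat \<Rightarrow> complex \<Rightarrow> (nat \<Rightarrow> real) \<Rightarrow> complex" where
  "deviation n z x = empirical_stieltjes n z x - sc_stieltjes z"

lemma deviation_measurable [measurable]: "deviation n z \<in> borel_measurable (lebesgue_Rn n)"
  unfolding deviation_def[abs_def] by measurable

lemma norm_deviation_bound:
  assumes "Im z > 0" shows "norm (deviation n z x) \<le> 1 / Im z + norm (sc_stieltjes z)"
  unfolding deviation_def by (intro norm_triangle_le_diff add_mono norm_empirical_stieltjes_le assms order_refl)

text \<open>Stability divides by |\<open>sc_root z\<close>|, which cancels exactly the same factor
  in the bound for the defect: no trace of the edge remains.\<close>

theorem deviation_fourth_moment:
  assumes \<beta>: "\<beta> > 0"
  obtains C where "C \<ge> 0"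
    "\<And>n z. n \<ge> 1 \<Longrightarrow> \<bar>Re z\<bar> < 2 \<Longrightarrow> Im z > 0 \<Longrightarrow> 1 \<le> real n * Im z * norm (sc_root z) \<Longrightarrow>
      (\<integral>x. norm (deviation n z x) ^ 4 \<partial>scaled_gbe \<beta> n) \<le> C\<^sup>2 / (real n * Im z) ^ 4"
    "\<And>n z. n \<ge> 1 \<Longrightarrow> \<bar>Re z\<bar> < 2 \<Longrightarrow> Im z > 0 \<Longrightarrow> 1 \<le> real n * Im z * norm (sc_root z) \<Longrightarrow>
      (\<integral>x. norm (deviation n z x) ^ 2 \<partial>scaled_gbe \<beta> n) \<le> C / (real n * Im z)\<^sup>2"
proof -
  obtain C where C: "C \<ge> 0" and mom: "\<And>n z. n \<ge> 1 \<Longrightarrow> Im z > 0 \<Longrightarrow> 1 \<le> real n * Im z * norm (sc_root z) \<Longrightarrow>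
    (\<integral>x. norm (sc_defect n z x) ^ 4 \<partial>scaled_gbe \<beta> n) \<le> C * (norm (sc_root z) / (real n * Im z)) ^ 4"
    using defect_fourth_moment[OF \<beta>] by blast
  have four: "(\<integral>x. norm (deviation n z x) ^ 4 \<partial>scaled_gbe \<beta> n) \<le> (8 * sqrt C)\<^sup>2 / (real n * Im z) ^ 4"
    if n: "n \<ge> 1" and z: "\<bar>Re z\<bar> < 2" "Im z > 0" and k: "1 \<le> real n * Im z * norm (sc_root z)" for n z
  proof -
    let ?M = "scaled_gbe \<beta> n" and ?k = "norm (sc_root z)"
    have k0: "?k > 0" by (rule norm_sc_root_pos[OF z(1)])
    have pt: "norm (deviation n z x) ^ 4 \<le> (64 / ?k ^ 4) * norm (sc_defect n z x) ^ 4" for x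
    proof -
      have "norm (deviation n z x) \<le> 2 * sqrt 2 * norm (sc_defect n z x) / ?k"
        unfolding deviation_def sc_defect_def using z Im_empirical_nonneg[OF z(2)] by (intro stability) auto
      then have "norm (deviation n z x) ^ 4 \<le> (2 * sqrt 2 * norm (sc_defect n z x) / ?k) ^ 4"
        by (intro power_mono) auto
      also have "\<dots> = (64 / ?k ^ 4) * norm (sc_defect n z x) ^ 4"
      proof -
        have "sqrt 2 ^ 4 = (4::real)" by (simp add: power_numeral_reduce)
        then show ?thesis by (simp add: power_mult_distrib power_divide)
      qed
      finally show ?thesis .
    qed
    have i: "integrable ?M (\<lambda>x. norm (sc_defect n z x) ^ 4)"
    proof (rule integrable_bounded_scaled'[OF \<beta>])
      show "norm (sc_defect n z x) ^ 4 \<le> ((1 / Im z)\<^sup>2 + norm z * (1 / Im z) + 1) ^ 4" for x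
        by (intro power_mono norm_sc_defect_le z) auto
    qed auto
    have "(\<integral>x. norm (deviation n z x) ^ 4 \<partial>?M) \<le> (\<integral>x. (64 / ?k ^ 4) * norm (sc_defect n z x) ^ 4 \<partial>?M)"
      using pt i by (intro integral_mono_AE') auto
    also have "\<dots> = (64 / ?k ^ 4) * (\<integral>x. norm (sc_defect n z x) ^ 4 \<partial>?M)" by (rule integral_mult_right_zero)
    also have "\<dots> \<le> (64 / ?k ^ 4) * (C * (?k / (real n * Im z)) ^ 4)"
      using k0 by (intro mult_left_mono mom n z k) auto
    also have "\<dots> = (8 * sqrt C)\<^sup>2 / (real n * Im z) ^ 4"
      using k0 C by (simp add: power_mult_distrib power_divide)
    finally show ?thesis .
  qed
  have two: "(\<integral>x. norm (deviation n z x) ^ 2 \<partial>scaled_gbe \<beta> n) \<le> (8 * sqrt C) / (real n * Im z)\<^sup>2"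
    if n: "n \<ge> 1" and z: "\<bar>Re z\<bar> < 2" "Im z > 0" and k: "1 \<le> real n * Im z * norm (sc_root z)" for n z
  proof -
    let ?M = "scaled_gbe \<beta> n"
    interpret prob_space ?M by (rule prob_space_scaled_gbe[OF \<beta>])
    have i: "integrable ?M (\<lambda>x. norm (deviation n z x) ^ m)" for m
    proof (rule integrable_bounded_scaled'[OF \<beta>])
      show "norm (deviation n z x) ^ m \<le> (1 / Im z + norm (sc_stieltjes z)) ^ m" for x
        by (intro power_mono norm_deviation_bound z) auto
    qed auto
    have p4: "((norm w)\<^sup>2)\<^sup>2 = norm w ^ 4" for w :: complex by (simp add: power_mult[symmetric])
    \<comment> \<open>Nonnegativity of the variance of the squared norm is the Cauchy-Schwarz
      inequality between the second and the fourth moment.\<close>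
    have "0 \<le> variance (\<lambda>x. (norm (deviation n z x))\<^sup>2)" by (rule variance_positive)
    also have "\<dots> = expectation (\<lambda>x. norm (deviation n z x) ^ 4) - (expectation (\<lambda>x. (norm (deviation n z x))\<^sup>2))\<^sup>2"
      using i[of 2] i[of 4] by (subst variance_eq) (auto simp: p4)
    finally have "(expectation (\<lambda>x. (norm (deviation n z x))\<^sup>2))\<^sup>2 \<le> expectation (\<lambda>x. norm (deviation n z x) ^ 4)" by simp
    also have "\<dots> \<le> (8 * sqrt C)\<^sup>2 / (real n * Im z) ^ 4" by (rule four[OF that])
    also have "\<dots> = ((8 * sqrt C) / (real n * Im z)\<^sup>2)\<^sup>2" by (simp add: power_divide power_mult[symmetric])
    finally show ?thesis using C by (rule_tac power2_le_imp_le) (auto intro!: divide_nonneg_nonneg)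
  qed
  show ?thesis by (rule that[of "8 * sqrt C"]) (use C four two in auto)
qed

section \<open>Variance of smoothed counts\<close>

text \<open>Heights are integrated over a finite measure in its own right, so that bounded jointly
  measurable functions are integrable on the product with the ensemble.\<close>

definition lborel_Icc :: "real \<Rightarrow> real \<Rightarrow> real measure" where
  "lborel_Icc a b = restrict_space lborel {a..b}"

lemma space_lborel_Icc [simp]: "space (lborel_Icc a b) = {a..b}"
  by (simp add: lborel_Icc_def)

lemma finite_measure_lborel_Icc: "finite_measure (lborel_Icc a b)"
  by (rule finite_measureI) (simp add: lborel_Icc_def emeasure_restrict_space ennreal_mult_eq_top_iff emeasure_lborel_Icc_eq)

lemma measurable_lborel_Icc_continuous:
  fixes f :: "real \<Rightarrow> 'a::topological_space"
  assumes "continuous_on {a..b} f" shows "f \<in> borel_measurable (lborel_Icc a b)"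
  using borel_measurable_continuous_on_restrict[OF assms]
  by (simp add: lborel_Icc_def measurable_def space_restrict_space sets_restrict_space)

lemma integrable_lborel_Icc_continuous:
  fixes f :: "real \<Rightarrow> 'a::{banach, second_countable_topology}"
  assumes "continuous_on {a..b} f" shows "integrable (lborel_Icc a b) f"
proof -
  interpret finite_measure "lborel_Icc a b" by (rule finite_measure_lborel_Icc)
  have "bounded (f ` {a..b})"
    by (intro compact_imp_bounded compact_continuous_image assms compact_Icc)
  then obtain B where "\<And>t. t \<in> {a..b} \<Longrightarrow> norm (f t) \<le> B" unfolding bounded_iff by blast
  then show ?thesis
    using measurable_lborel_Icc_continuous[OF assms] by (intro integrable_const_bound[of _ B] AE_I2) auto
qed

lemma integral_lborel_Icc_FTC:
  fixes f F :: "real \<Rightarrow> real"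
  assumes "a \<le> b" "\<And>t. t \<in> {a..b} \<Longrightarrow> (F has_real_derivative f t) (at t)" "continuous_on {a..b} f"
  shows "(\<integral>t. f t \<partial>lborel_Icc a b) = F b - F a"
proof -
  have "(\<integral>t. f t \<partial>lborel_Icc a b) = (\<integral>t. indicator {a..b} t *\<^sub>R f t \<partial>lborel)"
    unfolding lborel_Icc_def by (rule integral_restrict_space) simp
  also have "\<dots> = F b - F a"
    using assms by (intro integral_FTC_Icc)
      (auto simp: has_real_derivative_iff_has_vector_derivative intro: has_vector_derivative_at_within)
  finally show ?thesis .
qed

section \<open>Integrals along vertical lines\<close>

lemma has_field_derivative_empirical:
  assumes "Im z > 0"
  shows "((\<lambda>z. empirical_stieltjes n z x) has_field_derivative empirical_stieltjes' n z x) (at z)"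
proof -
  have nz: "complex_of_real (x j) - z \<noteq> 0" for j by (rule real_minus_nonreal[OF assms])
  have "((\<lambda>z. 1 / (of_real (x j) - z)) has_field_derivative 1 / (of_real (x j) - z)\<^sup>2) (at z)" for j
    using nz[of j] by (auto intro!: derivative_eq_intros simp: power2_eq_square)
  then show ?thesis
    unfolding empirical_stieltjes_def[abs_def] empirical_stieltjes'_def
    by (intro DERIV_cdivide DERIV_sum)
qed

lemma continuous_on_vertical:
  assumes "\<And>t. t \<in> {a..b} \<Longrightarrow> (f has_field_derivative g t) (at (Complex E t))"
  shows "continuous_on {a..b} (\<lambda>t. f (Complex E t))"
proof (rule continuous_at_imp_continuous_on, rule ballI)
  fix t assume "t \<in> {a..b}"
  from has_vector_derivative_vertical[OF assms[OF this]]
  show "isCont (\<lambda>t. f (Complex E t)) t" by (rule has_vector_derivative_continuous)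
qed

lemma continuous_vertical_sc_root:
  "\<bar>E\<bar> < 2 \<Longrightarrow> continuous_on {a..b} (\<lambda>t. sc_root (Complex E t))"
  by (rule continuous_on_vertical, rule has_field_derivative_sc_root) auto

lemma continuous_vertical_Complex: "continuous_on S (\<lambda>t. Complex E t)"
  unfolding Complex_eq by (intro continuous_intros)

lemma continuous_vertical_sc_stieltjes:
  "\<bar>E\<bar> < 2 \<Longrightarrow> continuous_on {a..b} (\<lambda>t. sc_stieltjes (Complex E t))"
  unfolding sc_stieltjes_def by (intro continuous_intros continuous_vertical_sc_root continuous_vertical_Complex) auto

lemma continuous_vertical_empirical:
  "a > 0 \<Longrightarrow> continuous_on {a..b} (\<lambda>t. empirical_stieltjes n (Complex E t) x)"
  by (rule continuous_on_vertical, rule has_field_derivative_empirical) auto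

lemma continuous_vertical_empirical':
  assumes "a > 0" shows "continuous_on {a..b} (\<lambda>t. empirical_stieltjes' n (Complex E t) x)"
proof -
  have "complex_of_real (x j) - Complex E t \<noteq> 0" if "t \<in> {a..b}" for t j
    using that assms by (intro real_minus_nonreal) auto
  then show ?thesis unfolding empirical_stieltjes'_def divide_inverse[of _ "of_nat n"]
    by (intro continuous_intros continuous_vertical_Complex) auto
qed

lemma continuous_vertical_deviation:
  "\<bar>E\<bar> < 2 \<Longrightarrow> a > 0 \<Longrightarrow> continuous_on {a..b} (\<lambda>t. deviation n (Complex E t) x)"
  unfolding deviation_def by (intro continuous_intros continuous_vertical_empirical continuous_vertical_sc_stieltjes)

text \<open>
  Dividing by \<open>2 s + z\<close> instead of \<open>sc_root z\<close> turns the integrand into a logarithmic derivative,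
  whose integral is bounded whatever the configuration.
\<close>
lemma integral_empirical'_over_root:
  assumes E: "\<bar>E\<bar> < 2" and a: "0 < a" "a \<le> b" and n: "n \<ge> 1"
  shows "\<bar>\<integral>t. Re (empirical_stieltjes' n (Complex E t) x / sc_root (Complex E t)) \<partial>lborel_Icc a b\<bar>
    \<le> 2 * pi + (\<integral>t. 2 * norm (deviation n (Complex E t) x) / (norm (sc_root (Complex E t)) * t) \<partial>lborel_Icc a b)"
proof -
  define s where "s t = empirical_stieltjes n (Complex E t) x" for t
  define s' where "s' t = empirical_stieltjes' n (Complex E t) x" for t
  define k where "k t = sc_root (Complex E t)" for t
  define w where "w t = 2 * s t + Complex E t" for t
  define d where "d t = deviation n (Complex E t) x" for t
  have k0: "k t \<noteq> 0" for t unfolding k_def using E by (intro sc_root_nonzero) auto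
  have w_Im: "Im (w t) \<ge> t" "t \<in> {a..b} \<Longrightarrow> Im (w t) > 0" if "t \<ge> a" for t
    using Im_empirical_nonneg[of "Complex E t" n x] that a by (auto simp: w_def s_def)
  have w0: "w t \<noteq> 0" if "t \<in> {a..b}" for t using w_Im[of t] that by auto
  have wk: "w t = k t + 2 * d t" for t
    by (simp add: w_def k_def d_def deviation_def s_def sc_stieltjes_def field_simps)
  have cont: "continuous_on {a..b} s" "continuous_on {a..b} s'" "continuous_on {a..b} k" "continuous_on {a..b} w" "continuous_on {a..b} d"
    unfolding s_def s'_def k_def w_def d_def using a E
    by (auto intro!: continuous_intros continuous_vertical_empirical continuous_vertical_empirical' continuous_vertical_sc_root
        continuous_vertical_Complex continuous_vertical_deviation)
  \<comment> \<open>Half the difference of the logarithmic derivatives of w = 2 s + z and of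
    \<open>sc_log\<close> is split off. Since w = k + 2 d, the remainder is (2 s' + 1) d / (k w),
    which carries the small factor d.\<close>
  define e where "e t = Re (s' t / k t) - (Re ((2 * s' t + 1) / w t) - Re (1 / k t)) / 2" for t
  have e_bound: "\<bar>e t\<bar> \<le> 2 * norm (d t) / (norm (k t) * t)" if t: "t \<in> {a..b}" for t
  proof -
    have t0: "t > 0" using t a by auto
    have nw: "norm (w t) > 0" and nk: "norm (k t) > 0" using w0[OF t] k0 by auto
    have nwt: "norm (w t) \<ge> t" using w_Im(1)[of t] t abs_Im_le_cmod[of "w t"] by auto
    have "s' t / k t - ((2 * s' t + 1) / w t - 1 / k t) / 2 = (2 * s' t + 1) * d t / (k t * w t)"
    proof -
      have "s' t / k t - ((2 * s' t + 1) / w t - 1 / k t) / 2 = (2 * s' t + 1) / 2 * (1 / k t - 1 / w t)"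
      proof -
        have "S * p - ((2 * S + 1) * q - p) / 2 = (2 * S + 1) / 2 * (p - q)" for S p q :: complex
          by (simp add: field_simps)
        from this[of "s' t" "1 / k t" "1 / w t"] show ?thesis by simp
      qed
      also have "1 / k t - 1 / w t = 2 * d t / (k t * w t)"
        using w0[OF t] k0[of t] by (subst diff_frac_eq) (simp_all add: wk)
      finally show ?thesis by simp
    qed
    moreover have "e t = Re (s' t / k t - ((2 * s' t + 1) / w t - 1 / k t) / 2)" by (simp add: e_def)
    ultimately have "\<bar>e t\<bar> \<le> norm ((2 * s' t + 1) * d t / (k t * w t))" by (metis abs_Re_le_cmod)
    also have "\<dots> = norm (2 * s' t + 1) / norm (w t) * (norm (d t) / norm (k t))"
      by (simp add: norm_mult norm_divide)
    also have "\<dots> \<le> 2 / t * (norm (d t) / norm (k t))"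
    proof (intro mult_right_mono)
      \<comment> \<open>The Ward identity and Im (2 s + z) >= 2 Im s make (2 s' + 1) / w of order 1
        / t for every configuration.\<close>
      have "norm (s' t) \<le> Im (s t) / t" unfolding s'_def s_def using norm_empirical'_le_Im[of "Complex E t" n x] t0 n by simp
      also have "\<dots> \<le> norm (w t) / 2 / t"
        using Im_empirical_le_discriminant[of "Complex E t" n x] t0 unfolding s_def w_def by (intro divide_right_mono) auto
      finally have "2 * norm (s' t) \<le> norm (w t) / t" by simp
      moreover have "1 \<le> norm (w t) / t" using nwt t0 by simp
      moreover have "norm (2 * s' t + 1) \<le> 2 * norm (s' t) + 1" using norm_triangle_ineq[of "2 * s' t" 1] by (simp add: norm_mult)
      ultimately have "norm (2 * s' t + 1) \<le> 2 / t * norm (w t)" by simp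
      then show "norm (2 * s' t + 1) / norm (w t) \<le> 2 / t" using nw by (simp add: pos_divide_le_eq)
    qed auto
    finally show ?thesis by (simp add: field_simps)
  qed
  have e_cont: "continuous_on {a..b} e"
    unfolding e_def using cont k0 w0 by (intro continuous_intros) auto
  have I1: "(\<integral>t. Re ((2 * s' t + 1) / w t) \<partial>lborel_Icc a b) = Im (Ln (w b)) - Im (Ln (w a))"
  proof (rule integral_lborel_Icc_FTC[OF a(2), where F = "\<lambda>t. Im (Ln (w t))"])
    fix t assume t: "t \<in> {a..b}"
    have wn: "2 * empirical_stieltjes n (Complex E t) x + Complex E t \<notin> \<real>\<^sub>\<le>\<^sub>0"
      using w_Im[of t] t by (auto simp: w_def s_def complex_nonpos_Reals_iff)
    have "((\<lambda>z. 2 * empirical_stieltjes n z x + z) has_field_derivative 2 * s' t + 1) (at (Complex E t))"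
      unfolding s'_def using t a by (intro DERIV_add DERIV_cmult has_field_derivative_empirical DERIV_ident) auto
    from DERIV_chain2[OF has_field_derivative_Ln[OF wn] this]
    have "((\<lambda>z. Ln (2 * empirical_stieltjes n z x + z)) has_field_derivative (2 * s' t + 1) / w t) (at (Complex E t))"
      by (simp add: w_def s_def divide_inverse mult.commute)
    from has_real_derivative_Im_vertical[OF this]
    show "((\<lambda>t. Im (Ln (w t))) has_real_derivative Re ((2 * s' t + 1) / w t)) (at t)"
      by (simp add: w_def s_def)
  qed (use cont w0 in \<open>auto intro!: continuous_intros\<close>)
  have I2: "(\<integral>t. Re (1 / k t) \<partial>lborel_Icc a b) = Im (sc_log (Complex E b)) - Im (sc_log (Complex E a))"
  proof (rule integral_lborel_Icc_FTC[OF a(2), where F = "\<lambda>t. Im (sc_log (Complex E t))"])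
    fix t assume t: "t \<in> {a..b}"
    show "((\<lambda>t. Im (sc_log (Complex E t))) has_real_derivative Re (1 / k t)) (at t)"
      unfolding k_def using t a E by (intro has_real_derivative_Im_vertical has_field_derivative_sc_log) auto
  qed (use cont k0 in \<open>auto intro!: continuous_intros\<close>)
  \<comment> \<open>w stays in the upper half-plane, so both arguments lie in (0, pi). This bound
    holds for every configuration.\<close>
  have b1: "\<bar>Im (Ln (w b)) - Im (Ln (w a))\<bar> \<le> pi"
    using Im_Ln_pos_lt_imp[of "w a"] Im_Ln_pos_lt_imp[of "w b"] w_Im[of a] w_Im[of b] a by (auto simp: abs_le_iff)
  have b2: "\<bar>Im (sc_log (Complex E b)) - Im (sc_log (Complex E a))\<bar> \<le> 2 * pi"
  proof -
    have "\<bar>Im (sc_log (Complex E t))\<bar> \<le> pi" if "t \<ge> a" for t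
    proof -
      have nz: "csqrt (4 - (Complex E t)\<^sup>2) - \<i> * Complex E t \<noteq> 0"
        using csqrt_minus_iz_notin(2)[of "Complex E t"] that a E by auto
      show ?thesis unfolding sc_log_def using mpi_less_Im_Ln[OF nz] Im_Ln_le_pi[OF nz] by linarith
    qed
    from this[of a] this[of b] a show ?thesis by linarith
  qed
  have ints: "integrable (lborel_Icc a b) (\<lambda>t. Re ((2 * s' t + 1) / w t))" "integrable (lborel_Icc a b) (\<lambda>t. Re (1 / k t))"
     "integrable (lborel_Icc a b) e"
     "integrable (lborel_Icc a b) (\<lambda>t. 2 * norm (d t) / (norm (k t) * t))"
    using cont w0 k0 a e_cont by (auto intro!: integrable_lborel_Icc_continuous continuous_intros)
  have "(\<integral>t. Re (s' t / k t) \<partial>lborel_Icc a b) = (\<integral>t. e t + (Re ((2 * s' t + 1) / w t) - Re (1 / k t)) / 2 \<partial>lborel_Icc a b)"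
    by (simp add: e_def)
  also have "\<dots> = (\<integral>t. e t \<partial>lborel_Icc a b) + ((\<integral>t. Re ((2 * s' t + 1) / w t) \<partial>lborel_Icc a b) - (\<integral>t. Re (1 / k t) \<partial>lborel_Icc a b)) / 2"
    using ints by (simp only: Bochner_Integration.integral_add Bochner_Integration.integral_diff
        Bochner_Integration.integrable_diff integrable_divide_zero integral_divide_zero)
  finally have eq: "(\<integral>t. Re (s' t / k t) \<partial>lborel_Icc a b) = (\<integral>t. e t \<partial>lborel_Icc a b) +
     ((\<integral>t. Re ((2 * s' t + 1) / w t) \<partial>lborel_Icc a b) - (\<integral>t. Re (1 / k t) \<partial>lborel_Icc a b)) / 2" .
  have "\<bar>\<integral>t. Re (s' t / k t) \<partial>lborel_Icc a b\<bar> \<le> \<bar>\<integral>t. e t \<partial>lborel_Icc a b\<bar> + 2 * pi"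
  proof -
    have "\<bar>X + (p - q) / 2\<bar> \<le> \<bar>X\<bar> + 2 * c" if "\<bar>p\<bar> \<le> c" "\<bar>q\<bar> \<le> 2 * c" "0 < c" for X p q c :: real
    proof -
      have "\<bar>(p - q) / 2\<bar> \<le> 2 * c" using that unfolding abs_le_iff by (auto simp: field_simps)
      then show ?thesis using abs_triangle_ineq[of X "(p - q) / 2"] by linarith
    qed
    from this[OF b1 b2 pi_gt_zero] show ?thesis
      unfolding eq I1 I2 .
  qed
  moreover have "\<bar>\<integral>t. e t \<partial>lborel_Icc a b\<bar> \<le> (\<integral>t. 2 * norm (d t) / (norm (k t) * t) \<partial>lborel_Icc a b)"
  proof -
    have "\<bar>\<integral>t. e t \<partial>lborel_Icc a b\<bar> \<le> (\<integral>t. \<bar>e t\<bar> \<partial>lborel_Icc a b)" by (rule integral_abs_bound)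
    also have "\<dots> \<le> (\<integral>t. 2 * norm (d t) / (norm (k t) * t) \<partial>lborel_Icc a b)"
      using ints e_bound by (intro integral_mono) auto
    finally show ?thesis .
  qed
  ultimately show ?thesis by (simp add: s'_def k_def d_def)
qed

section \<open>Fubini and second moments of vertical integrals\<close>

lemma component_measurable_compose:
  assumes "X \<in> N \<rightarrow>\<^sub>M lebesgue_Rn n" "j < n" shows "(\<lambda>p. X p j) \<in> borel_measurable N"
  by (rule measurable_compose[OF assms(1) component_measurable_Rn[OF assms(2)]])

lemma empirical_measurable_compose:
  assumes "X \<in> N \<rightarrow>\<^sub>M lebesgue_Rn n" "Z \<in> borel_measurable N"
  shows "(\<lambda>p. empirical_stieltjes n (Z p) (X p)) \<in> borel_measurable N"
    "(\<lambda>p. empirical_stieltjes' n (Z p) (X p)) \<in> borel_measurable N"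
proof -
  note [measurable] = assms(2)
  have c: "(\<lambda>p. complex_of_real (X p j)) \<in> borel_measurable N" if "j < n" for j
    using component_measurable_compose[OF assms(1) that] by measurable
  show "(\<lambda>p. empirical_stieltjes n (Z p) (X p)) \<in> borel_measurable N"
    unfolding empirical_stieltjes_def using c assms(2)
    by (intro borel_measurable_divide borel_measurable_sum borel_measurable_diff borel_measurable_const) auto
  show "(\<lambda>p. empirical_stieltjes' n (Z p) (X p)) \<in> borel_measurable N"
    unfolding empirical_stieltjes'_def using c assms(2)
    by (intro borel_measurable_divide borel_measurable_sum borel_measurable_power borel_measurable_diff borel_measurable_const) auto
qed

context
  fixes \<beta> :: real and n :: nat and a b :: real
  assumes \<beta>: "\<beta> > 0"
begin

lemma Fubini_scaled:
  fixes f :: "(nat \<Rightarrow> real) \<Rightarrow> real \<Rightarrow> real"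
  assumes f: "(\<lambda>p. f (fst p) (snd p)) \<in> borel_measurable (scaled_gbe \<beta> n \<Otimes>\<^sub>M lborel_Icc a b)"
    and C: "\<And>x t. t \<in> {a..b} \<Longrightarrow> \<bar>f x t\<bar> \<le> C"
  shows "integrable (scaled_gbe \<beta> n) (\<lambda>x. \<integral>t. f x t \<partial>lborel_Icc a b)"
    and "integrable (lborel_Icc a b) (\<lambda>t. \<integral>x. f x t \<partial>scaled_gbe \<beta> n)"
    and "(\<integral>x. (\<integral>t. f x t \<partial>lborel_Icc a b) \<partial>scaled_gbe \<beta> n) = (\<integral>t. (\<integral>x. f x t \<partial>scaled_gbe \<beta> n) \<partial>lborel_Icc a b)"
proof -
  interpret M: prob_space "scaled_gbe \<beta> n" by (rule prob_space_scaled_gbe[OF \<beta>])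
  interpret L: finite_measure "lborel_Icc a b" by (rule finite_measure_lborel_Icc)
  interpret P: pair_sigma_finite "scaled_gbe \<beta> n" "lborel_Icc a b" ..
  interpret F: finite_measure "scaled_gbe \<beta> n \<Otimes>\<^sub>M lborel_Icc a b"
    by (rule finite_measure_pair_measure) unfold_locales
  have "integrable (scaled_gbe \<beta> n \<Otimes>\<^sub>M lborel_Icc a b) (\<lambda>p. f (fst p) (snd p))"
    using f C by (intro F.integrable_const_bound[of _ C] AE_I2) (auto simp: space_pair_measure)
  then have i: "integrable (scaled_gbe \<beta> n \<Otimes>\<^sub>M lborel_Icc a b) (case_prod f)"
    by (simp add: case_prod_beta')
  show "integrable (scaled_gbe \<beta> n) (\<lambda>x. \<integral>t. f x t \<partial>lborel_Icc a b)" by (rule P.integrable_fst[OF i])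
  show "integrable (lborel_Icc a b) (\<lambda>t. \<integral>x. f x t \<partial>scaled_gbe \<beta> n)" by (rule P.integrable_snd[OF i])
  show "(\<integral>x. (\<integral>t. f x t \<partial>lborel_Icc a b) \<partial>scaled_gbe \<beta> n) = (\<integral>t. (\<integral>x. f x t \<partial>scaled_gbe \<beta> n) \<partial>lborel_Icc a b)"
    by (rule P.Fubini_integral[OF i, symmetric])
qed

lemma fst_measurable_scaled: "fst \<in> scaled_gbe \<beta> n \<Otimes>\<^sub>M lborel_Icc a b \<rightarrow>\<^sub>M lebesgue_Rn n"
  using measurable_fst[of "scaled_gbe \<beta> n" "lborel_Icc a b"]
  by (simp add: measurable_cong_sets[OF refl sets_scaled_gbe])

lemma snd_measurable_scaled:
  fixes g :: "real \<Rightarrow> 'b::topological_space"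
  assumes "continuous_on {a..b} g"
  shows "(\<lambda>p. g (snd p)) \<in> borel_measurable (scaled_gbe \<beta> n \<Otimes>\<^sub>M lborel_Icc a b)"
  by (rule measurable_compose[OF measurable_snd measurable_lborel_Icc_continuous[OF assms]])

lemma empirical_measurable_scaled:
  "(\<lambda>p. empirical_stieltjes n (Complex E (snd p)) (fst p)) \<in> borel_measurable (scaled_gbe \<beta> n \<Otimes>\<^sub>M lborel_Icc a b)"
  "(\<lambda>p. empirical_stieltjes' n (Complex E (snd p)) (fst p)) \<in> borel_measurable (scaled_gbe \<beta> n \<Otimes>\<^sub>M lborel_Icc a b)"
  by (intro empirical_measurable_compose fst_measurable_scaled snd_measurable_scaled continuous_vertical_Complex)+

lemma deviation_measurable_scaled:
  assumes "\<bar>E\<bar> < 2"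
  shows "(\<lambda>p. deviation n (Complex E (snd p)) (fst p)) \<in> borel_measurable (scaled_gbe \<beta> n \<Otimes>\<^sub>M lborel_Icc a b)"
  unfolding deviation_def
  by (intro borel_measurable_diff empirical_measurable_scaled snd_measurable_scaled continuous_vertical_sc_stieltjes assms)

lemma inverse_square_integral:
  assumes "0 < a" "a \<le> b" shows "(\<integral>t. 1 / t\<^sup>2 \<partial>lborel_Icc a b) \<le> 1 / a"
    "integrable (lborel_Icc a b) (\<lambda>t. 1 / t\<^sup>2)"
proof -
  have c: "continuous_on {a..b} (\<lambda>t. 1 / t\<^sup>2)" using assms by (intro continuous_intros) auto
  have "(\<integral>t. 1 / t\<^sup>2 \<partial>lborel_Icc a b) = - 1 / b - (- 1 / a)"
    by (rule integral_lborel_Icc_FTC[OF assms(2) _ c])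
      (use assms in \<open>auto intro!: derivative_eq_intros simp: power2_eq_square\<close>)
  then show "(\<integral>t. 1 / t\<^sup>2 \<partial>lborel_Icc a b) \<le> 1 / a" using assms by simp
  show "integrable (lborel_Icc a b) (\<lambda>t. 1 / t\<^sup>2)" by (rule integrable_lborel_Icc_continuous[OF c])
qed

text \<open>Cauchy-Schwarz with weight t^2: the square of the integral is at most 1 / a times the
  integral of t^2 u^2. After Fubini the moment bound leaves B / t^2, which integrates to a second
  factor 1 / a.\<close>

lemma second_moment_integral:
  fixes u :: "(nat \<Rightarrow> real) \<Rightarrow> real \<Rightarrow> real"
  assumes ab: "0 < a" "a \<le> b"
    and u: "(\<lambda>p. u (fst p) (snd p)) \<in> borel_measurable (scaled_gbe \<beta> n \<Otimes>\<^sub>M lborel_Icc a b)"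
    and C: "\<And>x t. t \<in> {a..b} \<Longrightarrow> u x t \<le> C" and u0: "\<And>x t. t \<in> {a..b} \<Longrightarrow> 0 \<le> u x t"
    and cont: "\<And>x. continuous_on {a..b} (u x)"
    and B: "\<And>t. t \<in> {a..b} \<Longrightarrow> (\<integral>x. (u x t)\<^sup>2 \<partial>scaled_gbe \<beta> n) \<le> B / t ^ 4" "B \<ge> 0"
  shows "(\<integral>x. (\<integral>t. u x t \<partial>lborel_Icc a b)\<^sup>2 \<partial>scaled_gbe \<beta> n) \<le> B / a\<^sup>2"
    "integrable (scaled_gbe \<beta> n) (\<lambda>x. (\<integral>t. u x t \<partial>lborel_Icc a b)\<^sup>2)"
proof -
  let ?M = "scaled_gbe \<beta> n" and ?L = "lborel_Icc a b"
  interpret M: prob_space ?M by (rule prob_space_scaled_gbe[OF \<beta>])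
  interpret L: finite_measure ?L by (rule finite_measure_lborel_Icc)
  define W where "W x = (\<integral>t. t\<^sup>2 * (u x t)\<^sup>2 \<partial>?L)" for x
  define V where "V x = (\<integral>t. u x t \<partial>?L)" for x
  have i1: "integrable ?L (u x)" for x by (rule integrable_lborel_Icc_continuous[OF cont])
  have i2: "integrable ?L (\<lambda>t. t\<^sup>2 * (u x t)\<^sup>2)" for x
    by (intro integrable_lborel_Icc_continuous continuous_intros cont)
  have V0: "V x \<ge> 0" for x unfolding V_def using u0 by (intro integral_nonneg_AE AE_I2) auto
  have VW: "(V x)\<^sup>2 \<le> W x / a" for x
  proof (cases "V x = 0")
    case True
    have "W x \<ge> 0" unfolding W_def by (intro integral_nonneg_AE AE_I2) auto
    then show ?thesis using True ab by simp
  next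
    case False
    then have V: "V x > 0" using V0[of x] by simp
    \<comment> \<open>Cauchy-Schwarz is done as a weighted arithmetic-geometric inequality; this
      weight makes its first term V / 2, to be absorbed on the left.\<close>
    define e where "e = a * V x"
    have e: "e > 0" using V ab by (simp add: e_def)
    have "V x \<le> (\<integral>t. (e * (1 / t\<^sup>2) + (t\<^sup>2 * (u x t)\<^sup>2) / e) / 2 \<partial>?L)"
      unfolding V_def
    proof (rule integral_mono[OF i1])
      show "integrable ?L (\<lambda>t. (e * (1 / t\<^sup>2) + (t\<^sup>2 * (u x t)\<^sup>2) / e) / 2)"
        using i2[of x] inverse_square_integral(2)[OF ab] by (intro integrable_divide Bochner_Integration.integrable_add integrable_mult_right)
      fix t assume "t \<in> space ?L"
      then have t: "t > 0" using ab by auto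
      have "0 \<le> (e / t - t * u x t)\<^sup>2 / (2 * e)" using e by simp
      also have "\<dots> = (e * (1 / t\<^sup>2) + (t\<^sup>2 * (u x t)\<^sup>2) / e) / 2 - u x t"
        using e t by (simp add: power2_eq_square field_simps)
      finally show "u x t \<le> (e * (1 / t\<^sup>2) + (t\<^sup>2 * (u x t)\<^sup>2) / e) / 2" by simp
    qed
    also have "\<dots> = (e * (\<integral>t. 1 / t\<^sup>2 \<partial>?L) + W x / e) / 2"
      unfolding W_def using i2[of x] inverse_square_integral(2)[OF ab]
      by (simp only: integral_divide_zero Bochner_Integration.integral_add integrable_mult_right integrable_divide integral_mult_right_zero)
    also have "\<dots> \<le> (e * (1 / a) + W x / e) / 2"
      using inverse_square_integral(1)[OF ab] e by (intro divide_right_mono add_right_mono mult_left_mono) auto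
    also have "\<dots> = (V x + W x / (a * V x)) / 2" using ab by (simp add: e_def)
    finally have "V x \<le> W x / (a * V x)" by simp
    then show ?thesis using V ab by (simp add: field_simps power2_eq_square)
  qed
  have C0: "0 \<le> u x t \<and> u x t \<le> \<bar>C\<bar>" if "t \<in> {a..b}" for x t using C[OF that, of x] u0[OF that, of x] by auto
  have W_f: "(\<lambda>p. (snd p)\<^sup>2 * (u (fst p) (snd p))\<^sup>2) \<in> borel_measurable (?M \<Otimes>\<^sub>M ?L)"
    using u by (intro borel_measurable_times borel_measurable_power snd_measurable_scaled[of "\<lambda>t. t"] continuous_intros)
  have W_b: "\<bar>t\<^sup>2 * (u x t)\<^sup>2\<bar> \<le> b\<^sup>2 * \<bar>C\<bar>\<^sup>2" if "t \<in> {a..b}" for x t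
  proof -
    have "(u x t)\<^sup>2 \<le> \<bar>C\<bar>\<^sup>2" by (rule power_mono) (use C0[OF that, of x] in auto)
    moreover have "t\<^sup>2 \<le> b\<^sup>2" by (rule power_mono) (use that ab in auto)
    ultimately have "t\<^sup>2 * (u x t)\<^sup>2 \<le> b\<^sup>2 * \<bar>C\<bar>\<^sup>2" by (intro mult_mono) auto
    then show ?thesis by (simp add: abs_mult)
  qed
  have u_b: "\<bar>u x t\<bar> \<le> \<bar>C\<bar>" if "t \<in> {a..b}" for x t using C0[OF that, of x] by auto
  note FW = Fubini_scaled[OF W_f W_b, folded W_def]
  note FV = Fubini_scaled[OF u u_b, folded V_def]
  have V_meas: "V \<in> borel_measurable ?M" using FV(1) by (rule borel_measurable_integrable)
  have W_int: "integrable ?M (\<lambda>x. W x / a)" using FW(1) by (rule integrable_divide)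
  have V_int: "integrable ?M (\<lambda>x. (V x)\<^sup>2)"
  proof (rule Bochner_Integration.integrable_bound[OF W_int])
    have "norm ((V x)\<^sup>2) \<le> norm (W x / a)" for x
      unfolding real_norm_def using VW[of x] zero_le_power2[of "V x"] by linarith
    then show "AE x in ?M. norm ((V x)\<^sup>2) \<le> norm (W x / a)" by simp
  qed (use V_meas in simp)
  show "integrable ?M (\<lambda>x. (\<integral>t. u x t \<partial>?L)\<^sup>2)" using V_int by (simp add: V_def)
  have "(\<integral>x. (V x)\<^sup>2 \<partial>?M) \<le> (\<integral>x. W x / a \<partial>?M)"
    using V_int W_int VW by (intro integral_mono) auto
  also have "\<dots> = (\<integral>t. (\<integral>x. t\<^sup>2 * (u x t)\<^sup>2 \<partial>?M) \<partial>?L) / a" using FW(3) by simp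
  also have "\<dots> \<le> (\<integral>t. B * (1 / t\<^sup>2) \<partial>?L) / a"
  proof (intro divide_right_mono integral_mono)
    show "integrable ?L (\<lambda>t. \<integral>x. t\<^sup>2 * (u x t)\<^sup>2 \<partial>?M)" by (rule FW(2))
    show "integrable ?L (\<lambda>t. B * (1 / t\<^sup>2))" using inverse_square_integral(2)[OF ab] by (rule integrable_mult_right)
    fix t assume "t \<in> space ?L"
    then have t: "t \<in> {a..b}" "t > 0" using ab by auto
    have "t\<^sup>2 * (\<integral>x. (u x t)\<^sup>2 \<partial>?M) \<le> t\<^sup>2 * (B / t ^ 4)" by (intro mult_left_mono B t) auto
    also have "\<dots> = B * (1 / t\<^sup>2)" using t by (simp add: power_numeral_reduce)
    finally show "(\<integral>x. t\<^sup>2 * (u x t)\<^sup>2 \<partial>?M) \<le> B * (1 / t\<^sup>2)" by simp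
  qed (use ab in auto)
  also have "\<dots> = B * (\<integral>t. 1 / t\<^sup>2 \<partial>?L) / a" by (simp only: integral_mult_right_zero)
  also have "\<dots> \<le> B * (1 / a) / a"
    using inverse_square_integral(1)[OF ab] ab B by (intro divide_right_mono mult_left_mono) auto
  finally show "(\<integral>x. (\<integral>t. u x t \<partial>?L)\<^sup>2 \<partial>?M) \<le> B / a\<^sup>2"
    by (simp add: V_def power2_eq_square)
qed

end

section \<open>Smoothed counts truncated at height b: main term and remainder\<close>

definition angle :: "nat \<Rightarrow> real \<Rightarrow> real \<Rightarrow> real \<Rightarrow> (nat \<Rightarrow> real) \<Rightarrow> real" where
  "angle n E a b x = (\<Sum>j<n. arctan ((x j - E) / a) - arctan ((x j - E) / b))
     - real n * (Im (sc_primitive (Complex E b)) - Im (sc_primitive (Complex E a)))"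

lemma Re_resolvent: "t > 0 \<Longrightarrow> Re (1 / (of_real y - Complex E t)) = (y - E) / ((y - E)\<^sup>2 + t\<^sup>2)"
  by (simp add: Re_divide)

lemma Im_resolvent': "t > 0 \<Longrightarrow> Im (1 / (of_real y - Complex E t)) = t / ((y - E)\<^sup>2 + t\<^sup>2)"
  by (simp add: Im_divide)

lemma square_sum_pos: "(t::real) > 0 \<Longrightarrow> y\<^sup>2 + t\<^sup>2 > 0"
  by (simp add: add_nonneg_pos)

text \<open>The height derivative of - arctan ((x - E) / t) is the real part of the resolvent at E +
  i t, and that of Im \<open>sc_primitive\<close> is Re \<open>sc_stieltjes\<close>.\<close>

lemma angle_eq_integral:
  assumes E: "\<bar>E\<bar> < 2" and ab: "0 < a" "a \<le> b"
  shows "angle n E a b x = (\<integral>t. real n * Re (deviation n (Complex E t) x) \<partial>lborel_Icc a b)"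
proof -
  define F where "F t = - (\<Sum>j<n. arctan ((x j - E) / t)) - real n * Im (sc_primitive (Complex E t))" for t
  have "(\<integral>t. real n * Re (deviation n (Complex E t) x) \<partial>lborel_Icc a b) = F b - F a"
  proof (rule integral_lborel_Icc_FTC[OF ab(2)])
    fix t assume "t \<in> {a..b}"
    then have t: "t > 0" using ab by auto
    have 1: "((\<lambda>t. arctan (y / t)) has_real_derivative - (y / (y\<^sup>2 + t\<^sup>2))) (at t)" for y
    proof -
      have "1 + (y / t)\<^sup>2 = (y\<^sup>2 + t\<^sup>2) / t\<^sup>2" using t by (simp add: field_simps)
      then show ?thesis using t square_sum_pos[OF t, of y]
        by (auto intro!: derivative_eq_intros simp: power2_eq_square)
    qed
    have 2: "((\<lambda>t. Im (sc_primitive (Complex E t))) has_real_derivative Re (sc_stieltjes (Complex E t))) (at t)"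
      using E t by (intro has_real_derivative_Im_vertical has_field_derivative_sc_primitive) auto
    have "(F has_real_derivative - (\<Sum>j<n. - ((x j - E) / ((x j - E)\<^sup>2 + t\<^sup>2))) - real n * Re (sc_stieltjes (Complex E t))) (at t)"
      unfolding F_def by (intro DERIV_diff DERIV_minus DERIV_sum DERIV_cmult 1 2)
    moreover have "- (\<Sum>j<n. - ((x j - E) / ((x j - E)\<^sup>2 + t\<^sup>2))) = real n * Re (empirical_stieltjes n (Complex E t) x)"
      using t by (cases "n = 0") (simp_all add: empirical_stieltjes_def Re_resolvent sum_negf)
    ultimately show "(F has_real_derivative real n * Re (deviation n (Complex E t) x)) (at t)"
      by (simp add: deviation_def right_diff_distrib)
  qed (use E ab in \<open>auto intro!: continuous_intros continuous_vertical_deviation\<close>)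
  then show ?thesis by (simp add: F_def angle_def sum_subtractf algebra_simps)
qed

text \<open>The gradient in one point is a difference of two Poisson kernels, so its size is again
  controlled by Im s.\<close>

lemma smooth_statistic_angle:
  assumes ab: "0 < a" "0 < b"
  shows "smooth_statistic n (\<lambda>x. of_real (angle n E a b x))
    (\<lambda>j x. of_real (Im (1 / (of_real (x j) - Complex E a)) - Im (1 / (of_real (x j) - Complex E b))))"
proof -
  define K where "K = real n * (Im (sc_primitive (Complex E b)) - Im (sc_primitive (Complex E a)))"
  have "smooth_statistic n (\<lambda>x. \<Sum>j<n. of_real (arctan ((x j - E) / a) - arctan ((x j - E) / b)))
    (\<lambda>j x. of_real (Im (1 / (of_real (x j) - Complex E a)) - Im (1 / (of_real (x j) - Complex E b))))"
  proof (rule smooth_statistic_linear[where A = pi and B = "1 / a + 1 / b"])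
    fix t :: real
    have d: "((\<lambda>t. arctan ((t - E) / c)) has_real_derivative Im (1 / (of_real t - Complex E c))) (at t)" if c: "c > 0" for c
    proof -
      have "1 + ((t - E) / c)\<^sup>2 = ((t - E)\<^sup>2 + c\<^sup>2) / c\<^sup>2" using c by (simp add: field_simps)
      then show ?thesis unfolding Im_resolvent'[OF c] using c square_sum_pos[OF c, of "t - E"]
        by (auto intro!: derivative_eq_intros simp: power2_eq_square)
    qed
    show "((\<lambda>t. complex_of_real (arctan ((t - E) / a) - arctan ((t - E) / b))) has_vector_derivative
       of_real (Im (1 / (of_real t - Complex E a)) - Im (1 / (of_real t - Complex E b)))) (at t)"
      using ab by (intro has_vector_derivative_of_real DERIV_diff d)
    show "norm (complex_of_real (arctan ((t - E) / a) - arctan ((t - E) / b))) \<le> pi"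
      using arctan_bounded[of "(t - E) / a"] arctan_bounded[of "(t - E) / b"]
      unfolding norm_of_real by linarith
    have "\<bar>Im (1 / (of_real t - Complex E c))\<bar> \<le> 1 / c" if "c > 0" for c
      using abs_Im_le_cmod[of "1 / (of_real t - Complex E c)"] norm_resolvent_le[of "Complex E c" t] that by simp
    from this[OF ab(1)] this[OF ab(2)]
    show "norm (complex_of_real (Im (1 / (of_real t - Complex E a)) - Im (1 / (of_real t - Complex E b)))) \<le> 1 / a + 1 / b"
      unfolding norm_of_real by linarith
  qed measurable
  from smooth_statistic_add[OF this smooth_statistic_const[of n "- of_real K"]]
  show ?thesis by (simp add: angle_def K_def)
qed

text \<open>The defect equals k d + d^2 with k = \<open>sc_root z\<close>. Writing it through the
  loop operator isolates the one term whose correlations the loop equation computes; the other two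
  form the remainder.\<close>

lemma deviation_decomposition:
  assumes "\<bar>Re z\<bar> < 2" "n \<ge> 1"
  shows "of_nat n * deviation n z x = of_nat n / sc_root z * loop_operator \<beta> n z x
    + of_real (1 - 2 / \<beta>) * (empirical_stieltjes' n z x / sc_root z) - of_nat n * (deviation n z x)\<^sup>2 / sc_root z"
proof -
  let ?k = "sc_root z" and ?d = "deviation n z x" and ?n = "complex_of_nat n"
  have k: "?k \<noteq> 0" by (rule sc_root_nonzero[OF assms(1)])
  have n: "?n \<noteq> 0" using assms by auto
  have s: "empirical_stieltjes n z x = ?d + (?k - z) / 2" by (simp add: deviation_def sc_stieltjes_def)
  have "4 * sc_defect n z x = 4 * (?k * ?d + ?d\<^sup>2) + (?k\<^sup>2 - z\<^sup>2 + 4)"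
    unfolding sc_defect_def s by (simp add: power2_eq_square field_simps)
  then have "4 * sc_defect n z x = 4 * (?k * ?d + ?d\<^sup>2)" by (simp add: sc_root_square)
  then have P: "sc_defect n z x = ?k * ?d + ?d\<^sup>2" by (metis mult_left_cancel zero_neq_numeral)
  have "?k * (?n * ?d) = ?n * sc_defect n z x - ?n * ?d\<^sup>2" unfolding P by (simp add: algebra_simps)
  also have "?n * sc_defect n z x = ?n * loop_operator \<beta> n z x + of_real (1 - 2 / \<beta>) * empirical_stieltjes' n z x"
  proof -
    have "?n * (of_real (c / real n) * w) = of_real c * w" for c w using n by simp
    from this[of "1 - 2 / \<beta>"] show ?thesis unfolding loop_operator_def right_diff_distrib by (simp only: diff_add_cancel)
  qed
  finally have "?n * ?d = (?n * loop_operator \<beta> n z x + of_real (1 - 2 / \<beta>) * empirical_stieltjes' n z x - ?n * ?d\<^sup>2) / ?k"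
    using k by (metis nonzero_mult_div_cancel_left)
  then show ?thesis by (simp add: add_divide_distrib diff_divide_distrib)
qed

definition angle_main :: "real \<Rightarrow> nat \<Rightarrow> real \<Rightarrow> real \<Rightarrow> real \<Rightarrow> (nat \<Rightarrow> real) \<Rightarrow> real" where
  "angle_main \<beta> n E a b x =
     (\<integral>t. Re (of_nat n / sc_root (Complex E t) * loop_operator \<beta> n (Complex E t) x) \<partial>lborel_Icc a b)"

lemma continuous_vertical_loop_operator:
  "a > 0 \<Longrightarrow> continuous_on {a..b} (\<lambda>t. loop_operator \<beta> n (Complex E t) x)"
  unfolding loop_operator_def sc_defect_def
  by (intro continuous_intros continuous_vertical_empirical continuous_vertical_empirical' continuous_vertical_Complex)

lemma continuous_vertical_main:
  assumes "a > 0" "\<bar>E\<bar> < 2"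
  shows "continuous_on {a..b} (\<lambda>t. of_nat n / sc_root (Complex E t) * loop_operator \<beta> n (Complex E t) x)"
  using sc_root_nonzero assms
  by (intro continuous_intros continuous_vertical_loop_operator continuous_vertical_sc_root) auto

text \<open>The constant 2 pi |1 - 2 / \<beta>| is the logarithmic derivative part; everything under
  the integral contains the deviation, and \<open>sc_root\<close> is replaced by its smallest value
  on the line.\<close>

lemma angle_remainder_bound:
  assumes E: "\<bar>E\<bar> < 2" and ab: "0 < a" "a \<le> b" and n: "n \<ge> 1"
  shows "\<bar>angle n E a b x - angle_main \<beta> n E a b x\<bar> \<le> 2 * pi * \<bar>1 - 2 / \<beta>\<bar>
    + (\<integral>t. (real n * (norm (deviation n (Complex E t) x))\<^sup>2 + 2 * \<bar>1 - 2 / \<beta>\<bar> * norm (deviation n (Complex E t) x) / t)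
         / norm (sc_root (Complex E a)) \<partial>lborel_Icc a b)"
proof -
  define c0 where "c0 = 1 - 2 / \<beta>"
  define d where "d t = deviation n (Complex E t) x" for t
  define k where "k t = sc_root (Complex E t)" for t
  define s' where "s' t = empirical_stieltjes' n (Complex E t) x" for t
  define l where "l t = of_nat n / k t * loop_operator \<beta> n (Complex E t) x" for t
  have k0: "k t \<noteq> 0" for t unfolding k_def using E by (intro sc_root_nonzero) auto
  have cont: "continuous_on {a..b} d" "continuous_on {a..b} k" "continuous_on {a..b} s'"
    unfolding d_def k_def s'_def using ab E
    by (auto intro!: continuous_vertical_deviation continuous_vertical_sc_root continuous_vertical_empirical')
  have cont_l: "continuous_on {a..b} l"
    unfolding l_def k_def by (rule continuous_vertical_main[OF ab(1) E])
  have i: "integrable (lborel_Icc a b) (\<lambda>t. Re (l t))" "integrable (lborel_Icc a b) (\<lambda>t. Re (s' t / k t))"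
      "integrable (lborel_Icc a b) (\<lambda>t. Re (of_nat n * (d t)\<^sup>2 / k t))"
      "integrable (lborel_Icc a b) (\<lambda>t. real n * (norm (d t))\<^sup>2 / norm (k a))"
      "integrable (lborel_Icc a b) (\<lambda>t. 2 * norm (d t) / (norm (k t) * t))"
      "integrable (lborel_Icc a b) (\<lambda>t. 2 * norm (d t) / (norm (k a) * t))"
    using cont cont_l k0 ab by (auto intro!: integrable_lborel_Icc_continuous continuous_intros)
  have "angle n E a b x = (\<integral>t. Re (l t) + c0 * Re (s' t / k t) - Re (of_nat n * (d t)\<^sup>2 / k t) \<partial>lborel_Icc a b)"
    unfolding angle_eq_integral[OF E ab]
  proof (rule Bochner_Integration.integral_cong[OF refl])
    fix t
    have "real n * Re (deviation n (Complex E t) x) = Re (of_nat n * deviation n (Complex E t) x)" by simp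
    also have "\<dots> = Re (l t) + c0 * Re (s' t / k t) - Re (of_nat n * (d t)\<^sup>2 / k t)"
    proof -
      have rr: "Re (of_real c * w) = c * Re w" for c w by simp
      show ?thesis using E n
        by (subst deviation_decomposition[where \<beta> = \<beta>])
          (simp_all only: l_def c0_def s'_def k_def d_def minus_complex.sel plus_complex.sel rr complex.sel)
    qed
    finally show "real n * Re (deviation n (Complex E t) x) = Re (l t) + c0 * Re (s' t / k t) - Re (of_nat n * (d t)\<^sup>2 / k t)" .
  qed
  also have "\<dots> = (\<integral>t. Re (l t) \<partial>lborel_Icc a b) + c0 * (\<integral>t. Re (s' t / k t) \<partial>lborel_Icc a b)
     - (\<integral>t. Re (of_nat n * (d t)\<^sup>2 / k t) \<partial>lborel_Icc a b)"
    using i by (simp only: Bochner_Integration.integral_add Bochner_Integration.integral_diff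
        Bochner_Integration.integrable_add integrable_mult_right integral_mult_right_zero)
  finally have "angle n E a b x - angle_main \<beta> n E a b x = c0 * (\<integral>t. Re (s' t / k t) \<partial>lborel_Icc a b)
     - (\<integral>t. Re (of_nat n * (d t)\<^sup>2 / k t) \<partial>lborel_Icc a b)"
    by (simp add: angle_main_def l_def k_def)
  then have "\<bar>angle n E a b x - angle_main \<beta> n E a b x\<bar> \<le> \<bar>c0 * (\<integral>t. Re (s' t / k t) \<partial>lborel_Icc a b)\<bar>
     + \<bar>\<integral>t. Re (of_nat n * (d t)\<^sup>2 / k t) \<partial>lborel_Icc a b\<bar>"
    by (simp only: abs_triangle_ineq4)
  also have "\<dots> \<le> \<bar>c0\<bar> * (2 * pi + (\<integral>t. 2 * norm (d t) / (norm (k a) * t) \<partial>lborel_Icc a b))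
     + (\<integral>t. real n * (norm (d t))\<^sup>2 / norm (k a) \<partial>lborel_Icc a b)"
  proof (intro add_mono)
    have kmono: "norm (k a) \<le> norm (k t)" if "t \<in> {a..b}" for t
      unfolding k_def using that ab by (intro norm_sc_root_mono) auto
    have kpos: "norm (k t) > 0" for t using k0 by simp
    have "\<bar>\<integral>t. Re (s' t / k t) \<partial>lborel_Icc a b\<bar> \<le> 2 * pi + (\<integral>t. 2 * norm (d t) / (norm (k t) * t) \<partial>lborel_Icc a b)"
      unfolding s'_def k_def d_def by (rule integral_empirical'_over_root[OF E ab n])
    also have "(\<integral>t. 2 * norm (d t) / (norm (k t) * t) \<partial>lborel_Icc a b) \<le> (\<integral>t. 2 * norm (d t) / (norm (k a) * t) \<partial>lborel_Icc a b)"
      using i kmono kpos ab by (intro integral_mono divide_left_mono mult_right_mono mult_pos_pos) auto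
    finally have *: "\<bar>\<integral>t. Re (s' t / k t) \<partial>lborel_Icc a b\<bar> \<le> 2 * pi + (\<integral>t. 2 * norm (d t) / (norm (k a) * t) \<partial>lborel_Icc a b)" by simp
    show "\<bar>c0 * (\<integral>t. Re (s' t / k t) \<partial>lborel_Icc a b)\<bar> \<le> \<bar>c0\<bar> * (2 * pi + (\<integral>t. 2 * norm (d t) / (norm (k a) * t) \<partial>lborel_Icc a b))"
      unfolding abs_mult by (rule mult_left_mono[OF *]) simp
    have "\<bar>\<integral>t. Re (of_nat n * (d t)\<^sup>2 / k t) \<partial>lborel_Icc a b\<bar> \<le> (\<integral>t. \<bar>Re (of_nat n * (d t)\<^sup>2 / k t)\<bar> \<partial>lborel_Icc a b)"
      by (rule integral_abs_bound)
    also have "\<dots> \<le> (\<integral>t. real n * (norm (d t))\<^sup>2 / norm (k a) \<partial>lborel_Icc a b)"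
    proof (intro integral_mono integrable_abs i)
      fix t assume t: "t \<in> space (lborel_Icc a b)"
      have "\<bar>Re (of_nat n * (d t)\<^sup>2 / k t)\<bar> \<le> norm (of_nat n * (d t)\<^sup>2 / k t)" by (rule abs_Re_le_cmod)
      also have "\<dots> = real n * (norm (d t))\<^sup>2 / norm (k t)" by (simp add: norm_mult norm_divide norm_power)
      also have "\<dots> \<le> real n * (norm (d t))\<^sup>2 / norm (k a)"
        using kmono[of t] t kpos by (intro divide_left_mono) auto
      finally show "\<bar>Re (of_nat n * (d t)\<^sup>2 / k t)\<bar> \<le> real n * (norm (d t))\<^sup>2 / norm (k a)" .
    qed
    finally show "\<bar>\<integral>t. Re (of_nat n * (d t)\<^sup>2 / k t) \<partial>lborel_Icc a b\<bar> \<le> (\<integral>t. real n * (norm (d t))\<^sup>2 / norm (k a) \<partial>lborel_Icc a b)" .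
  qed
  also have "\<dots> = 2 * pi * \<bar>c0\<bar> + ((\<integral>t. real n * (norm (d t))\<^sup>2 / norm (k a) \<partial>lborel_Icc a b) + \<bar>c0\<bar> * (\<integral>t. 2 * norm (d t) / (norm (k a) * t) \<partial>lborel_Icc a b))"
    by (simp add: algebra_simps)
  also have "(\<integral>t. real n * (norm (d t))\<^sup>2 / norm (k a) \<partial>lborel_Icc a b) + \<bar>c0\<bar> * (\<integral>t. 2 * norm (d t) / (norm (k a) * t) \<partial>lborel_Icc a b)
     = (\<integral>t. real n * (norm (d t))\<^sup>2 / norm (k a) + \<bar>c0\<bar> * (2 * norm (d t) / (norm (k a) * t)) \<partial>lborel_Icc a b)"
    using i by (simp only: Bochner_Integration.integral_add integrable_mult_right integral_mult_right_zero)
  also have "\<dots> = (\<integral>t. (real n * (norm (d t))\<^sup>2 + 2 * \<bar>c0\<bar> * norm (d t) / t) / norm (k a) \<partial>lborel_Icc a b)"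
    by (intro Bochner_Integration.integral_cong refl) (simp add: add_divide_distrib mult_ac)
  finally show ?thesis by (simp add: c0_def d_def k_def)
qed

text \<open>Used only for integrability; the bound deteriorates as a decreases.\<close>

lemma deviation_vertical_bounded:
  assumes "\<bar>E\<bar> < 2" "0 < a"
  obtains D where "D \<ge> 0" "\<And>t x. t \<in> {a..b} \<Longrightarrow> norm (deviation n (Complex E t) x) \<le> D"
proof -
  have "bounded ((\<lambda>t. sc_stieltjes (Complex E t)) ` {a..b})"
    by (intro compact_imp_bounded compact_continuous_image continuous_vertical_sc_stieltjes assms compact_Icc)
  then obtain B where B: "\<And>t. t \<in> {a..b} \<Longrightarrow> norm (sc_stieltjes (Complex E t)) \<le> B" unfolding bounded_iff by blast
  show ?thesis
  proof (rule that[of "1 / a + \<bar>B\<bar>"])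
    fix t x assume t: "t \<in> {a..b}"
    then have "1 / t \<le> 1 / a" using assms by (intro divide_left_mono) auto
    moreover have "norm (deviation n (Complex E t) x) \<le> 1 / t + norm (sc_stieltjes (Complex E t))"
      using norm_deviation_bound[of "Complex E t" n x] t assms by simp
    ultimately show "norm (deviation n (Complex E t) x) \<le> 1 / a + \<bar>B\<bar>" using B[OF t] by linarith
  qed (use assms in auto)
qed

text \<open>Height and \<open>sc_root\<close> both increase along the line, so the scale condition
  is needed at the lowest height only.\<close>

lemma condition_vertical:
  assumes "1 \<le> real n * a * norm (sc_root (Complex E a))" "0 < a" "a \<le> t"
  shows "1 \<le> real n * Im (Complex E t) * norm (sc_root (Complex E t))"
proof -
  have "real n * a * norm (sc_root (Complex E a)) \<le> real n * t * norm (sc_root (Complex E t))"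
    using assms norm_sc_root_mono[of a t E] by (intro mult_mono) auto
  then show ?thesis using assms by simp
qed

lemma angle_measurable [measurable]: "angle n E a b \<in> borel_measurable (lebesgue_Rn n)"
  unfolding angle_def[abs_def] by measurable

lemma loop_operator_vertical_bounded:
  assumes "0 < a"
  obtains B where "\<And>t x. t \<in> {a..b} \<Longrightarrow> norm (loop_operator \<beta> n (Complex E t) x) \<le> B"
proof (rule that)
  fix t x assume t: "t \<in> {a..b}"
  let ?z = "Complex E t"
  have z: "Im ?z > 0" using t assms by simp
  have i: "1 / Im ?z \<le> 1 / a" using t assms by (auto intro!: divide_left_mono)
  have nz: "norm ?z \<le> \<bar>E\<bar> + \<bar>b\<bar>" using cmod_le[of ?z] t assms by auto
  have "norm (of_real ((1 - 2 / \<beta>) / real n) * empirical_stieltjes' n ?z x) \<le> \<bar>(1 - 2 / \<beta>) / real n\<bar> * (1 / a)\<^sup>2"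
    unfolding norm_mult norm_of_real
    by (intro mult_left_mono order_trans[OF norm_empirical_stieltjes'_le[OF z]] power_mono i) (use z in auto)
  moreover have "norm (sc_defect n ?z x) \<le> (1 / a)\<^sup>2 + (\<bar>E\<bar> + \<bar>b\<bar>) * (1 / a) + 1"
    by (rule order_trans[OF norm_sc_defect_le[OF z]], intro add_mono power_mono mult_mono i nz) (use z in auto)
  ultimately show "norm (loop_operator \<beta> n ?z x) \<le> ((1 / a)\<^sup>2 + (\<bar>E\<bar> + \<bar>b\<bar>) * (1 / a) + 1) + \<bar>(1 - 2 / \<beta>) / real n\<bar> * (1 / a)\<^sup>2"
    unfolding loop_operator_def by (intro norm_triangle_le_diff add_mono)
qed

lemma loop_operator_measurable_scaled:
  assumes "\<beta> > 0"
  shows "(\<lambda>p. loop_operator \<beta> n (Complex E (snd p)) (fst p)) \<in> borel_measurable (scaled_gbe \<beta> n \<Otimes>\<^sub>M lborel_Icc a b)"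
  unfolding loop_operator_def sc_defect_def
  by (intro borel_measurable_diff borel_measurable_add borel_measurable_times borel_measurable_power borel_measurable_const
      empirical_measurable_scaled[OF assms] snd_measurable_scaled[OF assms] continuous_vertical_Complex)

lemma main_measurable_scaled:
  assumes "\<beta> > 0" "\<bar>E\<bar> < 2" "0 < a"
  shows "(\<lambda>p. Re (of_nat n / sc_root (Complex E (snd p)) * loop_operator \<beta> n (Complex E (snd p)) (fst p)))
    \<in> borel_measurable (scaled_gbe \<beta> n \<Otimes>\<^sub>M lborel_Icc a b)"
proof -
  note [measurable] = loop_operator_measurable_scaled[OF assms(1), of n E a b]
    snd_measurable_scaled[OF assms(1) continuous_vertical_sc_root[OF assms(2)], where a = a and b = b and n = n]
  show ?thesis by measurable
qed

lemma main_vertical_bounded: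
  assumes "\<bar>E\<bar> < 2" "0 < a"
  obtains B where "\<And>t x. t \<in> {a..b} \<Longrightarrow> \<bar>Re (of_nat n / sc_root (Complex E t) * loop_operator \<beta> n (Complex E t) x)\<bar> \<le> B"
proof -
  obtain B where B: "\<And>t x. t \<in> {a..b} \<Longrightarrow> norm (loop_operator \<beta> n (Complex E t) x) \<le> B"
    using loop_operator_vertical_bounded[OF assms(2)] by metis
  have k: "norm (sc_root (Complex E a)) > 0" using assms by (intro norm_sc_root_pos) auto
  show ?thesis
  proof (rule that)
    fix t x assume t: "t \<in> {a..b}"
    have "\<bar>Re (of_nat n / sc_root (Complex E t) * loop_operator \<beta> n (Complex E t) x)\<bar>
      \<le> real n / norm (sc_root (Complex E t)) * norm (loop_operator \<beta> n (Complex E t) x)"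
      using abs_Re_le_cmod[of "of_nat n / sc_root (Complex E t) * loop_operator \<beta> n (Complex E t) x"]
      by (simp only: norm_mult norm_divide norm_of_nat)
    also have "\<dots> \<le> real n / norm (sc_root (Complex E a)) * \<bar>B\<bar>"
      using t k assms norm_sc_root_mono[of a t E] B[OF t, of x]
      by (intro mult_mono divide_left_mono mult_pos_pos) (auto intro: less_le_trans)
    finally show "\<bar>Re (of_nat n / sc_root (Complex E t) * loop_operator \<beta> n (Complex E t) x)\<bar> \<le> real n / norm (sc_root (Complex E a)) * \<bar>B\<bar>" .
  qed
qed

lemma angle_main_measurable:
  assumes "\<beta> > 0" "\<bar>E\<bar> < 2" "0 < a"
  shows "angle_main \<beta> n E a b \<in> borel_measurable (scaled_gbe \<beta> n)"
proof -
  obtain B where B: "\<And>t x. t \<in> {a..b} \<Longrightarrow> \<bar>Re (of_nat n / sc_root (Complex E t) * loop_operator \<beta> n (Complex E t) x)\<bar> \<le> B"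
    using main_vertical_bounded[OF assms(2,3)] by metis
  show ?thesis
    using Fubini_scaled(1)[OF assms(1) main_measurable_scaled[OF assms] B]
    unfolding angle_main_def[abs_def] by (rule borel_measurable_integrable)
qed

text \<open>The deviation at height t is of order 1 / (n t) in fourth mean, so the integrand is of
  order 1 / (n k t^2) in mean square with k = |\<open>sc_root\<close>| at height a. The integral is
  of order 1 / (n k a), bounded by the scale condition.\<close>

theorem angle_remainder_moment:
  assumes \<beta>: "\<beta> > 0"
  obtains C where "C \<ge> 0"
    "\<And>n E a b. n \<ge> 1 \<Longrightarrow> \<bar>E\<bar> < 2 \<Longrightarrow> 0 < a \<Longrightarrow> a \<le> b \<Longrightarrow> 1 \<le> real n * a * norm (sc_root (Complex E a)) \<Longrightarrow>
      integrable (scaled_gbe \<beta> n) (\<lambda>x. (angle n E a b x - angle_main \<beta> n E a b x)\<^sup>2) \<and>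
      (\<integral>x. (angle n E a b x - angle_main \<beta> n E a b x)\<^sup>2 \<partial>scaled_gbe \<beta> n) \<le> C"
proof -
  obtain C where C: "C \<ge> 0" and
    four: "\<And>n z. n \<ge> 1 \<Longrightarrow> \<bar>Re z\<bar> < 2 \<Longrightarrow> Im z > 0 \<Longrightarrow> 1 \<le> real n * Im z * norm (sc_root z) \<Longrightarrow>
      (\<integral>x. norm (deviation n z x) ^ 4 \<partial>scaled_gbe \<beta> n) \<le> C\<^sup>2 / (real n * Im z) ^ 4" and
    two: "\<And>n z. n \<ge> 1 \<Longrightarrow> \<bar>Re z\<bar> < 2 \<Longrightarrow> Im z > 0 \<Longrightarrow> 1 \<le> real n * Im z * norm (sc_root z) \<Longrightarrow>
      (\<integral>x. norm (deviation n z x) ^ 2 \<partial>scaled_gbe \<beta> n) \<le> C / (real n * Im z)\<^sup>2"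
    using deviation_fourth_moment[OF \<beta>] by metis
  define c0 where "c0 = \<bar>1 - 2 / \<beta>\<bar>"
  have c0: "c0 \<ge> 0" by (simp add: c0_def)
  \<comment> \<open>From squaring the two summands n d^2 and 2 c0 d / t of the integrand.\<close>
  define C1 where "C1 = 2 * C\<^sup>2 + 8 * c0\<^sup>2 * C"
  have C1: "C1 \<ge> 0" using C by (simp add: C1_def)
  show ?thesis
  proof (rule that[of "2 * (2 * pi * c0)\<^sup>2 + 2 * C1"])
    show "0 \<le> 2 * (2 * pi * c0)\<^sup>2 + 2 * C1" using C1 by simp
    fix n :: nat and E a b :: real
    assume n: "n \<ge> 1" and E: "\<bar>E\<bar> < 2" and a: "0 < a" "a \<le> b" and cond: "1 \<le> real n * a * norm (sc_root (Complex E a))"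
    let ?M = "scaled_gbe \<beta> n" and ?L = "lborel_Icc a b"
    interpret prob_space ?M by (rule prob_space_scaled_gbe[OF \<beta>])
    define k0 where "k0 = norm (sc_root (Complex E a))"
    have k0: "k0 > 0" unfolding k0_def using E by (intro norm_sc_root_pos) auto
    define d where "d x t = norm (deviation n (Complex E t) x)" for x t
    define u where "u x t = (real n * (d x t)\<^sup>2 + 2 * c0 * d x t / t) / k0" for x t
    obtain D where D: "D \<ge> 0" "\<And>t x. t \<in> {a..b} \<Longrightarrow> d x t \<le> D"
      unfolding d_def using deviation_vertical_bounded[OF E a(1)] by metis
    have d0: "d x t \<ge> 0" for x t by (simp add: d_def)
    have d_meas: "(\<lambda>p. d (fst p) (snd p)) \<in> borel_measurable (?M \<Otimes>\<^sub>M ?L)"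
      unfolding d_def using deviation_measurable_scaled[OF \<beta> E, of n a b] by (rule measurable_compose[OF _ borel_measurable_norm])
    have u_meas: "(\<lambda>p. u (fst p) (snd p)) \<in> borel_measurable (?M \<Otimes>\<^sub>M ?L)"
      unfolding u_def using d_meas snd_measurable_scaled[OF \<beta>, where a = a and b = b and n = n and g = "\<lambda>t. t"]
      by (intro borel_measurable_divide borel_measurable_add borel_measurable_times borel_measurable_power borel_measurable_const)
        (auto intro: continuous_intros)
    have dx_meas[measurable]: "(\<lambda>x. d x t) \<in> borel_measurable (lebesgue_Rn n)" for t
      unfolding d_def by measurable
    have u0: "0 \<le> u x t" if "t \<in> {a..b}" for x t
      using that a d0 c0 k0 by (auto simp: u_def intro!: divide_nonneg_nonneg add_nonneg_nonneg mult_nonneg_nonneg)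
    have u_le: "u x t \<le> (real n * D\<^sup>2 + 2 * c0 * D / a) / k0" if t: "t \<in> {a..b}" for x t
    proof -
      have "2 * c0 * d x t / t \<le> 2 * c0 * D / a" using t a c0 d0 D(2)[OF t] D(1) by (intro frac_le mult_left_mono mult_nonneg_nonneg) auto
      moreover have "real n * (d x t)\<^sup>2 \<le> real n * D\<^sup>2" using d0 D(2)[OF t] by (intro mult_left_mono power_mono) auto
      ultimately show ?thesis unfolding u_def using k0 by (intro divide_right_mono add_mono) auto
    qed
    have u_cont: "continuous_on {a..b} (u x)" for x
      unfolding u_def d_def using a E k0
      by (intro continuous_intros continuous_vertical_deviation) auto
    have u_mom: "(\<integral>x. (u x t)\<^sup>2 \<partial>?M) \<le> (C1 / (real n * k0)\<^sup>2) / t ^ 4" if t: "t \<in> {a..b}" for t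
    proof -
      have t0: "t > 0" using t a by auto
      have cnd: "1 \<le> real n * Im (Complex E t) * norm (sc_root (Complex E t))"
        using t by (intro condition_vertical[OF cond a(1)]) auto
      have i: "integrable ?M (\<lambda>x. d x t ^ m)" for m
        by (rule integrable_bounded_scaled'[OF \<beta>, of _ _ "D ^ m"]) (use D d0 t in \<open>auto intro!: power_mono\<close>)
      have "(u x t)\<^sup>2 \<le> (2 * (real n)\<^sup>2 * d x t ^ 4 + 8 * c0\<^sup>2 / t\<^sup>2 * d x t ^ 2) / k0\<^sup>2" for x
      proof -
        have sq: "(p + q)\<^sup>2 \<le> 2 * p\<^sup>2 + 2 * q\<^sup>2" for p q :: real
          using zero_le_power2[of "p - q"] by (simp add: power2_sum power2_diff)
        have "(u x t)\<^sup>2 = (real n * (d x t)\<^sup>2 + 2 * c0 * d x t / t)\<^sup>2 / k0\<^sup>2" by (simp add: u_def power_divide)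
        also have "\<dots> \<le> (2 * (real n * (d x t)\<^sup>2)\<^sup>2 + 2 * (2 * c0 * d x t / t)\<^sup>2) / k0\<^sup>2"
          by (intro divide_right_mono sq) auto
        also have "2 * (real n * (d x t)\<^sup>2)\<^sup>2 + 2 * (2 * c0 * d x t / t)\<^sup>2 = 2 * (real n)\<^sup>2 * d x t ^ 4 + 8 * c0\<^sup>2 / t\<^sup>2 * d x t ^ 2"
          by (simp add: power_mult_distrib power_divide power_mult[symmetric])
        finally show ?thesis .
      qed
      then have "(\<integral>x. (u x t)\<^sup>2 \<partial>?M) \<le> (\<integral>x. (2 * (real n)\<^sup>2 * d x t ^ 4 + 8 * c0\<^sup>2 / t\<^sup>2 * d x t ^ 2) / k0\<^sup>2 \<partial>?M)"
        using i by (intro integral_mono_AE' integrable_divide Bochner_Integration.integrable_add integrable_mult_right AE_I2) auto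
      also have "\<dots> = (2 * (real n)\<^sup>2 * (\<integral>x. d x t ^ 4 \<partial>?M) + 8 * c0\<^sup>2 / t\<^sup>2 * (\<integral>x. d x t ^ 2 \<partial>?M)) / k0\<^sup>2"
        using i by (simp only: integral_divide_zero Bochner_Integration.integral_add integrable_mult_right integral_mult_right_zero)
      also have "\<dots> \<le> (2 * (real n)\<^sup>2 * (C\<^sup>2 / (real n * t) ^ 4) + 8 * c0\<^sup>2 / t\<^sup>2 * (C / (real n * t)\<^sup>2)) / k0\<^sup>2"
      proof (intro divide_right_mono add_mono mult_left_mono)
        show "(\<integral>x. d x t ^ 4 \<partial>?M) \<le> C\<^sup>2 / (real n * t) ^ 4"
          using four[OF n _ _ cnd] E t0 by (simp add: d_def)
        show "(\<integral>x. d x t ^ 2 \<partial>?M) \<le> C / (real n * t)\<^sup>2"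
          using two[OF n _ _ cnd] E t0 by (simp add: d_def)
      qed auto
      also have "\<dots> = (C1 / (real n * k0)\<^sup>2) / t ^ 4"
        using n t0 k0 by (simp add: C1_def field_simps power_numeral_reduce power2_eq_square)
      finally show ?thesis .
    qed
    define U where "U x = (\<integral>t. u x t \<partial>?L)" for x
    have B0: "C1 / (real n * k0)\<^sup>2 \<ge> 0" using C1 by simp
    note SM = second_moment_integral[OF \<beta> a u_meas u_le u0 u_cont u_mom B0, folded U_def]
    have U_mom: "(\<integral>x. (U x)\<^sup>2 \<partial>?M) \<le> C1"
    proof -
      have "(1::real) \<le> (real n * a * k0)\<^sup>2" using cond by (simp add: k0_def one_le_power)
      then have "C1 / (real n * k0)\<^sup>2 / a\<^sup>2 \<le> C1"
        using mult_left_mono[of 1 "(real n * a * k0)\<^sup>2" C1] C1 n k0 a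
        by (simp add: field_simps power_mult_distrib)
      then show ?thesis using SM(1) by linarith
    qed
    have bound: "(angle n E a b x - angle_main \<beta> n E a b x)\<^sup>2 \<le> 2 * (2 * pi * c0)\<^sup>2 + 2 * (U x)\<^sup>2" for x
    proof -
      have "\<bar>angle n E a b x - angle_main \<beta> n E a b x\<bar> \<le> 2 * pi * c0 + U x"
        using angle_remainder_bound[OF E a n, of x \<beta>] by (simp add: c0_def U_def u_def d_def k0_def)
      then have "(angle n E a b x - angle_main \<beta> n E a b x)\<^sup>2 \<le> (2 * pi * c0 + U x)\<^sup>2"
        by (metis abs_ge_zero power2_abs power_mono)
      also have "\<dots> \<le> 2 * (2 * pi * c0)\<^sup>2 + 2 * (U x)\<^sup>2"
        using zero_le_power2[of "2 * pi * c0 - U x"] by (simp add: power2_sum power2_diff)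
      finally show ?thesis .
    qed
    have m: "(\<lambda>x. (angle n E a b x - angle_main \<beta> n E a b x)\<^sup>2) \<in> borel_measurable ?M"
      using angle_main_measurable[OF \<beta> E a(1), of n b] by measurable
    have iU: "integrable ?M (\<lambda>x. 2 * (2 * pi * c0)\<^sup>2 + 2 * (U x)\<^sup>2)" using SM(2) by simp
    have i: "integrable ?M (\<lambda>x. (angle n E a b x - angle_main \<beta> n E a b x)\<^sup>2)"
      by (rule Bochner_Integration.integrable_bound[OF iU m]) (use bound in \<open>auto intro!: AE_I2 order_trans[OF bound]\<close>)
    have "(\<integral>x. (angle n E a b x - angle_main \<beta> n E a b x)\<^sup>2 \<partial>?M) \<le> (\<integral>x. 2 * (2 * pi * c0)\<^sup>2 + 2 * (U x)\<^sup>2 \<partial>?M)"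
      by (intro integral_mono i iU bound)
    also have "\<dots> = 2 * (2 * pi * c0)\<^sup>2 + 2 * (\<integral>x. (U x)\<^sup>2 \<partial>?M)" using SM(2) by (simp add: prob_space)
    also have "\<dots> \<le> 2 * (2 * pi * c0)\<^sup>2 + 2 * C1" using U_mom by simp
    finally show "integrable ?M (\<lambda>x. (angle n E a b x - angle_main \<beta> n E a b x)\<^sup>2) \<and>
      (\<integral>x. (angle n E a b x - angle_main \<beta> n E a b x)\<^sup>2 \<partial>?M) \<le> 2 * (2 * pi * c0)\<^sup>2 + 2 * C1" using i by simp
  qed
qed

text \<open>The density of points smoothed at height a is, in mean, at most of the order of
  \<open>sc_root\<close>: the semicircle part is at most half of it, and the deviation is of order 1
  / (n a), which the scale condition compares with it.\<close>

lemma expectation_Im_empirical: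
  assumes \<beta>: "\<beta> > 0"
  obtains C where "C \<ge> 0"
    "\<And>n E a. n \<ge> 1 \<Longrightarrow> \<bar>E\<bar> < 2 \<Longrightarrow> 0 < a \<Longrightarrow> 1 \<le> real n * a * norm (sc_root (Complex E a)) \<Longrightarrow>
      (\<integral>x. Im (empirical_stieltjes n (Complex E a) x) \<partial>scaled_gbe \<beta> n) \<le> C * norm (sc_root (Complex E a))"
proof -
  obtain C where C: "C \<ge> 0" and
    two: "\<And>n z. n \<ge> 1 \<Longrightarrow> \<bar>Re z\<bar> < 2 \<Longrightarrow> Im z > 0 \<Longrightarrow> 1 \<le> real n * Im z * norm (sc_root z) \<Longrightarrow>
      (\<integral>x. norm (deviation n z x) ^ 2 \<partial>scaled_gbe \<beta> n) \<le> C / (real n * Im z)\<^sup>2"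
    using deviation_fourth_moment[OF \<beta>] by metis
  show ?thesis
  proof (rule that[of "C + 2"])
    fix n :: nat and E a :: real
    assume n: "n \<ge> 1" and E: "\<bar>E\<bar> < 2" and a: "0 < a" and cond: "1 \<le> real n * a * norm (sc_root (Complex E a))"
    let ?M = "scaled_gbe \<beta> n" and ?z = "Complex E a"
    interpret prob_space ?M by (rule prob_space_scaled_gbe[OF \<beta>])
    define k where "k = norm (sc_root ?z)"
    define e where "e = real n * a"
    have e: "e > 0" using n a by (simp add: e_def)
    have ek: "1 / e \<le> k" using cond e by (simp add: e_def k_def field_simps)
    have i: "integrable ?M (\<lambda>x. norm (deviation n ?z x) ^ 2)"
    proof (rule integrable_bounded_scaled'[OF \<beta>])
      show "norm (deviation n ?z x) ^ 2 \<le> (1 / Im ?z + norm (sc_stieltjes ?z))\<^sup>2" for x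
        by (intro power_mono norm_deviation_bound) (use a in auto)
    qed auto
    have i': "integrable ?M (\<lambda>x. Im (empirical_stieltjes n ?z x))"
      by (rule integrable_bounded_scaled[OF \<beta>, of _ _ "1 / Im ?z"])
        (use a order_trans[OF abs_Im_le_cmod norm_empirical_stieltjes_le[of ?z n]] in auto)
    have pt: "Im (empirical_stieltjes n ?z x) \<le> e * norm (deviation n ?z x) ^ 2 + 1 / e + k" for x
    proof -
      define d where "d = norm (deviation n ?z x)"
      have "Im (empirical_stieltjes n ?z x) = Im (deviation n ?z x) + Im (sc_stieltjes ?z)" by (simp add: deviation_def)
      also have "\<dots> \<le> d + k / 2" unfolding d_def k_def
        using a by (intro add_mono Im_sc_stieltjes_le) (auto intro: order_trans[OF _ abs_Im_le_cmod])
      also have "d \<le> e * d\<^sup>2 + 1 / e"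
      proof -
        have "0 \<le> (e * d - 1)\<^sup>2" by simp
        then have "2 * (e * d) \<le> (e * d)\<^sup>2 + 1" by (simp add: power2_diff)
        moreover have "0 \<le> e * d" using e by (simp add: d_def)
        ultimately have "e * d \<le> (e * d)\<^sup>2 + 1" by linarith
        then show ?thesis using e by (simp add: field_simps power2_eq_square)
      qed
      finally show ?thesis using norm_ge_zero[of "sc_root ?z"] unfolding d_def k_def by linarith
    qed
    have "(\<integral>x. Im (empirical_stieltjes n ?z x) \<partial>?M) \<le> (\<integral>x. e * norm (deviation n ?z x) ^ 2 + (1 / e + k) \<partial>?M)"
      using i i' pt by (intro integral_mono) (auto simp: add.assoc)
    also have "\<dots> = e * (\<integral>x. norm (deviation n ?z x) ^ 2 \<partial>?M) + (1 / e + k)"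
      using i by (simp add: prob_space)
    also have "\<dots> \<le> e * (C / e\<^sup>2) + (1 / e + k)"
      using two[of n ?z] n E a cond e by (intro add_right_mono mult_left_mono) (auto simp: e_def)
    also have "e * (C / e\<^sup>2) = C * (1 / e)" using e by (simp add: power2_eq_square)
    also have "C * (1 / e) + (1 / e + k) \<le> C * k + (k + k)" using ek C by (intro add_mono mult_left_mono) auto
    finally show "(\<integral>x. Im (empirical_stieltjes n ?z x) \<partial>?M) \<le> (C + 2) * norm (sc_root ?z)"
      by (simp add: k_def algebra_simps)
  qed (use C in simp)
qed

section \<open>The variance of truncated smoothed counts\<close>

definition angle_slope :: "real \<Rightarrow> real \<Rightarrow> real \<Rightarrow> real \<Rightarrow> real" where
  "angle_slope E a b y = Im (1 / (of_real y - Complex E a)) - Im (1 / (of_real y - Complex E b))"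

lemma Im_resolvent_nonneg: "t > 0 \<Longrightarrow> Im (1 / (of_real y - Complex E t)) \<ge> 0"
  by (subst Im_resolvent') (auto intro!: divide_nonneg_nonneg add_nonneg_nonneg)

lemma sum_Im_resolvent: "n \<ge> 1 \<Longrightarrow> (\<Sum>j<n. Im (1 / (of_real (x j) - z))) = real n * Im (empirical_stieltjes n z x)"
  by (simp add: empirical_stieltjes_def)

lemma integrable_resolvent_sum:
  assumes \<beta>: "\<beta> > 0" and F: "smooth_statistic n F G" and z: "Im z > 0"
  shows "integrable (scaled_gbe \<beta> n) (\<lambda>x. \<Sum>j<n. G j x / (of_real (x j) - z))"
proof -
  obtain A where A: "\<And>x. norm (F x) \<le> A" "\<And>x j. j < n \<Longrightarrow> norm (G j x) \<le> A" "A \<ge> 0"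
    using smooth_statistic_bound[OF F] by metis
  show ?thesis
  proof (rule integrable_bounded_scaled[OF \<beta>])
    show "(\<lambda>x. \<Sum>j<n. G j x / (of_real (x j) - z)) \<in> borel_measurable (lebesgue_Rn n)"
      using smooth_statisticD(2)[OF F] by (intro borel_measurable_sum borel_measurable_divide) auto
    fix x :: "nat \<Rightarrow> real"
    have "norm (G j x / (of_real (x j) - z)) \<le> A * (1 / Im z)" if "j \<in> {..<n}" for j
    proof -
      have "norm (G j x) * norm (1 / (of_real (x j) - z)) \<le> A * (1 / Im z)"
        using that A z by (intro mult_mono norm_resolvent_le) auto
      then show ?thesis by (simp add: norm_divide)
    qed
    from sum_norm_bound[of "{..<n}" "\<lambda>j. G j x / (of_real (x j) - z)", OF this]
    show "norm (\<Sum>j<n. G j x / (of_real (x j) - z)) \<le> real n * (A * (1 / Im z))" by simp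
  qed
qed

text \<open>At a fixed height the loop equation turns the correlation into an expected sum of
  gradient entries times the kernel 1 / ((y - z) \<open>sc_root z\<close>). The two energies are
  combined before absolute values are taken, so that \<open>K\<close> may exploit cancellation
  between the kernels.\<close>

lemma correlation_pointwise:
  assumes \<beta>: "\<beta> > 0" and n: "n \<ge> 1" and E: "\<bar>E1\<bar> < 2" "\<bar>E2\<bar> < 2" and t: "t > 0"
    and F: "smooth_statistic n (\<lambda>x. of_real (f x)) (\<lambda>j x. of_real (g j x))"
    and K: "\<And>y. \<bar>Re (1 / ((of_real y - Complex E1 t) * sc_root (Complex E1 t)))
        - c * Re (1 / ((of_real y - Complex E2 t) * sc_root (Complex E2 t)))\<bar> \<le> K"
    and S: "integrable (scaled_gbe \<beta> n) (\<lambda>x. \<Sum>j<n. \<bar>g j x\<bar>)" "(\<integral>x. (\<Sum>j<n. \<bar>g j x\<bar>) \<partial>scaled_gbe \<beta> n) \<le> S"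
  shows "(\<integral>x. f x * (Re (of_nat n / sc_root (Complex E1 t) * loop_operator \<beta> n (Complex E1 t) x)
      - c * Re (of_nat n / sc_root (Complex E2 t) * loop_operator \<beta> n (Complex E2 t) x)) \<partial>scaled_gbe \<beta> n)
      \<le> 2 / (\<beta> * real n) * (K * S)"
proof -
  let ?M = "scaled_gbe \<beta> n"
  interpret prob_space ?M by (rule prob_space_scaled_gbe[OF \<beta>])
  define k1 where "k1 = sc_root (Complex E1 t)"
  define k2 where "k2 = sc_root (Complex E2 t)"
  define L1 where "L1 = loop_operator \<beta> n (Complex E1 t)"
  define L2 where "L2 = loop_operator \<beta> n (Complex E2 t)"
  define R1 where "R1 x = (\<Sum>j<n. of_real (g j x) / (of_real (x j) - Complex E1 t))" for x
  define R2 where "R2 x = (\<Sum>j<n. of_real (g j x) / (of_real (x j) - Complex E2 t))" for x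
  define w where "w y = Re (1 / ((of_real y - Complex E1 t) * k1)) - c * Re (1 / ((of_real y - Complex E2 t) * k2))" for y
  have wK: "\<bar>w y\<bar> \<le> K" for y using K[of y] by (simp add: w_def k1_def k2_def)
  have K0: "K \<ge> 0" using wK[of 0] by linarith
  define l where "l = 2 / (\<beta> * (real n)\<^sup>2)"
  have l: "l \<ge> 0" using \<beta> by (simp add: l_def)
  have iR: "integrable ?M R1" "integrable ?M R2"
    unfolding R1_def[abs_def] R2_def[abs_def] using t by (auto intro!: integrable_resolvent_sum[OF \<beta> F])
  have loop: "(\<integral>x. of_real (f x) * L1 x \<partial>?M) = of_real l * (\<integral>x. R1 x \<partial>?M)"
      "(\<integral>x. of_real (f x) * L2 x \<partial>?M) = of_real l * (\<integral>x. R2 x \<partial>?M)"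
    unfolding L1_def L2_def R1_def R2_def l_def
    by (rule loop_equation[OF \<beta> n _ F], use t in simp)+
  obtain A where A: "\<And>x. norm (complex_of_real (f x)) \<le> A" "A \<ge> 0"
    using smooth_statistic_bound[OF F] by metis
  have F_meas[measurable]: "(\<lambda>x. complex_of_real (f x)) \<in> borel_measurable (lebesgue_Rn n)" by (rule smooth_statisticD(1)[OF F])
  have iL: "integrable ?M (\<lambda>x. of_real (f x) * loop_operator \<beta> n (Complex E t) x)" for E
  proof -
    obtain B where B: "\<And>x. norm (loop_operator \<beta> n (Complex E t) x) \<le> B"
      using loop_operator_bound[of "Complex E t" \<beta> n] t unfolding complex.sel by blast
    show ?thesis
      using A B by (intro integrable_bounded_scaled[OF \<beta>, of _ _ "A * B"]) (auto simp: norm_mult intro!: mult_mono)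
  qed
  have iL12: "integrable ?M (\<lambda>x. of_real (f x) * L1 x)" "integrable ?M (\<lambda>x. of_real (f x) * L2 x)"
    unfolding L1_def L2_def by (rule iL)+
  have "(\<integral>x. f x * (Re (of_nat n / k1 * L1 x) - c * Re (of_nat n / k2 * L2 x)) \<partial>?M)
      = (\<integral>x. Re (of_nat n / k1 * (of_real (f x) * L1 x) - of_real c * (of_nat n / k2) * (of_real (f x) * L2 x)) \<partial>?M)"
  proof (rule Bochner_Integration.integral_cong[OF refl])
    fix x
    have "r * (Re (p * u) - c * Re (q * v)) = Re (p * (of_real r * u) - of_real c * q * (of_real r * v))" for r p q u v
    proof -
      have e: "p * (of_real r * u) = of_real r * (p * u)" "of_real c * q * (of_real r * v) = of_real (r * c) * (q * v)"
        by simp_all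
      show ?thesis unfolding e minus_complex.sel by (simp only: Re_complex_of_real times_complex.sel Im_complex_of_real) (simp add: algebra_simps)
    qed
    then show "f x * (Re (of_nat n / k1 * L1 x) - c * Re (of_nat n / k2 * L2 x)) =
        Re (of_nat n / k1 * (of_real (f x) * L1 x) - of_real c * (of_nat n / k2) * (of_real (f x) * L2 x))" .
  qed
  also have "\<dots> = Re (\<integral>x. of_nat n / k1 * (of_real (f x) * L1 x) - of_real c * (of_nat n / k2) * (of_real (f x) * L2 x) \<partial>?M)"
    using iL12 by (intro integral_Re Bochner_Integration.integrable_diff integrable_mult_right)
  also have "(\<integral>x. of_nat n / k1 * (of_real (f x) * L1 x) - of_real c * (of_nat n / k2) * (of_real (f x) * L2 x) \<partial>?M)
      = of_nat n / k1 * (of_real l * (\<integral>x. R1 x \<partial>?M)) - of_real c * (of_nat n / k2) * (of_real l * (\<integral>x. R2 x \<partial>?M))"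
    using iL12 by (simp only: Bochner_Integration.integral_diff integrable_mult_right integral_mult_right_zero loop)
  also have "\<dots> = (\<integral>x. of_real (l * real n) * (R1 x / k1 - of_real c * (R2 x / k2)) \<partial>?M)"
  proof -
    have "(\<integral>x. of_real (l * real n) * (R1 x / k1 - of_real c * (R2 x / k2)) \<partial>?M)
      = of_real (l * real n) * ((\<integral>x. R1 x \<partial>?M) / k1 - of_real c * ((\<integral>x. R2 x \<partial>?M) / k2))"
      using iR by (simp only: Bochner_Integration.integral_diff integrable_mult_right integral_mult_right_zero
        integrable_divide integral_divide_zero)
    then show ?thesis by (simp add: algebra_simps)
  qed
  also have "Re \<dots> = (\<integral>x. Re (of_real (l * real n) * (R1 x / k1 - of_real c * (R2 x / k2))) \<partial>?M)"
    using iR by (intro integral_Re[symmetric] integrable_mult_right Bochner_Integration.integrable_diff integrable_divide)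
  also have "\<dots> \<le> (\<integral>x. l * real n * (K * (\<Sum>j<n. \<bar>g j x\<bar>)) \<partial>?M)"
  proof (rule integral_mono)
    show "integrable ?M (\<lambda>x. Re (of_real (l * real n) * (R1 x / k1 - of_real c * (R2 x / k2))))"
      using iR by (intro integrable_Re integrable_mult_right Bochner_Integration.integrable_diff integrable_divide)
    show "integrable ?M (\<lambda>x. l * real n * (K * (\<Sum>j<n. \<bar>g j x\<bar>)))" using S(1) by (intro integrable_mult_right)
    fix x
    have "R1 x / k1 - of_real c * (R2 x / k2) = (\<Sum>j<n. of_real (g j x) * (1 / ((of_real (x j) - Complex E1 t) * k1) - of_real c * (1 / ((of_real (x j) - Complex E2 t) * k2))))"
      unfolding R1_def R2_def sum_divide_distrib sum_distrib_left sum_subtractf[symmetric]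
      by (intro sum.cong refl) (simp add: right_diff_distrib mult_ac)
    moreover have "Re (of_real r * (p - of_real c * q)) = r * (Re p - c * Re q)" for r p q
    proof -
      have rr: "Re (of_real r * u) = r * Re u" for r u by simp
      show ?thesis by (simp only: rr minus_complex.sel)
    qed
    ultimately have "Re (R1 x / k1 - of_real c * (R2 x / k2)) = (\<Sum>j<n. g j x * w (x j))"
      by (simp only: w_def Re_sum)
    also have "\<dots> \<le> (\<Sum>j<n. K * \<bar>g j x\<bar>)"
    proof (rule sum_mono)
      fix j
      have "g j x * w (x j) \<le> \<bar>g j x\<bar> * \<bar>w (x j)\<bar>" by (metis abs_ge_self abs_mult)
      also have "\<dots> \<le> \<bar>g j x\<bar> * K" by (intro mult_left_mono wK) auto
      finally show "g j x * w (x j) \<le> K * \<bar>g j x\<bar>" by (simp add: mult.commute)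
    qed
    finally have "Re (R1 x / k1 - of_real c * (R2 x / k2)) \<le> K * (\<Sum>j<n. \<bar>g j x\<bar>)" by (simp add: sum_distrib_left)
    then have "l * real n * Re (R1 x / k1 - of_real c * (R2 x / k2)) \<le> l * real n * (K * (\<Sum>j<n. \<bar>g j x\<bar>))"
      using l by (intro mult_left_mono) auto
    moreover have "Re (of_real r * u) = r * Re u" for r u by simp
    ultimately show "Re (of_real (l * real n) * (R1 x / k1 - of_real c * (R2 x / k2))) \<le> l * real n * (K * (\<Sum>j<n. \<bar>g j x\<bar>))"
      by (simp only:)
  qed
  also have "\<dots> = l * real n * (K * (\<integral>x. (\<Sum>j<n. \<bar>g j x\<bar>) \<partial>?M))" by (simp only: integral_mult_right_zero)
  also have "\<dots> \<le> l * real n * (K * S)" using l K0 S by (intro mult_left_mono) auto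
  also have "l * real n = 2 / (\<beta> * real n)" using n by (simp add: l_def power2_eq_square)
  finally show ?thesis by (simp add: k1_def k2_def L1_def L2_def)
qed

text \<open>\<open>K\<close> majorises the kernel of the loop equation at height t uniformly in the
  position y of a point. The factor c is 0 for one endpoint and 1 for the difference of two.\<close>

definition dominates_kernel :: "real \<Rightarrow> real \<Rightarrow> real \<Rightarrow> real \<Rightarrow> real \<Rightarrow> (real \<Rightarrow> real) \<Rightarrow> bool" where
  "dominates_kernel E1 E2 c a b K \<longleftrightarrow> integrable (lborel_Icc a b) K \<and>
     (\<forall>t\<in>{a..b}. \<forall>y. \<bar>Re (1 / ((of_real y - Complex E1 t) * sc_root (Complex E1 t)))
        - c * Re (1 / ((of_real y - Complex E2 t) * sc_root (Complex E2 t)))\<bar> \<le> K t)"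

text \<open>The loop equation is tested against the angle difference X itself. With Y its main part,
  X^2 <= 2 X Y + (X - Y)^2; X - Y is the remainder of bounded second moment, and the mean of X Y is
  an integral over heights of the correlations just computed. The gradient has total mass of order n
  |\<open>sc_root\<close>|, which supplies the factor before the integral of
  \<open>K\<close>.\<close>

theorem angle_variance:
  assumes \<beta>: "\<beta> > 0"
  obtains C where "C > 0"
    "\<And>n E1 E2 a b c K. n \<ge> 1 \<Longrightarrow> \<bar>E1\<bar> < 2 \<Longrightarrow> \<bar>E2\<bar> < 2 \<Longrightarrow> 0 < a \<Longrightarrow> a \<le> b \<Longrightarrow> \<bar>c\<bar> \<le> 1 \<Longrightarrow>
      1 \<le> real n * a * norm (sc_root (Complex E1 a)) \<Longrightarrow> 1 \<le> real n * a * norm (sc_root (Complex E2 a)) \<Longrightarrow>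
      1 \<le> b * norm (sc_root (Complex E1 a)) \<Longrightarrow> 1 \<le> b * norm (sc_root (Complex E2 a)) \<Longrightarrow>
      dominates_kernel E1 E2 c a b K \<Longrightarrow>
      (\<integral>x. (angle n E1 a b x - c * angle n E2 a b x)\<^sup>2 \<partial>scaled_gbe \<beta> n)
        \<le> C * (1 + (norm (sc_root (Complex E1 a)) + norm (sc_root (Complex E2 a))) * (\<integral>t. K t \<partial>lborel_Icc a b))"
proof -
  obtain C1 where C1: "C1 \<ge> 0" and rem: "\<And>n E a b. n \<ge> 1 \<Longrightarrow> \<bar>E\<bar> < 2 \<Longrightarrow> 0 < a \<Longrightarrow> a \<le> b \<Longrightarrow>
      1 \<le> real n * a * norm (sc_root (Complex E a)) \<Longrightarrow>
      integrable (scaled_gbe \<beta> n) (\<lambda>x. (angle n E a b x - angle_main \<beta> n E a b x)\<^sup>2) \<and>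
      (\<integral>x. (angle n E a b x - angle_main \<beta> n E a b x)\<^sup>2 \<partial>scaled_gbe \<beta> n) \<le> C1"
    by (rule angle_remainder_moment[OF \<beta>]) (rule that; assumption)
  obtain C2 where C2: "C2 \<ge> 0" and Im_mom: "\<And>n E a. n \<ge> 1 \<Longrightarrow> \<bar>E\<bar> < 2 \<Longrightarrow> 0 < a \<Longrightarrow> 1 \<le> real n * a * norm (sc_root (Complex E a)) \<Longrightarrow>
      (\<integral>x. Im (empirical_stieltjes n (Complex E a) x) \<partial>scaled_gbe \<beta> n) \<le> C2 * norm (sc_root (Complex E a))"
    by (rule expectation_Im_empirical[OF \<beta>]) (rule that; assumption)
  define C where "C = 4 * C1 + 4 / \<beta> * (C2 + 1) + 1"
  show ?thesis
  proof (rule that[of C])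
    show "C > 0" using C1 C2 \<beta> by (auto simp: C_def intro!: add_nonneg_pos add_nonneg_nonneg)
    fix n :: nat and E1 E2 a b c :: real and K :: "real \<Rightarrow> real"
    assume n: "n \<ge> 1" and E: "\<bar>E1\<bar> < 2" "\<bar>E2\<bar> < 2" and a: "0 < a" "a \<le> b" and c: "\<bar>c\<bar> \<le> 1"
      and cond: "1 \<le> real n * a * norm (sc_root (Complex E1 a))" "1 \<le> real n * a * norm (sc_root (Complex E2 a))"
      and b: "1 \<le> b * norm (sc_root (Complex E1 a))" "1 \<le> b * norm (sc_root (Complex E2 a))"
      and K_dom: "dominates_kernel E1 E2 c a b K"
    have K_int: "integrable (lborel_Icc a b) K"
      and K: "\<And>t y. t \<in> {a..b} \<Longrightarrow> \<bar>Re (1 / ((of_real y - Complex E1 t) * sc_root (Complex E1 t)))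
        - c * Re (1 / ((of_real y - Complex E2 t) * sc_root (Complex E2 t)))\<bar> \<le> K t"
      using K_dom by (auto simp: dominates_kernel_def)
    let ?M = "scaled_gbe \<beta> n" and ?L = "lborel_Icc a b"
    interpret prob_space ?M by (rule prob_space_scaled_gbe[OF \<beta>])
    have b0: "0 < b" using a by linarith
    define k where "k = norm (sc_root (Complex E1 a)) + norm (sc_root (Complex E2 a))"
    define X where "X x = angle n E1 a b x - c * angle n E2 a b x" for x
    define Y where "Y x = angle_main \<beta> n E1 a b x - c * angle_main \<beta> n E2 a b x" for x
    define g where "g j x = angle_slope E1 a b (x j) - c * angle_slope E2 a b (x j)" for j :: nat and x :: "nat \<Rightarrow> real"
    have smooth: "smooth_statistic n (\<lambda>x. of_real (X x)) (\<lambda>j x. of_real (g j x))"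
    proof -
      from smooth_statistic_add[OF smooth_statistic_angle[OF a(1) b0, of n E1]
          smooth_statistic_mult[OF smooth_statistic_const[of n "- of_real c"] smooth_statistic_angle[OF a(1) b0, of n E2]]]
      show ?thesis by (simp add: X_def g_def angle_slope_def)
    qed
    obtain A where A: "\<And>x. norm (complex_of_real (X x)) \<le> A" "\<And>j x. j < n \<Longrightarrow> norm (complex_of_real (g j x)) \<le> A" "A \<ge> 0"
      using smooth_statistic_bound[OF smooth] by metis
    have X_bound: "\<bar>X x\<bar> \<le> A" for x using A(1)[of x] by simp
    have X_meas[measurable]: "X \<in> borel_measurable (lebesgue_Rn n)" unfolding X_def[abs_def] by measurable
    have slope_meas[measurable]: "angle_slope E a b \<in> borel_measurable borel" for E unfolding angle_slope_def[abs_def] by measurable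
    \<comment> \<open>C2 times \<open>k\<close> accounts for the Poisson kernels at height a, the
      extra \<open>k\<close> for those at height b.\<close>
    define S where "S = real n * ((C2 + 1) * k)"
    have g_sum_meas: "(\<lambda>x. \<Sum>j<n. \<bar>g j x\<bar>) \<in> borel_measurable (lebesgue_Rn n)"
      unfolding g_def[abs_def] by measurable
    have g_int: "integrable ?M (\<lambda>x. \<Sum>j<n. \<bar>g j x\<bar>)"
    proof (rule integrable_bounded_scaled[OF \<beta> g_sum_meas])
      fix x
      have "(\<Sum>j<n. \<bar>g j x\<bar>) \<le> (\<Sum>j<n. A)" using A(2) by (intro sum_mono) auto
      then show "norm (\<Sum>j<n. \<bar>g j x\<bar>) \<le> real n * A" by (simp add: sum_nonneg)
    qed
    have Im_int: "integrable ?M (\<lambda>x. Im (empirical_stieltjes n (Complex E t) x))" if "t > 0" for E t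
      by (rule integrable_bounded_scaled[OF \<beta>, of _ _ "1 / Im (Complex E t)"])
        (use that order_trans[OF abs_Im_le_cmod norm_empirical_stieltjes_le[of "Complex E t" n]] in auto)
    have g_S: "(\<integral>x. (\<Sum>j<n. \<bar>g j x\<bar>) \<partial>?M) \<le> S"
    proof -
      define I where "I E t x = Im (empirical_stieltjes n (Complex E t) x)" for E t x
      have "(\<Sum>j<n. \<bar>g j x\<bar>) \<le> real n * (I E1 a x + I E1 b x + (I E2 a x + I E2 b x))" for x
      proof -
        define r where "r E t y = Im (1 / (of_real y - Complex E t))" for E t y
        have r: "r E a y \<ge> 0" "r E b y \<ge> 0" for y E unfolding r_def using a b0 by (auto intro!: Im_resolvent_nonneg)
        have "\<bar>g j x\<bar> \<le> r E1 a (x j) + r E1 b (x j) + (r E2 a (x j) + r E2 b (x j))" for j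
        proof -
          have "\<bar>g j x\<bar> \<le> \<bar>r E1 a (x j) - r E1 b (x j)\<bar> + \<bar>c\<bar> * \<bar>r E2 a (x j) - r E2 b (x j)\<bar>"
            unfolding g_def angle_slope_def r_def abs_mult[symmetric] by (rule abs_triangle_ineq4)
          moreover have "\<bar>c\<bar> * \<bar>r E2 a (x j) - r E2 b (x j)\<bar> \<le> 1 * \<bar>r E2 a (x j) - r E2 b (x j)\<bar>"
            using c by (intro mult_right_mono) auto
          moreover have "\<bar>r E a (x j) - r E b (x j)\<bar> \<le> r E a (x j) + r E b (x j)" for E
            using r[of E "x j"] by (simp add: abs_le_iff)
          note this[of E1] this[of E2]
          ultimately show ?thesis by linarith
        qed
        then have "(\<Sum>j<n. \<bar>g j x\<bar>) \<le> (\<Sum>j<n. r E1 a (x j) + r E1 b (x j) + (r E2 a (x j) + r E2 b (x j)))"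
          by (intro sum_mono)
        also have "\<dots> = real n * (I E1 a x + I E1 b x + (I E2 a x + I E2 b x))"
          unfolding sum.distrib r_def sum_Im_resolvent[OF n] I_def by (simp add: algebra_simps)
        finally show ?thesis .
      qed
      moreover have ints: "integrable ?M (I E a)" "integrable ?M (I E b)" for E
        unfolding I_def[abs_def] using a b0 by (auto intro: Im_int)
      ultimately have "(\<integral>x. (\<Sum>j<n. \<bar>g j x\<bar>) \<partial>?M) \<le> (\<integral>x. real n * (I E1 a x + I E1 b x + (I E2 a x + I E2 b x)) \<partial>?M)"
        by (intro integral_mono g_int integrable_mult_right Bochner_Integration.integrable_add)
      also have "\<dots> = real n * ((\<integral>x. I E1 a x \<partial>?M) + (\<integral>x. I E1 b x \<partial>?M) + ((\<integral>x. I E2 a x \<partial>?M) + (\<integral>x. I E2 b x \<partial>?M)))"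
        using ints by (simp only: integral_mult_right_zero Bochner_Integration.integral_add Bochner_Integration.integrable_add)
      also have "\<dots> \<le> real n * ((C2 * norm (sc_root (Complex E1 a)) + norm (sc_root (Complex E1 a))) + (C2 * norm (sc_root (Complex E2 a)) + norm (sc_root (Complex E2 a))))"
      proof -
        \<comment> \<open>At the upper end the trivial bound Im s <= 1 / b is enough; the hypothesis
          on b compares it with \<open>sc_root\<close> at height a.\<close>
        have ib: "(\<integral>x. I E b x \<partial>?M) \<le> norm (sc_root (Complex E a))" if "1 \<le> b * norm (sc_root (Complex E a))" for E
        proof -
          have "I E b x \<le> 1 / b" for x
            using order_trans[OF abs_Im_le_cmod norm_empirical_stieltjes_le[of "Complex E b" n x]] b0 unfolding I_def by fastforce
          then have "(\<integral>x. I E b x \<partial>?M) \<le> 1 / b" using ints by (intro integral_le_const) auto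
          also have "\<dots> \<le> norm (sc_root (Complex E a))" using that b0 by (simp add: field_simps)
          finally show ?thesis .
        qed
        have ia: "(\<integral>x. I E1 a x \<partial>?M) \<le> C2 * norm (sc_root (Complex E1 a))" "(\<integral>x. I E2 a x \<partial>?M) \<le> C2 * norm (sc_root (Complex E2 a))"
          unfolding I_def by (rule Im_mom[OF n E(1) a(1) cond(1)], rule Im_mom[OF n E(2) a(1) cond(2)])
        show ?thesis using ib[OF b(1)] ib[OF b(2)] ia by (intro mult_left_mono add_mono) auto
      qed
      also have "\<dots> = S" by (simp add: S_def k_def algebra_simps)
      finally show ?thesis .
    qed
    define h where "h x t = Re (of_nat n / sc_root (Complex E1 t) * loop_operator \<beta> n (Complex E1 t) x)
      - c * Re (of_nat n / sc_root (Complex E2 t) * loop_operator \<beta> n (Complex E2 t) x)" for x t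
    have Y_eq: "Y x = (\<integral>t. h x t \<partial>?L)" for x
    proof -
      have "integrable ?L (\<lambda>t. Re (of_nat n / sc_root (Complex E t) * loop_operator \<beta> n (Complex E t) x))" if "\<bar>E\<bar> < 2" for E
        using continuous_vertical_main[OF a(1) that] by (intro integrable_lborel_Icc_continuous continuous_on_Re)
      then show ?thesis unfolding Y_def h_def angle_main_def using E
        by (simp only: Bochner_Integration.integral_diff integrable_mult_right integral_mult_right_zero)
    qed
    obtain B1 where B1: "\<And>t x. t \<in> {a..b} \<Longrightarrow> \<bar>Re (of_nat n / sc_root (Complex E1 t) * loop_operator \<beta> n (Complex E1 t) x)\<bar> \<le> B1"
      using main_vertical_bounded[OF E(1) a(1)] by metis
    obtain B2 where B2: "\<And>t x. t \<in> {a..b} \<Longrightarrow> \<bar>Re (of_nat n / sc_root (Complex E2 t) * loop_operator \<beta> n (Complex E2 t) x)\<bar> \<le> B2"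
      using main_vertical_bounded[OF E(2) a(1)] by metis
    have h_bound: "\<bar>h x t\<bar> \<le> B1 + B2" if t: "t \<in> {a..b}" for x t
    proof -
      have "\<bar>h x t\<bar> \<le> B1 + \<bar>c\<bar> * B2"
        unfolding h_def using B1[OF t, of x] mult_left_mono[OF B2[OF t, of x] abs_ge_zero[of c]]
        unfolding abs_mult[symmetric] by linarith
      moreover have "\<bar>c\<bar> * B2 \<le> 1 * B2" using c B2[OF t, of x] by (intro mult_right_mono) auto
      ultimately show ?thesis by simp
    qed
    have f_meas: "(\<lambda>p. X (fst p) * h (fst p) (snd p)) \<in> borel_measurable (?M \<Otimes>\<^sub>M ?L)"
    proof -
      note [measurable] = main_measurable_scaled[OF \<beta> E(1) a(1), of n b] main_measurable_scaled[OF \<beta> E(2) a(1), of n b]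
      have [measurable]: "(\<lambda>p. X (fst p)) \<in> borel_measurable (?M \<Otimes>\<^sub>M ?L)"
        by (rule measurable_compose[OF fst_measurable_scaled[OF \<beta>] X_meas])
      show ?thesis unfolding h_def by measurable
    qed
    have f_bound: "\<bar>X x * h x t\<bar> \<le> A * (B1 + B2)" if "t \<in> {a..b}" for x t
      unfolding abs_mult using h_bound[OF that, of x] X_bound[of x] A(3) by (intro mult_mono) auto
    note FU = Fubini_scaled[OF \<beta> f_meas f_bound]
    have XY_eq: "(\<integral>t. X x * h x t \<partial>?L) = X x * Y x" for x unfolding Y_eq by (rule integral_mult_right_zero)
    have XY_int: "integrable ?M (\<lambda>x. X x * Y x)" using FU(1) unfolding XY_eq .
    have XY: "(\<integral>x. X x * Y x \<partial>?M) \<le> 2 / \<beta> * ((C2 + 1) * k) * (\<integral>t. K t \<partial>?L)"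
    proof -
      have "(\<integral>x. X x * Y x \<partial>?M) = (\<integral>t. (\<integral>x. X x * h x t \<partial>?M) \<partial>?L)" using FU(3) unfolding XY_eq .
      also have "\<dots> \<le> (\<integral>t. 2 / (\<beta> * real n) * (K t * S) \<partial>?L)"
      proof (rule integral_mono[OF FU(2)])
        show "integrable ?L (\<lambda>t. 2 / (\<beta> * real n) * (K t * S))" using K_int by (intro integrable_mult_right integrable_mult_left)
        fix t assume "t \<in> space ?L"
        then have t: "t \<in> {a..b}" "t > 0" using a by auto
        show "(\<integral>x. X x * h x t \<partial>?M) \<le> 2 / (\<beta> * real n) * (K t * S)"
          unfolding h_def by (rule correlation_pointwise[OF \<beta> n E t(2) smooth K[OF t(1)] g_int g_S])
      qed
      also have "\<dots> = 2 / (\<beta> * real n) * ((\<integral>t. K t \<partial>?L) * S)" by (simp only: integral_mult_right_zero integral_mult_left_zero)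
      also have "\<dots> = 2 / \<beta> * ((C2 + 1) * k) * (\<integral>t. K t \<partial>?L)" using n \<beta> by (simp add: S_def)
      finally show ?thesis .
    qed
    define R1 where "R1 x = angle n E1 a b x - angle_main \<beta> n E1 a b x" for x
    define R2 where "R2 x = angle n E2 a b x - angle_main \<beta> n E2 a b x" for x
    have R1: "integrable ?M (\<lambda>x. (R1 x)\<^sup>2)" "(\<integral>x. (R1 x)\<^sup>2 \<partial>?M) \<le> C1"
      using rem[OF n E(1) a cond(1)] by (simp_all add: R1_def)
    have R2: "integrable ?M (\<lambda>x. (R2 x)\<^sup>2)" "(\<integral>x. (R2 x)\<^sup>2 \<partial>?M) \<le> C1"
      using rem[OF n E(2) a cond(2)] by (simp_all add: R2_def)
    have X2_int: "integrable ?M (\<lambda>x. (X x)\<^sup>2)"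
      using X_bound by (intro integrable_bounded_scaled'[OF \<beta>, of _ _ "A\<^sup>2"]) (auto simp: abs_le_square_iff[symmetric] A(3))
    have pt: "(X x)\<^sup>2 \<le> 2 * (X x * Y x) + (2 * (R1 x)\<^sup>2 + 2 * (R2 x)\<^sup>2)" for x
    proof -
      have "X x - Y x = R1 x - c * R2 x" by (simp add: X_def Y_def R1_def R2_def algebra_simps)
      moreover have "(R1 x - c * R2 x)\<^sup>2 \<le> 2 * (R1 x)\<^sup>2 + 2 * (c * R2 x)\<^sup>2"
        using zero_le_power2[of "R1 x + c * R2 x"] by (simp add: power2_sum power2_diff)
      moreover have "(c * R2 x)\<^sup>2 \<le> (R2 x)\<^sup>2"
        unfolding power_mult_distrib using c by (intro mult_left_le_one_le) (auto simp: abs_square_le_1)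
      moreover have "(X x)\<^sup>2 \<le> 2 * (X x * Y x) + (X x - Y x)\<^sup>2" by (simp add: power2_diff)
      ultimately show ?thesis by simp
    qed
    have "(\<integral>x. (X x)\<^sup>2 \<partial>?M) \<le> (\<integral>x. 2 * (X x * Y x) + (2 * (R1 x)\<^sup>2 + 2 * (R2 x)\<^sup>2) \<partial>?M)"
      using X2_int XY_int R1 R2 pt by (intro integral_mono) auto
    also have "\<dots> = 2 * (\<integral>x. X x * Y x \<partial>?M) + (2 * (\<integral>x. (R1 x)\<^sup>2 \<partial>?M) + 2 * (\<integral>x. (R2 x)\<^sup>2 \<partial>?M))"
      using XY_int R1 R2 by simp
    also have "\<dots> \<le> 2 * (2 / \<beta> * ((C2 + 1) * k) * (\<integral>t. K t \<partial>?L)) + (2 * C1 + 2 * C1)"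
      using XY R1 R2 by (intro add_mono mult_left_mono) auto
    also have "\<dots> = (4 / \<beta> * (C2 + 1)) * (k * (\<integral>t. K t \<partial>?L)) + (4 * C1) * 1" by (simp add: algebra_simps)
    also have "\<dots> \<le> C * (k * (\<integral>t. K t \<partial>?L)) + C * 1"
    proof -
      have "K t \<ge> 0" if "t \<in> {a..b}" for t using K[OF that, of 0] by linarith
      then have "(\<integral>t. K t \<partial>?L) \<ge> 0" by (intro integral_nonneg_AE AE_I2) auto
      then have "k * (\<integral>t. K t \<partial>?L) \<ge> 0" by (simp add: k_def)
      moreover have "4 / \<beta> * (C2 + 1) \<ge> 0" using \<beta> C2 by simp
      ultimately show ?thesis using C1 by (intro add_mono mult_right_mono) (auto simp: C_def)
    qed
    finally show "(\<integral>x. (angle n E1 a b x - c * angle n E2 a b x)\<^sup>2 \<partial>?M)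
        \<le> C * (1 + (norm (sc_root (Complex E1 a)) + norm (sc_root (Complex E2 a))) * (\<integral>t. K t \<partial>?L))"
      by (simp add: X_def k_def algebra_simps)
  qed
qed

section \<open>Removing the truncation\<close>

definition phase :: "nat \<Rightarrow> real \<Rightarrow> real \<Rightarrow> (nat \<Rightarrow> real) \<Rightarrow> real" where
  "phase n E a x = (\<Sum>j<n. arctan ((x j - E) / a)) + real n * Im (sc_primitive (Complex E a))"

lemma angle_tendsto_phase:
  assumes "\<bar>E\<bar> < 2" and b: "filterlim b at_top sequentially"
  shows "(\<lambda>m. angle n E a (b m) x) \<longlonglongrightarrow> phase n E a x"
proof -
  have 1: "(\<lambda>m. arctan ((x j - E) / b m)) \<longlonglongrightarrow> 0" for j
  proof -
    have "(\<lambda>m. (x j - E) / b m) \<longlonglongrightarrow> 0"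
      by (rule tendsto_divide_0[OF tendsto_const filterlim_at_top_imp_at_infinity[OF b]])
    from tendsto_arctan[OF this] show ?thesis by simp
  qed
  have 2: "(\<lambda>m. Im (sc_primitive (Complex E (b m)))) \<longlonglongrightarrow> 0"
  proof (rule Lim_null_comparison)
    have "eventually (\<lambda>m. b m > 0) sequentially" using b by (rule eventually_compose_filterlim[OF eventually_gt_at_top])
    then show "\<forall>\<^sub>F m in sequentially. norm (Im (sc_primitive (Complex E (b m)))) \<le> 20 / b m"
      by eventually_elim (use Im_sc_primitive_bound[of "Complex E _"] assms in auto)
    show "(\<lambda>m. 20 / b m) \<longlonglongrightarrow> 0"
      by (rule tendsto_divide_0[OF tendsto_const filterlim_at_top_imp_at_infinity[OF b]])
  qed
  have "(\<lambda>m. angle n E a (b m) x) \<longlonglongrightarrow> (\<Sum>j<n. arctan ((x j - E) / a) - 0) - real n * (0 - Im (sc_primitive (Complex E a)))"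
    unfolding angle_def by (intro tendsto_intros 1 2)
  then show ?thesis by (simp add: phase_def)
qed

lemma phase_measurable [measurable]: "phase n E a \<in> borel_measurable (lebesgue_Rn n)"
  unfolding phase_def[abs_def] by measurable

lemma phase_bound: "\<bar>phase n E a x\<bar> \<le> real n * (pi / 2) + real n * \<bar>Im (sc_primitive (Complex E a))\<bar>"
proof -
  have "\<bar>arctan y\<bar> \<le> pi / 2" for y using arctan_bounded[of y] by linarith
  then have "\<bar>\<Sum>j<n. arctan ((x j - E) / a)\<bar> \<le> (\<Sum>j<n. pi / 2)"
    by (intro order_trans[OF sum_abs] sum_mono)
  then show ?thesis unfolding phase_def using abs_triangle_ineq[of "\<Sum>j<n. arctan ((x j - E) / a)" "real n * Im (sc_primitive (Complex E a))"]
    by (simp add: abs_mult)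
qed

lemma phase_square_integrable:
  assumes "\<beta> > 0" shows "integrable (scaled_gbe \<beta> n) (\<lambda>x. (phase n E a x)\<^sup>2)"
    "integrable (scaled_gbe \<beta> n) (\<lambda>x. (phase n E1 a x - c * phase n E2 a x)\<^sup>2)"
proof -
  define B where "B E = real n * (pi / 2) + real n * \<bar>Im (sc_primitive (Complex E a))\<bar>" for E
  have B: "\<bar>phase n E a x\<bar> \<le> B E" for E x unfolding B_def by (rule phase_bound)
  have B0: "B E \<ge> 0" for E by (simp add: B_def)
  show "integrable (scaled_gbe \<beta> n) (\<lambda>x. (phase n E a x)\<^sup>2)"
    by (rule integrable_bounded_scaled'[OF assms, of _ _ "(B E)\<^sup>2"])
      (use B[of E] B0[of E] in \<open>auto simp: abs_le_square_iff[symmetric]\<close>)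
  have C: "\<bar>phase n E1 a x - c * phase n E2 a x\<bar> \<le> B E1 + \<bar>c\<bar> * B E2" for x
  proof -
    have "\<bar>phase n E1 a x - c * phase n E2 a x\<bar> \<le> \<bar>phase n E1 a x\<bar> + \<bar>c\<bar> * \<bar>phase n E2 a x\<bar>"
      unfolding abs_mult[symmetric] by (rule abs_triangle_ineq4)
    also have "\<dots> \<le> B E1 + \<bar>c\<bar> * B E2" by (intro add_mono mult_left_mono B) auto
    finally show ?thesis .
  qed
  have C0: "B E1 + \<bar>c\<bar> * B E2 \<ge> 0" using B0 by simp
  show "integrable (scaled_gbe \<beta> n) (\<lambda>x. (phase n E1 a x - c * phase n E2 a x)\<^sup>2)"
    by (rule integrable_bounded_scaled'[OF assms, of _ _ "(B E1 + \<bar>c\<bar> * B E2)\<^sup>2"])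
      (use C C0 in \<open>auto simp: abs_le_square_iff[symmetric]\<close>)
qed

text \<open>The kernel bound is uniform in the upper height, so Fatou's lemma passes to the limit b
  to infinity.\<close>

theorem phase_variance:
  assumes \<beta>: "\<beta> > 0"
  obtains C where "C > 0"
    "\<And>n E1 E2 a c K I. n \<ge> 1 \<Longrightarrow> \<bar>E1\<bar> < 2 \<Longrightarrow> \<bar>E2\<bar> < 2 \<Longrightarrow> 0 < a \<Longrightarrow> \<bar>c\<bar> \<le> 1 \<Longrightarrow>
      1 \<le> real n * a * norm (sc_root (Complex E1 a)) \<Longrightarrow> 1 \<le> real n * a * norm (sc_root (Complex E2 a)) \<Longrightarrow>
      \<forall>b\<ge>a. dominates_kernel E1 E2 c a b K \<and> (\<integral>t. K t \<partial>lborel_Icc a b) \<le> I \<Longrightarrow>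
      (\<integral>x. (phase n E1 a x - c * phase n E2 a x)\<^sup>2 \<partial>scaled_gbe \<beta> n)
        \<le> C * (1 + (norm (sc_root (Complex E1 a)) + norm (sc_root (Complex E2 a))) * I)"
proof -
  obtain C where C: "C > 0" and angle: "\<And>n E1 E2 a b c K. n \<ge> 1 \<Longrightarrow> \<bar>E1\<bar> < 2 \<Longrightarrow> \<bar>E2\<bar> < 2 \<Longrightarrow> 0 < a \<Longrightarrow> a \<le> b \<Longrightarrow> \<bar>c\<bar> \<le> 1 \<Longrightarrow>
      1 \<le> real n * a * norm (sc_root (Complex E1 a)) \<Longrightarrow> 1 \<le> real n * a * norm (sc_root (Complex E2 a)) \<Longrightarrow>
      1 \<le> b * norm (sc_root (Complex E1 a)) \<Longrightarrow> 1 \<le> b * norm (sc_root (Complex E2 a)) \<Longrightarrow>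
      dominates_kernel E1 E2 c a b K \<Longrightarrow>
      (\<integral>x. (angle n E1 a b x - c * angle n E2 a b x)\<^sup>2 \<partial>scaled_gbe \<beta> n)
        \<le> C * (1 + (norm (sc_root (Complex E1 a)) + norm (sc_root (Complex E2 a))) * (\<integral>t. K t \<partial>lborel_Icc a b))"
    by (rule angle_variance[OF \<beta>]) (rule that; assumption)
  show ?thesis
  proof (rule that[OF C])
    fix n :: nat and E1 E2 a c I :: real and K :: "real \<Rightarrow> real"
    assume n: "n \<ge> 1" and E: "\<bar>E1\<bar> < 2" "\<bar>E2\<bar> < 2" and a: "0 < a" and c: "\<bar>c\<bar> \<le> 1"
      and cond: "1 \<le> real n * a * norm (sc_root (Complex E1 a))" "1 \<le> real n * a * norm (sc_root (Complex E2 a))"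
      and KI: "\<forall>b\<ge>a. dominates_kernel E1 E2 c a b K \<and> (\<integral>t. K t \<partial>lborel_Icc a b) \<le> I"
    let ?M = "scaled_gbe \<beta> n"
    interpret prob_space ?M by (rule prob_space_scaled_gbe[OF \<beta>])
    define k1 where "k1 = norm (sc_root (Complex E1 a))"
    define k2 where "k2 = norm (sc_root (Complex E2 a))"
    have k: "k1 > 0" "k2 > 0" unfolding k1_def k2_def using E norm_sc_root_pos[of "Complex E1 a"] norm_sc_root_pos[of "Complex E2 a"] by auto
    \<comment> \<open>The summands 1 / k1 and 1 / k2 ensure the conditions on b from the first term
      of the sequence on.\<close>
    define b where "b m = a + 1 / k1 + 1 / k2 + real m" for m
    have b: "a \<le> b m" "1 \<le> b m * k1" "1 \<le> b m * k2" for m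
      using k a by (auto simp: b_def field_simps)
    have b_lim: "filterlim b at_top sequentially"
      unfolding b_def by (rule filterlim_tendsto_add_at_top[OF tendsto_const filterlim_real_sequentially])
    define B where "B = C * (1 + (k1 + k2) * I)"
    define u where "u m x = (angle n E1 a (b m) x - c * angle n E2 a (b m) x)\<^sup>2" for m x
    have u_meas: "u m \<in> borel_measurable ?M" for m unfolding u_def[abs_def] by measurable
    have u_int: "integrable ?M (u m)" for m
    proof -
      have sm: "smooth_statistic n (\<lambda>x. complex_of_real (angle n E a (b m) x)) (\<lambda>j x. of_real (Im (1 / (of_real (x j) - Complex E a)) - Im (1 / (of_real (x j) - Complex E (b m)))))" for E
        using a b(1)[of m] by (intro smooth_statistic_angle) auto
      obtain A1 where A1: "\<And>x. norm (complex_of_real (angle n E1 a (b m) x)) \<le> A1" using smooth_statistic_bound[OF sm] by metis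
      obtain A2 where A2: "\<And>x. norm (complex_of_real (angle n E2 a (b m) x)) \<le> A2" using smooth_statistic_bound[OF sm] by metis
      have "\<bar>angle n E1 a (b m) x - c * angle n E2 a (b m) x\<bar> \<le> A1 + \<bar>c\<bar> * A2" for x
      proof -
        have "\<bar>angle n E1 a (b m) x - c * angle n E2 a (b m) x\<bar> \<le> \<bar>angle n E1 a (b m) x\<bar> + \<bar>c\<bar> * \<bar>angle n E2 a (b m) x\<bar>"
          unfolding abs_mult[symmetric] by (rule abs_triangle_ineq4)
        also have "\<dots> \<le> A1 + \<bar>c\<bar> * A2" using A1[of x] A2[of x] by (intro add_mono mult_left_mono) auto
        finally show ?thesis .
      qed
      from power_mono[OF this abs_ge_zero, where n = 2] show ?thesis
        using u_meas[of m] by (intro integrable_bounded_scaled'[OF \<beta>, of _ _ "(A1 + \<bar>c\<bar> * A2)\<^sup>2"]) (auto simp: u_def measurable_cong_sets[OF sets_scaled_gbe refl])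
    qed
    have u_le: "(\<integral>\<^sup>+ x. ennreal (u m x) \<partial>?M) \<le> ennreal B" for m
    proof -
      have "(\<integral>x. u m x \<partial>?M) \<le> C * (1 + (k1 + k2) * (\<integral>t. K t \<partial>lborel_Icc a (b m)))"
        unfolding u_def k1_def k2_def
        by (rule angle[OF n E a b(1) c cond b(2,3)[unfolded k1_def k2_def]]) (use KI b(1) in auto)
      also have "\<dots> \<le> B" unfolding B_def using KI b(1)[of m] k C by (intro mult_left_mono add_left_mono) auto
      finally have "ennreal (\<integral>x. u m x \<partial>?M) \<le> ennreal B" by (rule ennreal_leI)
      moreover have "AE x in ?M. 0 \<le> u m x" by (simp add: u_def)
      ultimately show ?thesis by (simp only: nn_integral_eq_integral[OF u_int])
    qed
    have lim: "(\<lambda>m. ennreal (u m x)) \<longlonglongrightarrow> ennreal ((phase n E1 a x - c * phase n E2 a x)\<^sup>2)" for x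
      unfolding u_def by (intro tendsto_ennrealI tendsto_intros angle_tendsto_phase b_lim E)
    have "(\<integral>\<^sup>+ x. ennreal ((phase n E1 a x - c * phase n E2 a x)\<^sup>2) \<partial>?M) = (\<integral>\<^sup>+ x. liminf (\<lambda>m. ennreal (u m x)) \<partial>?M)"
      by (intro nn_integral_cong) (simp add: lim_imp_Liminf[OF _ lim])
    also have "\<dots> \<le> liminf (\<lambda>m. \<integral>\<^sup>+ x. ennreal (u m x) \<partial>?M)"
      using u_meas by (intro nn_integral_liminf) auto
    also have "\<dots> \<le> liminf (\<lambda>m. ennreal B)" by (intro Liminf_mono always_eventually allI u_le)
    also have "\<dots> = ennreal B" by (rule Liminf_const) simp
    finally have "ennreal (\<integral>x. (phase n E1 a x - c * phase n E2 a x)\<^sup>2 \<partial>?M) \<le> ennreal B"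
      by (subst (asm) nn_integral_eq_integral[OF phase_square_integrable(2)[OF \<beta>]]) auto
    \<comment> \<open>Needed to return from extended to real numbers. The degenerate interval {a..a}
      shows that I is nonnegative.\<close>
    moreover have "B \<ge> 0"
    proof -
      have "\<forall>t\<in>{a..a}. \<forall>y. \<bar>Re (1 / ((of_real y - Complex E1 t) * sc_root (Complex E1 t)))
        - c * Re (1 / ((of_real y - Complex E2 t) * sc_root (Complex E2 t)))\<bar> \<le> K t"
        using KI unfolding dominates_kernel_def by blast
      then have "K t \<ge> 0" if "t \<in> {a..a}" for t using that by (meson abs_ge_zero order_trans)
      then have "0 \<le> (\<integral>t. K t \<partial>lborel_Icc a a)" by (intro integral_nonneg_AE AE_I2) auto
      also have "\<dots> \<le> I" using KI by simp
      finally show ?thesis using C k by (simp add: B_def)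
    qed
    ultimately show "(\<integral>x. (phase n E1 a x - c * phase n E2 a x)\<^sup>2 \<partial>?M) \<le> C * (1 + (norm (sc_root (Complex E1 a)) + norm (sc_root (Complex E2 a))) * I)"
      by (simp add: B_def k1_def k2_def)
  qed
qed

section \<open>Bounds for the kernels\<close>

lemma norm_sc_root_vertical_lower:
  assumes "\<bar>E\<bar> < 2" "\<alpha> \<le> 2 - \<bar>E\<bar>" "0 < \<alpha>" "0 \<le> t"
  shows "sqrt (2 * \<alpha>) \<le> norm (sc_root (Complex E t))" "sqrt (2 * t) \<le> norm (sc_root (Complex E t))"
    "(sqrt \<alpha> + sqrt t) / sqrt 2 \<le> norm (sc_root (Complex E t))"
proof -
  have 1: "2 * \<alpha> \<le> (norm (sc_root (Complex E t)))\<^sup>2" "2 * t \<le> (norm (sc_root (Complex E t)))\<^sup>2"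
    using norm_sc_root_lower(1,2)[of "Complex E t"] assms by auto
  show a: "sqrt (2 * \<alpha>) \<le> norm (sc_root (Complex E t))" "sqrt (2 * t) \<le> norm (sc_root (Complex E t))"
    using 1 by (auto intro!: real_le_lsqrt real_sqrt_le_iff[THEN iffD1] simp: real_le_lsqrt)
  have e: "(sqrt \<alpha> + sqrt t) / sqrt 2 = (sqrt (2 * \<alpha>) + sqrt (2 * t)) / 2"
    by (simp add: real_sqrt_mult field_simps)
  have "(p + q) / 2 \<le> r" if "p \<le> r" "q \<le> r" for p q r :: real using that by simp
  from this[OF a] show "(sqrt \<alpha> + sqrt t) / sqrt 2 \<le> norm (sc_root (Complex E t))" unfolding e .
qed

lemma norm_kernel_le:
  assumes "t > 0" shows "norm (1 / ((of_real y - Complex E t) * sc_root (Complex E t))) \<le> 1 / (t * norm (sc_root (Complex E t)))"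
proof -
  have "norm (1 / (of_real y - Complex E t)) / norm (sc_root (Complex E t)) \<le> (1 / t) / norm (sc_root (Complex E t))"
    using norm_resolvent_le[of "Complex E t" y] assms by (intro divide_right_mono) auto
  then show ?thesis by (simp add: norm_divide norm_mult)
qed

text \<open>|\<open>sc_root\<close>| is at least of order sqrt \<alpha> + sqrt t: below height
  \<alpha> the kernel behaves like 1 / (t sqrt \<alpha>) and produces the logarithm of \<alpha> / a,
  above it decays like t^(-3/2). Hence no upper cutoff is needed.\<close>

lemma one_sided_kernel:
  assumes E: "\<bar>E\<bar> < 2" "\<alpha> \<le> 2 - \<bar>E\<bar>" "0 < \<alpha>" and a: "0 < a"
  defines "K \<equiv> \<lambda>t. sqrt 2 / (t * (sqrt \<alpha> + sqrt t))"
  shows "a \<le> b \<Longrightarrow> integrable (lborel_Icc a b) K \<and> (\<integral>t. K t \<partial>lborel_Icc a b) \<le> 2 * sqrt 2 / sqrt \<alpha> * ln (1 + sqrt (\<alpha> / a))"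
    and "a \<le> t \<Longrightarrow> \<bar>Re (1 / ((of_real y - Complex E t) * sc_root (Complex E t)))\<bar> \<le> K t"
proof -
  assume ab: "a \<le> b"
  have pos: "sqrt \<alpha> + sqrt t > 0" if "t \<ge> 0" for t using E(3) that by (simp add: add_pos_nonneg)
  have cont: "continuous_on {a..b} K"
    unfolding K_def using a pos by (intro continuous_intros) (auto simp: less_imp_neq[symmetric])
  \<comment> \<open>Partial fractions in the variable sqrt t.\<close>
  define F where "F t = 2 * sqrt 2 / sqrt \<alpha> * (ln (sqrt t) - ln (sqrt t + sqrt \<alpha>))" for t
  have "(\<integral>t. K t \<partial>lborel_Icc a b) = F b - F a"
  proof (rule integral_lborel_Icc_FTC[OF ab _ cont])
    fix t assume "t \<in> {a..b}"
    then have t: "t > 0" using a by auto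
    have p: "sqrt t + sqrt \<alpha> > 0" using t E(3) by (simp add: add_pos_pos)
    have "(F has_real_derivative 2 * sqrt 2 / sqrt \<alpha> * (inverse (sqrt t) / 2 / sqrt t - (inverse (sqrt t) / 2) / (sqrt t + sqrt \<alpha>))) (at t)"
    proof -
      have "((\<lambda>t. ln (sqrt t) - ln (sqrt t + sqrt \<alpha>)) has_real_derivative
          (inverse (sqrt t) / 2 / sqrt t - (inverse (sqrt t) / 2) / (sqrt t + sqrt \<alpha>))) (at t)"
        using t p by (auto intro!: derivative_eq_intros) (simp_all add: divide_simps)
      from DERIV_cmult[OF this] show ?thesis unfolding F_def .
    qed
    moreover have "2 * sqrt 2 / sqrt \<alpha> * (inverse (sqrt t) / 2 / sqrt t - (inverse (sqrt t) / 2) / (sqrt t + sqrt \<alpha>)) = K t"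
    proof -
      define s where "s = sqrt t" define q where "q = sqrt \<alpha>"
      have sq: "s > 0" "q > 0" "t = s * s" using t E(3) by (auto simp: s_def q_def)
      then have "inverse s / 2 / s - inverse s / 2 / (s + q) = q / (2 * (s * s) * (s + q))"
        by (simp add: divide_simps)
      then show ?thesis using sq unfolding K_def s_def[symmetric] q_def[symmetric]
        by (simp add: add.commute)
    qed
    ultimately show "(F has_real_derivative K t) (at t)" by simp
  qed
  also have "\<dots> \<le> 2 * sqrt 2 / sqrt \<alpha> * ln (1 + sqrt (\<alpha> / a))"
  proof -
    have "ln (sqrt b) \<le> ln (sqrt b + sqrt \<alpha>)"
      using ab a E(3) by (subst ln_le_cancel_iff) (auto intro: add_pos_pos)
    moreover have "ln (sqrt a + sqrt \<alpha>) - ln (sqrt a) = ln (1 + sqrt (\<alpha> / a))"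
    proof -
      have "1 + sqrt (\<alpha> / a) = (sqrt a + sqrt \<alpha>) / sqrt a" using a by (simp add: real_sqrt_divide add_divide_distrib)
      then show ?thesis using a E(3) by (simp add: ln_divide_pos add_pos_pos)
    qed
    ultimately have "(ln (sqrt b) - ln (sqrt b + sqrt \<alpha>)) - (ln (sqrt a) - ln (sqrt a + sqrt \<alpha>)) \<le> ln (1 + sqrt (\<alpha> / a))" by linarith
    then have "2 * sqrt 2 / sqrt \<alpha> * ((ln (sqrt b) - ln (sqrt b + sqrt \<alpha>)) - (ln (sqrt a) - ln (sqrt a + sqrt \<alpha>))) \<le> 2 * sqrt 2 / sqrt \<alpha> * ln (1 + sqrt (\<alpha> / a))"
      using E(3) by (intro mult_left_mono) auto
    then show ?thesis by (simp add: F_def right_diff_distrib)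
  qed
  finally show "integrable (lborel_Icc a b) K \<and> (\<integral>t. K t \<partial>lborel_Icc a b) \<le> 2 * sqrt 2 / sqrt \<alpha> * ln (1 + sqrt (\<alpha> / a))"
    using integrable_lborel_Icc_continuous[OF cont] by simp
next
  assume at: "a \<le> t"
  then have t: "t > 0" using a by simp
  have p: "(sqrt \<alpha> + sqrt t) / sqrt 2 > 0" using t E(3) by (simp add: add_pos_pos)
  have "\<bar>Re (1 / ((of_real y - Complex E t) * sc_root (Complex E t)))\<bar> \<le> 1 / (t * norm (sc_root (Complex E t)))"
    by (rule order_trans[OF abs_Re_le_cmod norm_kernel_le[OF t]])
  also have "\<dots> \<le> 1 / (t * ((sqrt \<alpha> + sqrt t) / sqrt 2))"
    using norm_sc_root_vertical_lower(3)[OF E, of t] t p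
    by (intro divide_left_mono mult_left_mono mult_pos_pos) auto
  also have "\<dots> = K t" by (simp add: K_def)
  finally show "\<bar>Re (1 / ((of_real y - Complex E t) * sc_root (Complex E t)))\<bar> \<le> K t" .
qed

text \<open>With l = |E1 - E2|, the trivial bound is of order 1 / (t sqrt \<alpha>) and the
  Lipschitz bound of order l / (t^2 sqrt \<alpha>). Their minimum is l / (t (t + l) sqrt \<alpha>)
  up to a constant, so heights above l contribute a bounded amount to the integral after
  multiplication by sqrt \<alpha>.\<close>

lemma kernel_difference:
  assumes E1: "\<bar>E1\<bar> < 2" "\<alpha> \<le> 2 - \<bar>E1\<bar>" and E2: "\<bar>E2\<bar> < 2" "\<alpha> \<le> 2 - \<bar>E2\<bar>" and \<alpha>: "0 < \<alpha>" and t: "0 < t"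
  shows "norm (1 / ((of_real y - Complex E1 t) * sc_root (Complex E1 t)) - 1 / ((of_real y - Complex E2 t) * sc_root (Complex E2 t)))
    \<le> 8 / sqrt (2 * \<alpha>) * (\<bar>E1 - E2\<bar> / (t * (t + \<bar>E1 - E2\<bar>)))"
proof -
  define l where "l = \<bar>E1 - E2\<bar>"
  define m where "m = sqrt (2 * \<alpha>)"
  define z1 where "z1 = Complex E1 t" define z2 where "z2 = Complex E2 t"
  define k1 where "k1 = sc_root z1" define k2 where "k2 = sc_root z2"
  define r1 where "r1 = 1 / (of_real y - z1)" define r2 where "r2 = 1 / (of_real y - z2)"
  have m: "m > 0" using \<alpha> by (simp add: m_def)
  have l: "l \<ge> 0" by (simp add: l_def)
  have k: "norm k1 \<ge> m" "norm k2 \<ge> m" unfolding k1_def k2_def z1_def z2_def m_def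
    using norm_sc_root_vertical_lower(1)[OF E1 \<alpha>, of t] norm_sc_root_vertical_lower(1)[OF E2 \<alpha>, of t] t by auto
  have k0: "norm k1 > 0" "norm k2 > 0" using k m by linarith+
  have knz: "k1 \<noteq> 0" "k2 \<noteq> 0" using k0 by auto
  have r: "norm r1 \<le> 1 / t" "norm r2 \<le> 1 / t"
    using norm_resolvent_le[of z1 y] norm_resolvent_le[of z2 y] t by (auto simp: r1_def r2_def z1_def z2_def)
  have ynz: "of_real y - z1 \<noteq> 0" "of_real y - z2 \<noteq> 0"
    using real_minus_nonreal[of z1 y] real_minus_nonreal[of z2 y] t by (auto simp: z1_def z2_def)
  have zl: "norm (z1 - z2) = l" by (simp add: z1_def z2_def l_def cmod_def)
  have e: "1 / ((of_real y - z1) * k1) - 1 / ((of_real y - z2) * k2) = r1 / k1 - r2 / k2" by (simp add: r1_def r2_def)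
  have ik: "1 / norm k1 \<le> 1 / m" "1 / norm k2 \<le> 1 / m" using k m k0 by (auto intro!: divide_left_mono)
  have rk: "norm (r1 / k1) \<le> (1 / t) * (1 / m)" "norm (r2 / k2) \<le> (1 / t) * (1 / m)"
  proof -
    have "norm r1 * (1 / norm k1) \<le> (1 / t) * (1 / m)" "norm r2 * (1 / norm k2) \<le> (1 / t) * (1 / m)"
      by (rule mult_mono[OF r(1) ik(1)], use t in simp, simp, rule mult_mono[OF r(2) ik(2)], use t in simp, simp)
    then show "norm (r1 / k1) \<le> (1 / t) * (1 / m)" "norm (r2 / k2) \<le> (1 / t) * (1 / m)" by (simp_all add: norm_divide)
  qed
  have b1: "norm (r1 / k1 - r2 / k2) \<le> 4 * ((1 / t) * (1 / m))"
  proof -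
    have "norm (r1 / k1 - r2 / k2) \<le> norm (r1 / k1) + norm (r2 / k2)" by (rule norm_triangle_ineq4)
    also have "\<dots> \<le> (1 / t) * (1 / m) + (1 / t) * (1 / m)" by (rule add_mono[OF rk])
    also have "\<dots> \<le> 4 * ((1 / t) * (1 / m))" using t m by (simp add: field_simps)
    finally show ?thesis .
  qed
  have rd: "norm (r1 - r2) \<le> l * ((1 / t) * (1 / t))"
  proof -
    have "r1 - r2 = (z1 - z2) * (r1 * r2)"
      unfolding r1_def r2_def using ynz by (simp add: field_simps)
    then have "norm (r1 - r2) = l * (norm r1 * norm r2)" by (simp add: norm_mult zl)
    also have "\<dots> \<le> l * ((1 / t) * (1 / t))" using r l t by (intro mult_left_mono mult_mono) auto
    finally show ?thesis .
  qed
  \<comment> \<open>The numerator |z1| + |z2| of the root difference is not bounded at large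
    heights; it is traded for the squared roots divided by t, using Im z |z| <=
    |\<open>sc_root z\<close>|^2.\<close>
  have kd: "norm (1 / k1 - 1 / k2) \<le> 3 * (l * ((1 / t) * (1 / m)))"
  proof -
    have z_le: "norm z1 \<le> (norm k1)\<^sup>2 / t" "norm z2 \<le> (norm k2)\<^sup>2 / t"
      using norm_sc_root_lower(3)[of z1] norm_sc_root_lower(3)[of z2] E1 E2 t
      by (simp_all add: k1_def k2_def z1_def z2_def pos_le_divide_eq mult.commute)
    have "norm (1 / k1 - 1 / k2) = norm (k1 - k2) / (norm k1 * norm k2)"
    proof -
      have "1 / k1 - 1 / k2 = - ((k1 - k2) / (k1 * k2))" using knz by (simp add: field_simps)
      then show ?thesis by (simp only: norm_minus_cancel norm_divide norm_mult)
    qed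
    also have "\<dots> \<le> (sqrt 2 * l * (norm z1 + norm z2) / (norm k1 + norm k2)) / (norm k1 * norm k2)"
      using sc_root_diff_le[of z1 z2] E1 E2 t zl
      by (intro divide_right_mono) (auto simp: k1_def k2_def z1_def z2_def)
    also have "\<dots> \<le> (sqrt 2 * l * ((norm k1 + norm k2)\<^sup>2 / t) / (norm k1 + norm k2)) / (norm k1 * norm k2)"
    proof (intro divide_right_mono mult_left_mono)
      have "norm z1 + norm z2 \<le> ((norm k1)\<^sup>2 + (norm k2)\<^sup>2) / t" using z_le by (simp add: add_divide_distrib)
      also have "\<dots> \<le> (norm k1 + norm k2)\<^sup>2 / t" using t by (intro divide_right_mono) (auto simp: power2_sum)
      finally show "norm z1 + norm z2 \<le> (norm k1 + norm k2)\<^sup>2 / t" .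
    qed (use l in auto)
    also have "\<dots> = sqrt 2 * (l * ((1 / t) * (1 / norm k1 + 1 / norm k2)))"
    proof -
      have gen: "(sqrt 2 * l * ((p + q)\<^sup>2 / t) / (p + q)) / (p * q) = sqrt 2 * (l * ((1 / t) * (1 / p + 1 / q)))"
        if "p > 0" "q > 0" for p q :: real
      proof -
        have S: "p + q > 0" using that by simp
        have i: "1 / p + 1 / q = (p + q) / (p * q)" using that by (simp add: field_simps)
        have g: "(c * (S\<^sup>2 / t) / S) / w = c * ((1 / t) * (S / w))" if "S > 0" for c S w :: real
          using that by (simp add: power2_eq_square)
        show ?thesis unfolding i g[OF S] by (simp only: mult.assoc)
      qed
      show ?thesis by (rule gen[OF k0])
    qed
    also have "\<dots> \<le> 3 / 2 * (l * ((1 / t) * (1 / m + 1 / m)))"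
    proof -
      have "sqrt 2 \<le> 3 / 2" by (rule real_le_lsqrt) (simp_all add: power2_eq_square)
      then show ?thesis using ik l t m k0 by (intro mult_mono mult_nonneg_nonneg add_mono) auto
    qed
    finally show ?thesis by (simp add: field_simps)
  qed
  have b2: "norm (r1 / k1 - r2 / k2) \<le> 4 * (l / t * ((1 / t) * (1 / m)))"
  proof -
    have "r1 / k1 - r2 / k2 = (r1 - r2) * (1 / k1) + r2 * (1 / k1 - 1 / k2)"
      by (simp add: diff_divide_distrib right_diff_distrib)
    then have "norm (r1 / k1 - r2 / k2) \<le> norm (r1 - r2) * (1 / norm k1) + norm r2 * norm (1 / k1 - 1 / k2)"
      by (metis norm_triangle_ineq norm_mult norm_divide norm_one)
    also have "\<dots> \<le> (l * ((1 / t) * (1 / t))) * (1 / m) + (1 / t) * (3 * (l * ((1 / t) * (1 / m))))"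
      using rd ik r kd l t m by (intro add_mono mult_mono) auto
    finally show ?thesis by (simp add: field_simps)
  qed
  have "norm (r1 / k1 - r2 / k2) \<le> 8 / m * (l / (t * (t + l)))"
  \<comment> \<open>In both cases min 1 (l / t) <= 2 l / (t + l), applied to the bounds with
    constant 4.\<close>
  proof (cases "l \<le> t")
    case True
    have "4 * (l / t * ((1 / t) * (1 / m))) \<le> 8 / m * (l / (t * (t + l)))"
    proof -
      have "l * (t + l) \<le> l * (2 * t)" using True l by (intro mult_left_mono) auto
      then have "l / t \<le> 2 * (l / (t + l))" using t l by (simp add: field_simps)
      then have "(4 / (t * m)) * (l / t) \<le> (4 / (t * m)) * (2 * (l / (t + l)))" using t m by (intro mult_left_mono) auto
      then show ?thesis by (simp add: field_simps)
    qed
    then show ?thesis using b2 by linarith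
  next
    case False
    have "1 \<le> 2 * (l / (t + l))" using False t by (simp add: field_simps)
    then have "(4 / (t * m)) * 1 \<le> (4 / (t * m)) * (2 * (l / (t + l)))" using t m by (intro mult_left_mono) auto
    then have "4 * ((1 / t) * (1 / m)) \<le> 8 / m * (l / (t * (t + l)))" by (simp add: field_simps)
    then show ?thesis using b1 by linarith
  qed
  then have "norm (1 / ((of_real y - z1) * k1) - 1 / ((of_real y - z2) * k2)) \<le> 8 / m * (l / (t * (t + l)))"
    by (simp only: e)
  then show ?thesis by (simp only: l_def m_def k1_def k2_def z1_def z2_def)
qed

lemma two_sided_kernel_integral:
  assumes "0 < a" "0 \<le> l" "c \<ge> 0" "a \<le> b"
  shows "integrable (lborel_Icc a b) (\<lambda>t. c * (l / (t * (t + l)))) \<and>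
    (\<integral>t. c * (l / (t * (t + l))) \<partial>lborel_Icc a b) \<le> c * ln (1 + l / a)"
proof -
  have cont: "continuous_on {a..b} (\<lambda>t. c * (l / (t * (t + l))))"
    using assms by (intro continuous_intros) (auto simp: add_eq_0_iff)
  have "(\<integral>t. c * (l / (t * (t + l))) \<partial>lborel_Icc a b) = c * (ln b - ln (b + l)) - c * (ln a - ln (a + l))"
  proof (rule integral_lborel_Icc_FTC[OF assms(4) _ cont])
    fix t assume "t \<in> {a..b}"
    then have t: "t > 0" "t + l > 0" using assms by auto
    then have "((\<lambda>t. c * (ln t - ln (t + l))) has_real_derivative c * (1 / t - 1 / (t + l))) (at t)"
      by (auto intro!: derivative_eq_intros)
    moreover have "1 / t - 1 / (t + l) = l / (t * (t + l))" using t by (simp add: field_simps)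
    ultimately show "((\<lambda>t. c * (ln t - ln (t + l))) has_real_derivative c * (l / (t * (t + l)))) (at t)" by simp
  qed
  also have "\<dots> = c * ((ln b - ln (b + l)) + (ln (a + l) - ln a))" by (simp add: algebra_simps)
  also have "\<dots> \<le> c * ln (1 + l / a)"
  proof (intro mult_left_mono)
    have "ln b \<le> ln (b + l)" using assms by simp
    moreover have "ln (a + l) - ln a = ln (1 + l / a)"
    proof -
      have "1 + l / a = (a + l) / a" using assms by (simp add: add_divide_distrib)
      then show ?thesis using assms by (simp only: ln_divide_pos[of "a + l" a])
    qed
    ultimately show "(ln b - ln (b + l)) + (ln (a + l) - ln a) \<le> ln (1 + l / a)" by linarith
  qed (use assms in auto)
  finally show ?thesis using integrable_lborel_Icc_continuous[OF cont] by simp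
qed

section \<open>Logarithms and the choice of scales\<close>

lemma ln_two_ge: "ln (2::real) \<ge> 1 / 2"
proof -
  have "exp (1 / 2 :: real) \<le> 2"
  proof (rule power2_le_imp_le)
    have "(exp (1 / 2 :: real))\<^sup>2 = exp 1" by (simp add: exp_double[symmetric])
    then show "(exp (1 / 2 :: real))\<^sup>2 \<le> 2\<^sup>2" using exp_le by simp
  qed simp
  then show ?thesis by (subst ln_ge_iff) auto
qed

lemma ln_two_plus_ge: "u \<ge> 0 \<Longrightarrow> ln (2 + u :: real) \<ge> 1 / 2"
  using ln_two_ge ln_mono[of 2 "2 + u"] by linarith

text \<open>2 + 4 u <= (2 + u)^2: constants inside the logarithm cost a factor 2 outside.\<close>

lemma ln_linear_le:
  fixes u v :: real
  assumes "0 < v" "v \<le> 2 + 4 * u" "0 \<le> u" shows "ln v \<le> 2 * ln (2 + u)"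
proof -
  have "v \<le> (2 + u)\<^sup>2" using assms by (simp add: power2_sum) (use zero_le_power2[of u] in linarith)
  then have "ln v \<le> ln ((2 + u)\<^sup>2)" using assms by (intro ln_mono) auto
  then show ?thesis using assms by (simp add: ln_realpow)
qed

text \<open>\<alpha> is the distance to the nearest edge up to a factor 2, and a the local spacing 1
  / (n sqrt \<alpha>) up to a factor 2. The second freedom is there because the extrapolation
  evaluates the phase at heights a and 2 a; the first lets two endpoints share one \<alpha>.\<close>

lemma scale_facts:
  fixes \<alpha> a :: real
  assumes n: "n \<ge> 1" and E: "\<bar>E\<bar> < 2" "\<alpha> \<le> 2 - \<bar>E\<bar>" "2 - \<bar>E\<bar> \<le> 2 * \<alpha>" and \<alpha>: "\<alpha> > 0" "1 \<le> real n * \<alpha> * sqrt \<alpha>"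
    and a: "0 < a" "1 \<le> real n * a * sqrt \<alpha>" "real n * a * sqrt \<alpha> \<le> 2"
  shows "a \<le> 2 * \<alpha>" "1 / a \<le> real n * sqrt \<alpha>" "norm (sc_root (Complex E a)) \<le> 6 * sqrt \<alpha>"
    "1 \<le> real n * a * norm (sc_root (Complex E a))"
proof -
  have "real n * a * sqrt \<alpha> \<le> 2 * (real n * \<alpha> * sqrt \<alpha>)" using a \<alpha> by linarith
  then have "(real n * sqrt \<alpha>) * a \<le> (real n * sqrt \<alpha>) * (2 * \<alpha>)" by (simp add: mult_ac)
  then show a2: "a \<le> 2 * \<alpha>" using n \<alpha> by (simp add: mult_le_cancel_left_pos)
  show "1 / a \<le> real n * sqrt \<alpha>" using a by (simp add: field_simps)
  have "\<alpha> \<le> 2" using E by linarith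
  then have "(2 - \<bar>E\<bar> + a) * (4 + a) \<le> (2 * \<alpha> + 2 * \<alpha>) * (4 + 4)"
    using E a2 a \<alpha> by (intro mult_mono add_mono) auto
  then have "(norm (sc_root (Complex E a)))\<^sup>2 \<le> (2 * \<alpha> + 2 * \<alpha>) * (4 + 4)"
    using norm_sc_root_upper[of "Complex E a"] E a by simp
  also have "\<dots> \<le> (6 * sqrt \<alpha>)\<^sup>2" using \<alpha> by (simp add: power_mult_distrib)
  finally show "norm (sc_root (Complex E a)) \<le> 6 * sqrt \<alpha>" by (rule power2_le_imp_le) (use \<alpha> in simp)
  have "sqrt \<alpha> \<le> sqrt (2 * \<alpha>)" using \<alpha> by simp
  then have "sqrt \<alpha> \<le> norm (sc_root (Complex E a))"
    using norm_sc_root_vertical_lower(1)[OF E(1,2) \<alpha>(1), of a] a by linarith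
  then have "real n * a * sqrt \<alpha> \<le> real n * a * norm (sc_root (Complex E a))" using a by (intro mult_left_mono) auto
  then show "1 \<le> real n * a * norm (sc_root (Complex E a))" using a by linarith
qed

lemma sqrt2_le: "sqrt 2 \<le> 3 / 2" by (rule real_le_lsqrt) (simp_all add: power2_eq_square)

text \<open>The argument n (2 - |E|)^(3/2) of the logarithm is the order of the semicircle count
  between E and the nearest edge; it arises as \<alpha> / a at the local spacing. Multiplication by
  |\<open>sc_root\<close>| <= 6 sqrt \<alpha> removes the factor 1 / sqrt \<alpha> of the kernel
  integral.\<close>

theorem one_sided_variance:
  assumes \<beta>: "\<beta> > 0"
  obtains C where "C > 0"
    "\<And>n E a. n \<ge> 1 \<Longrightarrow> \<bar>E\<bar> < 2 \<Longrightarrow> 1 \<le> real n * (2 - \<bar>E\<bar>) * sqrt (2 - \<bar>E\<bar>) \<Longrightarrow> 0 < a \<Longrightarrow>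
      1 \<le> real n * a * sqrt (2 - \<bar>E\<bar>) \<Longrightarrow> real n * a * sqrt (2 - \<bar>E\<bar>) \<le> 2 \<Longrightarrow>
      (\<integral>x. (phase n E a x)\<^sup>2 \<partial>scaled_gbe \<beta> n) \<le> C * ln (2 + real n * (2 - \<bar>E\<bar>) * sqrt (2 - \<bar>E\<bar>))"
proof -
  obtain C where C: "C > 0" and var: "\<And>n E1 E2 a c K I. n \<ge> 1 \<Longrightarrow> \<bar>E1\<bar> < 2 \<Longrightarrow> \<bar>E2\<bar> < 2 \<Longrightarrow> 0 < a \<Longrightarrow> \<bar>c\<bar> \<le> 1 \<Longrightarrow>
      1 \<le> real n * a * norm (sc_root (Complex E1 a)) \<Longrightarrow> 1 \<le> real n * a * norm (sc_root (Complex E2 a)) \<Longrightarrow>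
      \<forall>b\<ge>a. dominates_kernel E1 E2 c a b K \<and> (\<integral>t. K t \<partial>lborel_Icc a b) \<le> I \<Longrightarrow>
      (\<integral>x. (phase n E1 a x - c * phase n E2 a x)\<^sup>2 \<partial>scaled_gbe \<beta> n)
        \<le> C * (1 + (norm (sc_root (Complex E1 a)) + norm (sc_root (Complex E2 a))) * I)"
    by (rule phase_variance[OF \<beta>]) (rule that; assumption)
  show ?thesis
  proof (rule that[of "38 * C"])
    show "38 * C > 0" using C by simp
    fix n :: nat and E a :: real
    define \<alpha> where "\<alpha> = 2 - \<bar>E\<bar>"
    assume n: "n \<ge> 1" and E: "\<bar>E\<bar> < 2" and \<alpha>n: "1 \<le> real n * (2 - \<bar>E\<bar>) * sqrt (2 - \<bar>E\<bar>)" and a: "0 < a"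
      "1 \<le> real n * a * sqrt (2 - \<bar>E\<bar>)" "real n * a * sqrt (2 - \<bar>E\<bar>) \<le> 2"
    have \<alpha>: "\<alpha> > 0" "\<alpha> \<le> 2 - \<bar>E\<bar>" "2 - \<bar>E\<bar> \<le> 2 * \<alpha>" using E by (auto simp: \<alpha>_def)
    note sf = scale_facts[OF n E \<alpha>(2,3,1) \<alpha>n[folded \<alpha>_def] a[folded \<alpha>_def]]
    define u where "u = real n * \<alpha> * sqrt \<alpha>"
    have u: "u \<ge> 1" using \<alpha>n by (simp add: u_def \<alpha>_def)
    define I where "I = 2 * sqrt 2 / sqrt \<alpha> * ln (1 + sqrt (\<alpha> / a))"
    have I0: "I \<ge> 0" using \<alpha> a by (simp add: I_def)
    note ker = one_sided_kernel[OF E \<alpha>(2,1) a(1)]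
    \<comment> \<open>With c = 0 the second energy is irrelevant to the kernel and is taken equal to
      E.\<close>
    have dom: "\<forall>b\<ge>a. dominates_kernel E E 0 a b (\<lambda>t. sqrt 2 / (t * (sqrt \<alpha> + sqrt t))) \<and>
        (\<integral>t. sqrt 2 / (t * (sqrt \<alpha> + sqrt t)) \<partial>lborel_Icc a b) \<le> I"
      using ker unfolding dominates_kernel_def I_def by auto
    have "(\<integral>x. (phase n E a x - 0 * phase n E a x)\<^sup>2 \<partial>scaled_gbe \<beta> n)
        \<le> C * (1 + (norm (sc_root (Complex E a)) + norm (sc_root (Complex E a))) * I)"
      by (rule var[OF n E E a(1) _ sf(4) sf(4) dom]) simp
    also have "\<dots> \<le> C * (1 + 36 * ln (2 + u))"
    proof -
      have "(norm (sc_root (Complex E a)) + norm (sc_root (Complex E a))) * I \<le> (12 * sqrt \<alpha>) * I"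
        using sf(3) I0 by (intro mult_right_mono) auto
      also have "\<dots> = 24 * sqrt 2 * ln (1 + sqrt (\<alpha> / a))" using \<alpha> by (simp add: I_def)
      also have "\<dots> \<le> 36 * ln (2 + u)"
      proof (rule mult_mono)
        have "\<alpha> / a = \<alpha> * (1 / a)" by simp
        also have "\<dots> \<le> \<alpha> * (real n * sqrt \<alpha>)" using sf(2) \<alpha> by (intro mult_left_mono) auto
        also have "\<dots> = u" by (simp add: u_def)
        finally have "sqrt (\<alpha> / a) \<le> sqrt u" by simp
        also have "sqrt u \<le> 1 + u" using u by (intro real_le_lsqrt) (auto simp: power2_sum)
        finally show "ln (1 + sqrt (\<alpha> / a)) \<le> ln (2 + u)" using \<alpha> a by (intro ln_mono) (auto intro: add_pos_nonneg)
        show "0 \<le> ln (1 + sqrt (\<alpha> / a))" using \<alpha> a by simp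
      qed (use sqrt2_le in auto)
      finally show ?thesis using C by simp
    qed
    also have "\<dots> \<le> C * (2 * ln (2 + u) + 36 * ln (2 + u))"
      using ln_two_plus_ge[of u] u C by (intro mult_left_mono add_right_mono) auto
    finally show "(\<integral>x. (phase n E a x)\<^sup>2 \<partial>scaled_gbe \<beta> n) \<le> 38 * C * ln (2 + real n * (2 - \<bar>E\<bar>) * sqrt (2 - \<bar>E\<bar>))"
      by (simp add: u_def \<alpha>_def)
  qed
qed

text \<open>Here c = 1. A common \<alpha> makes both roots comparable to sqrt \<alpha>, so the
  factor before the kernel integral again cancels the singularity at the edge, and 1 / a <= 2 n
  bounds what is left.\<close>

theorem two_sided_variance:
  assumes \<beta>: "\<beta> > 0"
  obtains C where "C > 0"
    "\<And>n E1 E2 \<alpha> a. n \<ge> 1 \<Longrightarrow> \<bar>E1\<bar> < 2 \<Longrightarrow> \<alpha> \<le> 2 - \<bar>E1\<bar> \<Longrightarrow> 2 - \<bar>E1\<bar> \<le> 2 * \<alpha> \<Longrightarrow>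
      \<bar>E2\<bar> < 2 \<Longrightarrow> \<alpha> \<le> 2 - \<bar>E2\<bar> \<Longrightarrow> 2 - \<bar>E2\<bar> \<le> 2 * \<alpha> \<Longrightarrow> 0 < \<alpha> \<Longrightarrow> 1 \<le> real n * \<alpha> * sqrt \<alpha> \<Longrightarrow> 0 < a \<Longrightarrow>
      1 \<le> real n * a * sqrt \<alpha> \<Longrightarrow> real n * a * sqrt \<alpha> \<le> 2 \<Longrightarrow>
      (\<integral>x. (phase n E1 a x - phase n E2 a x)\<^sup>2 \<partial>scaled_gbe \<beta> n) \<le> C * ln (2 + real n * \<bar>E1 - E2\<bar>)"
proof -
  obtain C where C: "C > 0" and var: "\<And>n E1 E2 a c K I. n \<ge> 1 \<Longrightarrow> \<bar>E1\<bar> < 2 \<Longrightarrow> \<bar>E2\<bar> < 2 \<Longrightarrow> 0 < a \<Longrightarrow> \<bar>c\<bar> \<le> 1 \<Longrightarrow>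
      1 \<le> real n * a * norm (sc_root (Complex E1 a)) \<Longrightarrow> 1 \<le> real n * a * norm (sc_root (Complex E2 a)) \<Longrightarrow>
      \<forall>b\<ge>a. dominates_kernel E1 E2 c a b K \<and> (\<integral>t. K t \<partial>lborel_Icc a b) \<le> I \<Longrightarrow>
      (\<integral>x. (phase n E1 a x - c * phase n E2 a x)\<^sup>2 \<partial>scaled_gbe \<beta> n)
        \<le> C * (1 + (norm (sc_root (Complex E1 a)) + norm (sc_root (Complex E2 a))) * I)"
    by (rule phase_variance[OF \<beta>]) (rule that; assumption)
  show ?thesis
  proof (rule that[of "194 * C"])
    show "194 * C > 0" using C by simp
    fix n :: nat and E1 E2 \<alpha> a :: real
    assume n: "n \<ge> 1" and E1: "\<bar>E1\<bar> < 2" "\<alpha> \<le> 2 - \<bar>E1\<bar>" "2 - \<bar>E1\<bar> \<le> 2 * \<alpha>"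
      and E2: "\<bar>E2\<bar> < 2" "\<alpha> \<le> 2 - \<bar>E2\<bar>" "2 - \<bar>E2\<bar> \<le> 2 * \<alpha>" and \<alpha>: "0 < \<alpha>" "1 \<le> real n * \<alpha> * sqrt \<alpha>"
      and a: "0 < a" "1 \<le> real n * a * sqrt \<alpha>" "real n * a * sqrt \<alpha> \<le> 2"
    note sf1 = scale_facts[OF n E1 \<alpha> a] and sf2 = scale_facts[OF n E2 \<alpha> a]
    define l where "l = \<bar>E1 - E2\<bar>"
    have l: "l \<ge> 0" by (simp add: l_def)
    define m where "m = 8 / sqrt (2 * \<alpha>)"
    have m: "m \<ge> 0" using \<alpha> by (simp add: m_def)
    define u where "u = real n * l"
    have u: "u \<ge> 0" using l by (simp add: u_def)
    have "\<bar>Re (1 / ((of_real y - Complex E1 t) * sc_root (Complex E1 t)))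
        - 1 * Re (1 / ((of_real y - Complex E2 t) * sc_root (Complex E2 t)))\<bar> \<le> m * (l / (t * (t + l)))" if "t \<ge> a" for t y
    proof -
      have "\<bar>Re (1 / ((of_real y - Complex E1 t) * sc_root (Complex E1 t)) - 1 / ((of_real y - Complex E2 t) * sc_root (Complex E2 t)))\<bar> \<le> m * (l / (t * (t + l)))"
        unfolding m_def l_def using that a by (intro order_trans[OF abs_Re_le_cmod kernel_difference] E1 E2 \<alpha>) auto
      then show ?thesis by (simp only: minus_complex.sel mult_1)
    qed
    then have dom: "\<forall>b\<ge>a. dominates_kernel E1 E2 1 a b (\<lambda>t. m * (l / (t * (t + l)))) \<and>
        (\<integral>t. m * (l / (t * (t + l))) \<partial>lborel_Icc a b) \<le> m * ln (1 + l / a)"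
      using two_sided_kernel_integral[OF a(1) l m] unfolding dominates_kernel_def by auto
    have "(\<integral>x. (phase n E1 a x - 1 * phase n E2 a x)\<^sup>2 \<partial>scaled_gbe \<beta> n)
        \<le> C * (1 + (norm (sc_root (Complex E1 a)) + norm (sc_root (Complex E2 a))) * (m * ln (1 + l / a)))"
      by (rule var[OF n E1(1) E2(1) a(1) _ sf1(4) sf2(4) dom]) simp
    also have "\<dots> \<le> C * (1 + 96 * (2 * ln (2 + u)))"
    proof -
      have ln0: "ln (1 + l / a) \<ge> 0" using l a by simp
      have "(norm (sc_root (Complex E1 a)) + norm (sc_root (Complex E2 a))) * (m * ln (1 + l / a)) \<le> (6 * sqrt \<alpha> + 6 * sqrt \<alpha>) * (m * ln (1 + l / a))"
        using sf1(3) sf2(3) m ln0 by (intro mult_right_mono add_mono) auto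
      also have "\<dots> = 96 / sqrt 2 * ln (1 + l / a)" using \<alpha> by (simp add: m_def real_sqrt_mult)
      also have "\<dots> \<le> 96 * (2 * ln (2 + u))"
      proof (rule mult_mono)
        have "l / a = l * (1 / a)" by simp
        also have "\<dots> \<le> l * (real n * 2)"
        proof (intro mult_left_mono order_trans[OF sf1(2)])
          show "sqrt \<alpha> \<le> 2" using E1 by (intro real_le_lsqrt) auto
        qed (use l in auto)
        also have "\<dots> = 2 * u" by (simp add: u_def)
        finally have "1 + l / a \<le> 2 + 4 * u" using u by linarith
        then show "ln (1 + l / a) \<le> 2 * ln (2 + u)" using l a u by (intro ln_linear_le) (auto intro: add_pos_nonneg)
        show "96 / sqrt 2 \<le> (96::real)" by (simp add: divide_le_eq)
      qed (use ln0 in auto)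
      finally show ?thesis using C by simp
    qed
    also have "\<dots> \<le> C * (2 * ln (2 + u) + 96 * (2 * ln (2 + u)))"
      using ln_two_plus_ge[of u] u C by (intro mult_left_mono add_right_mono) auto
    finally show "(\<integral>x. (phase n E1 a x - phase n E2 a x)\<^sup>2 \<partial>scaled_gbe \<beta> n) \<le> 194 * C * ln (2 + real n * \<bar>E1 - E2\<bar>)"
      by (simp add: u_def l_def)
  qed
qed

text \<open>The linear terms cancel, so the left side is at most of order u^2 near 0, and it is
  bounded elsewhere. The right side is chosen to become a Poisson kernel under u = a / y.\<close>

lemma arctan_doubling:
  assumes "u \<ge> 0" shows "\<bar>2 * arctan u - arctan (2 * u)\<bar> \<le> 12 * (u\<^sup>2 / (1 + u\<^sup>2))"
proof (cases "u \<le> 1")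
  case True
  show ?thesis
  proof (cases "u = 0")
    case False
    then have u: "0 < u" using assms by simp
    define g where "g s = 2 * arctan s - arctan (2 * s)" for s :: real
    have d: "(g has_real_derivative 2 / (1 + s\<^sup>2) - 2 / (1 + (2 * s)\<^sup>2)) (at s)" for s
      unfolding g_def by (auto intro!: derivative_eq_intros simp: divide_inverse)
    obtain s where s: "0 < s" "s < u" "g u - g 0 = (u - 0) * (2 / (1 + s\<^sup>2) - 2 / (1 + (2 * s)\<^sup>2))"
      using MVT2[OF u d] by blast
    have p: "1 + s\<^sup>2 > 0" "1 + (2 * s)\<^sup>2 > 0" by (auto intro: add_pos_nonneg)
    have "2 / (1 + s\<^sup>2) - 2 / (1 + (2 * s)\<^sup>2) = 6 * s\<^sup>2 / ((1 + s\<^sup>2) * (1 + (2 * s)\<^sup>2))"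
      using p by (simp add: diff_frac_eq less_imp_neq[symmetric])
    also have "\<dots> \<le> 6 * s\<^sup>2 / 1"
      using mult_mono[of 1 "1 + s\<^sup>2" 1 "1 + (2 * s)\<^sup>2"] by (intro divide_left_mono) auto
    also have "\<dots> \<le> 6 * u" using s True u power_le_one[of s 1] mult_mono[of s u s 1] by (simp add: power2_eq_square)
    finally have le: "2 / (1 + s\<^sup>2) - 2 / (1 + (2 * s)\<^sup>2) \<le> 6 * u" .
    have ge: "0 \<le> 2 / (1 + s\<^sup>2) - 2 / (1 + (2 * s)\<^sup>2)"
      using p by (simp add: frac_le power_mult_distrib)
    have "\<bar>g u\<bar> \<le> u * (6 * u)" using s(3) le ge u by (simp add: g_def abs_mult)
    also have "\<dots> \<le> 12 * (u\<^sup>2 / (1 + u\<^sup>2))"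
    proof -
      have "u\<^sup>2 * (1 + u\<^sup>2) \<le> u\<^sup>2 * 2" using True u by (intro mult_left_mono) (auto simp: power_le_one)
      then have "u\<^sup>2 \<le> 2 * (u\<^sup>2 / (1 + u\<^sup>2))" using add_pos_nonneg[of 1 "u\<^sup>2"] by (simp add: pos_le_divide_eq)
      then show ?thesis by (simp add: power2_eq_square)
    qed
    finally show ?thesis by (simp add: g_def)
  qed simp
next
  case False
  then have u: "u > 1" by simp
  have "1 + u\<^sup>2 \<le> 2 * u\<^sup>2" using u by simp
  then have "1 / 2 \<le> u\<^sup>2 / (1 + u\<^sup>2)" using add_pos_nonneg[of 1 "u\<^sup>2"] by (simp add: pos_le_divide_eq)
  then have six: "6 \<le> 12 * (u\<^sup>2 / (1 + u\<^sup>2))" by linarith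
  have "0 < arctan u" "0 < arctan (2 * u)" using u by auto
  moreover have "arctan u < pi / 2" "arctan (2 * u) < pi / 2" by (rule arctan_ubound)+
  ultimately have "2 * arctan u - arctan (2 * u) \<le> 6" "- (2 * arctan u - arctan (2 * u)) \<le> 6"
    using pi_less_4 by linarith+
  then have "\<bar>2 * arctan u - arctan (2 * u)\<bar> \<le> 6" by (rule abs_leI)
  then show ?thesis using six by (rule order_trans)
qed

text \<open>For y > 0, arctan (y / a) = pi / 2 - arctan (a / y), and \<open>arctan_doubling\<close>
  applies with u = a / y. The error is a times the Poisson kernel, whose sum over the points is n a
  Im s. The value H at y = 0 is left free so that open and closed rays are treated alike.\<close>

lemma step_approximation:
  assumes a: "0 < a" and H: "y > 0 \<Longrightarrow> H = 1" "y < 0 \<Longrightarrow> H = 0" "0 \<le> H" "H \<le> 1"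
  shows "\<bar>H - 1 / 2 - (2 * arctan (y / a) - arctan (y / (2 * a))) / pi\<bar> \<le> 12 * (a * (a / (y\<^sup>2 + a\<^sup>2)))"
proof -
  have pos: "\<bar>1 / 2 - (2 * arctan (y / a) - arctan (y / (2 * a))) / pi\<bar> \<le> 12 * (a * (a / (y\<^sup>2 + a\<^sup>2)))" if y: "y > 0" for y
  proof -
    define u where "u = a / y"
    have u: "u > 0" using a y by (simp add: u_def)
    have "arctan (y / a) = pi / 2 - arctan u" using arctan_inverse[of u] u a y by (simp add: u_def sgn_if)
    moreover have "arctan (y / (2 * a)) = pi / 2 - arctan (2 * u)" using arctan_inverse[of "2 * u"] u a y by (simp add: u_def sgn_if)
    moreover have "1 / 2 - (2 * (pi / 2 - p) - (pi / 2 - q)) / pi = (2 * p - q) / pi" for p q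
      by (simp add: field_simps)
    ultimately have "1 / 2 - (2 * arctan (y / a) - arctan (y / (2 * a))) / pi = (2 * arctan u - arctan (2 * u)) / pi"
      by (simp only:)
    also have "\<bar>\<dots>\<bar> \<le> \<bar>2 * arctan u - arctan (2 * u)\<bar> / 1"
      unfolding abs_divide using pi_ge_two by (intro divide_left_mono) auto
    also have "\<dots> \<le> 12 * (u\<^sup>2 / (1 + u\<^sup>2))" using arctan_doubling[of u] u by simp
    also have "u\<^sup>2 / (1 + u\<^sup>2) = a * (a / (y\<^sup>2 + a\<^sup>2))"
    proof -
      have "1 + u\<^sup>2 = (y\<^sup>2 + a\<^sup>2) / y\<^sup>2" using y by (simp add: u_def power_divide add_divide_distrib)
      then show ?thesis using y by (simp add: u_def power_divide power2_eq_square)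
    qed
    finally show ?thesis .
  qed
  consider "y > 0" | "y < 0" | "y = 0" by linarith
  then show ?thesis
  proof cases
    case 1
    then show ?thesis using pos[OF 1] H(1) by simp
  next
    case 2
    have "\<bar>H - 1 / 2 - (2 * arctan (y / a) - arctan (y / (2 * a))) / pi\<bar> = \<bar>1 / 2 - (2 * arctan (- y / a) - arctan (- y / (2 * a))) / pi\<bar>"
      using H(2)[OF 2] by (simp add: arctan_minus field_simps abs_if)
    then show ?thesis using pos[of "- y"] 2 by simp
  next
    case 3
    then show ?thesis using H a by (auto simp: abs_le_iff power2_eq_square)
  qed
qed

section \<open>Counting points in a half-line\<close>

text \<open>For |E| <= 2, the semicircle mass to the right of E.\<close>

definition sc_tail :: "real \<Rightarrow> real" where
  "sc_tail E = 1 / 2 - sc_antideriv E / pi"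

definition points_in :: "nat \<Rightarrow> real set \<Rightarrow> (nat \<Rightarrow> real) \<Rightarrow> real" where
  "points_in n A x = (\<Sum>j<n. indicator A (x j))"

definition upper_ray :: "real \<Rightarrow> real set \<Rightarrow> bool" where
  "upper_ray E A \<longleftrightarrow> A = {E<..} \<or> A = {E..}"

definition tail_error :: "nat \<Rightarrow> real \<Rightarrow> real set \<Rightarrow> (nat \<Rightarrow> real) \<Rightarrow> real" where
  "tail_error n E A x = points_in n A x - real n * sc_tail E"

lemma upper_ray_borel: "upper_ray E A \<Longrightarrow> A \<in> sets borel"
  by (auto simp: upper_ray_def)

lemma points_in_measurable:
  assumes "A \<in> sets borel" shows "points_in n A \<in> borel_measurable (lebesgue_Rn n)"
proof -
  note [measurable] = assms
  show ?thesis unfolding points_in_def[abs_def] by measurable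
qed

lemma points_in_bounds: "0 \<le> points_in n A x" "points_in n A x \<le> real n"
  using sum_mono[of "{..<n}" "\<lambda>j. indicator A (x j)" "\<lambda>_. 1::real"]
  by (auto simp: points_in_def indicator_def intro!: sum_nonneg)

lemma square_integrable_scaled:
  fixes f :: "(nat \<Rightarrow> real) \<Rightarrow> real"
  assumes "\<beta> > 0" "f \<in> borel_measurable (lebesgue_Rn n)" "\<And>x. \<bar>f x\<bar> \<le> B"
  shows "integrable (scaled_gbe \<beta> n) (\<lambda>x. (f x)\<^sup>2)"
proof (rule integrable_bounded_scaled'[OF assms(1), of _ _ "B\<^sup>2"])
  show "(\<lambda>x. (f x)\<^sup>2) \<in> borel_measurable (lebesgue_Rn n)" using assms(2) by measurable
  show "(f x)\<^sup>2 \<le> B\<^sup>2" for x using power_mono[OF assms(3)[of x] abs_ge_zero, where n = 2] by simp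
qed simp

text \<open>The random part is the step approximation summed over the points; the deterministic part
  is the same extrapolation applied to \<open>sc_primitive\<close>.\<close>

lemma tail_error_deviation:
  assumes E: "\<bar>E\<bar> < 2" and a: "0 < a" "a \<le> 1" and A: "upper_ray E A" and n: "n \<ge> 1"
  shows "\<bar>tail_error n E A x - (2 * phase n E a x - phase n E (2 * a) x) / pi\<bar>
    \<le> 12 * (real n * a * Im (empirical_stieltjes n (Complex E a) x)) + 3 * (real n * a\<^sup>2 / sqrt (2 - \<bar>E\<bar>))"
proof -
  define H where "H j = (indicator A (x j) :: real)" for j
  define r where "r j = H j - 1 / 2 - (2 * arctan ((x j - E) / a) - arctan ((x j - E) / (2 * a))) / pi" for j
  define P where "P = 2 * Im (sc_primitive (Complex E a)) - Im (sc_primitive (Complex E (2 * a))) - sc_antideriv E"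
  have r: "\<bar>r j\<bar> \<le> 12 * (a * Im (1 / (of_real (x j) - Complex E a)))" for j
    unfolding r_def Im_resolvent'[OF a(1)] using A
    by (intro step_approximation a) (auto simp: H_def upper_ray_def indicator_def)
  have "(\<Sum>j<n. H j) - real n / 2 - (2 * (\<Sum>j<n. arctan ((x j - E) / a)) - (\<Sum>j<n. arctan ((x j - E) / (2 * a)))) / pi = (\<Sum>j<n. r j)"
    by (simp add: r_def sum_subtractf sum_divide_distrib[symmetric] sum_distrib_left)
  moreover have "tail_error n E A x - (2 * phase n E a x - phase n E (2 * a) x) / pi
     = ((\<Sum>j<n. H j) - real n / 2 - (2 * (\<Sum>j<n. arctan ((x j - E) / a)) - (\<Sum>j<n. arctan ((x j - E) / (2 * a)))) / pi) - real n * P / pi"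
    by (simp add: tail_error_def points_in_def H_def phase_def sc_tail_def P_def add_divide_distrib diff_divide_distrib algebra_simps)
  ultimately have "tail_error n E A x - (2 * phase n E a x - phase n E (2 * a) x) / pi = (\<Sum>j<n. r j) - real n * P / pi" by simp
  then have "\<bar>tail_error n E A x - (2 * phase n E a x - phase n E (2 * a) x) / pi\<bar> \<le> \<bar>\<Sum>j<n. r j\<bar> + \<bar>real n * P / pi\<bar>"
    by (simp only: abs_triangle_ineq4)
  also have "\<bar>\<Sum>j<n. r j\<bar> \<le> (\<Sum>j<n. 12 * (a * Im (1 / (of_real (x j) - Complex E a))))"
    by (rule order_trans[OF sum_abs sum_mono[OF r]])
  also have "\<dots> = 12 * (real n * a * Im (empirical_stieltjes n (Complex E a) x))"
    unfolding sum_distrib_left[symmetric] sum_Im_resolvent[OF n] by simp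
  also have "\<bar>real n * P / pi\<bar> \<le> 3 * (real n * a\<^sup>2 / sqrt (2 - \<bar>E\<bar>))"
  proof -
    have "\<bar>real n * P / pi\<bar> = real n * \<bar>P\<bar> / pi" by (simp add: abs_mult)
    also have "\<dots> \<le> real n * \<bar>P\<bar> / 1" using pi_ge_two by (intro divide_left_mono) auto
    also have "\<dots> \<le> real n * (3 * a\<^sup>2 / sqrt (2 - \<bar>E\<bar>))"
      unfolding P_def div_by_1 by (rule mult_left_mono[OF sc_primitive_extrapolation[OF E a]]) simp
    finally show ?thesis by (simp add: mult_ac)
  qed
  finally show ?thesis by simp
qed

text \<open>a is the typical spacing at distance \<alpha> from the edge; the hypothesis says that
  \<alpha> is at least of the order n^(-2/3) of the spacing at the edge.\<close>

lemma mesoscopic_scale: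
  fixes \<alpha> :: real
  assumes n: "n \<ge> 1" and \<alpha>: "\<alpha> > 0" "\<alpha> \<le> 2" "1 \<le> real n * \<alpha> * sqrt \<alpha>"
  defines "a \<equiv> 1 / (real n * sqrt \<alpha>)"
  shows "0 < a" "a \<le> 1" "real n * a * sqrt \<alpha> = 1" "real n * a\<^sup>2 / sqrt \<alpha> \<le> 1"
proof -
  have p: "real n * sqrt \<alpha> > 0" using n \<alpha> by simp
  then show "0 < a" by (simp add: a_def)
  show "real n * a * sqrt \<alpha> = 1" using n \<alpha>(1) by (simp add: a_def)
  have "1 \<le> real n * sqrt \<alpha>"
  proof (cases "\<alpha> \<le> 1")
    case True
    then have "\<alpha> * (real n * sqrt \<alpha>) \<le> 1 * (real n * sqrt \<alpha>)" using p by (intro mult_right_mono) auto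
    then show ?thesis using \<alpha>(3) by (simp add: mult_ac)
  next
    case False
    then have "1 * 1 \<le> real n * sqrt \<alpha>" using n by (intro mult_mono) auto
    then show ?thesis by simp
  qed
  then show "a \<le> 1" unfolding a_def using p by simp
  have "real n * a\<^sup>2 / sqrt \<alpha> = 1 / (real n * \<alpha> * sqrt \<alpha>)"
    using n \<alpha> by (simp add: a_def power2_eq_square field_simps)
  also have "\<dots> \<le> 1" using \<alpha>(3) by simp
  finally show "real n * a\<^sup>2 / sqrt \<alpha> \<le> 1" .
qed

lemma tail_error_measurable: "upper_ray E A \<Longrightarrow> tail_error n E A \<in> borel_measurable (lebesgue_Rn n)"
  unfolding tail_error_def[abs_def] using points_in_measurable[OF upper_ray_borel] by measurable

lemma tail_error_bound: "\<bar>tail_error n E A x\<bar> \<le> real n + real n * \<bar>sc_tail E\<bar>"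
proof -
  have "\<bar>tail_error n E A x\<bar> \<le> \<bar>points_in n A x\<bar> + \<bar>real n * sc_tail E\<bar>"
    unfolding tail_error_def by (rule abs_triangle_ineq4)
  then show ?thesis using points_in_bounds[of n A x] by (simp add: abs_mult)
qed

definition tail_remainder :: "nat \<Rightarrow> real \<Rightarrow> real \<Rightarrow> real set \<Rightarrow> (nat \<Rightarrow> real) \<Rightarrow> real" where
  "tail_remainder n E a A x = tail_error n E A x - (2 * phase n E a x - phase n E (2 * a) x) / pi"

lemma tail_remainder_square_integrable:
  assumes "\<beta> > 0" "upper_ray E A"
  shows "integrable (scaled_gbe \<beta> n) (\<lambda>x. (tail_remainder n E a A x)\<^sup>2)"
proof -
  define B where "B a = real n * (pi / 2) + real n * \<bar>Im (sc_primitive (Complex E a))\<bar>" for a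
  have B: "\<bar>phase n E a x\<bar> \<le> B a" for a x unfolding B_def by (rule phase_bound)
  show ?thesis
  proof (rule square_integrable_scaled[OF assms(1)])
    show "tail_remainder n E a A \<in> borel_measurable (lebesgue_Rn n)"
      unfolding tail_remainder_def[abs_def] using tail_error_measurable[OF assms(2)] by measurable
    fix x
    have "\<bar>tail_remainder n E a A x\<bar> \<le> \<bar>tail_error n E A x\<bar> + \<bar>2 * phase n E a x - phase n E (2 * a) x\<bar> / pi"
      unfolding tail_remainder_def using abs_triangle_ineq4 by (metis abs_divide abs_of_pos pi_gt_zero)
    also have "\<bar>2 * phase n E a x - phase n E (2 * a) x\<bar> / pi \<le> (2 * B a + B (2 * a)) / pi"
      using B[of a x] B[of "2 * a" x] by (intro divide_right_mono) auto
    finally show "\<bar>tail_remainder n E a A x\<bar> \<le> (real n + real n * \<bar>sc_tail E\<bar>) + (2 * B a + B (2 * a)) / pi"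
      using tail_error_bound[of n E A x] by simp
  qed
qed

text \<open>At the local spacing n a |\<open>sc_root\<close>| is bounded and the deviation is of
  order 1 / (n a) in mean square, so n a Im s has bounded second moment.\<close>

lemma tail_remainder_moment:
  assumes \<beta>: "\<beta> > 0"
  obtains C where "C \<ge> 0"
    "\<And>n E \<alpha> A. n \<ge> 1 \<Longrightarrow> \<bar>E\<bar> < 2 \<Longrightarrow> \<alpha> \<le> 2 - \<bar>E\<bar> \<Longrightarrow> 2 - \<bar>E\<bar> \<le> 2 * \<alpha> \<Longrightarrow> 0 < \<alpha> \<Longrightarrow> 1 \<le> real n * \<alpha> * sqrt \<alpha> \<Longrightarrow>
      upper_ray E A \<Longrightarrow> (\<integral>x. (tail_remainder n E (1 / (real n * sqrt \<alpha>)) A x)\<^sup>2 \<partial>scaled_gbe \<beta> n) \<le> C"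
proof -
  obtain C where C: "C \<ge> 0" and
    two: "\<And>n z. n \<ge> 1 \<Longrightarrow> \<bar>Re z\<bar> < 2 \<Longrightarrow> Im z > 0 \<Longrightarrow> 1 \<le> real n * Im z * norm (sc_root z) \<Longrightarrow>
      (\<integral>x. norm (deviation n z x) ^ 2 \<partial>scaled_gbe \<beta> n) \<le> C / (real n * Im z)\<^sup>2"
    using deviation_fourth_moment[OF \<beta>] by metis
  show ?thesis
  proof (rule that[of "576 * C + 20754"])
    show "576 * C + 20754 \<ge> 0" using C by simp
    fix n :: nat and E \<alpha> :: real and A
    assume n: "n \<ge> 1" and E: "\<bar>E\<bar> < 2" "\<alpha> \<le> 2 - \<bar>E\<bar>" "2 - \<bar>E\<bar> \<le> 2 * \<alpha>" and \<alpha>: "0 < \<alpha>" "1 \<le> real n * \<alpha> * sqrt \<alpha>" and A: "upper_ray E A"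
    let ?M = "scaled_gbe \<beta> n"
    interpret prob_space ?M by (rule prob_space_scaled_gbe[OF \<beta>])
    define a where "a = 1 / (real n * sqrt \<alpha>)"
    have "\<alpha> \<le> 2" using E by linarith
    note ms = mesoscopic_scale[OF n \<alpha>(1) this \<alpha>(2), folded a_def]
    note sf = scale_facts[OF n E \<alpha> ms(1) eq_refl[OF ms(3)[symmetric]]]
    let ?z = "Complex E a"
    define k where "k = norm (sc_root ?z)"
    define d where "d x = norm (deviation n ?z x)" for x
    have nak: "real n * a * k \<le> 6"
    proof -
      have "real n * a * k \<le> real n * a * (6 * sqrt \<alpha>)" using sf(3) ms n unfolding k_def by (intro mult_left_mono) auto
      then show ?thesis using ms(3) by simp
    qed
    have k0: "k \<ge> 0" by (simp add: k_def)
    have i: "integrable ?M (\<lambda>x. (d x)\<^sup>2)"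
      unfolding d_def
    proof (rule square_integrable_scaled[OF \<beta>])
      show "\<bar>norm (deviation n ?z x)\<bar> \<le> 1 / Im ?z + norm (sc_stieltjes ?z)" for x
        using norm_deviation_bound[of ?z n x] ms by simp
    qed measurable
    have pt: "(tail_remainder n E a A x)\<^sup>2 \<le> 576 * (real n * a)\<^sup>2 * (d x)\<^sup>2 + 20754" for x
    proof -
      define I where "I = Im (empirical_stieltjes n ?z x)"
      have I0: "I \<ge> 0" unfolding I_def using ms by (intro Im_empirical_nonneg) auto
      have "I = Im (deviation n ?z x) + Im (sc_stieltjes ?z)" by (simp add: I_def deviation_def)
      also have "\<dots> \<le> d x + k" unfolding d_def k_def
      proof (rule add_mono)
        show "Im (deviation n ?z x) \<le> norm (deviation n ?z x)" using abs_Im_le_cmod abs_le_D1 by blast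
        have "Im (sc_stieltjes ?z) * 2 \<le> norm (sc_root ?z)" using Im_sc_stieltjes_le[of ?z] ms by simp
        then show "Im (sc_stieltjes ?z) \<le> norm (sc_root ?z)" using norm_ge_zero[of "sc_root ?z"] by linarith
      qed
      finally have I_le: "I \<le> d x + k" .
      have "\<bar>tail_remainder n E a A x\<bar> \<le> 12 * (real n * a * I) + 3 * (real n * a\<^sup>2 / sqrt (2 - \<bar>E\<bar>))"
        unfolding tail_remainder_def I_def by (rule tail_error_deviation[OF E(1) ms(1,2) A n])
      also have "\<dots> \<le> 12 * (real n * a * (d x) + 6) + 3 * 1"
      proof (intro add_mono mult_left_mono)
        have "real n * a * I \<le> real n * a * (d x + k)" using I_le ms by (intro mult_left_mono) auto
        then show "real n * a * I \<le> real n * a * (d x) + 6" using nak by (simp add: distrib_left)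
        have "real n * a\<^sup>2 / sqrt (2 - \<bar>E\<bar>) \<le> real n * a\<^sup>2 / sqrt \<alpha>"
          using E \<alpha> by (intro divide_left_mono) auto
        then show "real n * a\<^sup>2 / sqrt (2 - \<bar>E\<bar>) \<le> 1" using ms(4) by linarith
      qed auto
      finally have "\<bar>tail_remainder n E a A x\<bar> \<le> 12 * (real n * a * d x) + 75" by simp
      then have "(tail_remainder n E a A x)\<^sup>2 \<le> (12 * (real n * a * d x) + 75)\<^sup>2"
        by (metis abs_ge_zero power2_abs power_mono)
      also have "\<dots> \<le> 2 * (12 * (real n * a * d x))\<^sup>2 + 2 * 75\<^sup>2"
        using zero_le_power2[of "12 * (real n * a * d x) - 75"] by (simp add: power2_sum power2_diff)
      also have "\<dots> \<le> 576 * (real n * a)\<^sup>2 * (d x)\<^sup>2 + 20754"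
        using zero_le_power2[of "real n * a * d x"] by (simp add: power_mult_distrib)
      finally show ?thesis .
    qed
    have "(\<integral>x. (tail_remainder n E a A x)\<^sup>2 \<partial>?M) \<le> (\<integral>x. 576 * (real n * a)\<^sup>2 * (d x)\<^sup>2 + 20754 \<partial>?M)"
      using i pt by (intro integral_mono tail_remainder_square_integrable \<beta> A) auto
    also have "\<dots> = 576 * (real n * a)\<^sup>2 * (\<integral>x. (d x)\<^sup>2 \<partial>?M) + 20754" using i by (simp add: prob_space)
    also have "\<dots> \<le> 576 * (real n * a)\<^sup>2 * (C / (real n * a)\<^sup>2) + 20754"
      using two[OF n, of ?z] E ms sf(4) unfolding d_def by (intro add_right_mono mult_left_mono) auto
    also have "\<dots> = 576 * C + 20754" using n ms by simp
    finally show "(\<integral>x. (tail_remainder n E (1 / (real n * sqrt \<alpha>)) A x)\<^sup>2 \<partial>?M) \<le> 576 * C + 20754"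
      by (simp add: a_def)
  qed
qed

text \<open>The tail error is the bounded remainder plus phases at heights a and 2 a with
  coefficients 2 / pi and - 1 / pi, both at most 1 in absolute value.\<close>

theorem tail_error_one_point:
  assumes \<beta>: "\<beta> > 0"
  obtains C where "C > 0"
    "\<And>n E A. n \<ge> 1 \<Longrightarrow> \<bar>E\<bar> < 2 \<Longrightarrow> 1 \<le> real n * (2 - \<bar>E\<bar>) * sqrt (2 - \<bar>E\<bar>) \<Longrightarrow> upper_ray E A \<Longrightarrow>
      (\<integral>x. (tail_error n E A x)\<^sup>2 \<partial>scaled_gbe \<beta> n) \<le> C * ln (2 + real n * (2 - \<bar>E\<bar>) * sqrt (2 - \<bar>E\<bar>))"
proof -
  obtain C1 where C1: "C1 \<ge> 0" and rem: "\<And>n E \<alpha> A. n \<ge> 1 \<Longrightarrow> \<bar>E\<bar> < 2 \<Longrightarrow> \<alpha> \<le> 2 - \<bar>E\<bar> \<Longrightarrow> 2 - \<bar>E\<bar> \<le> 2 * \<alpha> \<Longrightarrow> 0 < \<alpha> \<Longrightarrow> 1 \<le> real n * \<alpha> * sqrt \<alpha> \<Longrightarrow>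
      upper_ray E A \<Longrightarrow> (\<integral>x. (tail_remainder n E (1 / (real n * sqrt \<alpha>)) A x)\<^sup>2 \<partial>scaled_gbe \<beta> n) \<le> C1"
    by (rule tail_remainder_moment[OF \<beta>]) (rule that; assumption)
  obtain C2 where C2: "C2 > 0" and var: "\<And>n E a. n \<ge> 1 \<Longrightarrow> \<bar>E\<bar> < 2 \<Longrightarrow> 1 \<le> real n * (2 - \<bar>E\<bar>) * sqrt (2 - \<bar>E\<bar>) \<Longrightarrow> 0 < a \<Longrightarrow>
      1 \<le> real n * a * sqrt (2 - \<bar>E\<bar>) \<Longrightarrow> real n * a * sqrt (2 - \<bar>E\<bar>) \<le> 2 \<Longrightarrow>
      (\<integral>x. (phase n E a x)\<^sup>2 \<partial>scaled_gbe \<beta> n) \<le> C2 * ln (2 + real n * (2 - \<bar>E\<bar>) * sqrt (2 - \<bar>E\<bar>))"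
    by (rule one_sided_variance[OF \<beta>]) (rule that; assumption)
  show ?thesis
  proof (rule that[of "6 * C1 + 6 * C2"])
    show "6 * C1 + 6 * C2 > 0" using C1 C2 by simp
    fix n :: nat and E :: real and A
    define \<alpha> where "\<alpha> = 2 - \<bar>E\<bar>"
    assume n: "n \<ge> 1" and E: "\<bar>E\<bar> < 2" and \<alpha>n: "1 \<le> real n * (2 - \<bar>E\<bar>) * sqrt (2 - \<bar>E\<bar>)" and A: "upper_ray E A"
    let ?M = "scaled_gbe \<beta> n"
    have \<alpha>: "\<alpha> > 0" "\<alpha> \<le> 2 - \<bar>E\<bar>" "2 - \<bar>E\<bar> \<le> 2 * \<alpha>" "\<alpha> \<le> 2" using E by (auto simp: \<alpha>_def)
    define a where "a = 1 / (real n * sqrt \<alpha>)"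
    note ms = mesoscopic_scale[OF n \<alpha>(1,4) \<alpha>n[folded \<alpha>_def], folded a_def]
    define L where "L = ln (2 + real n * (2 - \<bar>E\<bar>) * sqrt (2 - \<bar>E\<bar>))"
    have L: "L \<ge> 1 / 2" unfolding L_def using \<alpha>n ln_two_plus_ge[of "real n * (2 - \<bar>E\<bar>) * sqrt (2 - \<bar>E\<bar>)"] by linarith
    have v1: "(\<integral>x. (phase n E a x)\<^sup>2 \<partial>?M) \<le> C2 * L"
      unfolding L_def using ms by (intro var[OF n E \<alpha>n]) (auto simp: \<alpha>_def)
    have v2: "(\<integral>x. (phase n E (2 * a) x)\<^sup>2 \<partial>?M) \<le> C2 * L"
      unfolding L_def using ms by (intro var[OF n E \<alpha>n]) (auto simp: \<alpha>_def)
    have v3: "(\<integral>x. (tail_remainder n E a A x)\<^sup>2 \<partial>?M) \<le> C1"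
      unfolding a_def by (rule rem[OF n E \<alpha>(2,3,1) \<alpha>n[folded \<alpha>_def] A])
    have pt: "(tail_error n E A x)\<^sup>2 \<le> 3 * (tail_remainder n E a A x)\<^sup>2 + (3 * (phase n E a x)\<^sup>2 + 3 * (phase n E (2 * a) x)\<^sup>2)" for x
    proof -
      have "tail_error n E A x = tail_remainder n E a A x + (2 / pi) * phase n E a x + (- 1 / pi) * phase n E (2 * a) x"
        by (simp add: tail_remainder_def diff_divide_distrib)
      moreover have "(p + s * q + t * r)\<^sup>2 \<le> 3 * p\<^sup>2 + (3 * q\<^sup>2 + 3 * r\<^sup>2)" if "s\<^sup>2 \<le> 1" "t\<^sup>2 \<le> 1" for p q r s t :: real
      proof -
        have "(p + s * q + t * r)\<^sup>2 \<le> 3 * p\<^sup>2 + (3 * (s * q)\<^sup>2 + 3 * (t * r)\<^sup>2)"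
          using zero_le_power2[of "p - s * q"] zero_le_power2[of "p - t * r"] zero_le_power2[of "s * q - t * r"]
          by (simp add: power2_eq_square algebra_simps)
        moreover have "(s * q)\<^sup>2 \<le> q\<^sup>2" "(t * r)\<^sup>2 \<le> r\<^sup>2"
          using mult_right_mono[OF that(1), of "q\<^sup>2"] mult_right_mono[OF that(2), of "r\<^sup>2"] by (auto simp: power_mult_distrib)
        ultimately show ?thesis by linarith
      qed
      moreover have "(2 / pi)\<^sup>2 \<le> 1" "(- 1 / pi)\<^sup>2 \<le> 1"
        using pi_ge_two by (auto simp: abs_square_le_1)
      ultimately show ?thesis by (simp only:)
    qed
    have ints: "integrable ?M (\<lambda>x. (tail_error n E A x)\<^sup>2)" "integrable ?M (\<lambda>x. (tail_remainder n E a A x)\<^sup>2)"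
      "integrable ?M (\<lambda>x. (phase n E a x)\<^sup>2)" "integrable ?M (\<lambda>x. (phase n E (2 * a) x)\<^sup>2)"
      by (rule square_integrable_scaled[OF \<beta> tail_error_measurable[OF A] tail_error_bound])
        (intro tail_remainder_square_integrable[OF \<beta> A] phase_square_integrable(1)[OF \<beta>])+
    have "(\<integral>x. (tail_error n E A x)\<^sup>2 \<partial>?M) \<le> (\<integral>x. 3 * (tail_remainder n E a A x)\<^sup>2 + (3 * (phase n E a x)\<^sup>2 + 3 * (phase n E (2 * a) x)\<^sup>2) \<partial>?M)"
      using ints pt by (intro integral_mono) auto
    also have "\<dots> = 3 * (\<integral>x. (tail_remainder n E a A x)\<^sup>2 \<partial>?M) + (3 * (\<integral>x. (phase n E a x)\<^sup>2 \<partial>?M) + 3 * (\<integral>x. (phase n E (2 * a) x)\<^sup>2 \<partial>?M))"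
      using ints by simp
    also have "\<dots> \<le> 3 * (C1 * (2 * L)) + (3 * (C2 * L) + 3 * (C2 * L))"
      using v1 v2 v3 L C1 mult_left_mono[of 1 "2 * L" C1] by (intro add_mono mult_left_mono) auto
    also have "\<dots> = (6 * C1 + 6 * C2) * L" by (simp add: algebra_simps)
    finally show "(\<integral>x. (tail_error n E A x)\<^sup>2 \<partial>?M) \<le> (6 * C1 + 6 * C2) * ln (2 + real n * (2 - \<bar>E\<bar>) * sqrt (2 - \<bar>E\<bar>))"
      by (simp add: L_def)
  qed
qed

text \<open>As for one point, with the phases of both endpoints at the same two heights, so that
  only their differences enter; for this both endpoints use the same \<alpha>.\<close>

theorem tail_error_two_points:
  assumes \<beta>: "\<beta> > 0"
  obtains C where "C > 0"
    "\<And>n E1 E2 \<alpha> A1 A2. n \<ge> 1 \<Longrightarrow> \<bar>E1\<bar> < 2 \<Longrightarrow> \<alpha> \<le> 2 - \<bar>E1\<bar> \<Longrightarrow> 2 - \<bar>E1\<bar> \<le> 2 * \<alpha> \<Longrightarrow>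
      \<bar>E2\<bar> < 2 \<Longrightarrow> \<alpha> \<le> 2 - \<bar>E2\<bar> \<Longrightarrow> 2 - \<bar>E2\<bar> \<le> 2 * \<alpha> \<Longrightarrow> 0 < \<alpha> \<Longrightarrow> 1 \<le> real n * \<alpha> * sqrt \<alpha> \<Longrightarrow>
      upper_ray E1 A1 \<Longrightarrow> upper_ray E2 A2 \<Longrightarrow>
      (\<integral>x. (tail_error n E1 A1 x - tail_error n E2 A2 x)\<^sup>2 \<partial>scaled_gbe \<beta> n) \<le> C * ln (2 + real n * \<bar>E1 - E2\<bar>)"
proof -
  obtain C1 where C1: "C1 \<ge> 0" and rem: "\<And>n E \<alpha> A. n \<ge> 1 \<Longrightarrow> \<bar>E\<bar> < 2 \<Longrightarrow> \<alpha> \<le> 2 - \<bar>E\<bar> \<Longrightarrow> 2 - \<bar>E\<bar> \<le> 2 * \<alpha> \<Longrightarrow> 0 < \<alpha> \<Longrightarrow> 1 \<le> real n * \<alpha> * sqrt \<alpha> \<Longrightarrow>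
      upper_ray E A \<Longrightarrow> (\<integral>x. (tail_remainder n E (1 / (real n * sqrt \<alpha>)) A x)\<^sup>2 \<partial>scaled_gbe \<beta> n) \<le> C1"
    by (rule tail_remainder_moment[OF \<beta>]) (rule that; assumption)
  obtain C2 where C2: "C2 > 0" and var: "\<And>n E1 E2 \<alpha> a. n \<ge> 1 \<Longrightarrow> \<bar>E1\<bar> < 2 \<Longrightarrow> \<alpha> \<le> 2 - \<bar>E1\<bar> \<Longrightarrow> 2 - \<bar>E1\<bar> \<le> 2 * \<alpha> \<Longrightarrow>
      \<bar>E2\<bar> < 2 \<Longrightarrow> \<alpha> \<le> 2 - \<bar>E2\<bar> \<Longrightarrow> 2 - \<bar>E2\<bar> \<le> 2 * \<alpha> \<Longrightarrow> 0 < \<alpha> \<Longrightarrow> 1 \<le> real n * \<alpha> * sqrt \<alpha> \<Longrightarrow> 0 < a \<Longrightarrow>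
      1 \<le> real n * a * sqrt \<alpha> \<Longrightarrow> real n * a * sqrt \<alpha> \<le> 2 \<Longrightarrow>
      (\<integral>x. (phase n E1 a x - phase n E2 a x)\<^sup>2 \<partial>scaled_gbe \<beta> n) \<le> C2 * ln (2 + real n * \<bar>E1 - E2\<bar>)"
    by (rule two_sided_variance[OF \<beta>]) (rule that; assumption)
  show ?thesis
  proof (rule that[of "16 * C1 + 8 * C2"])
    show "16 * C1 + 8 * C2 > 0" using C1 C2 by simp
    fix n :: nat and E1 E2 \<alpha> :: real and A1 A2
    assume n: "n \<ge> 1" and E1: "\<bar>E1\<bar> < 2" "\<alpha> \<le> 2 - \<bar>E1\<bar>" "2 - \<bar>E1\<bar> \<le> 2 * \<alpha>"
      and E2: "\<bar>E2\<bar> < 2" "\<alpha> \<le> 2 - \<bar>E2\<bar>" "2 - \<bar>E2\<bar> \<le> 2 * \<alpha>" and \<alpha>: "0 < \<alpha>" "1 \<le> real n * \<alpha> * sqrt \<alpha>"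
      and A: "upper_ray E1 A1" "upper_ray E2 A2"
    let ?M = "scaled_gbe \<beta> n"
    define a where "a = 1 / (real n * sqrt \<alpha>)"
    have "\<alpha> \<le> 2" using E1 by linarith
    note ms = mesoscopic_scale[OF n \<alpha>(1) this \<alpha>(2), folded a_def]
    define L where "L = ln (2 + real n * \<bar>E1 - E2\<bar>)"
    have L: "L \<ge> 1 / 2" unfolding L_def by (rule ln_two_plus_ge) simp
    define f where "f a x = phase n E1 a x - phase n E2 a x" for a x
    have v1: "(\<integral>x. (f a x)\<^sup>2 \<partial>?M) \<le> C2 * L"
      unfolding L_def f_def using ms by (intro var[OF n E1 E2 \<alpha>]) auto
    have v2: "(\<integral>x. (f (2 * a) x)\<^sup>2 \<partial>?M) \<le> C2 * L"
      unfolding L_def f_def using ms by (intro var[OF n E1 E2 \<alpha>]) auto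
    have v3: "(\<integral>x. (tail_remainder n E1 a A1 x)\<^sup>2 \<partial>?M) \<le> C1" "(\<integral>x. (tail_remainder n E2 a A2 x)\<^sup>2 \<partial>?M) \<le> C1"
      unfolding a_def by (rule rem[OF n E1 \<alpha> A(1)], rule rem[OF n E2 \<alpha> A(2)])
    have pt: "(tail_error n E1 A1 x - tail_error n E2 A2 x)\<^sup>2 \<le> (4 * (tail_remainder n E1 a A1 x)\<^sup>2 + 4 * (tail_remainder n E2 a A2 x)\<^sup>2)
        + (4 * (f a x)\<^sup>2 + 4 * (f (2 * a) x)\<^sup>2)" for x
    proof -
      have "tail_error n E1 A1 x - tail_error n E2 A2 x = tail_remainder n E1 a A1 x - tail_remainder n E2 a A2 x + (2 / pi) * f a x + (- 1 / pi) * f (2 * a) x"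
        by (simp add: tail_remainder_def f_def diff_divide_distrib right_diff_distrib)
      moreover have "(p - o' + s * q + t * r)\<^sup>2 \<le> (4 * p\<^sup>2 + 4 * o'\<^sup>2) + (4 * q\<^sup>2 + 4 * r\<^sup>2)" if "s\<^sup>2 \<le> 1" "t\<^sup>2 \<le> 1" for o' p q r s t :: real
      proof -
        have "(p - o' + s * q + t * r)\<^sup>2 \<le> (4 * p\<^sup>2 + 4 * o'\<^sup>2) + (4 * (s * q)\<^sup>2 + 4 * (t * r)\<^sup>2)"
          using zero_le_power2[of "p - s * q"] zero_le_power2[of "p - t * r"] zero_le_power2[of "s * q - t * r"]
            zero_le_power2[of "p + o'"] zero_le_power2[of "o' + s * q"] zero_le_power2[of "o' + t * r"]
          by (simp add: power2_eq_square algebra_simps)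
        moreover have "(s * q)\<^sup>2 \<le> q\<^sup>2" "(t * r)\<^sup>2 \<le> r\<^sup>2"
          using mult_right_mono[OF that(1), of "q\<^sup>2"] mult_right_mono[OF that(2), of "r\<^sup>2"] by (auto simp: power_mult_distrib)
        ultimately show ?thesis by linarith
      qed
      moreover have "(2 / pi)\<^sup>2 \<le> 1" "(- 1 / pi)\<^sup>2 \<le> 1"
        using pi_ge_two by (auto simp: abs_square_le_1)
      ultimately show ?thesis by (simp only:)
    qed
    have ints: "integrable ?M (\<lambda>x. (tail_error n E1 A1 x - tail_error n E2 A2 x)\<^sup>2)"
      "integrable ?M (\<lambda>x. (tail_remainder n E1 a A1 x)\<^sup>2)" "integrable ?M (\<lambda>x. (tail_remainder n E2 a A2 x)\<^sup>2)"
      "integrable ?M (\<lambda>x. (f a x)\<^sup>2)" "integrable ?M (\<lambda>x. (f (2 * a) x)\<^sup>2)"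
    proof -
      show "integrable ?M (\<lambda>x. (tail_error n E1 A1 x - tail_error n E2 A2 x)\<^sup>2)"
      proof (rule square_integrable_scaled[OF \<beta>])
        show "(\<lambda>x. tail_error n E1 A1 x - tail_error n E2 A2 x) \<in> borel_measurable (lebesgue_Rn n)"
          using tail_error_measurable[OF A(1)] tail_error_measurable[OF A(2)] by measurable
        show "\<bar>tail_error n E1 A1 x - tail_error n E2 A2 x\<bar> \<le> (real n + real n * \<bar>sc_tail E1\<bar>) + (real n + real n * \<bar>sc_tail E2\<bar>)" for x
          by (rule order_trans[OF abs_triangle_ineq4 add_mono[OF tail_error_bound tail_error_bound]])
      qed
      show "integrable ?M (\<lambda>x. (tail_remainder n E1 a A1 x)\<^sup>2)" "integrable ?M (\<lambda>x. (tail_remainder n E2 a A2 x)\<^sup>2)"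
        by (rule tail_remainder_square_integrable[OF \<beta> A(1)], rule tail_remainder_square_integrable[OF \<beta> A(2)])
      show "integrable ?M (\<lambda>x. (f a x)\<^sup>2)" "integrable ?M (\<lambda>x. (f (2 * a) x)\<^sup>2)"
        unfolding f_def using phase_square_integrable(2)[OF \<beta>, of n E1 _ 1 E2] by simp_all
    qed
    have "(\<integral>x. (tail_error n E1 A1 x - tail_error n E2 A2 x)\<^sup>2 \<partial>?M) \<le> (\<integral>x. (4 * (tail_remainder n E1 a A1 x)\<^sup>2 + 4 * (tail_remainder n E2 a A2 x)\<^sup>2)
        + (4 * (f a x)\<^sup>2 + 4 * (f (2 * a) x)\<^sup>2) \<partial>?M)"
      using ints pt by (intro integral_mono) auto
    also have "\<dots> = (4 * (\<integral>x. (tail_remainder n E1 a A1 x)\<^sup>2 \<partial>?M) + 4 * (\<integral>x. (tail_remainder n E2 a A2 x)\<^sup>2 \<partial>?M))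
      + (4 * (\<integral>x. (f a x)\<^sup>2 \<partial>?M) + 4 * (\<integral>x. (f (2 * a) x)\<^sup>2 \<partial>?M))"
      using ints by simp
    also have "\<dots> \<le> (4 * (C1 * (2 * L)) + 4 * (C1 * (2 * L))) + (4 * (C2 * L) + 4 * (C2 * L))"
      using v1 v2 v3 L C1 mult_left_mono[of 1 "2 * L" C1] by (intro add_mono mult_left_mono) auto
    also have "\<dots> = (16 * C1 + 8 * C2) * L" by (simp add: algebra_simps)
    finally show "(\<integral>x. (tail_error n E1 A1 x - tail_error n E2 A2 x)\<^sup>2 \<partial>?M) \<le> (16 * C1 + 8 * C2) * ln (2 + real n * \<bar>E1 - E2\<bar>)"
      by (simp add: L_def)
  qed
qed

text \<open>Either the distances to the edges are within a factor 2 of each other and the two-point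
  bound applies, or |E1 - E2| is at least half of each distance. In the latter case the logarithms
  of the one-point bounds are already no larger than that of the interval, up to a constant.\<close>

theorem tail_error_pair:
  assumes \<beta>: "\<beta> > 0"
  obtains C where "C > 0"
    "\<And>n \<epsilon> E1 E2 A1 A2. n \<ge> 1 \<Longrightarrow> 0 < \<epsilon> \<Longrightarrow> 1 \<le> real n * \<epsilon> * sqrt \<epsilon> \<Longrightarrow> \<bar>E1\<bar> \<le> 2 - \<epsilon> \<Longrightarrow> \<bar>E2\<bar> \<le> 2 - \<epsilon> \<Longrightarrow>
      upper_ray E1 A1 \<Longrightarrow> upper_ray E2 A2 \<Longrightarrow>
      (\<integral>x. (tail_error n E1 A1 x - tail_error n E2 A2 x)\<^sup>2 \<partial>scaled_gbe \<beta> n) \<le> C * ln (2 + real n * \<bar>E1 - E2\<bar>)"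
proof -
  obtain C1 where C1: "C1 > 0" and one: "\<And>n E A. n \<ge> 1 \<Longrightarrow> \<bar>E\<bar> < 2 \<Longrightarrow> 1 \<le> real n * (2 - \<bar>E\<bar>) * sqrt (2 - \<bar>E\<bar>) \<Longrightarrow> upper_ray E A \<Longrightarrow>
      (\<integral>x. (tail_error n E A x)\<^sup>2 \<partial>scaled_gbe \<beta> n) \<le> C1 * ln (2 + real n * (2 - \<bar>E\<bar>) * sqrt (2 - \<bar>E\<bar>))"
    by (rule tail_error_one_point[OF \<beta>]) (rule that; assumption)
  obtain C2 where C2: "C2 > 0" and two: "\<And>n E1 E2 \<alpha> A1 A2. n \<ge> 1 \<Longrightarrow> \<bar>E1\<bar> < 2 \<Longrightarrow> \<alpha> \<le> 2 - \<bar>E1\<bar> \<Longrightarrow> 2 - \<bar>E1\<bar> \<le> 2 * \<alpha> \<Longrightarrow>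
      \<bar>E2\<bar> < 2 \<Longrightarrow> \<alpha> \<le> 2 - \<bar>E2\<bar> \<Longrightarrow> 2 - \<bar>E2\<bar> \<le> 2 * \<alpha> \<Longrightarrow> 0 < \<alpha> \<Longrightarrow> 1 \<le> real n * \<alpha> * sqrt \<alpha> \<Longrightarrow>
      upper_ray E1 A1 \<Longrightarrow> upper_ray E2 A2 \<Longrightarrow>
      (\<integral>x. (tail_error n E1 A1 x - tail_error n E2 A2 x)\<^sup>2 \<partial>scaled_gbe \<beta> n) \<le> C2 * ln (2 + real n * \<bar>E1 - E2\<bar>)"
    by (rule tail_error_two_points[OF \<beta>]) (rule that; assumption)
  show ?thesis
  proof (rule that[of "8 * C1 + C2"])
    show "8 * C1 + C2 > 0" using C1 C2 by simp
    fix n :: nat and \<epsilon> E1 E2 :: real and A1 A2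
    assume n: "n \<ge> 1" and \<epsilon>: "0 < \<epsilon>" "1 \<le> real n * \<epsilon> * sqrt \<epsilon>" and E: "\<bar>E1\<bar> \<le> 2 - \<epsilon>" "\<bar>E2\<bar> \<le> 2 - \<epsilon>"
      and A: "upper_ray E1 A1" "upper_ray E2 A2"
    let ?M = "scaled_gbe \<beta> n"
    have scale: "1 \<le> real n * \<alpha> * sqrt \<alpha>" if "\<epsilon> \<le> \<alpha>" for \<alpha>
    proof -
      have "real n * \<epsilon> * sqrt \<epsilon> \<le> real n * \<alpha> * sqrt \<alpha>"
        using that \<epsilon>(1) by (intro mult_mono mult_left_mono) auto
      then show ?thesis using \<epsilon> by linarith
    qed
    have lt: "\<bar>E1\<bar> < 2" "\<bar>E2\<bar> < 2" using E \<epsilon> by linarith+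
    define L where "L = ln (2 + real n * \<bar>E1 - E2\<bar>)"
    have L: "L \<ge> 0" unfolding L_def using ln_two_plus_ge[of "real n * \<bar>E1 - E2\<bar>"] by simp
    define \<alpha> where "\<alpha> = min (2 - \<bar>E1\<bar>) (2 - \<bar>E2\<bar>)"
    have \<alpha>: "\<epsilon> \<le> \<alpha>" "\<alpha> \<le> 2 - \<bar>E1\<bar>" "\<alpha> \<le> 2 - \<bar>E2\<bar>" using E by (auto simp: \<alpha>_def)
    have "(\<integral>x. (tail_error n E1 A1 x - tail_error n E2 A2 x)\<^sup>2 \<partial>?M) \<le> (8 * C1 + C2) * L"
    proof (cases "2 - \<bar>E1\<bar> \<le> 2 * \<alpha> \<and> 2 - \<bar>E2\<bar> \<le> 2 * \<alpha>")
      case True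
      then have "(\<integral>x. (tail_error n E1 A1 x - tail_error n E2 A2 x)\<^sup>2 \<partial>?M) \<le> C2 * L"
        unfolding L_def using \<alpha> \<epsilon> lt A n scale[OF \<alpha>(1)] by (intro two[where \<alpha> = \<alpha>]) auto
      also have "\<dots> \<le> (8 * C1 + C2) * L" using C1 L by (intro mult_right_mono) auto
      finally show ?thesis .
    next
      case False
      then have far: "2 - \<bar>E1\<bar> \<le> 2 * \<bar>E1 - E2\<bar>" "2 - \<bar>E2\<bar> \<le> 2 * \<bar>E1 - E2\<bar>"
        using abs_triangle_ineq2[of E1 E2] abs_triangle_ineq2_sym[of E2 E1] unfolding \<alpha>_def by (auto simp: min_def split: if_splits)
      have single: "(\<integral>x. (tail_error n E A x)\<^sup>2 \<partial>?M) \<le> C1 * (2 * L)"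
        if "\<bar>E\<bar> \<le> 2 - \<epsilon>" "\<bar>E\<bar> < 2" "2 - \<bar>E\<bar> \<le> 2 * \<bar>E1 - E2\<bar>" "upper_ray E A" for E A
      proof -
        define s where "s = 2 - \<bar>E\<bar>"
        have s: "0 < s" "\<epsilon> \<le> s" "s \<le> 2 * \<bar>E1 - E2\<bar>" "s \<le> 4" using that by (auto simp: s_def)
        \<comment> \<open>The exponent 3/2 is reduced to 1 at the cost of a constant, which gives
          the linear bound 2 + 4 u required by \<open>ln_linear_le\<close>.\<close>
        have "sqrt s \<le> 2" using real_sqrt_le_mono[OF s(4)] by simp
        then have "real n * s * sqrt s \<le> real n * (2 * \<bar>E1 - E2\<bar>) * 2"
          using s by (intro mult_mono mult_left_mono) auto
        then have "ln (2 + real n * s * sqrt s) \<le> 2 * L"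
          unfolding L_def using s by (intro ln_linear_le) (auto intro: add_pos_nonneg)
        moreover have "(\<integral>x. (tail_error n E A x)\<^sup>2 \<partial>?M) \<le> C1 * ln (2 + real n * s * sqrt s)"
          unfolding s_def by (intro one n that scale) (use s in \<open>auto simp: s_def\<close>)
        ultimately show ?thesis using C1 mult_left_mono[of "ln (2 + real n * s * sqrt s)" "2 * L" C1] by linarith
      qed
      have ints: "integrable ?M (\<lambda>x. (tail_error n E1 A1 x)\<^sup>2)" "integrable ?M (\<lambda>x. (tail_error n E2 A2 x)\<^sup>2)"
        by (rule square_integrable_scaled[OF \<beta> tail_error_measurable tail_error_bound], fact)+
      have sq: "(p - q)\<^sup>2 \<le> 2 * p\<^sup>2 + 2 * q\<^sup>2" for p q :: real
        using zero_le_power2[of "p + q"] by (simp add: power2_sum power2_diff)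
      have "(\<integral>x. (tail_error n E1 A1 x - tail_error n E2 A2 x)\<^sup>2 \<partial>?M) \<le> (\<integral>x. 2 * (tail_error n E1 A1 x)\<^sup>2 + 2 * (tail_error n E2 A2 x)\<^sup>2 \<partial>?M)"
        using ints sq by (intro integral_mono') auto
      also have "\<dots> = 2 * (\<integral>x. (tail_error n E1 A1 x)\<^sup>2 \<partial>?M) + 2 * (\<integral>x. (tail_error n E2 A2 x)\<^sup>2 \<partial>?M)"
        using ints by simp
      also have "\<dots> \<le> 8 * C1 * L"
        using single[OF E(1) lt(1) far(1) A(1)] single[OF E(2) lt(2) far(2) A(2)] by simp
      also have "\<dots> \<le> (8 * C1 + C2) * L" using C2 L by (intro mult_right_mono) auto
      finally show ?thesis .
    qed
    then show "(\<integral>x. (tail_error n E1 A1 x - tail_error n E2 A2 x)\<^sup>2 \<partial>?M) \<le> (8 * C1 + C2) * ln (2 + real n * \<bar>E1 - E2\<bar>)"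
      by (simp add: L_def)
  qed
qed

section \<open>Semicircle masses and clamped endpoints\<close>

lemma has_integral_semicircle:
  assumes "- 2 \<le> a" "a \<le> b" "b \<le> 2"
  shows "((\<lambda>x. sqrt (4 - x\<^sup>2) / 2) has_integral (sc_antideriv b - sc_antideriv a)) {a..b}"
\<comment> \<open>The square root and the arcsine are not differentiable at the edges, so
  derivatives are taken in the interior only.\<close>
proof (rule fundamental_theorem_of_calculus_interior[OF assms(2)])
  show "continuous_on {a..b} sc_antideriv"
    unfolding sc_antideriv_def[abs_def] using assms by (intro continuous_intros) auto
  fix x assume x: "x \<in> {a<..<b}"
  then have "- 2 < x" "x < 2" using assms by auto
  then have "0 < (2 - x) * (2 + x)" by (intro mult_pos_pos) auto
  then have p: "0 < 4 - x\<^sup>2" by (simp add: power2_eq_square algebra_simps)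
  define s where "s = sqrt (4 - x\<^sup>2)"
  have s: "s > 0" "s\<^sup>2 = 4 - x\<^sup>2" using p by (auto simp: s_def)
  have h: "sqrt (1 - (x / 2)\<^sup>2) = s / 2"
    by (rule real_sqrt_unique) (use s in \<open>auto simp: power_divide diff_divide_distrib\<close>)
  have "(sc_antideriv has_real_derivative ((s + x * (inverse s / 2 * (- (2 * x)))) / 4 + inverse (s / 2) * (1 / 2))) (at x)"
    unfolding sc_antideriv_def[abs_def] h[symmetric] unfolding s_def using p \<open>- 2 < x\<close> \<open>x < 2\<close>
    by (auto intro!: derivative_eq_intros)
  also have "(s + x * (inverse s / 2 * (- (2 * x)))) / 4 + inverse (s / 2) * (1 / 2) = (s\<^sup>2 - x\<^sup>2 + 4) / (4 * s)"
    using s(1) by (simp add: field_simps power2_eq_square)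
  also have "\<dots> = 2 * s\<^sup>2 / (4 * s)" using s(2) by simp
  also have "\<dots> = s / 2" using s(1) by (simp add: power2_eq_square)
  finally show "(sc_antideriv has_vector_derivative sqrt (4 - x\<^sup>2) / 2) (at x)"
    by (simp add: has_real_derivative_iff_has_vector_derivative s_def)
qed

lemma sc_antideriv_mono:
  assumes "- 2 \<le> a" "a \<le> b" "b \<le> 2" shows "sc_antideriv a \<le> sc_antideriv b"
proof -
  have "0 \<le> sqrt (4 - x\<^sup>2) / 2" if "x \<in> {a..b}" for x
    using that assms abs_le_square_iff[of x 2] by auto
  then have "0 \<le> sc_antideriv b - sc_antideriv a" by (rule has_integral_nonneg[OF has_integral_semicircle[OF assms]])
  then show ?thesis by simp
qed

lemma sc_antideriv_odd: "\<bar>x\<bar> \<le> 2 \<Longrightarrow> sc_antideriv (- x) = - sc_antideriv x"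
  using arcsin_minus[of "x / 2"] by (simp add: sc_antideriv_def abs_le_iff)

lemma sc_antideriv_2: "sc_antideriv 2 = pi / 2"
  by (simp add: sc_antideriv_def)

lemma sc_tail_antimono: "- 2 \<le> a \<Longrightarrow> a \<le> b \<Longrightarrow> b \<le> 2 \<Longrightarrow> sc_tail b \<le> sc_tail a"
  by (simp add: sc_tail_def divide_right_mono sc_antideriv_mono)

lemma sc_tail_minus: "\<bar>x\<bar> \<le> 2 \<Longrightarrow> sc_tail (- x) = 1 - sc_tail x"
  by (simp add: sc_tail_def sc_antideriv_odd)

lemma sc_tail_nonneg: "\<bar>x\<bar> \<le> 2 \<Longrightarrow> 0 \<le> sc_tail x"
  using sc_tail_antimono[of x 2] by (simp add: sc_tail_def sc_antideriv_2)

text \<open>On an interval of length \<epsilon> at the edge, half the square root in the density is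
  at most sqrt \<epsilon>. With \<epsilon> = n^(-2/3) the mass beyond 2 - \<epsilon> corresponds to
  at most one point.\<close>

lemma sc_tail_edge:
  assumes "0 \<le> \<epsilon>" "\<epsilon> \<le> 1" shows "sc_tail (2 - \<epsilon>) \<le> \<epsilon> * sqrt \<epsilon>"
proof -
  have "((\<lambda>x. sqrt \<epsilon>) has_integral (\<epsilon> * sqrt \<epsilon>)) {2 - \<epsilon>..2}"
    using has_integral_const_real[of "sqrt \<epsilon>" "2 - \<epsilon>" 2] assms by simp
  then have "sc_antideriv 2 - sc_antideriv (2 - \<epsilon>) \<le> \<epsilon> * sqrt \<epsilon>"
  proof (rule has_integral_le[OF has_integral_semicircle, rotated 3])
    fix x assume x: "x \<in> {2 - \<epsilon>..2}"
    then have "(2 - x) * (2 + x) \<le> \<epsilon> * 4" using assms by (intro mult_mono) auto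
    then have "4 - x\<^sup>2 \<le> 4 * \<epsilon>" by (simp add: power2_eq_square algebra_simps)
    then have "sqrt (4 - x\<^sup>2) \<le> sqrt (4 * \<epsilon>)" by (rule real_sqrt_le_mono)
    then show "sqrt (4 - x\<^sup>2) / 2 \<le> sqrt \<epsilon>" by (simp add: real_sqrt_mult)
  qed (use assms in auto)
  then have "(pi / 2 - sc_antideriv (2 - \<epsilon>)) / pi \<le> \<epsilon> * sqrt \<epsilon> / pi"
    by (intro divide_right_mono) (auto simp: sc_antideriv_2)
  also have "\<dots> \<le> \<epsilon> * sqrt \<epsilon> / 1" using pi_ge_two assms by (intro divide_left_mono) auto
  finally show ?thesis by (simp add: sc_tail_def diff_divide_distrib)
qed

text \<open>Clamps an extended real to [-E, E], which also disposes of infinite endpoints. It is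
  used with E = 2 for semicircle masses and with E slightly below 2 for counts.\<close>

definition edge_clip :: "real \<Rightarrow> ereal \<Rightarrow> real" where
  "edge_clip E e = real_of_ereal (max (ereal (- E)) (min (ereal E) e))"

lemma edge_clip_bound: "E \<ge> 0 \<Longrightarrow> \<bar>edge_clip E e\<bar> \<le> E"
  by (cases e) (auto simp: edge_clip_def max_def min_def)

lemma edge_clip_less:
  assumes "\<bar>y\<bar> < E"
  shows "edge_clip E e < y \<longleftrightarrow> e < ereal y" "y < edge_clip E e \<longleftrightarrow> ereal y < e"
  using assms by (cases e; auto simp: edge_clip_def max_def min_def)+

lemma edge_clip_mono: "E \<ge> 0 \<Longrightarrow> e \<le> e' \<Longrightarrow> edge_clip E e \<le> edge_clip E e'"
  by (cases e; cases e') (auto simp: edge_clip_def max_def min_def)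

lemma edge_clip_edge_clip: "0 \<le> E \<Longrightarrow> E \<le> E' \<Longrightarrow> edge_clip E e = max (- E) (min E (edge_clip E' e))"
  by (cases e) (auto simp: edge_clip_def max_def min_def)

text \<open>The density vanishes outside [-2, 2], so clamping the endpoints does not change the
  integral.\<close>

lemma semicircle_count_eq:
  fixes n :: nat
  assumes "\<Lambda>1 < \<Lambda>2"
  defines "c \<equiv> \<lambda>\<Lambda>. edge_clip 2 (\<Lambda> / ereal (sqrt (real n)))"
  shows "semicircle_count n \<Lambda>1 \<Lambda>2 = real n * (sc_tail (c \<Lambda>1) - sc_tail (c \<Lambda>2))"
proof (cases "n = 0")
  case False
  define e where "e \<Lambda> = \<Lambda> / ereal (sqrt (real n))" for \<Lambda>
  define g where "g = (\<lambda>x::real. sqrt (max (4 - x\<^sup>2) 0))"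
  have "e \<Lambda>1 \<le> e \<Lambda>2" unfolding e_def using False assms(1) by (intro ereal_divide_right_mono) auto
  then have c: "c \<Lambda>1 \<le> c \<Lambda>2" unfolding c_def e_def by (intro edge_clip_mono) auto
  have b: "- 2 \<le> c \<Lambda>1" "c \<Lambda>2 \<le> 2"
    using edge_clip_bound[of 2 "\<Lambda>1 / ereal (sqrt (real n))"] edge_clip_bound[of 2 "\<Lambda>2 / ereal (sqrt (real n))"] by (auto simp: c_def)
  have g0: "g x = 0" if "\<not> \<bar>x\<bar> < 2" for x
    using that abs_le_square_iff[of 2 x] by (simp add: g_def)
  have ind: "indicator (einterval (e \<Lambda>1) (e \<Lambda>2)) x *\<^sub>R g x = indicator (einterval (ereal (c \<Lambda>1)) (ereal (c \<Lambda>2))) x *\<^sub>R g x" for x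
  proof (cases "\<bar>x\<bar> < 2")
    case True
    then show ?thesis unfolding c_def e_def by (simp add: indicator_def einterval_def edge_clip_less)
  qed (simp add: g0)
  have "(LBINT x=e \<Lambda>1..e \<Lambda>2. g x) = (LBINT x=ereal (c \<Lambda>1)..ereal (c \<Lambda>2). g x)"
    unfolding interval_lebesgue_integral_def set_lebesgue_integral_def ind using \<open>e \<Lambda>1 \<le> e \<Lambda>2\<close> c by simp
  also have "\<dots> = integral {c \<Lambda>1..c \<Lambda>2} g"
    unfolding g_def by (intro interval_integral_eq_integral[OF c] borel_integrable_atLeastAtMost' continuous_intros)
  also have "\<dots> = integral {c \<Lambda>1..c \<Lambda>2} (\<lambda>x. 2 * (sqrt (4 - x\<^sup>2) / 2))"
  proof (rule integral_cong)
    fix x assume "x \<in> {c \<Lambda>1..c \<Lambda>2}"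
    then have "\<bar>x\<bar> \<le> \<bar>2\<bar>" using b by auto
    then show "g x = 2 * (sqrt (4 - x\<^sup>2) / 2)" unfolding abs_le_square_iff by (simp add: g_def)
  qed
  also have "\<dots> = 2 * (sc_antideriv (c \<Lambda>2) - sc_antideriv (c \<Lambda>1))"
    by (intro integral_unique has_integral_mult_right has_integral_semicircle b c)
  finally have "semicircle_count n \<Lambda>1 \<Lambda>2 = real n / (2 * pi) * (2 * (sc_antideriv (c \<Lambda>2) - sc_antideriv (c \<Lambda>1)))"
    by (simp add: semicircle_count_def e_def g_def)
  also have "\<dots> = real n * ((sc_antideriv (c \<Lambda>2) - sc_antideriv (c \<Lambda>1)) / pi)"
    by (simp del: right_diff_distrib_numeral)
  finally show ?thesis by (simp add: sc_tail_def diff_divide_distrib)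
qed (simp add: semicircle_count_def)

section \<open>Counting points in an interval\<close>

text \<open>The numbers of points beyond E and - E become tail errors plus a semicircle mass, so
  their second moments are covered by the one-point bound; the symmetry of the semicircle gives
  equal masses on both sides.\<close>

lemma points_in_edges:
  assumes E: "\<bar>E\<bar> < 2"
  shows "points_in n {E..} x = tail_error n E {E..} x + real n * sc_tail E"
    and "points_in n {..- E} x = real n * sc_tail E - tail_error n (- E) {- E<..} x"
proof -
  show "points_in n {E..} x = tail_error n E {E..} x + real n * sc_tail E" by (simp add: tail_error_def)
  have "points_in n {..- E} x + points_in n {- E<..} x = (\<Sum>j<n. 1)"
    unfolding points_in_def sum.distrib[symmetric] by (intro sum.cong) (auto simp: indicator_def)
  moreover have "sc_tail (- E) = 1 - sc_tail E" using E by (intro sc_tail_minus) simp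
  ultimately show "points_in n {..- E} x = real n * sc_tail E - tail_error n (- E) {- E<..} x"
    by (simp add: tail_error_def right_diff_distrib)
qed

text \<open>Clamping moves an endpoint only inside an edge interval, so the mass changes by at most
  the mass of that interval.\<close>

lemma sc_tail_clip:
  assumes E: "0 \<le> E" "E \<le> 2" shows "\<bar>sc_tail (edge_clip 2 e) - sc_tail (edge_clip E e)\<bar> \<le> sc_tail E"
proof -
  define c where "c = edge_clip 2 e"
  have c: "- 2 \<le> c" "c \<le> 2" using edge_clip_bound[of 2 e] by (auto simp: c_def)
  have f: "edge_clip E e = max (- E) (min E c)" unfolding c_def using E by (rule edge_clip_edge_clip)
  have T: "0 \<le> sc_tail E" "sc_tail (- E) = 1 - sc_tail E" "0 \<le> sc_tail c" "sc_tail c \<le> 1"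
    using E c sc_tail_nonneg[of E] sc_tail_minus[of E] sc_tail_nonneg[of c] sc_tail_nonneg[of "- c"] sc_tail_minus[of c] by auto
  consider "c < - E" | "\<bar>c\<bar> \<le> E" | "E < c" using E by linarith
  then show ?thesis
  proof cases
    case 1
    then have "sc_tail (- E) \<le> sc_tail c" using E c by (intro sc_tail_antimono) auto
    then show ?thesis using 1 E T unfolding f c_def[symmetric] by (simp add: max_def min_def)
  next
    case 2
    then have "edge_clip E e = c" unfolding f by auto
    then show ?thesis using T by (simp add: c_def)
  next
    case 3
    then have "sc_tail c \<le> sc_tail E" using E c by (intro sc_tail_antimono) auto
    then show ?thesis using 3 E T unfolding f c_def[symmetric] by (simp add: max_def min_def)
  qed
qed

text \<open>
  Endpoints in the edge region are moved to \<open>\<plusminus>E\<close>: both the counts and the semicircle masses there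
  are bounded.
\<close>

lemma counting_error_bound:
  assumes E: "0 < E" "E < 2" and tail: "real n * sc_tail E \<le> 1" and e: "e1 \<le> e2"
  defines "f1 \<equiv> edge_clip E e1" and "f2 \<equiv> edge_clip E e2"
  defines "A2 \<equiv> if f1 < f2 then {f2..} else {f2<..}"
  shows "\<bar>points_in n {t. e1 < ereal t \<and> ereal t < e2} x - real n * (sc_tail (edge_clip 2 e1) - sc_tail (edge_clip 2 e2))\<bar>
    \<le> \<bar>tail_error n f1 {f1<..} x - tail_error n f2 A2 x\<bar> + \<bar>tail_error n E {E..} x\<bar> + \<bar>tail_error n (- E) {- E<..} x\<bar> + 4"
proof -
  let ?I = "{t. e1 < ereal t \<and> ereal t < e2}"
  have "f1 \<le> f2" unfolding f1_def f2_def using e E by (intro edge_clip_mono) auto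
  have "\<bar>f1\<bar> \<le> E" "\<bar>f2\<bar> \<le> E" unfolding f1_def f2_def using E by (auto intro: edge_clip_bound)
  \<comment> \<open>Away from the edge intervals the open interval is the difference of two rays.
    The second ray is closed if f1 < f2; if the clamped endpoints coincide it is open, since a
    closed ray would leave the value -1 at f1.\<close>
  have ind: "\<bar>indicator ?I t - (indicator {f1<..} t - indicator A2 t)\<bar> \<le> indicator {..- E} t + (indicator {E..} t :: real)" for t
  proof (cases "\<bar>t\<bar> < E")
    case True
    then show ?thesis
      using \<open>f1 \<le> f2\<close> edge_clip_less[of t E e1] edge_clip_less[of t E e2]
      unfolding A2_def f1_def f2_def by (auto simp: indicator_def)
  next
    case False
    then have "indicator {..- E} t + (indicator {E..} t :: real) \<ge> 1" by (auto simp: indicator_def)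
    moreover have "\<bar>indicator ?I t - (indicator {f1<..} t - indicator A2 t)\<bar> \<le> (1::real)"
      using \<open>f1 \<le> f2\<close> unfolding A2_def by (auto simp: indicator_def)
    ultimately show ?thesis by linarith
  qed
  have "\<bar>points_in n ?I x - (points_in n {f1<..} x - points_in n A2 x)\<bar>
      = \<bar>\<Sum>j<n. indicator ?I (x j) - (indicator {f1<..} (x j) - indicator A2 (x j))\<bar>"
    by (simp add: points_in_def sum_subtractf)
  also have "\<dots> \<le> (\<Sum>j<n. indicator {..- E} (x j) + indicator {E..} (x j))"
    by (rule order_trans[OF sum_abs sum_mono[OF ind]])
  also have "\<dots> = points_in n {..- E} x + points_in n {E..} x" by (simp add: points_in_def sum.distrib)
  also have "\<dots> \<le> \<bar>tail_error n E {E..} x\<bar> + \<bar>tail_error n (- E) {- E<..} x\<bar> + 2"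
    using points_in_edges[of E n x] tail E by simp
  finally have 1: "\<bar>points_in n ?I x - (points_in n {f1<..} x - points_in n A2 x)\<bar>
    \<le> \<bar>tail_error n E {E..} x\<bar> + \<bar>tail_error n (- E) {- E<..} x\<bar> + 2" .
  have 2: "\<bar>real n * (sc_tail (edge_clip 2 e) - sc_tail (edge_clip E e))\<bar> \<le> 1" for e
    using mult_left_mono[OF sc_tail_clip[of E e], of "real n"] tail E by (simp add: abs_mult)
  have "points_in n {f1<..} x - points_in n A2 x = (tail_error n f1 {f1<..} x - tail_error n f2 A2 x) + real n * (sc_tail f1 - sc_tail f2)"
    by (simp add: tail_error_def right_diff_distrib)
  then show ?thesis using 1 2[of e1] 2[of e2]
    unfolding f1_def[symmetric] f2_def[symmetric] right_diff_distrib by linarith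
qed

lemma num_points_scaled:
  assumes "n \<ge> 1"
  shows "real (num_points n \<Lambda>1 \<Lambda>2 x) =
    points_in n {t. \<Lambda>1 / ereal (sqrt (real n)) < ereal t \<and> ereal t < \<Lambda>2 / ereal (sqrt (real n))} (coordwise n (\<lambda>t. t / sqrt (real n)) x)"
proof -
  define s where "s = sqrt (real n)"
  have s: "s > 0" using assms by (simp add: s_def)
  have a: "(\<Lambda> / ereal s < ereal (t / s)) = (\<Lambda> < ereal t)" "(ereal (t / s) < \<Lambda> / ereal s) = (ereal t < \<Lambda>)" for \<Lambda> t
    using s by (cases \<Lambda>; auto simp: divide_less_cancel)+
  have "points_in n {t. \<Lambda>1 / ereal s < ereal t \<and> ereal t < \<Lambda>2 / ereal s} (coordwise n (\<lambda>t. t / s) x)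
      = (\<Sum>j<n. indicator {j. \<Lambda>1 < ereal (x j) \<and> ereal (x j) < \<Lambda>2} j)"
    unfolding points_in_def coordwise_def by (intro sum.cong) (auto simp: indicator_def a)
  also have "\<dots> = real (card ({..<n} \<inter> {j. \<Lambda>1 < ereal (x j) \<and> ereal (x j) < \<Lambda>2}))"
    by (simp add: indicator_def sum_of_bool_eq)
  also have "{..<n} \<inter> {j. \<Lambda>1 < ereal (x j) \<and> ereal (x j) < \<Lambda>2} = {j. j < n \<and> \<Lambda>1 < ereal (x j) \<and> ereal (x j) < \<Lambda>2}" by auto
  finally show ?thesis by (simp add: num_points_def s_def)
qed

text \<open>Clamping is 1-Lipschitz and its values lie in [-2, 2]; these give the two entries of the
  minimum. The factor 4 is the one tolerated by \<open>ln_linear_le\<close>.\<close>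

lemma clipped_length:
  fixes n :: nat
  assumes n: "n \<ge> 1" and L: "\<Lambda>1 < \<Lambda>2" and E: "0 \<le> E" "E \<le> 2"
  defines "m \<equiv> real_of_ereal (min (ereal (sqrt (real n)) * (\<Lambda>2 - \<Lambda>1)) (ereal (real n)))"
  defines "f \<equiv> \<lambda>\<Lambda>. edge_clip E (\<Lambda> / ereal (sqrt (real n)))"
  shows "0 \<le> m" "real n * \<bar>f \<Lambda>1 - f \<Lambda>2\<bar> \<le> 4 * m"
proof -
  define s where "s = sqrt (real n)"
  have s: "s > 0" "real n = s * s" using n by (auto simp: s_def)
  have "\<bar>f \<Lambda>\<bar> \<le> 2" for \<Lambda> unfolding f_def using edge_clip_bound[OF E(1)] E(2) order_trans by blast
  from this[of \<Lambda>1] this[of \<Lambda>2] have "\<bar>f \<Lambda>1 - f \<Lambda>2\<bar> \<le> 4" by linarith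
  from mult_left_mono[OF this, of "real n"] have four: "real n * \<bar>f \<Lambda>1 - f \<Lambda>2\<bar> \<le> 4 * real n" by linarith
  have "0 \<le> m \<and> real n * \<bar>f \<Lambda>1 - f \<Lambda>2\<bar> \<le> 4 * m"
  \<comment> \<open>With an infinite endpoint the length is infinite and the minimum is n.\<close>
  proof (cases "\<bar>\<Lambda>1\<bar> = \<infinity> \<or> \<bar>\<Lambda>2\<bar> = \<infinity>")
    case True
    then have "\<Lambda>2 - \<Lambda>1 = \<infinity>" using L by (cases \<Lambda>1; cases \<Lambda>2) auto
    then have "m = real n" using s(1) by (simp add: m_def s_def[symmetric])
    then show ?thesis using four by simp
  next
    case False
    then obtain l1 l2 where l: "\<Lambda>1 = ereal l1" "\<Lambda>2 = ereal l2" by (cases \<Lambda>1; cases \<Lambda>2) auto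
    then have "l1 < l2" using L by simp
    have m: "m = min (s * (l2 - l1)) (real n)" by (simp add: m_def l s_def[symmetric] min_def)
    have f: "f (ereal t) = max (- E) (min E (t / s))" for t
      using s(1) by (simp add: f_def edge_clip_def s_def[symmetric] max_def min_def)
    have "\<bar>f \<Lambda>1 - f \<Lambda>2\<bar> \<le> \<bar>l1 / s - l2 / s\<bar>" unfolding l f by (auto simp: max_def min_def)
    also have "\<dots> = (l2 - l1) / s" using \<open>l1 < l2\<close> s(1) by (simp add: diff_divide_distrib[symmetric])
    finally have "real n * \<bar>f \<Lambda>1 - f \<Lambda>2\<bar> \<le> real n * ((l2 - l1) / s)" by (rule mult_left_mono) simp
    also have "\<dots> = s * (l2 - l1)" using s by simp
    finally have "real n * \<bar>f \<Lambda>1 - f \<Lambda>2\<bar> \<le> s * (l2 - l1)" .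
    moreover have "0 \<le> s * (l2 - l1)" using s \<open>l1 < l2\<close> by simp
    ultimately show ?thesis using four unfolding m min_def by auto
  qed
  then show "0 \<le> m" "real n * \<bar>f \<Lambda>1 - f \<Lambda>2\<bar> \<le> 4 * m" by auto
qed

text \<open>The witness n^(-2/3) is the order of the spacing of the points at the edge, the smallest
  distance from the edge that the scale condition admits.\<close>

lemma edge_scale_exists:
  assumes "n \<ge> 1"
  obtains \<epsilon> :: real where "0 < \<epsilon>" "\<epsilon> \<le> 1" "real n * \<epsilon> * sqrt \<epsilon> = 1"
proof (rule that[of "real n powr (- 2 / 3)"])
  have n: "real n \<ge> 1" using assms by simp
  then show "0 < real n powr (- 2 / 3)" by simp
  show "real n powr (- 2 / 3) \<le> 1" using n powr_mono[of "- 2 / 3" 0 "real n"] by simp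
  have "real n * real n powr (- 2 / 3) * sqrt (real n powr (- 2 / 3)) = real n powr (1 + (- 2 / 3) + (- 2 / 3) * (1 / 2))"
    unfolding powr_half_sqrt[symmetric, OF powr_ge_zero] powr_powr powr_add using n by simp
  then show "real n * real n powr (- 2 / 3) * sqrt (real n powr (- 2 / 3)) = 1" using n by simp
qed

text \<open>With the nonnegative integral the bound includes finiteness of the second moment; a
  Bochner integral would be 0 for a function that is not integrable.\<close>

theorem theorem7:
  fixes \<beta> :: real
  assumes "\<beta> > 0"
  shows "\<exists>C>0. \<forall>n\<ge>1. \<forall>\<Lambda>1 \<Lambda>2 :: ereal. \<Lambda>1 < \<Lambda>2 \<longrightarrow>
    (\<integral>\<^sup>+ x. ennreal ((real (num_points n \<Lambda>1 \<Lambda>2 x) - semicircle_count n \<Lambda>1 \<Lambda>2)\<^sup>2)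
        \<partial>gaussian_beta_ensemble \<beta> n)
      \<le> ennreal (C * ln (2 + real_of_ereal
                              (min (ereal (sqrt (real n)) * (\<Lambda>2 - \<Lambda>1)) (ereal (real n)))))"
proof -
  obtain C1 where C1: "C1 > 0" and one: "\<And>n E A. n \<ge> 1 \<Longrightarrow> \<bar>E\<bar> < 2 \<Longrightarrow> 1 \<le> real n * (2 - \<bar>E\<bar>) * sqrt (2 - \<bar>E\<bar>) \<Longrightarrow> upper_ray E A \<Longrightarrow>
      (\<integral>x. (tail_error n E A x)\<^sup>2 \<partial>scaled_gbe \<beta> n) \<le> C1 * ln (2 + real n * (2 - \<bar>E\<bar>) * sqrt (2 - \<bar>E\<bar>))"
    by (rule tail_error_one_point[OF assms]) (rule that; assumption)
  obtain C2 where C2: "C2 > 0" and pair: "\<And>n \<epsilon> E1 E2 A1 A2. n \<ge> 1 \<Longrightarrow> 0 < \<epsilon> \<Longrightarrow> 1 \<le> real n * \<epsilon> * sqrt \<epsilon> \<Longrightarrow> \<bar>E1\<bar> \<le> 2 - \<epsilon> \<Longrightarrow> \<bar>E2\<bar> \<le> 2 - \<epsilon> \<Longrightarrow>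
      upper_ray E1 A1 \<Longrightarrow> upper_ray E2 A2 \<Longrightarrow>
      (\<integral>x. (tail_error n E1 A1 x - tail_error n E2 A2 x)\<^sup>2 \<partial>scaled_gbe \<beta> n) \<le> C2 * ln (2 + real n * \<bar>E1 - E2\<bar>)"
    by (rule tail_error_pair[OF assms]) (rule that; assumption)
  show ?thesis
  \<comment> \<open>The square of four terms costs a factor 4. This gives 4 * 2 for the pair, 2 * 4
    * 4 for the two edges and 4 * 16 for the constant 4, doubled because \<open>L\<close> is at
    least 1 / 2.\<close>
  proof (intro exI[of _ "8 * C2 + 32 * C1 + 128"] conjI allI impI)
    show "8 * C2 + 32 * C1 + 128 > 0" using C1 C2 by simp
    fix n :: nat and \<Lambda>1 \<Lambda>2 :: ereal
    assume n: "n \<ge> 1" and \<Lambda>: "\<Lambda>1 < \<Lambda>2"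
    let ?M = "scaled_gbe \<beta> n"
    interpret prob_space ?M by (rule prob_space_scaled_gbe[OF assms])
    define m where "m = real_of_ereal (min (ereal (sqrt (real n)) * (\<Lambda>2 - \<Lambda>1)) (ereal (real n)))"
    define e1 e2 where "e1 = \<Lambda>1 / ereal (sqrt (real n))" and "e2 = \<Lambda>2 / ereal (sqrt (real n))"
    define S where "S = semicircle_count n \<Lambda>1 \<Lambda>2"
    define I where "I = {t. e1 < ereal t \<and> ereal t < e2}"
    obtain \<epsilon> where \<epsilon>: "0 < \<epsilon>" "\<epsilon> \<le> 1" "real n * \<epsilon> * sqrt \<epsilon> = 1" using edge_scale_exists[OF n] .
    define E where "E = 2 - \<epsilon>"
    have E: "0 < E" "E < 2" "\<bar>E\<bar> < 2" "\<bar>- E\<bar> < 2" "2 - \<bar>E\<bar> = \<epsilon>" "2 - \<bar>- E\<bar> = \<epsilon>" using \<epsilon> by (auto simp: E_def)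
    have tail: "real n * sc_tail E \<le> 1"
      using mult_left_mono[OF sc_tail_edge[of \<epsilon>], of "real n"] \<epsilon> by (simp add: E_def mult.assoc)
    have e: "e1 \<le> e2" unfolding e1_def e2_def using \<Lambda> n by (intro ereal_divide_right_mono) auto
    define f1 f2 where "f1 = edge_clip E e1" and "f2 = edge_clip E e2"
    define A2 where "A2 = (if f1 < f2 then {f2..} else {f2<..})"
    have rays: "upper_ray f1 {f1<..}" "upper_ray f2 A2" "upper_ray E {E..}" "upper_ray (- E) {- E<..}"
      by (auto simp: upper_ray_def A2_def)
    define D where "D x = tail_error n f1 {f1<..} x - tail_error n f2 A2 x" for x
    define P where "P = tail_error n E {E..}"
    define Q where "Q = tail_error n (- E) {- E<..}"
    define L where "L = ln (2 + m)"
    note len = clipped_length[OF n \<Lambda> less_imp_le[OF E(1)] less_imp_le[OF E(2)], folded m_def e1_def e2_def f1_def f2_def]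
    have L: "L \<ge> 1 / 2" unfolding L_def by (rule ln_two_plus_ge[OF len(1)])
    have sq: "(points_in n I x - S)\<^sup>2 \<le> 4 * (D x)\<^sup>2 + (4 * (P x)\<^sup>2 + 4 * (Q x)\<^sup>2) + 64" for x
    proof -
      have S: "S = real n * (sc_tail (edge_clip 2 e1) - sc_tail (edge_clip 2 e2))"
        unfolding S_def e1_def e2_def by (rule semicircle_count_eq[OF \<Lambda>])
      have "\<bar>points_in n I x - S\<bar> \<le> \<bar>D x\<bar> + \<bar>P x\<bar> + \<bar>Q x\<bar> + 4"
        unfolding S I_def D_def P_def Q_def f1_def f2_def A2_def by (rule counting_error_bound[OF E(1,2) tail e])
      then have "(points_in n I x - S)\<^sup>2 \<le> (\<bar>D x\<bar> + \<bar>P x\<bar> + \<bar>Q x\<bar> + 4)\<^sup>2"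
        by (metis abs_ge_zero power2_abs power_mono)
      moreover have "(p + q + r + 4)\<^sup>2 \<le> 4 * p\<^sup>2 + (4 * q\<^sup>2 + 4 * r\<^sup>2) + 64" for p q r :: real
        using zero_le_power2[of "p - q"] zero_le_power2[of "p - r"] zero_le_power2[of "q - r"]
          zero_le_power2[of "p - 4"] zero_le_power2[of "q - 4"] zero_le_power2[of "r - 4"]
        by (simp add: power2_eq_square algebra_simps)
      ultimately show ?thesis using order_trans by fastforce
    qed
    have ints: "integrable ?M (\<lambda>x. (D x)\<^sup>2)" "integrable ?M (\<lambda>x. (P x)\<^sup>2)" "integrable ?M (\<lambda>x. (Q x)\<^sup>2)"
    proof -
      show "integrable ?M (\<lambda>x. (P x)\<^sup>2)" "integrable ?M (\<lambda>x. (Q x)\<^sup>2)" unfolding P_def Q_def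
        by (rule square_integrable_scaled[OF assms tail_error_measurable tail_error_bound], fact)+
      show "integrable ?M (\<lambda>x. (D x)\<^sup>2)"
      proof (rule square_integrable_scaled[OF assms])
        show "D \<in> borel_measurable (lebesgue_Rn n)"
          unfolding D_def[abs_def] using tail_error_measurable[OF rays(1)] tail_error_measurable[OF rays(2)] by measurable
        show "\<bar>D x\<bar> \<le> (real n + real n * \<bar>sc_tail f1\<bar>) + (real n + real n * \<bar>sc_tail f2\<bar>)" for x
          unfolding D_def by (rule order_trans[OF abs_triangle_ineq4 add_mono[OF tail_error_bound tail_error_bound]])
      qed
    qed
    \<comment> \<open>At distance \<epsilon> from the edge the logarithm of the one-point bound is
      ln 3, a constant, hence at most 4 \<open>L\<close>.\<close>
    have edge: "(\<integral>x. (tail_error n F A x)\<^sup>2 \<partial>?M) \<le> C1 * (4 * L)" if "\<bar>F\<bar> < 2" "2 - \<bar>F\<bar> = \<epsilon>" "upper_ray F A" for F A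
    proof -
      have "ln 3 \<le> (3::real) - 1" by (rule ln_le_minus_one) simp
      then have "C1 * ln 3 \<le> C1 * (4 * L)" using L C1 by (intro mult_left_mono) auto
      moreover have "(\<integral>x. (tail_error n F A x)\<^sup>2 \<partial>?M) \<le> C1 * ln 3"
        using one[OF n that(1) _ that(3)] \<epsilon>(3) unfolding that(2) by simp
      ultimately show ?thesis by linarith
    qed
    have bound_D: "(\<integral>x. (D x)\<^sup>2 \<partial>?M) \<le> C2 * (2 * L)"
    proof -
      have "\<bar>f1\<bar> \<le> 2 - \<epsilon>" "\<bar>f2\<bar> \<le> 2 - \<epsilon>"
        using edge_clip_bound[OF less_imp_le[OF E(1)]] unfolding f1_def f2_def E_def by auto
      then have "(\<integral>x. (D x)\<^sup>2 \<partial>?M) \<le> C2 * ln (2 + real n * \<bar>f1 - f2\<bar>)"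
        unfolding D_def using \<epsilon> by (intro pair[OF n \<epsilon>(1) _ _ _ rays(1,2)]) auto
      also have "ln (2 + real n * \<bar>f1 - f2\<bar>) \<le> 2 * L"
        unfolding L_def using len by (intro ln_linear_le) (auto intro: add_pos_nonneg)
      finally show ?thesis using C2 by simp
    qed
    have meas: "(\<lambda>x. ennreal ((points_in n I x - S)\<^sup>2)) \<in> borel_measurable (lebesgue_Rn n)"
    proof -
      have "I \<in> sets borel" unfolding I_def by measurable
      note [measurable] = points_in_measurable[OF this]
      show ?thesis by measurable
    qed
    have "(\<integral>\<^sup>+ x. ennreal ((real (num_points n \<Lambda>1 \<Lambda>2 x) - S)\<^sup>2) \<partial>gaussian_beta_ensemble \<beta> n)
        = (\<integral>\<^sup>+ x. ennreal ((points_in n I x - S)\<^sup>2) \<partial>?M)"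
      unfolding scaled_gbe_def num_points_scaled[OF n] I_def[symmetric] e1_def[symmetric] e2_def[symmetric]
      by (rule nn_integral_distr[symmetric]) (use meas in \<open>simp_all add: measurable_cong_sets[OF sets_gbe refl] coordwise_scale_measurable\<close>)
    also have "\<dots> \<le> (\<integral>\<^sup>+ x. ennreal (4 * (D x)\<^sup>2 + (4 * (P x)\<^sup>2 + 4 * (Q x)\<^sup>2) + 64) \<partial>?M)"
      by (intro nn_integral_mono ennreal_leI sq)
    also have "\<dots> = ennreal (\<integral>x. 4 * (D x)\<^sup>2 + (4 * (P x)\<^sup>2 + 4 * (Q x)\<^sup>2) + 64 \<partial>?M)"
      using ints by (intro nn_integral_eq_integral) auto
    also have "(\<integral>x. 4 * (D x)\<^sup>2 + (4 * (P x)\<^sup>2 + 4 * (Q x)\<^sup>2) + 64 \<partial>?M)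
        = 4 * (\<integral>x. (D x)\<^sup>2 \<partial>?M) + (4 * (\<integral>x. (P x)\<^sup>2 \<partial>?M) + 4 * (\<integral>x. (Q x)\<^sup>2 \<partial>?M)) + 64"
      using ints by (simp add: prob_space)
    also have "\<dots> \<le> 4 * (C2 * (2 * L)) + (4 * (C1 * (4 * L)) + 4 * (C1 * (4 * L))) + 128 * L"
      using bound_D edge[OF E(3,5) rays(3)] edge[OF E(4,6) rays(4)] L unfolding P_def Q_def
      by (intro add_mono mult_left_mono) auto
    also have "\<dots> = (8 * C2 + 32 * C1 + 128) * L" by (simp add: algebra_simps)
    finally show "(\<integral>\<^sup>+ x. ennreal ((real (num_points n \<Lambda>1 \<Lambda>2 x) - semicircle_count n \<Lambda>1 \<Lambda>2)\<^sup>2) \<partial>gaussian_beta_ensemble \<beta> n)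
      \<le> ennreal ((8 * C2 + 32 * C1 + 128) * ln (2 + real_of_ereal (min (ereal (sqrt (real n)) * (\<Lambda>2 - \<Lambda>1)) (ereal (real n)))))"
      unfolding S_def L_def m_def by (simp add: ennreal_leI)
  qed
qed

end
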